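(* Let $X$ and $Y$ be complexes of injective $\Lambda$-modules. Suppose that $X^n=0$ for $n\ll 0$, that $H^nX$ is finitely generated over $\Lambda$ for all $n$, and that $H^nX=0$ for $n\gg 0$. Then there is an isomorphism $$D\operatorname{Hom}_{\mathbf K(\operatorname{Inj}\Lambda)}(X,Y)\cong \operatorname{Hom}_{\mathbf K(\operatorname{Inj}\Lambda)}(Y,(\pi X)\otimes_\Lambda D\Lambda)$$ which is natural in $X$ and $Y$.
   Context: $k$ is a commutative noetherian ring which is complete and local, with maximal ideal $\mathfrak m$, and $\Lambda$ is a noetherian $k$-algebra, i.e. a $k$-algebra which is finitely generated as a $k$-module. Modules are right modules. $E=E(k/\mathfrak m)$ is an injective envelope of $k/\mathfrak m$ over $k$, and $D=\operatorname{Hom}_k(-,E)$; $D\Lambda$ is regarded as a $\Lambda$-$\Lambda$-bimodule. $\operatorname{Mod}\Lambda$ is the category of $\Lambda$-modules, with full subcategories $\operatorname{mod}\Lambda$ (finitely presented), $\operatorname{Inj}\Lambda$ (injective), $\operatorname{proj}\Lambda$ (finitely generated projective). For an additive category $\mathcal A$, $\mathbf K(\mathcal A)$ is the category of cochain complexes in $\mathcal A$ with morphisms the chain maps up to homotopy; $\mathbf D(\mathcal A)$ is the derived category of an abelian category $\mathcal A$. $\mathbf K^c(\operatorname{Inj}\Lambda)$ is the full subcategory of compact objects of $\mathbf K(\operatorname{Inj}\Lambda)$. It consists exactly of the objects isomorphic to complexes $X$ of injectives with $X^n=0$ for $n\ll0$, $H^nX$ finitely generated for all $n$, and $H^nX=0$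 for $n\gg0$. The canonical functor $\mathbf K(\operatorname{Inj}\Lambda)\to\mathbf D(\operatorname{Mod}\Lambda)$ restricts to an equivalence $\mathbf K^c(\operatorname{Inj}\Lambda)\to\mathbf D^b(\operatorname{mod}\Lambda)$. $\mathbf K^{-,b}(\operatorname{proj}\Lambda)$ is the category of bounded above complexes of finitely generated projective modules with bounded cohomology, up to homotopy, and the canonical functor $\mathbf K^{-,b}(\operatorname{proj}\Lambda)\to\mathbf D^b(\operatorname{mod}\Lambda)$ is an equivalence. The functor $\pi\colon\mathbf K^c(\operatorname{Inj}\Lambda)\to\mathbf K^{-,b}(\operatorname{proj}\Lambda)$ is the composite of the first equivalence with a quasi-inverse of the second; thus $\pi X$ is a projective resolution of the complex $X$. *)

theory Defs
  imports "HOL-Algebra.Free_Abelian_Groups" "HOL-Algebra.Ideal_Product" "HOL-Algebra.Ring_Divisibility"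
begin

section \<open>Right modules over a possibly noncommutative ring\<close>

text \<open>
  The record \<open>module\<close> of HOL-Algebra is reused for right modules: \<open>a \<odot>\<^bsub>M\<^esub> x\<close> stands for the
  product of \<open>x\<close> with \<open>a\<close> from the right, whence the order of the factors in \<open>smult_assoc\<close>.
  The multiplicative fields \<open>mult\<close> and \<open>one\<close> of the record are never used for modules.
  Over a commutative ring this is the library's notion of module (\<open>right_module_iff_module\<close>).
\<close>

locale right_module = R: ring R + M: abelian_group M
  for R :: "('r, 'z) ring_scheme" and M :: "('r, 'm) module" +
  assumes smult_closed:
      "\<lbrakk>a \<in> carrier R; x \<in> carrier M\<rbrakk> \<Longrightarrow> a \<odot>\<^bsub>M\<^esub> x \<in> carrier M"
    and smult_l_distr:
      "\<lbrakk>a \<in> carrier R; b \<in> carrier R; x \<in> carrier M\<rbrakk> \<Longrightarrow>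
        (a \<oplus>\<^bsub>R\<^esub> b) \<odot>\<^bsub>M\<^esub> x = a \<odot>\<^bsub>M\<^esub> x \<oplus>\<^bsub>M\<^esub> b \<odot>\<^bsub>M\<^esub> x"
    and smult_r_distr:
      "\<lbrakk>a \<in> carrier R; x \<in> carrier M; y \<in> carrier M\<rbrakk> \<Longrightarrow>
        a \<odot>\<^bsub>M\<^esub> (x \<oplus>\<^bsub>M\<^esub> y) = a \<odot>\<^bsub>M\<^esub> x \<oplus>\<^bsub>M\<^esub> a \<odot>\<^bsub>M\<^esub> y"
    and smult_assoc:
      "\<lbrakk>a \<in> carrier R; b \<in> carrier R; x \<in> carrier M\<rbrakk> \<Longrightarrow>
        (a \<otimes>\<^bsub>R\<^esub> b) \<odot>\<^bsub>M\<^esub> x = b \<odot>\<^bsub>M\<^esub> (a \<odot>\<^bsub>M\<^esub> x)"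
    and smult_one: "x \<in> carrier M \<Longrightarrow> \<one>\<^bsub>R\<^esub> \<odot>\<^bsub>M\<^esub> x = x"

lemma right_module_iff_module:
  assumes "cring R"
  shows "right_module R M \<longleftrightarrow> module R M"
proof -
  interpret R: cring R by fact
  show ?thesis
  proof
    assume "right_module R M"
    then interpret M: right_module R M .
    have "(a \<otimes>\<^bsub>R\<^esub> b) \<odot>\<^bsub>M\<^esub> x = a \<odot>\<^bsub>M\<^esub> (b \<odot>\<^bsub>M\<^esub> x)"
      if "a \<in> carrier R" "b \<in> carrier R" "x \<in> carrier M" for a b x
      using that M.smult_assoc[of b a x] by (simp add: R.m_comm)
    then show "module R M"
      by (intro moduleI R.cring_axioms M.M.abelian_group_axioms)
        (auto simp: M.smult_closed M.smult_l_distr M.smult_r_distr M.smult_one)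
  next
    assume "module R M"
    then interpret M: module R M .
    show "right_module R M"
      by unfold_locales
        (auto simp: M.smult_l_distr M.smult_r_distr M.smult_assoc1[symmetric] R.m_comm)
  qed
qed

text \<open>Homomorphisms are extensional, so that they are equal iff they agree on the carrier.\<close>

definition module_homs :: "('r, 'z) ring_scheme \<Rightarrow> ('r, 'm) module \<Rightarrow> ('r, 'n) module \<Rightarrow> ('m \<Rightarrow> 'n) set"
  where "module_homs R M N =
    {f \<in> carrier M \<rightarrow>\<^sub>E carrier N.
      (\<forall>x\<in>carrier M. \<forall>y\<in>carrier M. f (x \<oplus>\<^bsub>M\<^esub> y) = f x \<oplus>\<^bsub>N\<^esub> f y) \<and>
      (\<forall>a\<in>carrier R. \<forall>x\<in>carrier M. f (a \<odot>\<^bsub>M\<^esub> x) = a \<odot>\<^bsub>N\<^esub> f x)}"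

definition module_isos :: "('r, 'z) ring_scheme \<Rightarrow> ('r, 'm) module \<Rightarrow> ('r, 'n) module \<Rightarrow> ('m \<Rightarrow> 'n) set"
  where "module_isos R M N = {f \<in> module_homs R M N. bij_betw f (carrier M) (carrier N)}"

definition fg_module :: "('r, 'z) ring_scheme \<Rightarrow> ('r, 'm) module \<Rightarrow> bool"
  where "fg_module R M \<longleftrightarrow> right_module R M \<and>
    (\<exists>S. finite S \<and> S \<subseteq> carrier M \<and>
      (\<forall>x\<in>carrier M. \<exists>c\<in>S \<rightarrow> carrier R. x = (\<Oplus>\<^bsub>M\<^esub>s\<in>S. c s \<odot>\<^bsub>M\<^esub> s)))"

text \<open>
  A HOL formula cannot quantify over types, so the test modules below have their elements in a
  fixed type.  That type is large enough for the lifting property to hold for test modules of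
  arbitrary types: see \<open>injective_module_lift\<close> and \<open>projective_module_lift\<close>.
\<close>

definition injective_module :: "('r, 'z) ring_scheme \<Rightarrow> ('r, 'm) module \<Rightarrow> bool"
  where "injective_module R I \<longleftrightarrow> right_module R I \<and>
    (\<forall>(A :: ('r, 'm \<Rightarrow> 'r) module) (B :: ('r, 'm \<Rightarrow> 'r) module).
      right_module R A \<longrightarrow> right_module R B \<longrightarrow>
      (\<forall>i\<in>module_homs R A B. \<forall>f\<in>module_homs R A I. inj_on i (carrier A) \<longrightarrow>
        (\<exists>g\<in>module_homs R B I. \<forall>x\<in>carrier A. g (i x) = f x)))"

definition projective_module :: "('r, 'z) ring_scheme \<Rightarrow> ('r, 'm) module \<Rightarrow> bool"
  where "projective_module R P \<longleftrightarrow> right_module R P \<and>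
    (\<forall>(A :: ('r, 'm \<Rightarrow> 'r) module) (B :: ('r, 'm) module).
      right_module R A \<longrightarrow> right_module R B \<longrightarrow>
      (\<forall>p\<in>module_homs R A B. \<forall>f\<in>module_homs R P B. p ` carrier A = carrier B \<longrightarrow>
        (\<exists>g\<in>module_homs R P A. \<forall>x\<in>carrier P. p (g x) = f x)))"

definition regular_module :: "('r, 'z) ring_scheme \<Rightarrow> ('r, 'r) module"
  where "regular_module R =
    \<lparr>carrier = carrier R, monoid.mult = (\<lambda>_ _. undefined), monoid.one = undefined,
     ring.zero = \<zero>\<^bsub>R\<^esub>, ring.add = (\<lambda>x y. x \<oplus>\<^bsub>R\<^esub> y), smult = (\<lambda>a x. x \<otimes>\<^bsub>R\<^esub> a)\<rparr>"

definition transport :: "('m \<Rightarrow> 't) \<Rightarrow> ('t \<Rightarrow> 'm) \<Rightarrow> ('r, 'm) module \<Rightarrow> ('r, 't) module"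
  where "transport c d M =
    \<lparr>carrier = c ` carrier M, monoid.mult = (\<lambda>_ _. undefined), monoid.one = undefined,
     ring.zero = c \<zero>\<^bsub>M\<^esub>, ring.add = (\<lambda>x y. c (d x \<oplus>\<^bsub>M\<^esub> d y)),
     smult = (\<lambda>a x. c (a \<odot>\<^bsub>M\<^esub> d x))\<rparr>"

lemma right_module_transport:
  assumes "right_module R M" and dc: "\<And>x. d (c x) = x"
  shows "right_module R (transport c d M)"
proof -
  interpret M: right_module R M by fact
  have "abelian_group (transport c d M)"
  proof (rule abelian_groupI)
    fix x assume "x \<in> carrier (transport c d M)"
    then show "\<exists>y\<in>carrier (transport c d M). y \<oplus>\<^bsub>transport c d M\<^esub> x = \<zero>\<^bsub>transport c d M\<^esub>"
      by (auto simp: transport_def dc M.M.l_neg intro!: bexI[of _ "\<ominus>\<^bsub>M\<^esub> d x"])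
  qed (auto simp: transport_def dc M.M.add.m_ac)
  then show ?thesis
    by (intro right_module.intro right_module_axioms.intro M.R.ring_axioms)
      (auto simp: transport_def dc M.smult_closed M.smult_l_distr M.smult_r_distr M.smult_assoc
        M.smult_one)
qed

context right_module
begin

lemma smult_minus_one: "x \<in> carrier M \<Longrightarrow> (\<ominus>\<^bsub>R\<^esub> \<one>\<^bsub>R\<^esub>) \<odot>\<^bsub>M\<^esub> x = \<ominus>\<^bsub>M\<^esub> x"
proof -
  assume x: "x \<in> carrier M"
  have z: "\<zero>\<^bsub>R\<^esub> \<odot>\<^bsub>M\<^esub> x = \<zero>\<^bsub>M\<^esub>"
    using smult_l_distr[of "\<zero>\<^bsub>R\<^esub>" "\<zero>\<^bsub>R\<^esub>" x] x smult_closed[of "\<zero>\<^bsub>R\<^esub>" x]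
    by (simp add: M.add.l_cancel_one')
  have "(\<ominus>\<^bsub>R\<^esub> \<one>\<^bsub>R\<^esub>) \<odot>\<^bsub>M\<^esub> x \<oplus>\<^bsub>M\<^esub> x = (\<ominus>\<^bsub>R\<^esub> \<one>\<^bsub>R\<^esub> \<oplus>\<^bsub>R\<^esub> \<one>\<^bsub>R\<^esub>) \<odot>\<^bsub>M\<^esub> x"
    using x by (simp add: smult_l_distr smult_one)
  also have "\<dots> = \<zero>\<^bsub>M\<^esub>" using x z by (simp add: R.l_neg)
  finally show ?thesis
    using x by (metis M.minus_equality R.a_inv_closed R.one_closed smult_closed)
qed

lemma smult_l_zero: "x \<in> carrier M \<Longrightarrow> \<zero>\<^bsub>R\<^esub> \<odot>\<^bsub>M\<^esub> x = \<zero>\<^bsub>M\<^esub>"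
  using smult_l_distr[of "\<zero>\<^bsub>R\<^esub>" "\<zero>\<^bsub>R\<^esub>" x] smult_closed[of "\<zero>\<^bsub>R\<^esub>" x]
  by (simp add: M.add.l_cancel_one')

lemma smult_r_zero: "a \<in> carrier R \<Longrightarrow> a \<odot>\<^bsub>M\<^esub> \<zero>\<^bsub>M\<^esub> = \<zero>\<^bsub>M\<^esub>"
  using smult_r_distr[of a "\<zero>\<^bsub>M\<^esub>" "\<zero>\<^bsub>M\<^esub>"] smult_closed[of a "\<zero>\<^bsub>M\<^esub>"]
  by (simp add: M.add.l_cancel_one')

lemma right_module_carrier_update:
  assumes "U \<subseteq> carrier M" "\<zero>\<^bsub>M\<^esub> \<in> U"
    and "\<And>x y. \<lbrakk>x \<in> U; y \<in> U\<rbrakk> \<Longrightarrow> x \<oplus>\<^bsub>M\<^esub> y \<in> U"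
    and sm: "\<And>a x. \<lbrakk>a \<in> carrier R; x \<in> U\<rbrakk> \<Longrightarrow> a \<odot>\<^bsub>M\<^esub> x \<in> U"
  shows "right_module R (M\<lparr>carrier := U\<rparr>)"
proof -
  have m: "\<ominus>\<^bsub>M\<^esub> x \<in> U" if "x \<in> U" for x
    using that sm[of "\<ominus>\<^bsub>R\<^esub> \<one>\<^bsub>R\<^esub>" x] smult_minus_one[of x] assms(1) by auto
  have "abelian_group (M\<lparr>carrier := U\<rparr>)"
  proof (rule abelian_groupI)
    fix x assume "x \<in> carrier (M\<lparr>carrier := U\<rparr>)"
    then show "\<exists>y\<in>carrier (M\<lparr>carrier := U\<rparr>). y \<oplus>\<^bsub>M\<lparr>carrier := U\<rparr>\<^esub> x = \<zero>\<^bsub>M\<lparr>carrier := U\<rparr>\<^esub>"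
      using m M.l_neg assms(1) by auto
  qed (use assms in \<open>auto simp: subset_iff intro: M.a_assoc M.a_comm\<close>)
  then show ?thesis
    using assms
    by (intro right_module.intro right_module_axioms.intro R.ring_axioms)
      (auto simp: subset_iff smult_l_distr smult_r_distr smult_assoc smult_one)
qed

end

lemma right_module_regular:
  assumes "ring R" shows "right_module R (regular_module R)"
proof -
  interpret R: ring R by fact
  have "abelian_group (regular_module R)"
  proof (rule abelian_groupI)
    fix x assume "x \<in> carrier (regular_module R)"
    then show "\<exists>y\<in>carrier (regular_module R). y \<oplus>\<^bsub>regular_module R\<^esub> x = \<zero>\<^bsub>regular_module R\<^esub>"
      using R.l_neg by (auto simp: regular_module_def)
  qed (simp_all add: regular_module_def R.add.m_ac)
  then show ?thesis
    by (intro right_module.intro right_module_axioms.intro R.ring_axioms)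
      (auto simp: regular_module_def R.l_distr R.r_distr R.m_assoc)
qed

lemma module_homsI:
  assumes "f \<in> carrier M \<rightarrow>\<^sub>E carrier N"
    and "\<And>x y. \<lbrakk>x \<in> carrier M; y \<in> carrier M\<rbrakk> \<Longrightarrow> f (x \<oplus>\<^bsub>M\<^esub> y) = f x \<oplus>\<^bsub>N\<^esub> f y"
    and "\<And>a x. \<lbrakk>a \<in> carrier R; x \<in> carrier M\<rbrakk> \<Longrightarrow> f (a \<odot>\<^bsub>M\<^esub> x) = a \<odot>\<^bsub>N\<^esub> f x"
  shows "f \<in> module_homs R M N"
  using assms by (simp add: module_homs_def)

lemma module_homsD:
  assumes "f \<in> module_homs R M N"
  shows "x \<in> carrier M \<Longrightarrow> f x \<in> carrier N"
    and "\<lbrakk>x \<in> carrier M; y \<in> carrier M\<rbrakk> \<Longrightarrow> f (x \<oplus>\<^bsub>M\<^esub> y) = f x \<oplus>\<^bsub>N\<^esub> f y"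
    and "\<lbrakk>a \<in> carrier R; x \<in> carrier M\<rbrakk> \<Longrightarrow> f (a \<odot>\<^bsub>M\<^esub> x) = a \<odot>\<^bsub>N\<^esub> f x"
  using assms by (auto simp: module_homs_def)

lemma module_homs_zero:
  assumes "right_module R M" "right_module R N" "f \<in> module_homs R M N"
  shows "f \<zero>\<^bsub>M\<^esub> = \<zero>\<^bsub>N\<^esub>"
proof -
  interpret M: right_module R M by fact
  interpret N: right_module R N by fact
  show ?thesis
    using module_homsD(1)[OF assms(3), of "\<zero>\<^bsub>M\<^esub>"] module_homsD(2)[OF assms(3), of "\<zero>\<^bsub>M\<^esub>" "\<zero>\<^bsub>M\<^esub>"]
    by (simp add: N.M.add.l_cancel_one')
qed

text \<open>Extension of homomorphisms from right ideals, as in Baer's criterion.\<close>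

lemma injective_module_ideal:
  fixes R :: "('r, 'z) ring_scheme" and I :: "('r, 'm) module"
  assumes inj: "injective_module R I"
    and J: "J \<subseteq> carrier R" "\<zero>\<^bsub>R\<^esub> \<in> J"
      "\<And>a b. \<lbrakk>a \<in> J; b \<in> J\<rbrakk> \<Longrightarrow> a \<oplus>\<^bsub>R\<^esub> b \<in> J"
      "\<And>a r. \<lbrakk>a \<in> J; r \<in> carrier R\<rbrakk> \<Longrightarrow> a \<otimes>\<^bsub>R\<^esub> r \<in> J"
    and h: "\<And>a. a \<in> J \<Longrightarrow> h a \<in> carrier I"
      "\<And>a b. \<lbrakk>a \<in> J; b \<in> J\<rbrakk> \<Longrightarrow> h (a \<oplus>\<^bsub>R\<^esub> b) = h a \<oplus>\<^bsub>I\<^esub> h b"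
      "\<And>a r. \<lbrakk>a \<in> J; r \<in> carrier R\<rbrakk> \<Longrightarrow> h (a \<otimes>\<^bsub>R\<^esub> r) = r \<odot>\<^bsub>I\<^esub> h a"
  shows "\<exists>y\<in>carrier I. \<forall>a\<in>J. h a = a \<odot>\<^bsub>I\<^esub> y"
proof -
  interpret I: right_module R I using inj by (simp add: injective_module_def)
  interpret Reg: right_module R "regular_module R"
    by (rule right_module_regular) (rule I.R.ring_axioms)
  define c :: "'r \<Rightarrow> 'm \<Rightarrow> 'r" where "c = (\<lambda>a _. a)"
  define d :: "('m \<Rightarrow> 'r) \<Rightarrow> 'r" where "d = (\<lambda>g. g undefined)"
  have dc: "d (c a) = a" for a by (simp add: c_def d_def)
  let ?A = "transport c d ((regular_module R)\<lparr>carrier := J\<rparr>)"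
  let ?B = "transport c d (regular_module R)"
  have "right_module R ((regular_module R)\<lparr>carrier := J\<rparr>)"
    using J by (intro Reg.right_module_carrier_update) (auto simp: regular_module_def)
  then have A: "right_module R ?A" by (rule right_module_transport) (rule dc)
  have B: "right_module R ?B"
    by (rule right_module_transport) (rule Reg.right_module_axioms, rule dc)
  define i where "i = restrict id (c ` J)"
  define f where "f = (\<lambda>x\<in>c ` J. h (d x))"
  have i: "i \<in> module_homs R ?A ?B"
    using J by (intro module_homsI) (auto simp: i_def transport_def regular_module_def dc)
  have f: "f \<in> module_homs R ?A I"
    using J h by (intro module_homsI) (auto simp: f_def transport_def regular_module_def dc)
  have "inj_on i (carrier ?A)"
    by (auto simp: inj_on_def i_def transport_def)
  then obtain g where g: "g \<in> module_homs R ?B I" "\<forall>x\<in>carrier ?A. g (i x) = f x"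
    using inj[unfolded injective_module_def, THEN conjunct2, rule_format, OF A B i f] by blast
  have one: "c \<one>\<^bsub>R\<^esub> \<in> carrier ?B" by (simp add: transport_def regular_module_def)
  show ?thesis
  proof (intro bexI ballI)
    show "g (c \<one>\<^bsub>R\<^esub>) \<in> carrier I" using module_homsD(1)[OF g(1) one] .
    fix a assume a: "a \<in> J"
    then have aR: "a \<in> carrier R" using J by blast
    have "h a = g (c a)"
      using g(2) a by (auto simp: transport_def i_def f_def dc)
    also have "c a = a \<odot>\<^bsub>?B\<^esub> c \<one>\<^bsub>R\<^esub>"
      using aR by (simp add: transport_def regular_module_def dc)
    also have "g \<dots> = a \<odot>\<^bsub>I\<^esub> g (c \<one>\<^bsub>R\<^esub>)"
      using module_homsD(3)[OF g(1) aR one] .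
    finally show "h a = a \<odot>\<^bsub>I\<^esub> g (c \<one>\<^bsub>R\<^esub>)" .
  qed
qed

lemma injective_module_lift:
  fixes R :: "('r, 'z) ring_scheme" and I :: "('r, 'm) module"
    and A :: "('r, 'a) module" and B :: "('r, 'b) module"
  assumes inj: "injective_module R I" and A: "right_module R A" and B: "right_module R B"
    and i: "i \<in> module_homs R A B" "inj_on i (carrier A)" and f: "f \<in> module_homs R A I"
  shows "\<exists>g\<in>module_homs R B I. \<forall>x\<in>carrier A. g (i x) = f x"
proof -
  interpret I: right_module R I using inj by (simp add: injective_module_def)
  interpret A: right_module R A by fact
  interpret B: right_module R B by fact
  define \<G> where "\<G> = {G. G \<subseteq> carrier B \<times> carrier I \<and>
      (\<lambda>x. (i x, f x)) ` carrier A \<subseteq> G \<and>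
      (\<forall>u v u' v'. (u, v) \<in> G \<longrightarrow> (u', v') \<in> G \<longrightarrow> (u \<oplus>\<^bsub>B\<^esub> u', v \<oplus>\<^bsub>I\<^esub> v') \<in> G) \<and>
      (\<forall>a u v. a \<in> carrier R \<longrightarrow> (u, v) \<in> G \<longrightarrow> (a \<odot>\<^bsub>B\<^esub> u, a \<odot>\<^bsub>I\<^esub> v) \<in> G) \<and>
      (\<forall>u v v'. (u, v) \<in> G \<longrightarrow> (u, v') \<in> G \<longrightarrow> v = v')}"
  have G0: "(\<lambda>x. (i x, f x)) ` carrier A \<in> \<G>"
  proof -
    have "(i x \<oplus>\<^bsub>B\<^esub> i y, f x \<oplus>\<^bsub>I\<^esub> f y) \<in> (\<lambda>x. (i x, f x)) ` carrier A"
      if "x \<in> carrier A" "y \<in> carrier A" for x y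
      by (rule image_eqI[of _ _ "x \<oplus>\<^bsub>A\<^esub> y"]) (use that in \<open>auto simp: module_homsD[OF i(1)] module_homsD[OF f]\<close>)
    moreover have "(a \<odot>\<^bsub>B\<^esub> i x, a \<odot>\<^bsub>I\<^esub> f x) \<in> (\<lambda>x. (i x, f x)) ` carrier A"
      if "x \<in> carrier A" "a \<in> carrier R" for x a
      by (rule image_eqI[of _ _ "a \<odot>\<^bsub>A\<^esub> x"])
        (use that in \<open>auto simp: module_homsD[OF i(1)] module_homsD[OF f] A.smult_closed\<close>)
    ultimately show ?thesis
      using i(2) by (auto simp: \<G>_def module_homsD[OF i(1)] module_homsD[OF f] inj_on_def)
  qed
  have "\<exists>G\<in>\<G>. \<forall>H\<in>\<G>. G \<subseteq> H \<longrightarrow> H = G"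
  proof (rule subset_Zorn_nonempty)
    show "\<G> \<noteq> {}" using G0 by blast
    fix \<C> assume ne: "\<C> \<noteq> {}" and ch: "subset.chain \<G> \<C>"
    have sub: "\<C> \<subseteq> \<G>" using ch by (simp add: subset.chain_def)
    have two: "\<exists>G\<in>\<C>. p \<in> G \<and> q \<in> G" if "p \<in> \<Union>\<C>" "q \<in> \<Union>\<C>" for p q
      using that ch unfolding subset.chain_def by blast
    show "\<Union>\<C> \<in> \<G>"
      unfolding \<G>_def mem_Collect_eq
    proof (intro conjI allI impI)
      show "\<Union>\<C> \<subseteq> carrier B \<times> carrier I" using sub by (auto simp: \<G>_def)
      show "(\<lambda>x. (i x, f x)) ` carrier A \<subseteq> \<Union>\<C>"
      proof -
        obtain G where "G \<in> \<C>" using ne by blast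
        then show ?thesis using sub by (fastforce simp: \<G>_def)
      qed
    next
      fix u v u' v' assume "(u, v) \<in> \<Union>\<C>" "(u', v') \<in> \<Union>\<C>"
      then obtain G where G: "G \<in> \<C>" "(u, v) \<in> G" "(u', v') \<in> G" using two by blast
      then have "(u \<oplus>\<^bsub>B\<^esub> u', v \<oplus>\<^bsub>I\<^esub> v') \<in> G" using sub by (auto simp: \<G>_def)
      then show "(u \<oplus>\<^bsub>B\<^esub> u', v \<oplus>\<^bsub>I\<^esub> v') \<in> \<Union>\<C>" using G by blast
    next
      fix a u v assume "a \<in> carrier R" "(u, v) \<in> \<Union>\<C>"
      then obtain G where G: "G \<in> \<C>" "(u, v) \<in> G" by blast
      then have "(a \<odot>\<^bsub>B\<^esub> u, a \<odot>\<^bsub>I\<^esub> v) \<in> G" using sub \<open>a \<in> carrier R\<close> by (auto simp: \<G>_def)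
      then show "(a \<odot>\<^bsub>B\<^esub> u, a \<odot>\<^bsub>I\<^esub> v) \<in> \<Union>\<C>" using G by blast
    next
      fix u v v' assume "(u, v) \<in> \<Union>\<C>" "(u, v') \<in> \<Union>\<C>"
      then obtain G where G: "G \<in> \<C>" "(u, v) \<in> G" "(u, v') \<in> G" using two by blast
      then have "G \<in> \<G>" using sub by blast
      then show "v = v'" using G unfolding \<G>_def by blast
    qed
  qed
  then obtain G where G: "G \<in> \<G>" and max: "\<And>H. H \<in> \<G> \<Longrightarrow> G \<subseteq> H \<Longrightarrow> H = G" by blast
  have Gsub: "G \<subseteq> carrier B \<times> carrier I"
    and G0': "\<And>x. x \<in> carrier A \<Longrightarrow> (i x, f x) \<in> G"
    and Gadd: "\<And>u v u' v'. (u, v) \<in> G \<Longrightarrow> (u', v') \<in> G \<Longrightarrow> (u \<oplus>\<^bsub>B\<^esub> u', v \<oplus>\<^bsub>I\<^esub> v') \<in> G"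
    and Gsm: "\<And>a u v. a \<in> carrier R \<Longrightarrow> (u, v) \<in> G \<Longrightarrow> (a \<odot>\<^bsub>B\<^esub> u, a \<odot>\<^bsub>I\<^esub> v) \<in> G"
    and Gfun: "\<And>u v v'. (u, v) \<in> G \<Longrightarrow> (u, v') \<in> G \<Longrightarrow> v = v'"
    using G unfolding \<G>_def by blast+
  have Gz: "(\<zero>\<^bsub>B\<^esub>, \<zero>\<^bsub>I\<^esub>) \<in> G"
    using G0'[of "\<zero>\<^bsub>A\<^esub>"] module_homs_zero[OF A B i(1)] module_homs_zero[OF A I.right_module_axioms f]
    by simp
  have Gneg: "(\<ominus>\<^bsub>B\<^esub> u, \<ominus>\<^bsub>I\<^esub> v) \<in> G" if "(u, v) \<in> G" for u v
    using Gsm[of "\<ominus>\<^bsub>R\<^esub> \<one>\<^bsub>R\<^esub>" u v] that Gsub by (auto simp: B.smult_minus_one I.smult_minus_one)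
  have total: "\<exists>v. (b, v) \<in> G" if b: "b \<in> carrier B" for b
  proof -
    define J where "J = {a \<in> carrier R. \<exists>v. (a \<odot>\<^bsub>B\<^esub> b, v) \<in> G}"
    define h where "h a = (THE v. (a \<odot>\<^bsub>B\<^esub> b, v) \<in> G)" for a
    have hI: "h a = v" if "(a \<odot>\<^bsub>B\<^esub> b, v) \<in> G" for a v
      unfolding h_def using that Gfun by blast
    have hG: "(a \<odot>\<^bsub>B\<^esub> b, h a) \<in> G" if "a \<in> J" for a
      using that hI by (auto simp: J_def)
    have JR: "a \<in> carrier R" if "a \<in> J" for a using that by (simp add: J_def)
    have Jadd: "((a \<oplus>\<^bsub>R\<^esub> a') \<odot>\<^bsub>B\<^esub> b, h a \<oplus>\<^bsub>I\<^esub> h a') \<in> G" if "a \<in> J" "a' \<in> J" for a a'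
      using Gadd[OF hG hG] that b JR by (simp add: B.smult_l_distr)
    have Jsm: "((a \<otimes>\<^bsub>R\<^esub> r) \<odot>\<^bsub>B\<^esub> b, r \<odot>\<^bsub>I\<^esub> h a) \<in> G" if "a \<in> J" "r \<in> carrier R" for a r
      using Gsm[OF _ hG] that b JR by (simp add: B.smult_assoc)
    have "\<exists>y\<in>carrier I. \<forall>a\<in>J. h a = a \<odot>\<^bsub>I\<^esub> y"
    proof (rule injective_module_ideal[OF inj])
      show "J \<subseteq> carrier R" by (auto simp: J_def)
      show "\<zero>\<^bsub>R\<^esub> \<in> J" using Gz b by (auto simp: J_def B.smult_l_zero)
      show "a \<oplus>\<^bsub>R\<^esub> a' \<in> J" if "a \<in> J" "a' \<in> J" for a a'
        using Jadd[OF that] JR that by (auto simp: J_def)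
      show "a \<otimes>\<^bsub>R\<^esub> r \<in> J" if "a \<in> J" "r \<in> carrier R" for a r
        using Jsm[OF that] JR that by (auto simp: J_def)
      show "h a \<in> carrier I" if "a \<in> J" for a using hG[OF that] Gsub by blast
      show "h (a \<oplus>\<^bsub>R\<^esub> a') = h a \<oplus>\<^bsub>I\<^esub> h a'" if "a \<in> J" "a' \<in> J" for a a'
        using hI[OF Jadd[OF that]] .
      show "h (a \<otimes>\<^bsub>R\<^esub> r) = r \<odot>\<^bsub>I\<^esub> h a" if "a \<in> J" "r \<in> carrier R" for a r
        using hI[OF Jsm[OF that]] .
    qed
    then obtain y where y: "y \<in> carrier I" "\<And>a. a \<in> J \<Longrightarrow> h a = a \<odot>\<^bsub>I\<^esub> y" by blast
    define H where "H = {(u \<oplus>\<^bsub>B\<^esub> a \<odot>\<^bsub>B\<^esub> b, v \<oplus>\<^bsub>I\<^esub> a \<odot>\<^bsub>I\<^esub> y) | u v a. (u, v) \<in> G \<and> a \<in> carrier R}"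
    have HI: "(u \<oplus>\<^bsub>B\<^esub> a \<odot>\<^bsub>B\<^esub> b, v \<oplus>\<^bsub>I\<^esub> a \<odot>\<^bsub>I\<^esub> y) \<in> H" if "(u, v) \<in> G" "a \<in> carrier R" for u v a
      using that by (auto simp: H_def)
    note cl = B.smult_closed I.smult_closed
    have GH: "G \<subseteq> H"
    proof
      fix q assume "q \<in> G"
      then show "q \<in> H"
        using HI[of "fst q" "snd q" "\<zero>\<^bsub>R\<^esub>"] Gsub b y(1)
        by (auto simp: B.smult_l_zero I.smult_l_zero)
    qed
    have "H \<in> \<G>"
      unfolding \<G>_def mem_Collect_eq
    proof (intro conjI allI impI)
      show "H \<subseteq> carrier B \<times> carrier I" using Gsub b y(1) by (auto simp: H_def cl)
      show "(\<lambda>x. (i x, f x)) ` carrier A \<subseteq> H" using G0' GH by blast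
    next
      fix u v u' v' assume "(u, v) \<in> H" "(u', v') \<in> H"
      then obtain u1 v1 a1 u2 v2 a2 where
        q: "(u1, v1) \<in> G" "a1 \<in> carrier R" "(u2, v2) \<in> G" "a2 \<in> carrier R"
          "u = u1 \<oplus>\<^bsub>B\<^esub> a1 \<odot>\<^bsub>B\<^esub> b" "v = v1 \<oplus>\<^bsub>I\<^esub> a1 \<odot>\<^bsub>I\<^esub> y"
          "u' = u2 \<oplus>\<^bsub>B\<^esub> a2 \<odot>\<^bsub>B\<^esub> b" "v' = v2 \<oplus>\<^bsub>I\<^esub> a2 \<odot>\<^bsub>I\<^esub> y"
        by (auto simp: H_def)
      have m: "u1 \<in> carrier B" "u2 \<in> carrier B" "v1 \<in> carrier I" "v2 \<in> carrier I"
        using q Gsub by auto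
      show "(u \<oplus>\<^bsub>B\<^esub> u', v \<oplus>\<^bsub>I\<^esub> v') \<in> H"
        using HI[OF Gadd[OF q(1) q(3)], of "a1 \<oplus>\<^bsub>R\<^esub> a2"] q m b y(1)
        by (simp add: B.smult_l_distr I.smult_l_distr cl B.M.a_ac I.M.a_ac)
    next
      fix a u v assume a: "a \<in> carrier R" and "(u, v) \<in> H"
      then obtain u1 v1 a1 where
        q: "(u1, v1) \<in> G" "a1 \<in> carrier R" "u = u1 \<oplus>\<^bsub>B\<^esub> a1 \<odot>\<^bsub>B\<^esub> b" "v = v1 \<oplus>\<^bsub>I\<^esub> a1 \<odot>\<^bsub>I\<^esub> y"
        by (auto simp: H_def)
      have m: "u1 \<in> carrier B" "v1 \<in> carrier I" using q Gsub by auto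
      show "(a \<odot>\<^bsub>B\<^esub> u, a \<odot>\<^bsub>I\<^esub> v) \<in> H"
        using HI[OF Gsm[OF a q(1)], of "a1 \<otimes>\<^bsub>R\<^esub> a"] q m a b y(1)
        by (simp add: B.smult_r_distr I.smult_r_distr B.smult_assoc I.smult_assoc cl)
    next
      fix u v v' assume "(u, v) \<in> H" "(u, v') \<in> H"
      then obtain u1 v1 a1 u2 v2 a2 where
        q: "(u1, v1) \<in> G" "a1 \<in> carrier R" "(u2, v2) \<in> G" "a2 \<in> carrier R"
          "u = u1 \<oplus>\<^bsub>B\<^esub> a1 \<odot>\<^bsub>B\<^esub> b" "v = v1 \<oplus>\<^bsub>I\<^esub> a1 \<odot>\<^bsub>I\<^esub> y"
          "u = u2 \<oplus>\<^bsub>B\<^esub> a2 \<odot>\<^bsub>B\<^esub> b" "v' = v2 \<oplus>\<^bsub>I\<^esub> a2 \<odot>\<^bsub>I\<^esub> y"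
        by (auto simp: H_def)
      have m: "u1 \<in> carrier B" "u2 \<in> carrier B" "v1 \<in> carrier I" "v2 \<in> carrier I"
        using q Gsub by auto
      define a where "a = a1 \<oplus>\<^bsub>R\<^esub> (\<ominus>\<^bsub>R\<^esub> \<one>\<^bsub>R\<^esub>) \<otimes>\<^bsub>R\<^esub> a2"
      have a: "a \<in> carrier R" using q by (simp add: a_def)
      have neg: "(\<ominus>\<^bsub>R\<^esub> \<one>\<^bsub>R\<^esub>) \<otimes>\<^bsub>R\<^esub> a2 = a2 \<otimes>\<^bsub>R\<^esub> (\<ominus>\<^bsub>R\<^esub> \<one>\<^bsub>R\<^esub>)"
        using q I.R.l_minus I.R.r_minus by simp
      have ab: "a \<odot>\<^bsub>B\<^esub> b = a1 \<odot>\<^bsub>B\<^esub> b \<oplus>\<^bsub>B\<^esub> \<ominus>\<^bsub>B\<^esub> (a2 \<odot>\<^bsub>B\<^esub> b)"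
        using q b unfolding a_def neg by (simp add: B.smult_l_distr B.smult_assoc B.smult_minus_one cl)
      have ay: "a \<odot>\<^bsub>I\<^esub> y = a1 \<odot>\<^bsub>I\<^esub> y \<oplus>\<^bsub>I\<^esub> \<ominus>\<^bsub>I\<^esub> (a2 \<odot>\<^bsub>I\<^esub> y)"
        using q y(1) unfolding a_def neg by (simp add: I.smult_l_distr I.smult_assoc I.smult_minus_one cl)
      have eq: "a1 \<odot>\<^bsub>B\<^esub> b \<oplus>\<^bsub>B\<^esub> \<ominus>\<^bsub>B\<^esub> (a2 \<odot>\<^bsub>B\<^esub> b) = u2 \<oplus>\<^bsub>B\<^esub> \<ominus>\<^bsub>B\<^esub> u1"
      proof -
        have "u1 \<oplus>\<^bsub>B\<^esub> a1 \<odot>\<^bsub>B\<^esub> b = u2 \<oplus>\<^bsub>B\<^esub> a2 \<odot>\<^bsub>B\<^esub> b" using q by simp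
        moreover have "p \<oplus>\<^bsub>B\<^esub> \<ominus>\<^bsub>B\<^esub> q = w \<oplus>\<^bsub>B\<^esub> \<ominus>\<^bsub>B\<^esub> u"
          if "u \<oplus>\<^bsub>B\<^esub> p = w \<oplus>\<^bsub>B\<^esub> q" "u \<in> carrier B" "w \<in> carrier B" "p \<in> carrier B" "q \<in> carrier B"
          for u w p q
        proof -
          have "p = \<ominus>\<^bsub>B\<^esub> u \<oplus>\<^bsub>B\<^esub> (w \<oplus>\<^bsub>B\<^esub> q)"
            using that B.M.r_neg1[of u p] by simp
          then have "p = (w \<oplus>\<^bsub>B\<^esub> \<ominus>\<^bsub>B\<^esub> u) \<oplus>\<^bsub>B\<^esub> q" using that by (simp add: B.M.add.m_ac)
          then show ?thesis using that by (simp add: B.M.a_assoc B.M.r_neg)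
        qed
        ultimately show ?thesis using m q b by (simp add: cl)
      qed
      have "(u2 \<oplus>\<^bsub>B\<^esub> \<ominus>\<^bsub>B\<^esub> u1, v2 \<oplus>\<^bsub>I\<^esub> \<ominus>\<^bsub>I\<^esub> v1) \<in> G"
        using Gadd[OF q(3) Gneg[OF q(1)]] .
      then have G': "(a \<odot>\<^bsub>B\<^esub> b, v2 \<oplus>\<^bsub>I\<^esub> \<ominus>\<^bsub>I\<^esub> v1) \<in> G" using ab eq by simp
      then have "a \<in> J" using a by (auto simp: J_def)
      then have "a \<odot>\<^bsub>I\<^esub> y = v2 \<oplus>\<^bsub>I\<^esub> \<ominus>\<^bsub>I\<^esub> v1" using y(2) hI[OF G'] by simp
      then have e: "a1 \<odot>\<^bsub>I\<^esub> y \<oplus>\<^bsub>I\<^esub> \<ominus>\<^bsub>I\<^esub> (a2 \<odot>\<^bsub>I\<^esub> y) = v2 \<oplus>\<^bsub>I\<^esub> \<ominus>\<^bsub>I\<^esub> v1" using ay by simp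
      have "v1 \<oplus>\<^bsub>I\<^esub> (a1 \<odot>\<^bsub>I\<^esub> y \<oplus>\<^bsub>I\<^esub> \<ominus>\<^bsub>I\<^esub> (a2 \<odot>\<^bsub>I\<^esub> y)) \<oplus>\<^bsub>I\<^esub> a2 \<odot>\<^bsub>I\<^esub> y =
          v1 \<oplus>\<^bsub>I\<^esub> (v2 \<oplus>\<^bsub>I\<^esub> \<ominus>\<^bsub>I\<^esub> v1) \<oplus>\<^bsub>I\<^esub> a2 \<odot>\<^bsub>I\<^esub> y" by (simp add: e)
      moreover have "v1 \<oplus>\<^bsub>I\<^esub> (a1 \<odot>\<^bsub>I\<^esub> y \<oplus>\<^bsub>I\<^esub> \<ominus>\<^bsub>I\<^esub> (a2 \<odot>\<^bsub>I\<^esub> y)) \<oplus>\<^bsub>I\<^esub> a2 \<odot>\<^bsub>I\<^esub> y = v"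
        using q m y(1) by (simp add: cl I.M.a_assoc I.M.l_neg)
      moreover have "v1 \<oplus>\<^bsub>I\<^esub> (v2 \<oplus>\<^bsub>I\<^esub> \<ominus>\<^bsub>I\<^esub> v1) = v2"
        using m by (metis I.M.a_comm I.M.a_inv_closed I.M.add.m_closed I.M.r_neg2)
      ultimately show "v = v'" using q by simp
    qed
    then have "H = G" using max GH by blast
    moreover have "(b, y) \<in> H"
      using HI[OF Gz, of "\<one>\<^bsub>R\<^esub>"] b y(1) by (simp add: B.smult_one I.smult_one)
    ultimately show ?thesis by blast
  qed
  define g where "g = (\<lambda>b\<in>carrier B. THE v. (b, v) \<in> G)"
  have gI: "g b = v" if "(b, v) \<in> G" for b v
    using that Gfun Gsub by (auto simp: g_def)
  have gG: "(b, g b) \<in> G" if "b \<in> carrier B" for b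
    using total[OF that] gI by auto
  show ?thesis
  proof (intro bexI ballI)
    show "g (i x) = f x" if "x \<in> carrier A" for x using gI[OF G0'[OF that]] .
    show "g \<in> module_homs R B I"
    proof (rule module_homsI)
      show "g \<in> carrier B \<rightarrow>\<^sub>E carrier I" using gG Gsub by (auto simp: g_def)
      show "g (x \<oplus>\<^bsub>B\<^esub> y) = g x \<oplus>\<^bsub>I\<^esub> g y" if "x \<in> carrier B" "y \<in> carrier B" for x y
        using gI[OF Gadd[OF gG gG]] that by simp
      show "g (a \<odot>\<^bsub>B\<^esub> x) = a \<odot>\<^bsub>I\<^esub> g x" if "a \<in> carrier R" "x \<in> carrier B" for a x
        using gI[OF Gsm[OF _ gG]] that by simp
    qed
  qed
qed

definition free_module :: "('r, 'z) ring_scheme \<Rightarrow> 'm set \<Rightarrow> ('r, 'm \<Rightarrow> 'r) module"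
  where "free_module R S =
    \<lparr>carrier = {c. (\<forall>x. c x \<in> carrier R) \<and> (\<forall>x. x \<notin> S \<longrightarrow> c x = \<zero>\<^bsub>R\<^esub>) \<and> finite {x. c x \<noteq> \<zero>\<^bsub>R\<^esub>}},
     monoid.mult = (\<lambda>_ _. undefined), monoid.one = undefined,
     ring.zero = (\<lambda>_. \<zero>\<^bsub>R\<^esub>), ring.add = (\<lambda>c c' x. c x \<oplus>\<^bsub>R\<^esub> c' x), smult = (\<lambda>a c x. c x \<otimes>\<^bsub>R\<^esub> a)\<rparr>"

lemma right_module_free:
  fixes R :: "('r, 'z) ring_scheme" and S :: "'m set"
  assumes "ring R" shows "right_module R (free_module R S)"
proof -
  interpret R: ring R by fact
  have fin: "finite {x. c x \<oplus>\<^bsub>R\<^esub> c' x \<noteq> \<zero>\<^bsub>R\<^esub>}"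
    if "finite {x. c x \<noteq> \<zero>\<^bsub>R\<^esub>}" "finite {x. c' x \<noteq> \<zero>\<^bsub>R\<^esub>}" for c c' :: "'m \<Rightarrow> 'r"
    by (rule finite_subset[OF _ finite_UnI[OF that]]) auto
  have fin2: "finite {x. c x \<otimes>\<^bsub>R\<^esub> a \<noteq> \<zero>\<^bsub>R\<^esub>}"
    if "finite {x. c x \<noteq> \<zero>\<^bsub>R\<^esub>}" "a \<in> carrier R" for c :: "'m \<Rightarrow> 'r" and a
    by (rule finite_subset[OF _ that(1)]) (use that in auto)
  have "abelian_group (free_module R S)"
  proof (rule abelian_groupI)
    fix c assume c: "c \<in> carrier (free_module R S)"
    have "finite {x. \<ominus>\<^bsub>R\<^esub> c x \<noteq> \<zero>\<^bsub>R\<^esub>}"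
      by (rule finite_subset[of _ "{x. c x \<noteq> \<zero>\<^bsub>R\<^esub>}"]) (use c in \<open>auto simp: free_module_def\<close>)
    then show "\<exists>y\<in>carrier (free_module R S). y \<oplus>\<^bsub>free_module R S\<^esub> c = \<zero>\<^bsub>free_module R S\<^esub>"
      using c by (intro bexI[of _ "\<lambda>x. \<ominus>\<^bsub>R\<^esub> c x"]) (auto simp: free_module_def R.l_neg)
  qed (auto simp: free_module_def R.add.m_ac intro: fin)
  then show ?thesis
    by (intro right_module.intro right_module_axioms.intro R.ring_axioms)
      (auto simp: free_module_def R.l_distr R.r_distr R.m_assoc fin2)
qed

definition free_extend ::
    "('r, 'z) ring_scheme \<Rightarrow> 'm set \<Rightarrow> ('r, 'a) module \<Rightarrow> ('m \<Rightarrow> 'a) \<Rightarrow> ('m \<Rightarrow> 'r) \<Rightarrow> 'a"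
  where "free_extend R S A t =
    (\<lambda>c\<in>carrier (free_module R S). \<Oplus>\<^bsub>A\<^esub>x\<in>{x. c x \<noteq> \<zero>\<^bsub>R\<^esub>}. c x \<odot>\<^bsub>A\<^esub> t x)"

context right_module
begin

lemma finsum_smult:
  "\<lbrakk>finite S; a \<in> carrier R; f \<in> S \<rightarrow> carrier M\<rbrakk> \<Longrightarrow>
    a \<odot>\<^bsub>M\<^esub> (\<Oplus>\<^bsub>M\<^esub>x\<in>S. f x) = (\<Oplus>\<^bsub>M\<^esub>x\<in>S. a \<odot>\<^bsub>M\<^esub> f x)"
proof (induction S rule: finite_induct)
  case empty then show ?case by (simp add: smult_r_zero)
next
  case (insert x S)
  then have "f \<in> S \<rightarrow> carrier M" "f x \<in> carrier M" by auto
  moreover from this have "(\<lambda>x. a \<odot>\<^bsub>M\<^esub> f x) \<in> S \<rightarrow> carrier M" using insert by (auto intro: smult_closed)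
  ultimately show ?case using insert by (simp add: smult_closed smult_r_distr M.finsum_closed)
qed

lemma free_extend_eq:
  assumes "c \<in> carrier (free_module R S)" "finite T" "{x. c x \<noteq> \<zero>\<^bsub>R\<^esub>} \<subseteq> T" "T \<subseteq> S"
    and "t \<in> S \<rightarrow> carrier M"
  shows "free_extend R S M t c = (\<Oplus>\<^bsub>M\<^esub>x\<in>T. c x \<odot>\<^bsub>M\<^esub> t x)"
proof -
  have cR: "c x \<in> carrier R" for x using assms by (simp add: free_module_def)
  have "(\<Oplus>\<^bsub>M\<^esub>x\<in>{x. c x \<noteq> \<zero>\<^bsub>R\<^esub>}. c x \<odot>\<^bsub>M\<^esub> t x) = (\<Oplus>\<^bsub>M\<^esub>x\<in>T. c x \<odot>\<^bsub>M\<^esub> t x)"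
    by (rule M.add.finprod_mono_neutral_cong_left)
      (use assms cR in \<open>auto simp: smult_l_zero smult_closed Pi_iff subset_iff\<close>)
  then show ?thesis using assms by (simp add: free_extend_def)
qed

lemma free_extend_hom:
  assumes t: "t \<in> S \<rightarrow> carrier M"
  shows "free_extend R S M t \<in> module_homs R (free_module R S) M"
proof -
  let ?F = "free_module R S"
  interpret F: right_module R ?F by (rule right_module_free) (rule R.ring_axioms)
  have supp: "finite {x. c x \<noteq> \<zero>\<^bsub>R\<^esub>}" "{x. c x \<noteq> \<zero>\<^bsub>R\<^esub>} \<subseteq> S" "c x \<in> carrier R"
    if "c \<in> carrier ?F" for c x using that by (auto simp: free_module_def)
  have tm: "c x \<odot>\<^bsub>M\<^esub> t x \<in> carrier M" if "c \<in> carrier ?F" "x \<in> S" for c x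
    using supp[OF that(1)] that t by (auto intro!: smult_closed)
  show ?thesis
  proof (rule module_homsI)
    show "free_extend R S M t \<in> carrier ?F \<rightarrow>\<^sub>E carrier M"
    proof
      fix c assume c: "c \<in> carrier ?F"
      show "free_extend R S M t c \<in> carrier M"
        using tm[OF c] supp(2)[OF c] c
        by (auto simp: free_extend_def intro!: M.finsum_closed)
    qed (simp add: free_extend_def)
  next
    fix c c' assume c: "c \<in> carrier ?F" "c' \<in> carrier ?F"
    let ?T = "{x. c x \<noteq> \<zero>\<^bsub>R\<^esub>} \<union> {x. c' x \<noteq> \<zero>\<^bsub>R\<^esub>}"
    have T: "finite ?T" "?T \<subseteq> S" using supp[OF c(1)] supp[OF c(2)] by auto
    have cc: "c \<oplus>\<^bsub>?F\<^esub> c' \<in> carrier ?F" using c by simp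
    have sub: "{x. (c \<oplus>\<^bsub>?F\<^esub> c') x \<noteq> \<zero>\<^bsub>R\<^esub>} \<subseteq> ?T" by (auto simp: free_module_def)
    have "free_extend R S M t (c \<oplus>\<^bsub>?F\<^esub> c') = (\<Oplus>\<^bsub>M\<^esub>x\<in>?T. (c \<oplus>\<^bsub>?F\<^esub> c') x \<odot>\<^bsub>M\<^esub> t x)"
      using free_extend_eq[OF cc T(1) sub T(2) t] .
    also have "\<dots> = (\<Oplus>\<^bsub>M\<^esub>x\<in>?T. c x \<odot>\<^bsub>M\<^esub> t x \<oplus>\<^bsub>M\<^esub> c' x \<odot>\<^bsub>M\<^esub> t x)"
    proof (rule M.finsum_cong')
      fix x assume "x \<in> ?T"
      then have "t x \<in> carrier M" using T t by auto
      then show "(c \<oplus>\<^bsub>?F\<^esub> c') x \<odot>\<^bsub>M\<^esub> t x = c x \<odot>\<^bsub>M\<^esub> t x \<oplus>\<^bsub>M\<^esub> c' x \<odot>\<^bsub>M\<^esub> t x"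
        using smult_l_distr[OF supp(3)[OF c(1)] supp(3)[OF c(2)], of "t x" x x]
        by (simp add: free_module_def)
    qed (use tm c T in auto)
    also have "\<dots> = (\<Oplus>\<^bsub>M\<^esub>x\<in>?T. c x \<odot>\<^bsub>M\<^esub> t x) \<oplus>\<^bsub>M\<^esub> (\<Oplus>\<^bsub>M\<^esub>x\<in>?T. c' x \<odot>\<^bsub>M\<^esub> t x)"
      by (rule M.finsum_addf) (use tm c T in auto)
    also have "\<dots> = free_extend R S M t c \<oplus>\<^bsub>M\<^esub> free_extend R S M t c'"
      using free_extend_eq[OF c(1) T(1) _ T(2) t] free_extend_eq[OF c(2) T(1) _ T(2) t] by simp
    finally show "free_extend R S M t (c \<oplus>\<^bsub>?F\<^esub> c') = free_extend R S M t c \<oplus>\<^bsub>M\<^esub> free_extend R S M t c'" .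
  next
    fix a c assume a: "a \<in> carrier R" and c: "c \<in> carrier ?F"
    let ?T = "{x. c x \<noteq> \<zero>\<^bsub>R\<^esub>}"
    have T: "finite ?T" "?T \<subseteq> S" using supp[OF c] by auto
    have ac: "a \<odot>\<^bsub>?F\<^esub> c \<in> carrier ?F" using a c by (rule F.smult_closed)
    have sub: "{x. (a \<odot>\<^bsub>?F\<^esub> c) x \<noteq> \<zero>\<^bsub>R\<^esub>} \<subseteq> ?T" using a by (auto simp: free_module_def)
    have "free_extend R S M t (a \<odot>\<^bsub>?F\<^esub> c) = (\<Oplus>\<^bsub>M\<^esub>x\<in>?T. (a \<odot>\<^bsub>?F\<^esub> c) x \<odot>\<^bsub>M\<^esub> t x)"
      using free_extend_eq[OF ac T(1) sub T(2) t] .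
    also have "\<dots> = (\<Oplus>\<^bsub>M\<^esub>x\<in>?T. a \<odot>\<^bsub>M\<^esub> (c x \<odot>\<^bsub>M\<^esub> t x))"
    proof (rule M.finsum_cong')
      fix x assume "x \<in> ?T"
      then have "t x \<in> carrier M" using T t by auto
      then show "(a \<odot>\<^bsub>?F\<^esub> c) x \<odot>\<^bsub>M\<^esub> t x = a \<odot>\<^bsub>M\<^esub> (c x \<odot>\<^bsub>M\<^esub> t x)"
        using smult_assoc[OF supp(3)[OF c] a, of "t x" x] by (simp add: free_module_def)
    qed (use tm[OF c] T a in \<open>auto intro!: smult_closed[OF a]\<close>)
    also have "\<dots> = a \<odot>\<^bsub>M\<^esub> (\<Oplus>\<^bsub>M\<^esub>x\<in>?T. c x \<odot>\<^bsub>M\<^esub> t x)"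
      by (rule finsum_smult[symmetric]) (use tm[OF c] T a in auto)
    also have "\<dots> = a \<odot>\<^bsub>M\<^esub> free_extend R S M t c"
      using free_extend_eq[OF c T(1) order_refl T(2) t] by simp
    finally show "free_extend R S M t (a \<odot>\<^bsub>?F\<^esub> c) = a \<odot>\<^bsub>M\<^esub> free_extend R S M t c" .
  qed
qed

end

lemma module_homs_finsum:
  assumes M: "right_module R M" and N: "right_module R N" and f: "f \<in> module_homs R M N"
  shows "finite S \<Longrightarrow> t \<in> S \<rightarrow> carrier M \<Longrightarrow> f (\<Oplus>\<^bsub>M\<^esub>x\<in>S. t x) = (\<Oplus>\<^bsub>N\<^esub>x\<in>S. f (t x))"
proof (induction S rule: finite_induct)
  interpret M: right_module R M by fact
  interpret N: right_module R N by fact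
  case empty then show ?case using module_homs_zero[OF M N f] by simp
next
  interpret M: right_module R M by fact
  interpret N: right_module R N by fact
  case (insert x S)
  then have "t \<in> S \<rightarrow> carrier M" "t x \<in> carrier M" by auto
  moreover from this have "(\<lambda>x. f (t x)) \<in> S \<rightarrow> carrier N" "f (t x) \<in> carrier N"
    using module_homsD(1)[OF f] by auto
  ultimately show ?case
    using insert by (simp add: module_homsD(2)[OF f] M.M.finsum_closed)
qed

lemma projective_module_lift:
  fixes R :: "('r, 'z) ring_scheme" and P :: "('r, 'm) module"
    and A :: "('r, 'a) module" and B :: "('r, 'b) module"
  assumes proj: "projective_module R P" and A: "right_module R A" and B: "right_module R B"
    and p: "p \<in> module_homs R A B" "p ` carrier A = carrier B" and f: "f \<in> module_homs R P B"
  shows "\<exists>g\<in>module_homs R P A. \<forall>x\<in>carrier P. p (g x) = f x"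
proof -
  interpret P: right_module R P using proj by (simp add: projective_module_def)
  interpret A: right_module R A by fact
  interpret B: right_module R B by fact
  let ?S = "carrier P" let ?F = "free_module R ?S"
  have F: "right_module R ?F" by (rule right_module_free) (rule P.R.ring_axioms)
  define q where "q = free_extend R ?S P (\<lambda>x. x)"
  have q: "q \<in> module_homs R ?F P" unfolding q_def by (rule P.free_extend_hom) auto
  have "x \<in> q ` carrier ?F" if x: "x \<in> ?S" for x
  proof -
    define c where "c = (\<lambda>y. if y = x then \<one>\<^bsub>R\<^esub> else \<zero>\<^bsub>R\<^esub>)"
    have c: "c \<in> carrier ?F" using x by (auto simp: free_module_def c_def)
    have "q c = (\<Oplus>\<^bsub>P\<^esub>y\<in>{x}. c y \<odot>\<^bsub>P\<^esub> y)"
      unfolding q_def by (rule P.free_extend_eq[OF c]) (use x in \<open>auto simp: c_def\<close>)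
    also have "\<dots> = x" using x by (simp add: c_def P.smult_one)
    finally show ?thesis using c by blast
  qed
  then have "q ` carrier ?F = ?S" using module_homsD(1)[OF q] by blast
  moreover have "restrict id ?S \<in> module_homs R P P"
    by (rule module_homsI) (auto simp: P.smult_closed)
  ultimately have "\<exists>s\<in>module_homs R P ?F. \<forall>x\<in>carrier P. q (s x) = restrict id ?S x"
    using proj[unfolded projective_module_def, THEN conjunct2, rule_format, OF F P.right_module_axioms q]
    by blast
  then obtain s where s: "s \<in> module_homs R P ?F" "\<And>x. x \<in> ?S \<Longrightarrow> q (s x) = x" by auto
  have "\<exists>a\<in>carrier A. p a = f x" if "x \<in> ?S" for x
    using module_homsD(1)[OF f that] p(2) by (metis imageE)
  then obtain t where t: "\<And>x. x \<in> ?S \<Longrightarrow> t x \<in> carrier A" "\<And>x. x \<in> ?S \<Longrightarrow> p (t x) = f x"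
    by metis
  define g' where "g' = free_extend R ?S A t"
  have g': "g' \<in> module_homs R ?F A" unfolding g'_def by (rule A.free_extend_hom) (use t in auto)
  have pg': "p (g' c) = f (q c)" if c: "c \<in> carrier ?F" for c
  proof -
    let ?T = "{x. c x \<noteq> \<zero>\<^bsub>R\<^esub>}"
    have T: "finite ?T" "?T \<subseteq> ?S" "\<And>x. c x \<in> carrier R" using c by (auto simp: free_module_def)
    have "p (g' c) = p (\<Oplus>\<^bsub>A\<^esub>x\<in>?T. c x \<odot>\<^bsub>A\<^esub> t x)"
      unfolding g'_def using c by (simp add: free_extend_def)
    also have "\<dots> = (\<Oplus>\<^bsub>B\<^esub>x\<in>?T. p (c x \<odot>\<^bsub>A\<^esub> t x))"
      by (rule module_homs_finsum[OF A B p(1) T(1)]) (use T t in \<open>auto intro!: A.smult_closed\<close>)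
    also have "\<dots> = (\<Oplus>\<^bsub>B\<^esub>x\<in>?T. f (c x \<odot>\<^bsub>P\<^esub> x))"
    proof (rule B.M.finsum_cong')
      show "(\<lambda>x. f (c x \<odot>\<^bsub>P\<^esub> x)) \<in> ?T \<rightarrow> carrier B"
        using T by (auto intro!: module_homsD(1)[OF f] P.smult_closed)
      fix x assume "x \<in> ?T"
      then have "x \<in> ?S" using T by blast
      then show "p (c x \<odot>\<^bsub>A\<^esub> t x) = f (c x \<odot>\<^bsub>P\<^esub> x)"
        using T t by (simp add: module_homsD(3)[OF p(1)] module_homsD(3)[OF f])
    qed simp
    also have "\<dots> = f (\<Oplus>\<^bsub>P\<^esub>x\<in>?T. c x \<odot>\<^bsub>P\<^esub> x)"
      by (rule module_homs_finsum[OF P.right_module_axioms B f T(1), symmetric])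
        (use T in \<open>auto intro!: P.smult_closed\<close>)
    also have "\<dots> = f (q c)" unfolding q_def using c by (simp add: free_extend_def)
    finally show ?thesis .
  qed
  have sF: "s x \<in> carrier ?F" if "x \<in> ?S" for x using module_homsD(1)[OF s(1) that] .
  show ?thesis
  proof (intro bexI ballI)
    let ?g = "\<lambda>x\<in>?S. g' (s x)"
    show "p (?g x) = f x" if "x \<in> ?S" for x using pg'[OF sF[OF that]] s(2)[OF that] that by simp
    show "?g \<in> module_homs R P A"
      by (rule module_homsI)
        (auto simp: sF module_homsD[OF g'] module_homsD[OF s(1)] P.smult_closed)
  qed
qed

definition quotient_module :: "('r, 'm) module \<Rightarrow> 'm set \<Rightarrow> ('r, 'm set) module"
  where "quotient_module M N =
    \<lparr>carrier = a_rcosets\<^bsub>M\<^esub> N, monoid.mult = (\<lambda>_ _. undefined), monoid.one = undefined,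
     ring.zero = N, ring.add = (\<lambda>C C'. C <+>\<^bsub>M\<^esub> C'), smult = (\<lambda>a C. \<Union>x\<in>C. N +>\<^bsub>M\<^esub> (a \<odot>\<^bsub>M\<^esub> x))\<rparr>"

definition quotient_map ::
    "('r, 'm) module \<Rightarrow> 'm set \<Rightarrow> ('r, 'n) module \<Rightarrow> 'n set \<Rightarrow> ('m \<Rightarrow> 'n) \<Rightarrow> 'm set \<Rightarrow> 'n set"
  where "quotient_map M N M' N' f = (\<lambda>C \<in> a_rcosets\<^bsub>M\<^esub> N. \<Union>x\<in>C. N' +>\<^bsub>M'\<^esub> f x)"

definition injective_envelope :: "('r, 'z) ring_scheme \<Rightarrow> ('r, 'm) module \<Rightarrow> ('r, 'n) module \<Rightarrow> bool"
  where "injective_envelope R M E \<longleftrightarrow> injective_module R E \<and>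
    (\<exists>i\<in>module_homs R M E. inj_on i (carrier M) \<and>
      (\<forall>U. submodule U R E \<and> U \<inter> i ` carrier M = {\<zero>\<^bsub>E\<^esub>} \<longrightarrow> U = {\<zero>\<^bsub>E\<^esub>}))"


section \<open>The base ring and the algebra\<close>

text \<open>
  The last clause says that \<open>k\<close> maps bijectively onto the inverse limit of the rings
  \<open>k / \<mm>\<^sup>n\<close>.
\<close>

definition complete_local_noetherian_ring :: "('k, 'z) ring_scheme \<Rightarrow> 'k set \<Rightarrow> bool"
  where "complete_local_noetherian_ring k \<mm> \<longleftrightarrow>
    cring k \<and> noetherian_ring k \<and>
    maximalideal \<mm> k \<and> (\<forall>J. maximalideal J k \<longrightarrow> J = \<mm>) \<and>
    (\<forall>a :: nat \<Rightarrow> 'k.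
      (\<forall>n. a n \<in> carrier k \<and> a (Suc n) \<ominus>\<^bsub>k\<^esub> a n \<in> \<mm> [^]\<^bsub>ideals_set k\<^esub> n) \<longrightarrow>
      (\<exists>!x. x \<in> carrier k \<and> (\<forall>n. x \<ominus>\<^bsub>k\<^esub> a n \<in> \<mm> [^]\<^bsub>ideals_set k\<^esub> n)))"

definition noetherian_algebra :: "('k, 'z) ring_scheme \<Rightarrow> ('k, 'r) module \<Rightarrow> bool"
  where "noetherian_algebra k \<Lambda> \<longleftrightarrow>
    module k \<Lambda> \<and> ring \<Lambda> \<and>
    (\<forall>a\<in>carrier k. \<forall>x\<in>carrier \<Lambda>. \<forall>y\<in>carrier \<Lambda>.
      (a \<odot>\<^bsub>\<Lambda>\<^esub> x) \<otimes>\<^bsub>\<Lambda>\<^esub> y = a \<odot>\<^bsub>\<Lambda>\<^esub> (x \<otimes>\<^bsub>\<Lambda>\<^esub> y) \<and>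
      x \<otimes>\<^bsub>\<Lambda>\<^esub> (a \<odot>\<^bsub>\<Lambda>\<^esub> y) = a \<odot>\<^bsub>\<Lambda>\<^esub> (x \<otimes>\<^bsub>\<Lambda>\<^esub> y)) \<and>
    fg_module k \<Lambda>"

definition dual :: "('k, 'z) ring_scheme \<Rightarrow> ('k, 'e) module \<Rightarrow> ('k, 'v) module \<Rightarrow> ('k, 'v \<Rightarrow> 'e) module"
  where "dual k E V =
    \<lparr>carrier = module_homs k V E, monoid.mult = (\<lambda>_ _. undefined), monoid.one = undefined,
     ring.zero = (\<lambda>x\<in>carrier V. \<zero>\<^bsub>E\<^esub>), ring.add = (\<lambda>\<phi> \<psi>. \<lambda>x\<in>carrier V. \<phi> x \<oplus>\<^bsub>E\<^esub> \<psi> x),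
     smult = (\<lambda>a \<phi>. \<lambda>x\<in>carrier V. a \<odot>\<^bsub>E\<^esub> \<phi> x)\<rparr>"

definition dual_map :: "('k, 'v) module \<Rightarrow> ('v \<Rightarrow> 'w) \<Rightarrow> ('w \<Rightarrow> 'e) \<Rightarrow> 'v \<Rightarrow> 'e"
  where "dual_map V f \<phi> = (\<lambda>x\<in>carrier V. \<phi> (f x))"

text \<open>
  The bimodule structure on the dual of the algebra is \<open>(s \<phi> t)(x) = \<phi> (t x s)\<close>.  The right action
  is part of \<open>dual_algebra\<close>, the left action is \<open>dual_algebra_left\<close>.
\<close>

definition dual_algebra ::
    "('k, 'z) ring_scheme \<Rightarrow> ('k, 'e) module \<Rightarrow> ('k, 'r) module \<Rightarrow> ('r, 'r \<Rightarrow> 'e) module"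
  where "dual_algebra k E \<Lambda> =
    \<lparr>carrier = carrier (dual k E \<Lambda>), monoid.mult = (\<lambda>_ _. undefined), monoid.one = undefined,
     ring.zero = \<zero>\<^bsub>dual k E \<Lambda>\<^esub>, ring.add = ring.add (dual k E \<Lambda>),
     smult = (\<lambda>t \<phi>. \<lambda>x\<in>carrier \<Lambda>. \<phi> (t \<otimes>\<^bsub>\<Lambda>\<^esub> x))\<rparr>"

definition dual_algebra_left :: "('k, 'r) module \<Rightarrow> 'r \<Rightarrow> ('r \<Rightarrow> 'e) \<Rightarrow> 'r \<Rightarrow> 'e"
  where "dual_algebra_left \<Lambda> s \<phi> = (\<lambda>x\<in>carrier \<Lambda>. \<phi> (x \<otimes>\<^bsub>\<Lambda>\<^esub> s))"


section \<open>Tensor products\<close>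

text \<open>
  The tensor product of a right module \<open>M\<close> with a bimodule, which consists of a right module \<open>N\<close>
  and a left action \<open>l\<close>: the free abelian group on pairs, modulo the usual relations.
\<close>

definition tensor_free :: "('r, 'm) module \<Rightarrow> ('r, 'n) module \<Rightarrow> ('r, 'm \<times> 'n \<Rightarrow>\<^sub>0 int) module"
  where "tensor_free M N =
    \<lparr>carrier = carrier (free_Abelian_group (carrier M \<times> carrier N)),
     monoid.mult = (\<lambda>_ _. undefined), monoid.one = undefined, ring.zero = 0, ring.add = (+),
     smult = (\<lambda>t. frag_extend (\<lambda>(x, y). frag_of (x, t \<odot>\<^bsub>N\<^esub> y)))\<rparr>"

definition tensor_relations ::
    "('r, 'z) ring_scheme \<Rightarrow> ('r, 'm) module \<Rightarrow> ('r, 'n) module \<Rightarrow> ('r \<Rightarrow> 'n \<Rightarrow> 'n) \<Rightarrow> ('m \<times> 'n \<Rightarrow>\<^sub>0 int) set"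
  where "tensor_relations R M N l =
    generate (free_Abelian_group (carrier M \<times> carrier N))
      ({frag_of (x \<oplus>\<^bsub>M\<^esub> x', y) - frag_of (x, y) - frag_of (x', y) | x x' y.
          x \<in> carrier M \<and> x' \<in> carrier M \<and> y \<in> carrier N} \<union>
       {frag_of (x, y \<oplus>\<^bsub>N\<^esub> y') - frag_of (x, y) - frag_of (x, y') | x y y'.
          x \<in> carrier M \<and> y \<in> carrier N \<and> y' \<in> carrier N} \<union>
       {frag_of (a \<odot>\<^bsub>M\<^esub> x, y) - frag_of (x, l a y) | a x y.
          a \<in> carrier R \<and> x \<in> carrier M \<and> y \<in> carrier N})"

definition tensor ::
    "('r, 'z) ring_scheme \<Rightarrow> ('r, 'm) module \<Rightarrow> ('r, 'n) module \<Rightarrow> ('r \<Rightarrow> 'n \<Rightarrow> 'n) \<Rightarrow>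
      ('r, ('m \<times> 'n \<Rightarrow>\<^sub>0 int) set) module"
  where "tensor R M N l = quotient_module (tensor_free M N) (tensor_relations R M N l)"

definition tensor_map ::
    "('r, 'z) ring_scheme \<Rightarrow> ('r, 'm) module \<Rightarrow> ('r, 'm') module \<Rightarrow> ('r, 'n) module \<Rightarrow> ('r \<Rightarrow> 'n \<Rightarrow> 'n) \<Rightarrow>
      ('m \<Rightarrow> 'm') \<Rightarrow> ('m \<times> 'n \<Rightarrow>\<^sub>0 int) set \<Rightarrow> ('m' \<times> 'n \<Rightarrow>\<^sub>0 int) set"
  where "tensor_map R M M' N l f =
    quotient_map (tensor_free M N) (tensor_relations R M N l)
      (tensor_free M' N) (tensor_relations R M' N l)
      (frag_extend (\<lambda>(x, y). frag_of (f x, y)))"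


section \<open>Cochain complexes and the homotopy category\<close>

record ('r, 'm) cochain_complex =
  cobj :: "int \<Rightarrow> ('r, 'm) module"
  cdiff :: "int \<Rightarrow> 'm \<Rightarrow> 'm"

definition is_complex :: "('r, 'z) ring_scheme \<Rightarrow> ('r, 'm) cochain_complex \<Rightarrow> bool"
  where "is_complex R X \<longleftrightarrow>
    (\<forall>n. right_module R (cobj X n) \<and>
      cdiff X n \<in> module_homs R (cobj X n) (cobj X (n + 1)) \<and>
      (\<forall>x\<in>carrier (cobj X n). cdiff X (n + 1) (cdiff X n x) = \<zero>\<^bsub>cobj X (n + 1 + 1)\<^esub>))"

definition chain_maps ::
    "('r, 'z) ring_scheme \<Rightarrow> ('r, 'm) cochain_complex \<Rightarrow> ('r, 'n) cochain_complex \<Rightarrow> (int \<Rightarrow> 'm \<Rightarrow> 'n) set"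
  where "chain_maps R X Y =
    {f. \<forall>n. f n \<in> module_homs R (cobj X n) (cobj Y n) \<and>
      (\<forall>x\<in>carrier (cobj X n). f (n + 1) (cdiff X n x) = cdiff Y n (f n x))}"

definition chain_id :: "('r, 'm) cochain_complex \<Rightarrow> int \<Rightarrow> 'm \<Rightarrow> 'm"
  where "chain_id X n = (\<lambda>x\<in>carrier (cobj X n). x)"

definition chain_comp ::
    "('r, 'l) cochain_complex \<Rightarrow> (int \<Rightarrow> 'm \<Rightarrow> 'n) \<Rightarrow> (int \<Rightarrow> 'l \<Rightarrow> 'm) \<Rightarrow> int \<Rightarrow> 'l \<Rightarrow> 'n"
  where "chain_comp X g f n = (\<lambda>x\<in>carrier (cobj X n). g n (f n x))"

definition null_homotopic ::
    "('r, 'z) ring_scheme \<Rightarrow> ('r, 'm) cochain_complex \<Rightarrow> ('r, 'n) cochain_complex \<Rightarrow> (int \<Rightarrow> 'm \<Rightarrow> 'n) set"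
  where "null_homotopic R X Y =
    {f \<in> chain_maps R X Y.
      \<exists>h. \<forall>n. h n \<in> module_homs R (cobj X n) (cobj Y (n - 1)) \<and>
        (\<forall>x\<in>carrier (cobj X n).
          f n x = cdiff Y (n - 1) (h n x) \<oplus>\<^bsub>cobj Y n\<^esub> h (n + 1) (cdiff X n x))}"

text \<open>
  For complexes over a \<open>k\<close>-algebra, chain maps form a \<open>k\<close>-module, where \<open>k\<close> acts on right modules
  through the structure map of the algebra.
\<close>

definition chain_map_module ::
    "('k, 'r) module \<Rightarrow> ('r, 'm) cochain_complex \<Rightarrow> ('r, 'n) cochain_complex \<Rightarrow> ('k, int \<Rightarrow> 'm \<Rightarrow> 'n) module"
  where "chain_map_module \<Lambda> X Y =
    \<lparr>carrier = chain_maps \<Lambda> X Y, monoid.mult = (\<lambda>_ _. undefined), monoid.one = undefined,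
     ring.zero = (\<lambda>n. \<lambda>x\<in>carrier (cobj X n). \<zero>\<^bsub>cobj Y n\<^esub>),
     ring.add = (\<lambda>f g n. \<lambda>x\<in>carrier (cobj X n). f n x \<oplus>\<^bsub>cobj Y n\<^esub> g n x),
     smult = (\<lambda>a f n. \<lambda>x\<in>carrier (cobj X n). (a \<odot>\<^bsub>\<Lambda>\<^esub> \<one>\<^bsub>\<Lambda>\<^esub>) \<odot>\<^bsub>cobj Y n\<^esub> f n x)\<rparr>"

definition hom_K ::
    "('k, 'r) module \<Rightarrow> ('r, 'm) cochain_complex \<Rightarrow> ('r, 'n) cochain_complex \<Rightarrow> ('k, (int \<Rightarrow> 'm \<Rightarrow> 'n) set) module"
  where "hom_K \<Lambda> X Y = quotient_module (chain_map_module \<Lambda> X Y) (null_homotopic \<Lambda> X Y)"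

definition class_K ::
    "('k, 'r) module \<Rightarrow> ('r, 'm) cochain_complex \<Rightarrow> ('r, 'n) cochain_complex \<Rightarrow>
      (int \<Rightarrow> 'm \<Rightarrow> 'n) \<Rightarrow> (int \<Rightarrow> 'm \<Rightarrow> 'n) set"
  where "class_K \<Lambda> X Y f = null_homotopic \<Lambda> X Y +>\<^bsub>chain_map_module \<Lambda> X Y\<^esub> f"

definition comp_K ::
    "('k, 'r) module \<Rightarrow> ('r, 'l) cochain_complex \<Rightarrow> ('r, 'n) cochain_complex \<Rightarrow>
      (int \<Rightarrow> 'm \<Rightarrow> 'n) set \<Rightarrow> (int \<Rightarrow> 'l \<Rightarrow> 'm) set \<Rightarrow> (int \<Rightarrow> 'l \<Rightarrow> 'n) set"
  where "comp_K \<Lambda> X Z \<beta> \<alpha> = (\<Union>f\<in>\<alpha>. \<Union>g\<in>\<beta>. class_K \<Lambda> X Z (chain_comp X g f))"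

definition cycles :: "('r, 'm) cochain_complex \<Rightarrow> int \<Rightarrow> ('r, 'm) module"
  where "cycles X n =
    (cobj X n)\<lparr>carrier := {x \<in> carrier (cobj X n). cdiff X n x = \<zero>\<^bsub>cobj X (n + 1)\<^esub>}\<rparr>"

definition boundaries :: "('r, 'm) cochain_complex \<Rightarrow> int \<Rightarrow> 'm set"
  where "boundaries X n = cdiff X (n - 1) ` carrier (cobj X (n - 1))"

definition cohomology :: "('r, 'm) cochain_complex \<Rightarrow> int \<Rightarrow> ('r, 'm set) module"
  where "cohomology X n = quotient_module (cycles X n) (boundaries X n)"

definition cohomology_map ::
    "('r, 'm) cochain_complex \<Rightarrow> ('r, 'n) cochain_complex \<Rightarrow> (int \<Rightarrow> 'm \<Rightarrow> 'n) \<Rightarrow> int \<Rightarrow> 'm set \<Rightarrow> 'n set"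
  where "cohomology_map X Y f n =
    quotient_map (cycles X n) (boundaries X n) (cycles Y n) (boundaries Y n) (f n)"

definition quasi_iso ::
    "('r, 'z) ring_scheme \<Rightarrow> ('r, 'm) cochain_complex \<Rightarrow> ('r, 'n) cochain_complex \<Rightarrow> (int \<Rightarrow> 'm \<Rightarrow> 'n) \<Rightarrow> bool"
  where "quasi_iso R X Y f \<longleftrightarrow> f \<in> chain_maps R X Y \<and>
    (\<forall>n. bij_betw (cohomology_map X Y f n) (carrier (cohomology X n)) (carrier (cohomology Y n)))"

definition zero_module :: "('r, 'm) module \<Rightarrow> bool"
  where "zero_module M \<longleftrightarrow> carrier M = {\<zero>\<^bsub>M\<^esub>}"

definition inj_complex :: "('r, 'z) ring_scheme \<Rightarrow> ('r, 'm) cochain_complex \<Rightarrow> bool"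
  where "inj_complex R X \<longleftrightarrow> is_complex R X \<and> (\<forall>n. injective_module R (cobj X n))"

definition compact_inj_complex :: "('r, 'z) ring_scheme \<Rightarrow> ('r, 'm) cochain_complex \<Rightarrow> bool"
  where "compact_inj_complex R X \<longleftrightarrow> inj_complex R X \<and>
    (\<exists>N. \<forall>n<N. zero_module (cobj X n)) \<and>
    (\<forall>n. fg_module R (cohomology X n)) \<and>
    (\<exists>N. \<forall>n>N. zero_module (cohomology X n))"

text \<open>The objects of \<open>K\<^sup>-\<^sup>,\<^sup>b(proj)\<close>.\<close>

definition proj_resolution_complex :: "('r, 'z) ring_scheme \<Rightarrow> ('r, 'm) cochain_complex \<Rightarrow> bool"
  where "proj_resolution_complex R P \<longleftrightarrow> is_complex R P \<and>
    (\<forall>n. projective_module R (cobj P n) \<and> fg_module R (cobj P n)) \<and>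
    (\<exists>N. \<forall>n>N. zero_module (cobj P n)) \<and>
    (\<exists>N. \<forall>n. \<bar>n\<bar> > N \<longrightarrow> zero_module (cohomology P n))"

definition tensor_complex ::
    "('r, 'z) ring_scheme \<Rightarrow> ('r, 'm) cochain_complex \<Rightarrow> ('r, 'n) module \<Rightarrow> ('r \<Rightarrow> 'n \<Rightarrow> 'n) \<Rightarrow>
      ('r, ('m \<times> 'n \<Rightarrow>\<^sub>0 int) set) cochain_complex"
  where "tensor_complex R X N l =
    \<lparr>cobj = (\<lambda>n. tensor R (cobj X n) N l),
     cdiff = (\<lambda>n. tensor_map R (cobj X n) (cobj X (n + 1)) N l (cdiff X n))\<rparr>"

definition tensor_dual ::
    "('k, 'z) ring_scheme \<Rightarrow> ('k, 'e) module \<Rightarrow> ('k, 'r) module \<Rightarrow> ('r, 'm) cochain_complex \<Rightarrow>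
      ('r, ('m \<times> ('r \<Rightarrow> 'e) \<Rightarrow>\<^sub>0 int) set) cochain_complex"
  where "tensor_dual k E \<Lambda> X =
    tensor_complex \<Lambda> X (dual_algebra k E \<Lambda>) (dual_algebra_left \<Lambda>)"

definition tensor_dual_map ::
    "('k, 'z) ring_scheme \<Rightarrow> ('k, 'e) module \<Rightarrow> ('k, 'r) module \<Rightarrow>
      ('r, 'm) cochain_complex \<Rightarrow> ('r, 'n) cochain_complex \<Rightarrow> (int \<Rightarrow> 'm \<Rightarrow> 'n) set \<Rightarrow>
      (int \<Rightarrow> ('m \<times> ('r \<Rightarrow> 'e) \<Rightarrow>\<^sub>0 int) set \<Rightarrow> ('n \<times> ('r \<Rightarrow> 'e) \<Rightarrow>\<^sub>0 int) set) set"
  where "tensor_dual_map k E \<Lambda> X Y \<alpha> =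
    (\<Union>f\<in>\<alpha>. class_K \<Lambda> (tensor_dual k E \<Lambda> X) (tensor_dual k E \<Lambda> Y)
      (\<lambda>n. tensor_map \<Lambda> (cobj X n) (cobj Y n) (dual_algebra k E \<Lambda>) (dual_algebra_left \<Lambda>) (f n)))"


section \<open>Morphisms in the derived category\<close>

text \<open>
  A morphism from \<open>X\<close> to \<open>Y\<close> in the derived category is represented by a roof, that is, a complex
  \<open>Z\<close> with a quasi-isomorphism \<open>s : Z \<rightarrow> X\<close> and a chain map \<open>f : Z \<rightarrow> Y\<close>.  Equality and composition
  of morphisms are expressed as relations between representing roofs.
\<close>

type_synonym ('r, 'm) roof =
  "('r, 'm) cochain_complex \<times> (int \<Rightarrow> 'm \<Rightarrow> 'm) \<times> (int \<Rightarrow> 'm \<Rightarrow> 'm)"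

definition is_roof ::
    "('k, 'r) module \<Rightarrow> ('r, 'm) cochain_complex \<Rightarrow> ('r, 'm) cochain_complex \<Rightarrow> ('r, 'm) roof \<Rightarrow> bool"
  where "is_roof \<Lambda> X Y = (\<lambda>(Z, s, f).
    is_complex \<Lambda> Z \<and> quasi_iso \<Lambda> Z X s \<and> f \<in> chain_maps \<Lambda> Z Y)"

definition roof_eq ::
    "('k, 'r) module \<Rightarrow> ('r, 'm) cochain_complex \<Rightarrow> ('r, 'm) cochain_complex \<Rightarrow>
      ('r, 'm) roof \<Rightarrow> ('r, 'm) roof \<Rightarrow> bool"
  where "roof_eq \<Lambda> X Y = (\<lambda>(Z, s, f) (Z', s', f').
    is_roof \<Lambda> X Y (Z, s, f) \<and> is_roof \<Lambda> X Y (Z', s', f') \<and>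
    (\<exists>W :: ('r, 'm) cochain_complex. is_complex \<Lambda> W \<and> (\<exists>u\<in>chain_maps \<Lambda> W Z. \<exists>v\<in>chain_maps \<Lambda> W Z'.
      quasi_iso \<Lambda> W X (chain_comp W s u) \<and>
      class_K \<Lambda> W X (chain_comp W s u) = class_K \<Lambda> W X (chain_comp W s' v) \<and>
      class_K \<Lambda> W Y (chain_comp W f u) = class_K \<Lambda> W Y (chain_comp W f' v))))"

text \<open>\<open>is_composite \<Lambda> X Y Y' r q p\<close>: the roof \<open>p\<close> represents \<open>q\<close> after \<open>r\<close>, where \<open>r\<close> goes from
  \<open>X\<close> to \<open>Y\<close> and \<open>q\<close> goes from \<open>Y\<close> to \<open>Y'\<close>.\<close>

definition is_composite ::
    "('k, 'r) module \<Rightarrow> ('r, 'm) cochain_complex \<Rightarrow> ('r, 'm) cochain_complex \<Rightarrow> ('r, 'm) cochain_complex \<Rightarrow>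
      ('r, 'm) roof \<Rightarrow> ('r, 'm) roof \<Rightarrow> ('r, 'm) roof \<Rightarrow> bool"
  where "is_composite \<Lambda> X Y Y' = (\<lambda>(Z, s, f) (Z', s', f') p.
    is_roof \<Lambda> X Y (Z, s, f) \<and> is_roof \<Lambda> Y Y' (Z', s', f') \<and>
    (\<exists>V u v. is_complex \<Lambda> V \<and> quasi_iso \<Lambda> V Z u \<and> v \<in> chain_maps \<Lambda> V Z' \<and>
      class_K \<Lambda> V Y (chain_comp V f u) = class_K \<Lambda> V Y (chain_comp V s' v) \<and>
      roof_eq \<Lambda> X Y' (V, chain_comp V s u, chain_comp V f' v) p))"

definition roof_of :: "('r, 'm) cochain_complex \<Rightarrow> (int \<Rightarrow> 'm \<Rightarrow> 'm) \<Rightarrow> ('r, 'm) roof"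
  where "roof_of X f = (X, chain_id X, f)"

definition is_derived_iso ::
    "('k, 'r) module \<Rightarrow> ('r, 'm) cochain_complex \<Rightarrow> ('r, 'm) cochain_complex \<Rightarrow> ('r, 'm) roof \<Rightarrow> bool"
  where "is_derived_iso \<Lambda> X Y r \<longleftrightarrow> (\<exists>q.
    is_composite \<Lambda> X Y X r q (roof_of X (chain_id X)) \<and>
    is_composite \<Lambda> Y X Y q r (roof_of Y (chain_id Y)))"

text \<open>
  A functor \<open>\<pi>\<close> from compact complexes of injectives to \<open>K\<^sup>-\<^sup>,\<^sup>b(proj)\<close>, with object part \<open>P\<close> and
  morphism part \<open>p\<close>, such that composing with the canonical functor to the derived category gives
  the canonical functor up to a natural isomorphism \<open>\<eta>\<close>.  As the canonical functors are
  equivalences onto \<open>D\<^sup>b(mod)\<close>, this says that \<open>\<pi>\<close> is the one equivalence followed by a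
  quasi-inverse of the other.
\<close>

definition projective_resolution_functor ::
    "('k, 'r) module \<Rightarrow> (('r, 'm) cochain_complex \<Rightarrow> ('r, 'm) cochain_complex) \<Rightarrow>
      (('r, 'm) cochain_complex \<Rightarrow> ('r, 'm) cochain_complex \<Rightarrow>
        (int \<Rightarrow> 'm \<Rightarrow> 'm) set \<Rightarrow> (int \<Rightarrow> 'm \<Rightarrow> 'm) set) \<Rightarrow> bool"
  where "projective_resolution_functor \<Lambda> P p \<longleftrightarrow>
    (\<forall>X. compact_inj_complex \<Lambda> X \<longrightarrow> proj_resolution_complex \<Lambda> (P X)) \<and>
    (\<forall>X Y. compact_inj_complex \<Lambda> X \<longrightarrow> compact_inj_complex \<Lambda> Y \<longrightarrow>
      p X Y \<in> carrier (hom_K \<Lambda> X Y) \<rightarrow> carrier (hom_K \<Lambda> (P X) (P Y))) \<and>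
    (\<forall>X. compact_inj_complex \<Lambda> X \<longrightarrow>
      p X X (class_K \<Lambda> X X (chain_id X)) = class_K \<Lambda> (P X) (P X) (chain_id (P X))) \<and>
    (\<forall>X Y Z. compact_inj_complex \<Lambda> X \<longrightarrow> compact_inj_complex \<Lambda> Y \<longrightarrow> compact_inj_complex \<Lambda> Z \<longrightarrow>
      (\<forall>\<alpha>\<in>carrier (hom_K \<Lambda> X Y). \<forall>\<beta>\<in>carrier (hom_K \<Lambda> Y Z).
        p X Z (comp_K \<Lambda> X Z \<beta> \<alpha>) = comp_K \<Lambda> (P X) (P Z) (p Y Z \<beta>) (p X Y \<alpha>))) \<and>
    (\<exists>\<eta>.
      (\<forall>X. compact_inj_complex \<Lambda> X \<longrightarrow> is_derived_iso \<Lambda> (P X) X (\<eta> X)) \<and>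
      (\<forall>X Y. compact_inj_complex \<Lambda> X \<longrightarrow> compact_inj_complex \<Lambda> Y \<longrightarrow>
        (\<forall>f\<in>chain_maps \<Lambda> X Y. \<forall>g\<in>p X Y (class_K \<Lambda> X Y f).
          \<exists>q. is_composite \<Lambda> (P X) X Y (\<eta> X) (roof_of X f) q \<and>
              is_composite \<Lambda> (P X) (P Y) Y (roof_of (P X) g) (\<eta> Y) q)))"

end

theory Submission
  imports Defs
begin

text \<open>
  If \<open>Q\<close> is finitely generated projective, then \<open>Q \<otimes> D\<Lambda>\<close> is the dual of \<open>Hom(Q, \<Lambda>)\<close>.  With
  \<open>T = P \<otimes> D\<Lambda>\<close> for \<open>P = \<pi> X\<close>, families of homomorphisms \<open>F\<^sup>n : Y\<^sup>n \<rightarrow> T\<^sup>n\<close> therefore correspond to functionals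
  on the complex of finitely supported families of homomorphisms \<open>P \<rightarrow> Y\<close>.  In degree zero,
  \<open>F\<close> is a chain map iff its functional vanishes on the boundaries, and, as \<open>E\<close> is injective, it is
  null homotopic iff its functional vanishes on the cycles.  So \<open>Hom\<^sub>K(Y, T)\<close> is the dual of the
  cohomology of that complex.

  Let \<open>u : P \<rightarrow> X\<close> be the comparison quasi-isomorphism.  For a chain map \<open>f : X \<rightarrow> Y\<close> the composite
  \<open>f u\<close> has finite support because \<open>X\<close> is bounded below and \<open>P\<close> is bounded above.  As \<open>Y\<close> consists of
  injectives, every finitely supported chain map \<open>P \<rightarrow> Y\<close> has the form \<open>f u\<close> up to a homotopy that
  vanishes in small degrees, hence has finite support, and \<open>f\<close> is unique up to homotopy.  So this
  cohomology is \<open>Hom\<^sub>K(X, Y)\<close>.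
\<close>

section \<open>Modules\<close>

text \<open>The choice of finitely supported families decides the shape of the proof. The dual of a
  direct sum is the product of the duals, so functionals on finitely supported families are exactly
  the unrestricted families \<open>F\<close>; the full Hom complex from \<open>P\<close> to
  \<open>Y\<close> would have too many functionals. The price is that homotopies between maps from
  \<open>P\<close> to \<open>Y\<close> must have finite support as well, which is why the homotopy
  lemmas carry explicit bounds \<open>N\<close>.

  No cohomology of this complex is formed. Everything is tested on rank one maps, which generate it,
  and injectivity of \<open>E\<close> extends functionals from images.

  The sign has its origin in the Hom complex: boundaries are \<open>d h + h d\<close>, so the
  transpose of the differential of \<open>P\<close> must enter \<open>T\<close> with a minus sign,
  while tensoring produces none. Changing the sign of the identification in odd degrees repairs
  this.

  The derived category enters through roofs only. As \<open>P\<close> is a bounded above complex of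
  projectives, the left leg of a roof starting at \<open>P\<close> has a section up to homotopy,
  unique up to homotopy; this produces \<open>u\<close> and its naturality.\<close>

text \<open>Homomorphisms that need not be extensional: they can be composed without restriction.\<close>

definition lin :: "('r, 'z) ring_scheme \<Rightarrow> ('r, 'm) module \<Rightarrow> ('r, 'n) module \<Rightarrow> ('m \<Rightarrow> 'n) \<Rightarrow> bool"
  where "lin R M N f \<longleftrightarrow> (\<forall>x\<in>carrier M. f x \<in> carrier N) \<and>
    (\<forall>x\<in>carrier M. \<forall>y\<in>carrier M. f (x \<oplus>\<^bsub>M\<^esub> y) = f x \<oplus>\<^bsub>N\<^esub> f y) \<and>
    (\<forall>a\<in>carrier R. \<forall>x\<in>carrier M. f (a \<odot>\<^bsub>M\<^esub> x) = a \<odot>\<^bsub>N\<^esub> f x)"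

lemma linI:
  assumes "\<And>x. x \<in> carrier M \<Longrightarrow> f x \<in> carrier N"
    and "\<And>x y. \<lbrakk>x \<in> carrier M; y \<in> carrier M\<rbrakk> \<Longrightarrow> f (x \<oplus>\<^bsub>M\<^esub> y) = f x \<oplus>\<^bsub>N\<^esub> f y"
    and "\<And>a x. \<lbrakk>a \<in> carrier R; x \<in> carrier M\<rbrakk> \<Longrightarrow> f (a \<odot>\<^bsub>M\<^esub> x) = a \<odot>\<^bsub>N\<^esub> f x"
  shows "lin R M N f"
  using assms by (simp add: lin_def)

lemma lin_closed: "lin R M N f \<Longrightarrow> x \<in> carrier M \<Longrightarrow> f x \<in> carrier N"
  by (simp add: lin_def)

lemma lin_add:
  "lin R M N f \<Longrightarrow> x \<in> carrier M \<Longrightarrow> y \<in> carrier M \<Longrightarrow> f (x \<oplus>\<^bsub>M\<^esub> y) = f x \<oplus>\<^bsub>N\<^esub> f y"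
  by (simp add: lin_def)

lemma lin_smult:
  "lin R M N f \<Longrightarrow> a \<in> carrier R \<Longrightarrow> x \<in> carrier M \<Longrightarrow> f (a \<odot>\<^bsub>M\<^esub> x) = a \<odot>\<^bsub>N\<^esub> f x"
  by (simp add: lin_def)

lemma module_homs_iff_lin: "f \<in> module_homs R M N \<longleftrightarrow> lin R M N f \<and> f \<in> extensional (carrier M)"
  by (auto simp: module_homs_def lin_def PiE_def)

lemma module_homs_lin: "f \<in> module_homs R M N \<Longrightarrow> lin R M N f"
  by (simp add: module_homs_iff_lin)

lemma module_homs_ext: "f \<in> module_homs R M N \<Longrightarrow> x \<notin> carrier M \<Longrightarrow> f x = undefined"
  by (auto simp: module_homs_def)

lemma module_homs_eqI:
  "f \<in> module_homs R M N \<Longrightarrow> g \<in> module_homs R M N' \<Longrightarrow> (\<And>x. x \<in> carrier M \<Longrightarrow> f x = g x) \<Longrightarrow> f = g"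
  by (auto simp: module_homs_iff_lin intro: extensionalityI[of f "carrier M" g])

lemma lin_cong:
  assumes "right_module R M" "lin R M N f" "\<And>x. x \<in> carrier M \<Longrightarrow> g x = f x"
  shows "lin R M N g"
proof -
  interpret right_module R M by fact
  show ?thesis using assms by (auto simp: lin_def smult_closed)
qed

lemma lin_restrict: "right_module R M \<Longrightarrow> lin R M N (\<lambda>x\<in>carrier M. f x) \<longleftrightarrow> lin R M N f"
  by (auto elim: lin_cong)

lemma restrict_module_homs: "right_module R M \<Longrightarrow> lin R M N f \<Longrightarrow> (\<lambda>x\<in>carrier M. f x) \<in> module_homs R M N"
  by (simp add: module_homs_iff_lin lin_restrict)

lemma lin_comp: "lin R M N f \<Longrightarrow> lin R N L g \<Longrightarrow> lin R M L (\<lambda>x. g (f x))"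
  by (simp add: lin_def)

lemma lin_zero:
  assumes "right_module R M" "right_module R N" "lin R M N f"
  shows "f \<zero>\<^bsub>M\<^esub> = \<zero>\<^bsub>N\<^esub>"
  using module_homs_zero[OF assms(1,2) restrict_module_homs[OF assms(1,3)]]
    right_module.axioms(2)[OF assms(1)] by (simp add: abelian_group.axioms(1) abelian_monoid.zero_closed)

lemma lin_minus:
  assumes "right_module R M" "right_module R N" "lin R M N f" "x \<in> carrier M"
  shows "f (\<ominus>\<^bsub>M\<^esub> x) = \<ominus>\<^bsub>N\<^esub> f x"
proof -
  interpret M: right_module R M by fact
  interpret N: right_module R N by fact
  have "f (\<ominus>\<^bsub>M\<^esub> x) \<oplus>\<^bsub>N\<^esub> f x = \<zero>\<^bsub>N\<^esub>"
    using lin_add[OF assms(3), of "\<ominus>\<^bsub>M\<^esub> x" x] assms(4) lin_zero[OF assms(1-3)] by (simp add: M.M.l_neg)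
  then show ?thesis
    using lin_closed[OF assms(3)] assms(4) by (metis M.M.a_inv_closed N.M.minus_equality)
qed

lemma lin_diff:
  assumes "right_module R M" "right_module R N" "lin R M N f" "x \<in> carrier M" "y \<in> carrier M"
  shows "f (x \<ominus>\<^bsub>M\<^esub> y) = f x \<ominus>\<^bsub>N\<^esub> f y"
proof -
  interpret M: right_module R M by fact
  show ?thesis
    using assms lin_add[OF assms(3), of x "\<ominus>\<^bsub>M\<^esub> y"] lin_minus[OF assms(1-3)]
    by (simp add: a_minus_def)
qed

lemma lin_finsum:
  assumes "right_module R M" "right_module R N" "lin R M N f" "finite S" "t \<in> S \<rightarrow> carrier M"
  shows "f (\<Oplus>\<^bsub>M\<^esub>x\<in>S. t x) = (\<Oplus>\<^bsub>N\<^esub>x\<in>S. f (t x))"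
proof -
  interpret M: right_module R M by fact
  interpret N: right_module R N by fact
  have "(\<lambda>x\<in>carrier M. f x) (\<Oplus>\<^bsub>M\<^esub>x\<in>S. t x) = (\<Oplus>\<^bsub>N\<^esub>x\<in>S. (\<lambda>x\<in>carrier M. f x) (t x))"
    by (rule module_homs_finsum[OF assms(1,2) restrict_module_homs[OF assms(1,3)] assms(4,5)])
  also have "\<dots> = (\<Oplus>\<^bsub>N\<^esub>x\<in>S. f (t x))"
    by (rule N.M.finsum_cong') (use assms(5) lin_closed[OF assms(3)] in auto)
  finally show ?thesis using assms(5) by simp
qed

context right_module
begin

lemma smult_minus: "a \<in> carrier R \<Longrightarrow> x \<in> carrier M \<Longrightarrow> a \<odot>\<^bsub>M\<^esub> (\<ominus>\<^bsub>M\<^esub> x) = \<ominus>\<^bsub>M\<^esub> (a \<odot>\<^bsub>M\<^esub> x)"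
  using smult_r_distr[of a "\<ominus>\<^bsub>M\<^esub> x" x] smult_r_zero[of a]
  by (simp add: M.l_neg M.minus_equality smult_closed)

lemma minus_add_distrib: "x \<in> carrier M \<Longrightarrow> y \<in> carrier M \<Longrightarrow> \<ominus>\<^bsub>M\<^esub> (x \<oplus>\<^bsub>M\<^esub> y) = \<ominus>\<^bsub>M\<^esub> x \<oplus>\<^bsub>M\<^esub> \<ominus>\<^bsub>M\<^esub> y"
  by (rule M.minus_add)

lemma diff_eq_zero_iff: "x \<in> carrier M \<Longrightarrow> y \<in> carrier M \<Longrightarrow> x \<ominus>\<^bsub>M\<^esub> y = \<zero>\<^bsub>M\<^esub> \<longleftrightarrow> x = y"
  by (metis a_minus_def M.add.inv_closed M.minus_equality M.minus_minus M.r_neg)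

lemma diff_eq_iff:
  assumes "x \<in> carrier M" "y \<in> carrier M" "z \<in> carrier M"
  shows "x \<ominus>\<^bsub>M\<^esub> y = z \<longleftrightarrow> x = z \<oplus>\<^bsub>M\<^esub> y"
  using assms by (metis M.a_assoc a_minus_def M.add.inv_closed M.l_neg M.r_neg M.r_zero)

lemma add_left_comm:
  "x \<in> carrier M \<Longrightarrow> y \<in> carrier M \<Longrightarrow> z \<in> carrier M \<Longrightarrow> x \<oplus>\<^bsub>M\<^esub> (y \<oplus>\<^bsub>M\<^esub> z) = y \<oplus>\<^bsub>M\<^esub> (x \<oplus>\<^bsub>M\<^esub> z)"
  by (rule M.add.m_lcomm)

end

lemma lin_const_zero:
  assumes "right_module R N" shows "lin R M N (\<lambda>_. \<zero>\<^bsub>N\<^esub>)"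
proof -
  interpret N: right_module R N by fact
  show ?thesis by (auto simp: lin_def N.smult_r_zero)
qed

lemma lin_plus:
  assumes "right_module R N" "lin R M N f" "lin R M N g"
  shows "lin R M N (\<lambda>x. f x \<oplus>\<^bsub>N\<^esub> g x)"
proof -
  interpret N: right_module R N by fact
  show ?thesis using assms(2,3) by (auto simp: lin_def N.smult_r_distr N.M.a_ac)
qed

lemma lin_uminus:
  assumes "right_module R N" "lin R M N f"
  shows "lin R M N (\<lambda>x. \<ominus>\<^bsub>N\<^esub> f x)"
proof -
  interpret N: right_module R N by fact
  show ?thesis using assms(2) by (auto simp: lin_def N.smult_minus N.minus_add_distrib)
qed

lemma lin_minus_fun:
  assumes "right_module R N" "lin R M N f" "lin R M N g"
  shows "lin R M N (\<lambda>x. f x \<ominus>\<^bsub>N\<^esub> g x)"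
  unfolding a_minus_def by (rule lin_plus[OF assms(1,2) lin_uminus[OF assms(1,3)]])

lemma lin_id: "lin R M M (\<lambda>x. x)"
  by (simp add: lin_def)

lemma right_module_image:
  assumes "right_module R M" "right_module R N" "lin R M N f"
  shows "right_module R (N\<lparr>carrier := f ` carrier M\<rparr>)"
proof -
  interpret M: right_module R M by fact
  interpret N: right_module R N by fact
  show ?thesis
  proof (rule N.right_module_carrier_update)
    show "f ` carrier M \<subseteq> carrier N" using lin_closed[OF assms(3)] by auto
    show "\<zero>\<^bsub>N\<^esub> \<in> f ` carrier M" using lin_zero[OF assms] by (metis M.M.zero_closed imageI)
    show "x \<oplus>\<^bsub>N\<^esub> y \<in> f ` carrier M" if "x \<in> f ` carrier M" "y \<in> f ` carrier M" for x y
      using that lin_add[OF assms(3)] by (metis (no_types, lifting) M.M.add.m_closed image_iff)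
    show "a \<odot>\<^bsub>N\<^esub> x \<in> f ` carrier M" if "a \<in> carrier R" "x \<in> f ` carrier M" for a x
      using that lin_smult[OF assms(3)] by (metis (no_types, lifting) M.smult_closed image_iff)
  qed
qed

text \<open>Since \<open>f\<close> vanishes on the kernel of \<open>d\<close>, it descends to the
  image of \<open>d\<close>, and injectivity of \<open>I\<close> extends it from that submodule to
  \<open>N\<close>. In this form the extension property applies directly to differentials, which
  have a kernel.\<close>

lemma injective_module_factor:
  assumes I: "injective_module R I" and M: "right_module R M" and N: "right_module R N"
    and d: "lin R M N d" and f: "lin R M I f"
    and ker: "\<And>x. x \<in> carrier M \<Longrightarrow> d x = \<zero>\<^bsub>N\<^esub> \<Longrightarrow> f x = \<zero>\<^bsub>I\<^esub>"
  shows "\<exists>g\<in>module_homs R N I. \<forall>x\<in>carrier M. g (d x) = f x"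
proof -
  interpret M: right_module R M by fact
  interpret N: right_module R N by fact
  have I': "right_module R I" using I by (simp add: injective_module_def)
  interpret I: right_module R I by (rule I')
  let ?B = "N\<lparr>carrier := d ` carrier M\<rparr>"
  have B: "right_module R ?B" by (rule right_module_image[OF M N d])
  have eq: "f x = f y" if "x \<in> carrier M" "y \<in> carrier M" "d x = d y" for x y
  proof -
    have "d (x \<ominus>\<^bsub>M\<^esub> y) = \<zero>\<^bsub>N\<^esub>"
      using that lin_diff[OF M N d] lin_closed[OF d] by (simp add: a_minus_def N.M.r_neg)
    then have "f x \<ominus>\<^bsub>I\<^esub> f y = \<zero>\<^bsub>I\<^esub>"
      using ker[of "x \<ominus>\<^bsub>M\<^esub> y"] that lin_diff[OF M I' f] by simp
    then show ?thesis using that lin_closed[OF f] I.diff_eq_zero_iff by simp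
  qed
  \<comment> \<open>Preimages are chosen arbitrarily; by \<open>eq\<close> the value does not depend
    on the choice, whence \<open>h\<close> is linear on the image.\<close>
  define h where "h = (\<lambda>y. f (SOME x. x \<in> carrier M \<and> d x = y))"
  have h: "h (d x) = f x" if "x \<in> carrier M" for x
  proof -
    have "(SOME x'. x' \<in> carrier M \<and> d x' = d x) \<in> carrier M \<and> d (SOME x'. x' \<in> carrier M \<and> d x' = d x) = d x"
      by (rule someI[of _ x]) (use that in simp)
    then show ?thesis unfolding h_def using eq that by blast
  qed
  have hl: "lin R ?B I h"
  proof (rule linI)
    show "h x \<in> carrier I" if "x \<in> carrier ?B" for x using that h lin_closed[OF f] by auto
    show "h (x \<oplus>\<^bsub>?B\<^esub> y) = h x \<oplus>\<^bsub>I\<^esub> h y" if xy: "x \<in> carrier ?B" "y \<in> carrier ?B" for x y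
    proof -
      obtain x' y' where "x = d x'" "y = d y'" "x' \<in> carrier M" "y' \<in> carrier M" using xy by auto
      then show ?thesis using h[of "x' \<oplus>\<^bsub>M\<^esub> y'"] h lin_add[OF d] lin_add[OF f] by simp
    qed
    show "h (a \<odot>\<^bsub>?B\<^esub> x) = a \<odot>\<^bsub>I\<^esub> h x" if a: "a \<in> carrier R" "x \<in> carrier ?B" for a x
    proof -
      obtain x' where "x = d x'" "x' \<in> carrier M" using a by auto
      then show ?thesis
        using h[of "a \<odot>\<^bsub>M\<^esub> x'"] h lin_smult[OF d] lin_smult[OF f] a M.smult_closed by simp
    qed
  qed
  have i: "restrict id (carrier ?B) \<in> module_homs R ?B N"
  proof -
    interpret B: right_module R ?B by (rule B)
    show ?thesis
      using lin_closed[OF d] B.M.add.m_closed B.smult_closed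
      by (intro module_homsI) (auto simp del: B.M.add.m_closed)
  qed
  have "inj_on (restrict id (carrier ?B)) (carrier ?B)" by (auto simp: inj_on_def)
  from injective_module_lift[OF I B N i this restrict_module_homs[OF B hl]] obtain g
    where "g \<in> module_homs R N I" "\<forall>x\<in>carrier ?B. g (restrict id (carrier ?B) x) = (\<lambda>x\<in>carrier ?B. h x) x"
    by blast
  then show ?thesis using h by (intro bexI[of _ g]) auto
qed

text \<open>Once the codomain is shrunk to its image, \<open>d\<close> becomes surjective and the
  lifting property applies; \<open>im\<close> guarantees that \<open>f\<close> still lands
  there.\<close>

lemma projective_module_factor:
  assumes P: "projective_module R P" and M: "right_module R M" and N: "right_module R N"
    and d: "lin R M N d" and f: "lin R P N f"
    and im: "\<And>x. x \<in> carrier P \<Longrightarrow> f x \<in> d ` carrier M"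
  shows "\<exists>g\<in>module_homs R P M. \<forall>x\<in>carrier P. d (g x) = f x"
proof -
  have P': "right_module R P" using P by (simp add: projective_module_def)
  let ?B = "N\<lparr>carrier := d ` carrier M\<rparr>"
  have B: "right_module R ?B" by (rule right_module_image[OF M N d])
  have d': "(\<lambda>x\<in>carrier M. d x) \<in> module_homs R M ?B"
    by (rule restrict_module_homs[OF M]) (use d in \<open>auto simp: lin_def\<close>)
  have f': "(\<lambda>x\<in>carrier P. f x) \<in> module_homs R P ?B"
    by (rule restrict_module_homs[OF P']) (use f im in \<open>auto simp: lin_def\<close>)
  have "(\<lambda>x\<in>carrier M. d x) ` carrier M = carrier ?B" by auto
  from projective_module_lift[OF P M B d' this f'] obtain g
    where g: "g \<in> module_homs R P M" "\<forall>x\<in>carrier P. (\<lambda>x\<in>carrier M. d x) (g x) = (\<lambda>x\<in>carrier P. f x) x"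
    by blast
  then show ?thesis using module_homsD(1)[OF g(1)] by (intro bexI[of _ g]) auto
qed

subsection \<open>Quotients\<close>

text \<open>Closure under negatives is left to the action of minus one, see
  \<open>submod_uminus\<close>.\<close>

definition submod :: "('r, 'z) ring_scheme \<Rightarrow> ('r, 'm) module \<Rightarrow> 'm set \<Rightarrow> bool"
  where "submod R M U \<longleftrightarrow> U \<subseteq> carrier M \<and> \<zero>\<^bsub>M\<^esub> \<in> U \<and> (\<forall>x\<in>U. \<forall>y\<in>U. x \<oplus>\<^bsub>M\<^esub> y \<in> U) \<and>
    (\<forall>a\<in>carrier R. \<forall>x\<in>U. a \<odot>\<^bsub>M\<^esub> x \<in> U)"

context right_module
begin

context
  fixes U assumes U: "submod R M U"
begin

lemma submod_uminus: "x \<in> U \<Longrightarrow> \<ominus>\<^bsub>M\<^esub> x \<in> U"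
  using smult_minus_one[of x] U by (metis submod_def R.a_inv_closed R.one_closed subsetD)

lemma submod_coset_eq_iff:
  assumes "x \<in> carrier M" "y \<in> carrier M"
  shows "U +>\<^bsub>M\<^esub> x = U +>\<^bsub>M\<^esub> y \<longleftrightarrow> (\<exists>u\<in>U. x = u \<oplus>\<^bsub>M\<^esub> y)"
proof
  assume "U +>\<^bsub>M\<^esub> x = U +>\<^bsub>M\<^esub> y"
  moreover have "x \<in> U +>\<^bsub>M\<^esub> x"
    using U assms by (auto simp: a_r_coset_def' submod_def intro!: bexI[of _ "\<zero>\<^bsub>M\<^esub>"])
  ultimately show "\<exists>u\<in>U. x = u \<oplus>\<^bsub>M\<^esub> y" by (auto simp: a_r_coset_def')
next
  assume "\<exists>u\<in>U. x = u \<oplus>\<^bsub>M\<^esub> y"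
  then obtain u where u: "u \<in> U" "x = u \<oplus>\<^bsub>M\<^esub> y" by blast
  have c: "v \<in> carrier M" if "v \<in> U" for v using U that by (auto simp: submod_def)
  have "v \<oplus>\<^bsub>M\<^esub> y = (v \<oplus>\<^bsub>M\<^esub> \<ominus>\<^bsub>M\<^esub> u) \<oplus>\<^bsub>M\<^esub> x" if "v \<in> U" for v
    using u assms c[OF that] c[OF u(1)] by (simp add: M.a_assoc M.r_neg1)
  moreover have "v \<oplus>\<^bsub>M\<^esub> x = (v \<oplus>\<^bsub>M\<^esub> u) \<oplus>\<^bsub>M\<^esub> y" if "v \<in> U" for v
    using u assms c[OF that] c[OF u(1)] by (simp add: M.a_assoc)
  moreover have "v \<oplus>\<^bsub>M\<^esub> u \<in> U" "v \<oplus>\<^bsub>M\<^esub> \<ominus>\<^bsub>M\<^esub> u \<in> U" if "v \<in> U" for v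
    using U that u(1) submod_uminus by (auto simp: submod_def)
  ultimately show "U +>\<^bsub>M\<^esub> x = U +>\<^bsub>M\<^esub> y"
    unfolding a_r_coset_def' by blast
qed

lemma submod_coset_self: "x \<in> carrier M \<Longrightarrow> x \<in> U +>\<^bsub>M\<^esub> x"
  using U by (auto simp: a_r_coset_def' submod_def intro!: bexI[of _ "\<zero>\<^bsub>M\<^esub>"])

lemma mem_coset_iff: "y \<in> U +>\<^bsub>M\<^esub> x \<longleftrightarrow> (\<exists>u\<in>U. y = u \<oplus>\<^bsub>M\<^esub> x)"
  by (auto simp: a_r_coset_def')

lemma coset_mem_carrier: "x \<in> carrier M \<Longrightarrow> y \<in> U +>\<^bsub>M\<^esub> x \<Longrightarrow> y \<in> carrier M"
  using U by (auto simp: a_r_coset_def' submod_def)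

lemma carrier_quotient_module: "carrier (quotient_module M U) = (\<lambda>x. U +>\<^bsub>M\<^esub> x) ` carrier M"
  by (auto simp: quotient_module_def A_RCOSETS_def RCOSETS_def a_r_coset_def)

lemma zero_quotient_module: "\<zero>\<^bsub>quotient_module M U\<^esub> = U +>\<^bsub>M\<^esub> \<zero>\<^bsub>M\<^esub>"
proof -
  have "h \<oplus>\<^bsub>M\<^esub> \<zero>\<^bsub>M\<^esub> = h" if "h \<in> U" for h using U that by (auto simp: submod_def)
  then have "U +>\<^bsub>M\<^esub> \<zero>\<^bsub>M\<^esub> = U" unfolding a_r_coset_def' by (simp cong: SUP_cong)
  then show ?thesis by (simp add: quotient_module_def)
qed

text \<open>The scalar action on a quotient module is a union over all representatives of a class.
  Such a union collapses to a single value when the value does not depend on the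
  representative.\<close>

lemma coset_UN_eq:
  assumes "x \<in> carrier M" and "\<And>y. y \<in> U +>\<^bsub>M\<^esub> x \<Longrightarrow> F y = F x"
  shows "(\<Union>y\<in>U +>\<^bsub>M\<^esub> x. F y) = F x"
  using assms submod_coset_self by blast

lemma add_quotient_module:
  assumes "x \<in> carrier M" "y \<in> carrier M"
  shows "(U +>\<^bsub>M\<^esub> x) \<oplus>\<^bsub>quotient_module M U\<^esub> (U +>\<^bsub>M\<^esub> y) = U +>\<^bsub>M\<^esub> (x \<oplus>\<^bsub>M\<^esub> y)"
proof -
  have c: "v \<in> carrier M" if "v \<in> U" for v using U that by (auto simp: submod_def)
  have 1: "(u \<oplus>\<^bsub>M\<^esub> x) \<oplus>\<^bsub>M\<^esub> (v \<oplus>\<^bsub>M\<^esub> y) = (u \<oplus>\<^bsub>M\<^esub> v) \<oplus>\<^bsub>M\<^esub> (x \<oplus>\<^bsub>M\<^esub> y)" if "u \<in> U" "v \<in> U" for u v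
    using assms c that by (simp add: M.a_ac)
  \<comment> \<open>The element of \<open>U\<close> goes entirely into the first summand, with zero
    in the second. This places the coset of the sum inside the sum of the cosets.\<close>
  have 2: "u \<oplus>\<^bsub>M\<^esub> (x \<oplus>\<^bsub>M\<^esub> y) = (u \<oplus>\<^bsub>M\<^esub> x) \<oplus>\<^bsub>M\<^esub> (\<zero>\<^bsub>M\<^esub> \<oplus>\<^bsub>M\<^esub> y)" if "u \<in> U" for u
    using assms c that by (simp add: M.a_ac)
  have "(U +>\<^bsub>M\<^esub> x) \<oplus>\<^bsub>quotient_module M U\<^esub> (U +>\<^bsub>M\<^esub> y) = {p \<oplus>\<^bsub>M\<^esub> q | p q. p \<in> U +>\<^bsub>M\<^esub> x \<and> q \<in> U +>\<^bsub>M\<^esub> y}"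
    by (auto simp: quotient_module_def set_add_def set_mult_def)
  also have "\<dots> = U +>\<^bsub>M\<^esub> (x \<oplus>\<^bsub>M\<^esub> y)"
  proof (intro Set.set_eqI iffI)
    fix z assume "z \<in> {p \<oplus>\<^bsub>M\<^esub> q | p q. p \<in> U +>\<^bsub>M\<^esub> x \<and> q \<in> U +>\<^bsub>M\<^esub> y}"
    then obtain u v where uv: "u \<in> U" "v \<in> U" "z = (u \<oplus>\<^bsub>M\<^esub> x) \<oplus>\<^bsub>M\<^esub> (v \<oplus>\<^bsub>M\<^esub> y)"
      by (auto simp: mem_coset_iff)
    moreover have "u \<oplus>\<^bsub>M\<^esub> v \<in> U" using U uv by (auto simp: submod_def)
    ultimately show "z \<in> U +>\<^bsub>M\<^esub> (x \<oplus>\<^bsub>M\<^esub> y)" using 1 by (auto simp: mem_coset_iff)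
  next
    fix z assume "z \<in> U +>\<^bsub>M\<^esub> (x \<oplus>\<^bsub>M\<^esub> y)"
    then obtain u where u: "u \<in> U" "z = u \<oplus>\<^bsub>M\<^esub> (x \<oplus>\<^bsub>M\<^esub> y)" by (auto simp: mem_coset_iff)
    then have "z = (u \<oplus>\<^bsub>M\<^esub> x) \<oplus>\<^bsub>M\<^esub> (\<zero>\<^bsub>M\<^esub> \<oplus>\<^bsub>M\<^esub> y)" using 2 by simp
    moreover have "u \<oplus>\<^bsub>M\<^esub> x \<in> U +>\<^bsub>M\<^esub> x" using u by (auto simp: mem_coset_iff)
    moreover have "\<zero>\<^bsub>M\<^esub> \<oplus>\<^bsub>M\<^esub> y \<in> U +>\<^bsub>M\<^esub> y"
      unfolding mem_coset_iff using U by (intro bexI[of _ "\<zero>\<^bsub>M\<^esub>"]) (auto simp: submod_def)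
    ultimately show "z \<in> {p \<oplus>\<^bsub>M\<^esub> q | p q. p \<in> U +>\<^bsub>M\<^esub> x \<and> q \<in> U +>\<^bsub>M\<^esub> y}" by blast
  qed
  finally show ?thesis .
qed

lemma smult_quotient_module:
  assumes a: "a \<in> carrier R" and x: "x \<in> carrier M"
  shows "a \<odot>\<^bsub>quotient_module M U\<^esub> (U +>\<^bsub>M\<^esub> x) = U +>\<^bsub>M\<^esub> (a \<odot>\<^bsub>M\<^esub> x)"
proof -
  have "U +>\<^bsub>M\<^esub> (a \<odot>\<^bsub>M\<^esub> y) = U +>\<^bsub>M\<^esub> (a \<odot>\<^bsub>M\<^esub> x)" if y: "y \<in> U +>\<^bsub>M\<^esub> x" for y
  proof -
    obtain u where u: "u \<in> U" "y = u \<oplus>\<^bsub>M\<^esub> x" using y mem_coset_iff by blast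
    then have "a \<odot>\<^bsub>M\<^esub> y = a \<odot>\<^bsub>M\<^esub> u \<oplus>\<^bsub>M\<^esub> a \<odot>\<^bsub>M\<^esub> x" "a \<odot>\<^bsub>M\<^esub> u \<in> U"
      using U a x by (auto simp: submod_def smult_r_distr)
    then show ?thesis
      by (intro submod_coset_eq_iff[THEN iffD2] bexI[of _ "a \<odot>\<^bsub>M\<^esub> u"])
        (use U u(1) in \<open>auto simp: smult_closed a x coset_mem_carrier[OF x y] submod_def subset_iff\<close>)
  qed
  then show ?thesis
    using coset_UN_eq[OF x, of "\<lambda>y. U +>\<^bsub>M\<^esub> (a \<odot>\<^bsub>M\<^esub> y)"] by (simp add: quotient_module_def)
qed

lemma right_module_quotient: "right_module R (quotient_module M U)"
proof -
  have "abelian_group (quotient_module M U)"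
  proof (rule abelian_groupI)
    fix C assume "C \<in> carrier (quotient_module M U)"
    then obtain x where x: "x \<in> carrier M" "C = U +>\<^bsub>M\<^esub> x" by (auto simp: carrier_quotient_module)
    then show "\<exists>D\<in>carrier (quotient_module M U). D \<oplus>\<^bsub>quotient_module M U\<^esub> C = \<zero>\<^bsub>quotient_module M U\<^esub>"
      by (intro bexI[of _ "U +>\<^bsub>M\<^esub> (\<ominus>\<^bsub>M\<^esub> x)"])
        (auto simp: add_quotient_module zero_quotient_module M.l_neg carrier_quotient_module)
  qed (auto simp: carrier_quotient_module add_quotient_module zero_quotient_module M.a_ac)
  then show ?thesis
    by (intro right_module.intro right_module_axioms.intro R.ring_axioms)
      (auto simp: carrier_quotient_module smult_quotient_module add_quotient_module smult_closed
        smult_l_distr smult_r_distr smult_assoc smult_one)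
qed

lemma lin_coset: "lin R M (quotient_module M U) (\<lambda>x. U +>\<^bsub>M\<^esub> x)"
  by (rule linI) (auto simp: carrier_quotient_module smult_quotient_module add_quotient_module)

end

end

lemma quotient_map_coset:
  assumes "right_module R M" "submod R M U" "x \<in> carrier M"
    and "\<And>y. y \<in> U +>\<^bsub>M\<^esub> x \<Longrightarrow> U' +>\<^bsub>M'\<^esub> f y = U' +>\<^bsub>M'\<^esub> f x"
  shows "quotient_map M U M' U' f (U +>\<^bsub>M\<^esub> x) = U' +>\<^bsub>M'\<^esub> f x"
proof -
  interpret right_module R M by fact
  have "U +>\<^bsub>M\<^esub> x \<in> a_rcosets\<^bsub>M\<^esub> U"
    using carrier_quotient_module[OF assms(2)] assms(3) by (auto simp: quotient_module_def)
  then show ?thesis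
    using coset_UN_eq[OF assms(2,3), of "\<lambda>y. U' +>\<^bsub>M'\<^esub> f y"] assms(4) by (simp add: quotient_map_def)
qed

subsection \<open>Products and direct sums\<close>

text \<open>The index set is a whole type, so that families are plain functions. Below it is the
  type of degrees, or a single point when only one module is involved.\<close>

definition prod_module :: "('i \<Rightarrow> ('r, 'm) module) \<Rightarrow> ('r, 'i \<Rightarrow> 'm) module"
  where "prod_module M =
    \<lparr>carrier = {f. \<forall>i. f i \<in> carrier (M i)}, monoid.mult = (\<lambda>_ _. undefined), monoid.one = undefined,
     ring.zero = (\<lambda>i. \<zero>\<^bsub>M i\<^esub>), ring.add = (\<lambda>f g i. f i \<oplus>\<^bsub>M i\<^esub> g i), smult = (\<lambda>a f i. a \<odot>\<^bsub>M i\<^esub> f i)\<rparr>"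

lemma prod_module_simps [simp]:
  "f \<in> carrier (prod_module M) \<longleftrightarrow> (\<forall>i. f i \<in> carrier (M i))"
  "\<zero>\<^bsub>prod_module M\<^esub> = (\<lambda>i. \<zero>\<^bsub>M i\<^esub>)"
  "f \<oplus>\<^bsub>prod_module M\<^esub> g = (\<lambda>i. f i \<oplus>\<^bsub>M i\<^esub> g i)"
  "a \<odot>\<^bsub>prod_module M\<^esub> f = (\<lambda>i. a \<odot>\<^bsub>M i\<^esub> f i)"
  by (simp_all add: prod_module_def)

lemma right_moduleI:
  assumes "ring R"
    and "\<zero>\<^bsub>M\<^esub> \<in> carrier M"
    and "\<And>x y. \<lbrakk>x \<in> carrier M; y \<in> carrier M\<rbrakk> \<Longrightarrow> x \<oplus>\<^bsub>M\<^esub> y \<in> carrier M"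
    and "\<And>a x. \<lbrakk>a \<in> carrier R; x \<in> carrier M\<rbrakk> \<Longrightarrow> a \<odot>\<^bsub>M\<^esub> x \<in> carrier M"
    and "\<And>x y z. \<lbrakk>x \<in> carrier M; y \<in> carrier M; z \<in> carrier M\<rbrakk> \<Longrightarrow> (x \<oplus>\<^bsub>M\<^esub> y) \<oplus>\<^bsub>M\<^esub> z = x \<oplus>\<^bsub>M\<^esub> (y \<oplus>\<^bsub>M\<^esub> z)"
    and "\<And>x y. \<lbrakk>x \<in> carrier M; y \<in> carrier M\<rbrakk> \<Longrightarrow> x \<oplus>\<^bsub>M\<^esub> y = y \<oplus>\<^bsub>M\<^esub> x"
    and "\<And>x. x \<in> carrier M \<Longrightarrow> \<zero>\<^bsub>M\<^esub> \<oplus>\<^bsub>M\<^esub> x = x"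
    and "\<And>x. x \<in> carrier M \<Longrightarrow> \<exists>y\<in>carrier M. y \<oplus>\<^bsub>M\<^esub> x = \<zero>\<^bsub>M\<^esub>"
    and "\<And>a b x. \<lbrakk>a \<in> carrier R; b \<in> carrier R; x \<in> carrier M\<rbrakk> \<Longrightarrow>
        (a \<oplus>\<^bsub>R\<^esub> b) \<odot>\<^bsub>M\<^esub> x = a \<odot>\<^bsub>M\<^esub> x \<oplus>\<^bsub>M\<^esub> b \<odot>\<^bsub>M\<^esub> x"
    and "\<And>a x y. \<lbrakk>a \<in> carrier R; x \<in> carrier M; y \<in> carrier M\<rbrakk> \<Longrightarrow>
        a \<odot>\<^bsub>M\<^esub> (x \<oplus>\<^bsub>M\<^esub> y) = a \<odot>\<^bsub>M\<^esub> x \<oplus>\<^bsub>M\<^esub> a \<odot>\<^bsub>M\<^esub> y"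
    and "\<And>a b x. \<lbrakk>a \<in> carrier R; b \<in> carrier R; x \<in> carrier M\<rbrakk> \<Longrightarrow>
        (a \<otimes>\<^bsub>R\<^esub> b) \<odot>\<^bsub>M\<^esub> x = b \<odot>\<^bsub>M\<^esub> (a \<odot>\<^bsub>M\<^esub> x)"
    and "\<And>x. x \<in> carrier M \<Longrightarrow> \<one>\<^bsub>R\<^esub> \<odot>\<^bsub>M\<^esub> x = x"
  shows "right_module R M"
  by (intro right_module.intro right_module_axioms.intro abelian_groupI assms)

lemma right_module_prod:
  fixes M :: "'i \<Rightarrow> ('r, 'm) module"
  assumes M: "\<And>i. right_module R (M i)"
  shows "right_module R (prod_module M)"
proof -
  interpret M: right_module R "M i" for i by (rule M)
  show ?thesis
  proof (rule right_moduleI)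
    show "ring R" by (rule M.R.ring_axioms)
    show "\<exists>y\<in>carrier (prod_module M). y \<oplus>\<^bsub>prod_module M\<^esub> x = \<zero>\<^bsub>prod_module M\<^esub>"
      if "x \<in> carrier (prod_module M)" for x
      using that by (intro bexI[of _ "\<lambda>i. \<ominus>\<^bsub>M i\<^esub> x i"]) (auto simp: M.M.l_neg)
  qed (auto simp: M.smult_closed M.smult_l_distr M.smult_r_distr M.smult_assoc M.smult_one M.M.a_ac)
qed

definition dsum :: "('r, 'm) module \<Rightarrow> ('r, 'n) module \<Rightarrow> ('r, 'm \<times> 'n) module"
  where "dsum M N =
    \<lparr>carrier = carrier M \<times> carrier N, monoid.mult = (\<lambda>_ _. undefined), monoid.one = undefined,
     ring.zero = (\<zero>\<^bsub>M\<^esub>, \<zero>\<^bsub>N\<^esub>), ring.add = (\<lambda>x y. (fst x \<oplus>\<^bsub>M\<^esub> fst y, snd x \<oplus>\<^bsub>N\<^esub> snd y)),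
     smult = (\<lambda>a x. (a \<odot>\<^bsub>M\<^esub> fst x, a \<odot>\<^bsub>N\<^esub> snd x))\<rparr>"

lemma dsum_simps [simp]:
  "x \<in> carrier (dsum M N) \<longleftrightarrow> fst x \<in> carrier M \<and> snd x \<in> carrier N"
  "\<zero>\<^bsub>dsum M N\<^esub> = (\<zero>\<^bsub>M\<^esub>, \<zero>\<^bsub>N\<^esub>)"
  "x \<oplus>\<^bsub>dsum M N\<^esub> y = (fst x \<oplus>\<^bsub>M\<^esub> fst y, snd x \<oplus>\<^bsub>N\<^esub> snd y)"
  "a \<odot>\<^bsub>dsum M N\<^esub> x = (a \<odot>\<^bsub>M\<^esub> fst x, a \<odot>\<^bsub>N\<^esub> snd x)"
  by (simp_all add: dsum_def mem_Times_iff)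

lemma right_module_dsum:
  assumes M: "right_module R M" and N: "right_module R N"
  shows "right_module R (dsum M N)"
proof -
  interpret M: right_module R M by (rule M)
  interpret N: right_module R N by (rule N)
  show ?thesis
  proof (rule right_moduleI)
    show "ring R" by (rule M.R.ring_axioms)
    show "\<exists>y\<in>carrier (dsum M N). y \<oplus>\<^bsub>dsum M N\<^esub> x = \<zero>\<^bsub>dsum M N\<^esub>"
      if "x \<in> carrier (dsum M N)" for x
      using that by (intro bexI[of _ "(\<ominus>\<^bsub>M\<^esub> fst x, \<ominus>\<^bsub>N\<^esub> snd x)"]) (auto simp: M.M.l_neg N.M.l_neg)
  qed (auto simp: M.smult_closed M.smult_l_distr M.smult_r_distr M.smult_assoc M.smult_one M.M.a_ac
      N.smult_closed N.smult_l_distr N.smult_r_distr N.smult_assoc N.smult_one N.M.a_ac prod_eq_iff)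
qed

lemma lin_inl:
  assumes "right_module R M" "right_module R N"
  shows "lin R M (dsum M N) (\<lambda>x. (x, \<zero>\<^bsub>N\<^esub>))"
proof -
  interpret M: right_module R M by fact
  interpret N: right_module R N by fact
  show ?thesis by (rule linI) (auto simp: N.smult_r_zero)
qed

lemma lin_inr:
  assumes "right_module R M" "right_module R N"
  shows "lin R N (dsum M N) (\<lambda>x. (\<zero>\<^bsub>M\<^esub>, x))"
proof -
  interpret M: right_module R M by fact
  interpret N: right_module R N by fact
  show ?thesis by (rule linI) (auto simp: M.smult_r_zero)
qed

lemma lin_fst: "lin R (dsum M N) M fst" and lin_snd: "lin R (dsum M N) N snd"
  by (auto simp: lin_def)

lemma lin_pair: "lin R L M f \<Longrightarrow> lin R L N g \<Longrightarrow> lin R L (dsum M N) (\<lambda>x. (f x, g x))"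
  by (auto simp: lin_def)

section \<open>Duality for finitely generated projective modules\<close>

text \<open>Evaluation at a point goes from a \<open>k\<close>-module of homomorphisms to a module
  over \<Lambda>. It is additive but not linear over a common ring, so \<open>lin_finsum\<close>
  does not apply to it.\<close>

lemma additive_finsum:
  assumes M: "abelian_group M" and N: "abelian_group N"
    and cl: "\<And>x. x \<in> carrier M \<Longrightarrow> f x \<in> carrier N"
    and add: "\<And>x y. x \<in> carrier M \<Longrightarrow> y \<in> carrier M \<Longrightarrow> f (x \<oplus>\<^bsub>M\<^esub> y) = f x \<oplus>\<^bsub>N\<^esub> f y"
    and S: "finite S" "t \<in> S \<rightarrow> carrier M"
  shows "f (\<Oplus>\<^bsub>M\<^esub>x\<in>S. t x) = (\<Oplus>\<^bsub>N\<^esub>x\<in>S. f (t x))"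
  using S
proof (induction S rule: finite_induct)
  interpret M: abelian_group M by fact
  interpret N: abelian_group N by fact
  case empty
  have "f \<zero>\<^bsub>M\<^esub> \<oplus>\<^bsub>N\<^esub> f \<zero>\<^bsub>M\<^esub> = f \<zero>\<^bsub>M\<^esub>" using add[of "\<zero>\<^bsub>M\<^esub>" "\<zero>\<^bsub>M\<^esub>"] by simp
  then show ?case using cl[of "\<zero>\<^bsub>M\<^esub>"] by (simp add: N.add.l_cancel_one')
next
  interpret M: abelian_group M by fact
  interpret N: abelian_group N by fact
  case (insert x S)
  then have "t \<in> S \<rightarrow> carrier M" "t x \<in> carrier M" by auto
  moreover from this have "(\<lambda>x. f (t x)) \<in> S \<rightarrow> carrier N" "f (t x) \<in> carrier N" using cl by auto
  ultimately show ?case using insert by (simp add: add M.finsum_closed)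
qed

text \<open>The data of the dual basis lemma for projective modules: they exhibit \<open>Q\<close>
  as a direct summand of a finite free module. The generators index themselves, and
  \<open>\<Xi> s\<close> is the coordinate function belonging to \<open>s\<close>.\<close>

definition dual_basis ::
    "('r, 'z) ring_scheme \<Rightarrow> ('r, 'q) module \<Rightarrow> 'q set \<Rightarrow> ('q \<Rightarrow> 'q \<Rightarrow> 'r) \<Rightarrow> bool"
  where "dual_basis R Q S \<Xi> \<longleftrightarrow> finite S \<and> S \<subseteq> carrier Q \<and>
    (\<forall>s\<in>S. \<Xi> s \<in> module_homs R Q (regular_module R)) \<and>
    (\<forall>x\<in>carrier Q. x = (\<Oplus>\<^bsub>Q\<^esub>s\<in>S. \<Xi> s x \<odot>\<^bsub>Q\<^esub> s))"

lemma regular_module_simps [simp]: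
  "carrier (regular_module R) = carrier R"
  "\<zero>\<^bsub>regular_module R\<^esub> = \<zero>\<^bsub>R\<^esub>"
  "x \<oplus>\<^bsub>regular_module R\<^esub> y = x \<oplus>\<^bsub>R\<^esub> y"
  "a \<odot>\<^bsub>regular_module R\<^esub> x = x \<otimes>\<^bsub>R\<^esub> a"
  by (simp_all add: regular_module_def)

text \<open>Projectivity splits the surjection \<open>e\<close> from the free module on a finite
  generating set; the coordinates of the splitting \<open>g\<close> are the functionals
  \<open>\<Xi> s\<close>.\<close>

lemma ex_dual_basis:
  assumes proj: "projective_module R Q" and fg: "fg_module R Q"
  shows "\<exists>S \<Xi>. dual_basis R Q S \<Xi>"
proof -
  have Q: "right_module R Q" using fg by (simp add: fg_module_def)
  interpret Q: right_module R Q by (rule Q)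
  obtain S where S: "finite S" "S \<subseteq> carrier Q"
    and gen: "\<And>x. x \<in> carrier Q \<Longrightarrow> \<exists>c\<in>S \<rightarrow> carrier R. x = (\<Oplus>\<^bsub>Q\<^esub>s\<in>S. c s \<odot>\<^bsub>Q\<^esub> s)"
    using fg by (auto simp: fg_module_def)
  let ?F = "free_module R S"
  have F: "right_module R ?F" by (rule right_module_free) (rule Q.R.ring_axioms)
  define e where "e = free_extend R S Q (\<lambda>s. s)"
  have S': "(\<lambda>s. s) \<in> S \<rightarrow> carrier Q" using S by auto
  have e: "e \<in> module_homs R ?F Q" unfolding e_def by (rule Q.free_extend_hom[OF S'])
  have ee: "e c = (\<Oplus>\<^bsub>Q\<^esub>s\<in>S. c s \<odot>\<^bsub>Q\<^esub> s)" if "c \<in> carrier ?F" for c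
    unfolding e_def by (rule Q.free_extend_eq[OF that S(1) _ order_refl S'])
      (use that in \<open>auto simp: free_module_def\<close>)
  have surj: "x \<in> e ` carrier ?F" if x: "x \<in> carrier Q" for x
  proof -
    obtain c where c: "c \<in> S \<rightarrow> carrier R" "x = (\<Oplus>\<^bsub>Q\<^esub>s\<in>S. c s \<odot>\<^bsub>Q\<^esub> s)" using gen[OF x] by blast
    \<comment> \<open>Coefficients are extended by zero, because elements of the free module on
      \<open>S\<close> have to vanish outside \<open>S\<close>.\<close>
    define c' where "c' s = (if s \<in> S then c s else \<zero>\<^bsub>R\<^esub>)" for s
    have "finite {x. c' x \<noteq> \<zero>\<^bsub>R\<^esub>}" by (rule finite_subset[OF _ S(1)]) (auto simp: c'_def)
    then have c': "c' \<in> carrier ?F" using c(1) by (auto simp: free_module_def c'_def)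
    have "e c' = x" unfolding ee[OF c'] c(2)
      by (rule Q.M.finsum_cong') (use c S in \<open>auto simp: c'_def intro!: Q.smult_closed\<close>)
    then show ?thesis using c' by blast
  qed
  obtain g where g: "g \<in> module_homs R Q ?F" "\<And>x. x \<in> carrier Q \<Longrightarrow> e (g x) = x"
    using projective_module_factor[OF proj F Q module_homs_lin[OF e] lin_id surj] by auto
  have gc: "g x \<in> carrier ?F" if "x \<in> carrier Q" for x using module_homsD(1)[OF g(1) that] .
  define \<Xi> where "\<Xi> s = (\<lambda>x\<in>carrier Q. g x s)" for s
  have "\<Xi> s \<in> module_homs R Q (regular_module R)" for s
    unfolding \<Xi>_def
  proof (rule restrict_module_homs[OF Q])
    show "lin R Q (regular_module R) (\<lambda>x. g x s)"
      by (rule linI)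
        (use gc in \<open>auto simp: module_homsD[OF g(1)] free_module_def regular_module_def\<close>)
  qed
  moreover have "x = (\<Oplus>\<^bsub>Q\<^esub>s\<in>S. \<Xi> s x \<odot>\<^bsub>Q\<^esub> s)" if x: "x \<in> carrier Q" for x
    using g(2)[OF x] ee[OF gc[OF x]] x by (simp add: \<Xi>_def)
  ultimately show ?thesis using S unfolding dual_basis_def by blast
qed

definition hom_module ::
    "('k, 'r) module \<Rightarrow> ('r, 'm) module \<Rightarrow> ('r, 'n) module \<Rightarrow> ('k, 'm \<Rightarrow> 'n) module"
  where "hom_module \<Lambda> M N =
    \<lparr>carrier = module_homs \<Lambda> M N, monoid.mult = (\<lambda>_ _. undefined), monoid.one = undefined,
     ring.zero = (\<lambda>x\<in>carrier M. \<zero>\<^bsub>N\<^esub>), ring.add = (\<lambda>f g. \<lambda>x\<in>carrier M. f x \<oplus>\<^bsub>N\<^esub> g x),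
     smult = (\<lambda>a f. \<lambda>x\<in>carrier M. (a \<odot>\<^bsub>\<Lambda>\<^esub> \<one>\<^bsub>\<Lambda>\<^esub>) \<odot>\<^bsub>N\<^esub> f x)\<rparr>"

lemma hom_module_simps [simp]:
  "carrier (hom_module \<Lambda> M N) = module_homs \<Lambda> M N"
  "\<zero>\<^bsub>hom_module \<Lambda> M N\<^esub> = (\<lambda>x\<in>carrier M. \<zero>\<^bsub>N\<^esub>)"
  "f \<oplus>\<^bsub>hom_module \<Lambda> M N\<^esub> g = (\<lambda>x\<in>carrier M. f x \<oplus>\<^bsub>N\<^esub> g x)"
  "a \<odot>\<^bsub>hom_module \<Lambda> M N\<^esub> f = (\<lambda>x\<in>carrier M. (a \<odot>\<^bsub>\<Lambda>\<^esub> \<one>\<^bsub>\<Lambda>\<^esub>) \<odot>\<^bsub>N\<^esub> f x)"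
  by (simp_all add: hom_module_def)

lemma module_homs_add:
  assumes "right_module R M" "right_module R N" "f \<in> module_homs R M N" "g \<in> module_homs R M N"
  shows "(\<lambda>x\<in>carrier M. f x \<oplus>\<^bsub>N\<^esub> g x) \<in> module_homs R M N"
  by (rule restrict_module_homs[OF assms(1) lin_plus[OF assms(2)]]) (use assms in \<open>auto intro: module_homs_lin\<close>)

lemma zero_module_homs:
  "right_module R M \<Longrightarrow> right_module R N \<Longrightarrow> (\<lambda>x\<in>carrier M. \<zero>\<^bsub>N\<^esub>) \<in> module_homs R M N"
  by (rule restrict_module_homs[OF _ lin_const_zero])

lemma comp_module_homs:
  assumes "right_module R L" "lin R L M f" "lin R M N g"
  shows "(\<lambda>x\<in>carrier L. g (f x)) \<in> module_homs R L N"
  by (rule restrict_module_homs[OF assms(1) lin_comp[OF assms(2,3)]])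

section \<open>Algebras over a commutative ring and their Hom modules\<close>

locale k_algebra =
  fixes k :: "('k, 'c) ring_scheme" and \<Lambda> :: "('k, 'r) module"
  assumes cring_base: "cring k" and ring_algebra: "ring \<Lambda>" and right_module_algebra: "right_module k \<Lambda>"
    and smult_mult: "\<lbrakk>a \<in> carrier k; x \<in> carrier \<Lambda>; y \<in> carrier \<Lambda>\<rbrakk> \<Longrightarrow>
      (a \<odot>\<^bsub>\<Lambda>\<^esub> x) \<otimes>\<^bsub>\<Lambda>\<^esub> y = a \<odot>\<^bsub>\<Lambda>\<^esub> (x \<otimes>\<^bsub>\<Lambda>\<^esub> y)"
    and mult_smult: "\<lbrakk>a \<in> carrier k; x \<in> carrier \<Lambda>; y \<in> carrier \<Lambda>\<rbrakk> \<Longrightarrow>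
      x \<otimes>\<^bsub>\<Lambda>\<^esub> (a \<odot>\<^bsub>\<Lambda>\<^esub> y) = a \<odot>\<^bsub>\<Lambda>\<^esub> (x \<otimes>\<^bsub>\<Lambda>\<^esub> y)"
begin

sublocale base: cring k by (rule cring_base)
sublocale alg: ring \<Lambda> by (rule ring_algebra)
sublocale algmod: right_module k \<Lambda> by (rule right_module_algebra)

definition scalar :: "'k \<Rightarrow> 'r" where "scalar a = a \<odot>\<^bsub>\<Lambda>\<^esub> \<one>\<^bsub>\<Lambda>\<^esub>"

lemma scalar_closed [simp]: "a \<in> carrier k \<Longrightarrow> scalar a \<in> carrier \<Lambda>"
  by (simp add: scalar_def algmod.smult_closed)

lemma scalar_mult: "a \<in> carrier k \<Longrightarrow> x \<in> carrier \<Lambda> \<Longrightarrow> scalar a \<otimes>\<^bsub>\<Lambda>\<^esub> x = a \<odot>\<^bsub>\<Lambda>\<^esub> x"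
  by (simp add: scalar_def smult_mult)

lemma mult_scalar: "a \<in> carrier k \<Longrightarrow> x \<in> carrier \<Lambda> \<Longrightarrow> x \<otimes>\<^bsub>\<Lambda>\<^esub> scalar a = a \<odot>\<^bsub>\<Lambda>\<^esub> x"
  by (simp add: scalar_def mult_smult)

lemma scalar_add: "a \<in> carrier k \<Longrightarrow> b \<in> carrier k \<Longrightarrow> scalar (a \<oplus>\<^bsub>k\<^esub> b) = scalar a \<oplus>\<^bsub>\<Lambda>\<^esub> scalar b"
  by (simp add: scalar_def algmod.smult_l_distr)

lemma scalar_times: "a \<in> carrier k \<Longrightarrow> b \<in> carrier k \<Longrightarrow> scalar (a \<otimes>\<^bsub>k\<^esub> b) = scalar a \<otimes>\<^bsub>\<Lambda>\<^esub> scalar b"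
  by (simp add: mult_scalar) (simp add: scalar_def algmod.smult_assoc)

lemma scalar_one: "scalar \<one>\<^bsub>k\<^esub> = \<one>\<^bsub>\<Lambda>\<^esub>"
  by (simp add: scalar_def algmod.smult_one)

text \<open>The image of \<open>k\<close> in \<Lambda> is central. Hence its elements act on modules
  by \<Lambda>-linear maps, which is what makes Hom over \<Lambda> a module over
  \<open>k\<close>.\<close>

lemma scalar_smult_commute:
  assumes "right_module \<Lambda> M" "a \<in> carrier k" "b \<in> carrier \<Lambda>" "x \<in> carrier M"
  shows "scalar a \<odot>\<^bsub>M\<^esub> (b \<odot>\<^bsub>M\<^esub> x) = b \<odot>\<^bsub>M\<^esub> (scalar a \<odot>\<^bsub>M\<^esub> x)"
proof -
  interpret M: right_module \<Lambda> M by fact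
  show ?thesis
    using assms M.smult_assoc[of b "scalar a" x] M.smult_assoc[of "scalar a" b x]
    by (simp add: scalar_mult mult_scalar)
qed

lemma lin_scalar:
  assumes "right_module \<Lambda> M" "a \<in> carrier k"
  shows "lin \<Lambda> M M (\<lambda>x. scalar a \<odot>\<^bsub>M\<^esub> x)"
proof -
  interpret M: right_module \<Lambda> M by fact
  show ?thesis
    by (rule linI) (use assms in \<open>auto simp: M.smult_closed M.smult_r_distr scalar_smult_commute\<close>)
qed

lemma smult_hom_module: "a \<odot>\<^bsub>hom_module \<Lambda> M N\<^esub> f = (\<lambda>x\<in>carrier M. scalar a \<odot>\<^bsub>N\<^esub> f x)"
  by (simp add: scalar_def)

lemma right_module_hom:
  assumes M: "right_module \<Lambda> M" and N: "right_module \<Lambda> N"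
  shows "right_module k (hom_module \<Lambda> M N)"
proof -
  interpret M: right_module \<Lambda> M by fact
  interpret N: right_module \<Lambda> N by fact
  note cl = module_homsD(1)[where R=\<Lambda> and M=M and N=N]
  have ext: "f = g" if "f \<in> module_homs \<Lambda> M N" "g \<in> module_homs \<Lambda> M N" "\<And>x. x \<in> carrier M \<Longrightarrow> f x = g x" for f g
    using module_homs_eqI that by blast
  have sm: "a \<odot>\<^bsub>hom_module \<Lambda> M N\<^esub> f \<in> module_homs \<Lambda> M N" if "a \<in> carrier k" "f \<in> module_homs \<Lambda> M N" for a f
    unfolding smult_hom_module
    by (rule comp_module_homs[OF M module_homs_lin[OF that(2)] lin_scalar[OF N that(1)]])
  show ?thesis
  proof (rule right_moduleI)
    show "ring k" by (rule base.ring_axioms)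
    show "\<exists>g\<in>carrier (hom_module \<Lambda> M N). g \<oplus>\<^bsub>hom_module \<Lambda> M N\<^esub> f = \<zero>\<^bsub>hom_module \<Lambda> M N\<^esub>"
      if f: "f \<in> carrier (hom_module \<Lambda> M N)" for f
    proof
      show "(\<lambda>x\<in>carrier M. \<ominus>\<^bsub>N\<^esub> f x) \<in> carrier (hom_module \<Lambda> M N)"
        using f by (auto intro!: restrict_module_homs[OF M] lin_uminus[OF N] dest: module_homs_lin)
      show "(\<lambda>x\<in>carrier M. \<ominus>\<^bsub>N\<^esub> f x) \<oplus>\<^bsub>hom_module \<Lambda> M N\<^esub> f = \<zero>\<^bsub>hom_module \<Lambda> M N\<^esub>"
        using f cl by (auto simp: N.M.l_neg intro!: restrict_ext)
    qed
    show "a \<odot>\<^bsub>hom_module \<Lambda> M N\<^esub> f \<in> carrier (hom_module \<Lambda> M N)"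
      if "a \<in> carrier k" "f \<in> carrier (hom_module \<Lambda> M N)" for a f
      using sm that by simp
    show "\<zero>\<^bsub>hom_module \<Lambda> M N\<^esub> \<oplus>\<^bsub>hom_module \<Lambda> M N\<^esub> f = f" if "f \<in> carrier (hom_module \<Lambda> M N)" for f
    proof (rule ext)
      show "\<zero>\<^bsub>hom_module \<Lambda> M N\<^esub> \<oplus>\<^bsub>hom_module \<Lambda> M N\<^esub> f \<in> module_homs \<Lambda> M N"
        using module_homs_add[OF M N zero_module_homs[OF M N]] that by (simp only: hom_module_simps)
    qed (use that cl in auto)
    show "\<one>\<^bsub>k\<^esub> \<odot>\<^bsub>hom_module \<Lambda> M N\<^esub> f = f" if "f \<in> carrier (hom_module \<Lambda> M N)" for f
      by (rule ext[OF sm]) (use that cl in \<open>auto simp: scalar_one smult_hom_module N.smult_one simp del: hom_module_simps(4)\<close>)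
  qed (auto simp: smult_hom_module module_homs_add[OF M N] zero_module_homs[OF M N] cl N.M.a_ac
      N.smult_closed N.smult_l_distr N.smult_r_distr N.smult_assoc scalar_add scalar_times
      simp del: hom_module_simps(4) intro!: restrict_ext)
qed

end

text \<open>The image of the tensor of \<open>m\<close> and \<open>\<xi>\<close> under the canonical
  map from the tensor product of \<open>M\<close> with Hom(\<open>Q\<close>, \<Lambda>) to
  Hom(\<open>Q\<close>, \<open>M\<close>). For finitely generated projective \<open>Q\<close> these
  maps generate Hom(\<open>Q\<close>, \<open>M\<close>).\<close>

definition rank_one :: "('r, 'q) module \<Rightarrow> ('r, 'm) module \<Rightarrow> ('q \<Rightarrow> 'r) \<Rightarrow> 'm \<Rightarrow> 'q \<Rightarrow> 'm"
  where "rank_one Q M \<xi> m = (\<lambda>q\<in>carrier Q. \<xi> q \<odot>\<^bsub>M\<^esub> m)"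

lemma rank_one_module_homs:
  assumes Q: "right_module R Q" and M: "right_module R M"
    and \<xi>: "\<xi> \<in> module_homs R Q (regular_module R)" and m: "m \<in> carrier M"
  shows "rank_one Q M \<xi> m \<in> module_homs R Q M"
proof -
  interpret M: right_module R M by fact
  show ?thesis
    unfolding rank_one_def
    by (rule restrict_module_homs[OF Q], rule linI)
      (use m in \<open>auto simp: module_homsD[OF \<xi>, simplified] M.smult_closed M.smult_l_distr M.smult_assoc\<close>)
qed

section \<open>Finitely supported families of homomorphisms\<close>

definition supp :: "('i \<Rightarrow> ('r, 'm) module) \<Rightarrow> ('i \<Rightarrow> ('r, 'n) module) \<Rightarrow> ('i \<Rightarrow> 'm \<Rightarrow> 'n) \<Rightarrow> 'i set"
  where "supp A B f = {i. \<exists>x\<in>carrier (A i). f i x \<noteq> \<zero>\<^bsub>B i\<^esub>}"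

text \<open>The direct sum of the modules Hom(\<open>A i\<close>, \<open>B i\<close>), realised
  inside their product so that its operations are inherited. Its functionals are arbitrary families
  of functionals on the summands.\<close>

definition fin_homs ::
    "('k, 'r) module \<Rightarrow> ('i \<Rightarrow> ('r, 'm) module) \<Rightarrow> ('i \<Rightarrow> ('r, 'n) module) \<Rightarrow> ('k, 'i \<Rightarrow> 'm \<Rightarrow> 'n) module"
  where "fin_homs \<Lambda> A B = (prod_module (\<lambda>i. hom_module \<Lambda> (A i) (B i)))
    \<lparr>carrier := {f. (\<forall>i. f i \<in> module_homs \<Lambda> (A i) (B i)) \<and> finite (supp A B f)}\<rparr>"

definition single ::
    "('i \<Rightarrow> ('r, 'm) module) \<Rightarrow> ('i \<Rightarrow> ('r, 'n) module) \<Rightarrow> 'i \<Rightarrow> ('m \<Rightarrow> 'n) \<Rightarrow> 'i \<Rightarrow> 'm \<Rightarrow> 'n"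
  where "single A B i f = (\<lambda>j. if j = i then f else (\<lambda>x\<in>carrier (A j). \<zero>\<^bsub>B j\<^esub>))"

lemma fin_homs_simps [simp]:
  "f \<in> carrier (fin_homs \<Lambda> A B) \<longleftrightarrow> (\<forall>i. f i \<in> module_homs \<Lambda> (A i) (B i)) \<and> finite (supp A B f)"
  "\<zero>\<^bsub>fin_homs \<Lambda> A B\<^esub> = (\<lambda>i. \<lambda>x\<in>carrier (A i). \<zero>\<^bsub>B i\<^esub>)"
  "f \<oplus>\<^bsub>fin_homs \<Lambda> A B\<^esub> g = (\<lambda>i. \<lambda>x\<in>carrier (A i). f i x \<oplus>\<^bsub>B i\<^esub> g i x)"
  "a \<odot>\<^bsub>fin_homs \<Lambda> A B\<^esub> f = (\<lambda>i. \<lambda>x\<in>carrier (A i). (a \<odot>\<^bsub>\<Lambda>\<^esub> \<one>\<^bsub>\<Lambda>\<^esub>) \<odot>\<^bsub>B i\<^esub> f i x)"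
  by (simp_all add: fin_homs_def)

lemma fin_homs_closed:
  "f \<in> carrier (fin_homs \<Lambda> A B) \<Longrightarrow> x \<in> carrier (A i) \<Longrightarrow> f i x \<in> carrier (B i)"
  using module_homsD(1)[of "f i" \<Lambda> "A i" "B i" x] by simp

lemma supp_single: "supp A B (single A B i f) \<subseteq> {i}"
  by (auto simp: supp_def single_def)

lemma supp_zero: "i \<notin> supp A B f \<Longrightarrow> x \<in> carrier (A i) \<Longrightarrow> f i x = \<zero>\<^bsub>B i\<^esub>"
  by (auto simp: supp_def)

lemma supp_add:
  assumes "\<And>i. right_module R (B i)"
  shows "supp A B (\<lambda>i. \<lambda>x\<in>carrier (A i). f i x \<oplus>\<^bsub>B i\<^esub> g i x) \<subseteq> supp A B f \<union> supp A B g"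
proof -
  interpret right_module R "B i" for i by fact
  show ?thesis by (rule subsetI, rule ccontr) (auto simp: supp_def)
qed

lemma supp_smult:
  assumes "\<And>i. right_module R (B i)" "a \<in> carrier R"
  shows "supp A B (\<lambda>i. \<lambda>x\<in>carrier (A i). a \<odot>\<^bsub>B i\<^esub> f i x) \<subseteq> supp A B f"
proof -
  interpret right_module R "B i" for i by fact
  show ?thesis by (rule subsetI, rule ccontr) (use assms(2) in \<open>auto simp: supp_def smult_r_zero\<close>)
qed

lemma single_fin_homs:
  assumes "\<And>i. right_module \<Lambda> (A i)" "\<And>i. right_module \<Lambda> (B i)" "f \<in> module_homs \<Lambda> (A i) (B i)"
  shows "single A B i f \<in> carrier (fin_homs \<Lambda> A B)"
  using assms finite_subset[OF supp_single[of A B i f]] by (auto simp: single_def zero_module_homs)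

text \<open>
  \<open>\<tau>\<close> identifies \<open>T\<close> with the dual of \<open>Hom(Q, \<Lambda>)\<close>, as \<open>Q \<otimes> D\<Lambda>\<close> is for \<open>Q\<close> finitely generated
  projective.
\<close>

definition represents ::
    "('k, 'z) ring_scheme \<Rightarrow> ('k, 'e) module \<Rightarrow> ('k, 'r) module \<Rightarrow> ('r, 'q) module \<Rightarrow> ('r, 't) module \<Rightarrow>
      ('t \<Rightarrow> ('q \<Rightarrow> 'r) \<Rightarrow> 'e) \<Rightarrow> bool"
  where "represents k E \<Lambda> Q T \<tau> \<longleftrightarrow> right_module \<Lambda> T \<and>
    bij_betw \<tau> (carrier T) (module_homs k (hom_module \<Lambda> Q (regular_module \<Lambda>)) E) \<and>
    (\<forall>t\<in>carrier T. \<forall>t'\<in>carrier T. \<forall>\<xi>\<in>module_homs \<Lambda> Q (regular_module \<Lambda>).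
      \<tau> (t \<oplus>\<^bsub>T\<^esub> t') \<xi> = \<tau> t \<xi> \<oplus>\<^bsub>E\<^esub> \<tau> t' \<xi>) \<and>
    (\<forall>a\<in>carrier \<Lambda>. \<forall>t\<in>carrier T. \<forall>\<xi>\<in>module_homs \<Lambda> Q (regular_module \<Lambda>).
      \<tau> (a \<odot>\<^bsub>T\<^esub> t) \<xi> = \<tau> t (\<lambda>q\<in>carrier Q. a \<otimes>\<^bsub>\<Lambda>\<^esub> \<xi> q))"

lemma representsD:
  assumes "represents k E \<Lambda> Q T \<tau>"
  shows "right_module \<Lambda> T"
    and "t \<in> carrier T \<Longrightarrow> \<tau> t \<in> module_homs k (hom_module \<Lambda> Q (regular_module \<Lambda>)) E"
    and "\<lbrakk>t \<in> carrier T; t' \<in> carrier T; \<xi> \<in> module_homs \<Lambda> Q (regular_module \<Lambda>)\<rbrakk> \<Longrightarrow>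
      \<tau> (t \<oplus>\<^bsub>T\<^esub> t') \<xi> = \<tau> t \<xi> \<oplus>\<^bsub>E\<^esub> \<tau> t' \<xi>"
    and "\<lbrakk>a \<in> carrier \<Lambda>; t \<in> carrier T; \<xi> \<in> module_homs \<Lambda> Q (regular_module \<Lambda>)\<rbrakk> \<Longrightarrow>
      \<tau> (a \<odot>\<^bsub>T\<^esub> t) \<xi> = \<tau> t (\<lambda>q\<in>carrier Q. a \<otimes>\<^bsub>\<Lambda>\<^esub> \<xi> q)"
  using assms by (auto simp: represents_def bij_betw_def)

lemma represents_eqI:
  assumes "represents k E \<Lambda> Q T \<tau>" "t \<in> carrier T" "t' \<in> carrier T"
    and "\<And>\<xi>. \<xi> \<in> module_homs \<Lambda> Q (regular_module \<Lambda>) \<Longrightarrow> \<tau> t \<xi> = \<tau> t' \<xi>"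
  shows "t = t'"
proof -
  have "\<tau> t = \<tau> t'"
    by (rule module_homs_eqI[OF representsD(2)[OF assms(1,2)] representsD(2)[OF assms(1,3)]])
      (use assms(4) in simp)
  then show ?thesis using assms(1-3) by (auto simp: represents_def bij_betw_def inj_on_def)
qed

lemma represents_ex:
  assumes "represents k E \<Lambda> Q T \<tau>" "\<psi> \<in> module_homs k (hom_module \<Lambda> Q (regular_module \<Lambda>)) E"
  shows "\<exists>t\<in>carrier T. \<tau> t = \<psi>"
  using assms by (auto simp: represents_def bij_betw_def image_iff) (metis image_iff)

context k_algebra
begin

lemma right_module_fin_homs:
  assumes A: "\<And>i. right_module \<Lambda> (A i)" and B: "\<And>i. right_module \<Lambda> (B i)"
  shows "right_module k (fin_homs \<Lambda> A B)"
proof -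
  have "right_module k (prod_module (\<lambda>i. hom_module \<Lambda> (A i) (B i)))"
    by (rule right_module_prod) (rule right_module_hom[OF A B])
  then interpret P: right_module k "prod_module (\<lambda>i. hom_module \<Lambda> (A i) (B i))" .
  show ?thesis
    unfolding fin_homs_def
  proof (rule P.right_module_carrier_update)
    show "\<zero>\<^bsub>prod_module (\<lambda>i. hom_module \<Lambda> (A i) (B i))\<^esub> \<in> {f. (\<forall>i. f i \<in> module_homs \<Lambda> (A i) (B i)) \<and> finite (supp A B f)}"
      by (auto simp: zero_module_homs A B supp_def)
  next
    fix f g
    assume "f \<in> {f. (\<forall>i. f i \<in> module_homs \<Lambda> (A i) (B i)) \<and> finite (supp A B f)}"
      "g \<in> {f. (\<forall>i. f i \<in> module_homs \<Lambda> (A i) (B i)) \<and> finite (supp A B f)}"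
    then show "f \<oplus>\<^bsub>prod_module (\<lambda>i. hom_module \<Lambda> (A i) (B i))\<^esub> g \<in>
        {f. (\<forall>i. f i \<in> module_homs \<Lambda> (A i) (B i)) \<and> finite (supp A B f)}"
      using finite_subset[OF supp_add[where A=A and f=f and g=g, OF B]] by (auto simp: module_homs_add A B)
  next
    fix a f
    assume *: "a \<in> carrier k" "f \<in> {f. (\<forall>i. f i \<in> module_homs \<Lambda> (A i) (B i)) \<and> finite (supp A B f)}"
    then have "finite (supp A B (\<lambda>i. \<lambda>x\<in>carrier (A i). scalar a \<odot>\<^bsub>B i\<^esub> f i x))"
      using finite_subset[OF supp_smult[where A=A and f=f and a="scalar a", OF B]] by auto
    then show "a \<odot>\<^bsub>prod_module (\<lambda>i. hom_module \<Lambda> (A i) (B i))\<^esub> f \<in>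
        {f. (\<forall>i. f i \<in> module_homs \<Lambda> (A i) (B i)) \<and> finite (supp A B f)}"
      using * right_module.smult_closed[OF right_module_hom[OF A B], of a] by (auto simp: scalar_def)
  qed auto
qed

text \<open>A linear map is determined by its values on the generators, with the coordinates of the
  argument as coefficients. The case of the regular module yields \<open>dual_expand\<close>, the
  general case the decomposition into rank one maps.\<close>

lemma dual_basis_expand:
  assumes A: "right_module \<Lambda> Q" and B: "right_module \<Lambda> M" and db: "dual_basis \<Lambda> Q S \<Xi>"
    and f: "lin \<Lambda> Q M f" and x: "x \<in> carrier Q"
  shows "f x = (\<Oplus>\<^bsub>M\<^esub>s\<in>S. \<Xi> s x \<odot>\<^bsub>M\<^esub> f s)"
proof -
  interpret Q: right_module \<Lambda> Q by fact
  interpret M: right_module \<Lambda> M by fact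
  have S: "finite S" "S \<subseteq> carrier Q" and \<Xi>: "\<And>s. s \<in> S \<Longrightarrow> \<Xi> s x \<in> carrier \<Lambda>"
    using db module_homsD(1)[OF _ x] by (fastforce simp: dual_basis_def)+
  have xx: "x = (\<Oplus>\<^bsub>Q\<^esub>s\<in>S. \<Xi> s x \<odot>\<^bsub>Q\<^esub> s)" using db x by (simp add: dual_basis_def)
  have "f x = f (\<Oplus>\<^bsub>Q\<^esub>s\<in>S. \<Xi> s x \<odot>\<^bsub>Q\<^esub> s)" using xx by simp
  also have "\<dots> = (\<Oplus>\<^bsub>M\<^esub>s\<in>S. f (\<Xi> s x \<odot>\<^bsub>Q\<^esub> s))"
    by (rule lin_finsum[OF A B f]) (use S \<Xi> Q.smult_closed in auto)
  also have "\<dots> = (\<Oplus>\<^bsub>M\<^esub>s\<in>S. \<Xi> s x \<odot>\<^bsub>M\<^esub> f s)"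
    by (rule M.M.finsum_cong')
      (use S \<Xi> M.smult_closed lin_closed[OF f] lin_smult[OF f] in \<open>auto simp: subset_iff\<close>)
  finally show ?thesis .
qed

lemma finsum_hom_module:
  assumes Q: "right_module \<Lambda> Q" and M: "right_module \<Lambda> M"
    and S: "finite S" "t \<in> S \<rightarrow> module_homs \<Lambda> Q M" and x: "x \<in> carrier Q"
  shows "(\<Oplus>\<^bsub>hom_module \<Lambda> Q M\<^esub>s\<in>S. t s) x = (\<Oplus>\<^bsub>M\<^esub>s\<in>S. t s x)"
proof -
  interpret M: right_module \<Lambda> M by fact
  interpret H: right_module k "hom_module \<Lambda> Q M" by (rule right_module_hom[OF Q M])
  show ?thesis
    using additive_finsum[OF H.M.abelian_group_axioms M.M.abelian_group_axioms, of "\<lambda>f. f x" S t]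
      x S by (simp add: module_homsD)
qed

text \<open>By \<open>dual_basis_expand\<close> for the regular module, the coordinate functions
  \<open>\<Xi> s\<close> generate Hom(\<open>Q\<close>, \<Lambda>) as a left module, and the
  coefficient of \<open>\<Xi> s\<close> in \<open>\<xi>\<close> is \<open>\<xi> s\<close>.\<close>

lemma dual_expand:
  assumes Q: "right_module \<Lambda> Q" and db: "dual_basis \<Lambda> Q S \<Xi>"
    and \<xi>: "\<xi> \<in> module_homs \<Lambda> Q (regular_module \<Lambda>)"
  shows "s \<in> S \<Longrightarrow> (\<lambda>q\<in>carrier Q. \<xi> s \<otimes>\<^bsub>\<Lambda>\<^esub> \<Xi> s q) \<in> module_homs \<Lambda> Q (regular_module \<Lambda>)"
    and "(\<Oplus>\<^bsub>hom_module \<Lambda> Q (regular_module \<Lambda>)\<^esub>s\<in>S. (\<lambda>q\<in>carrier Q. \<xi> s \<otimes>\<^bsub>\<Lambda>\<^esub> \<Xi> s q)) = \<xi>"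
proof -
  let ?H = "hom_module \<Lambda> Q (regular_module \<Lambda>)"
  have reg: "right_module \<Lambda> (regular_module \<Lambda>)" by (rule right_module_regular) (rule alg.ring_axioms)
  interpret H: right_module k ?H by (rule right_module_hom[OF Q reg])
  have S: "finite S" "S \<subseteq> carrier Q" "\<And>s. s \<in> S \<Longrightarrow> \<Xi> s \<in> module_homs \<Lambda> Q (regular_module \<Lambda>)"
    using db by (auto simp: dual_basis_def)
  define \<eta> where "\<eta> s = (\<lambda>q\<in>carrier Q. \<xi> s \<otimes>\<^bsub>\<Lambda>\<^esub> \<Xi> s q)" for s
  have \<eta>: "\<eta> s \<in> module_homs \<Lambda> Q (regular_module \<Lambda>)" if "s \<in> S" for s
  proof -
    have "\<xi> s \<in> carrier \<Lambda>" using module_homsD(1)[OF \<xi>] that S(2) by auto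
    then show ?thesis unfolding \<eta>_def
      using module_homsD[OF S(3)[OF that], simplified]
      by (intro restrict_module_homs[OF Q] linI) (auto simp: alg.r_distr alg.m_assoc)
  qed
  then show "s \<in> S \<Longrightarrow> (\<lambda>q\<in>carrier Q. \<xi> s \<otimes>\<^bsub>\<Lambda>\<^esub> \<Xi> s q) \<in> module_homs \<Lambda> Q (regular_module \<Lambda>)"
    by (simp add: \<eta>_def)
  have "(\<Oplus>\<^bsub>?H\<^esub>s\<in>S. \<eta> s) = \<xi>"
  proof (rule module_homs_eqI[OF _ \<xi>])
    show "(\<Oplus>\<^bsub>?H\<^esub>s\<in>S. \<eta> s) \<in> module_homs \<Lambda> Q (regular_module \<Lambda>)"
      using H.M.finsum_closed[of \<eta> S] \<eta> by auto
    fix q assume q: "q \<in> carrier Q"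
    have "(\<Oplus>\<^bsub>?H\<^esub>s\<in>S. \<eta> s) q = (\<Oplus>\<^bsub>regular_module \<Lambda>\<^esub>s\<in>S. \<eta> s q)"
      by (rule finsum_hom_module[OF Q reg]) (use S \<eta> q in auto)
    also have "\<dots> = \<xi> q"
      using dual_basis_expand[OF Q reg db module_homs_lin[OF \<xi>] q] q by (simp add: \<eta>_def)
    finally show "(\<Oplus>\<^bsub>?H\<^esub>s\<in>S. \<eta> s) q = \<xi> q" .
  qed
  then show "(\<Oplus>\<^bsub>?H\<^esub>s\<in>S. (\<lambda>q\<in>carrier Q. \<xi> s \<otimes>\<^bsub>\<Lambda>\<^esub> \<Xi> s q)) = \<xi>" by (simp add: \<eta>_def)
qed

text \<open>\<open>represents\<close> speaks of the action of \<Lambda> only. Compatibility with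
  \<open>k\<close> follows from centrality: the scalar multiplies the values of \<open>\<xi>\<close>
  from the left in \<open>represents\<close> and from the right in \<open>hom_module\<close>, with
  the same result.\<close>

lemma represents_scalar:
  assumes rep: "represents k E \<Lambda> Q T \<tau>" and Q: "right_module \<Lambda> Q"
    and a: "a \<in> carrier k" and t: "t \<in> carrier T" and \<xi>: "\<xi> \<in> module_homs \<Lambda> Q (regular_module \<Lambda>)"
  shows "\<tau> (scalar a \<odot>\<^bsub>T\<^esub> t) \<xi> = a \<odot>\<^bsub>E\<^esub> \<tau> t \<xi>"
proof -
  have "\<tau> (scalar a \<odot>\<^bsub>T\<^esub> t) \<xi> = \<tau> t (\<lambda>q\<in>carrier Q. scalar a \<otimes>\<^bsub>\<Lambda>\<^esub> \<xi> q)"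
    using representsD(4)[OF rep _ t \<xi>] a by simp
  also have "(\<lambda>q\<in>carrier Q. scalar a \<otimes>\<^bsub>\<Lambda>\<^esub> \<xi> q) = a \<odot>\<^bsub>hom_module \<Lambda> Q (regular_module \<Lambda>)\<^esub> \<xi>"
    using module_homsD(1)[OF \<xi>] a by (auto simp: smult_hom_module scalar_mult mult_scalar simp del: hom_module_simps(4) intro!: restrict_ext)
  also have "\<tau> t \<dots> = a \<odot>\<^bsub>E\<^esub> \<tau> t \<xi>"
    using module_homsD(3)[OF representsD(2)[OF rep t] a, of \<xi>] \<xi> by simp
  finally show ?thesis .
qed

end

text \<open>The index type is kept general for two uses. With degrees as indices, \<open>B\<close>
  is the complex \<open>Y\<close> shifted by 0, -1 or 1; with a single point as index, the locale
  serves to prove that \<open>T\<close> is injective.\<close>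

locale dual_families = k_algebra k \<Lambda>
  for k :: "('k, 'c) ring_scheme" and \<Lambda> :: "('k, 'r) module" +
  fixes E :: "('k, 'e) module" and A :: "'i \<Rightarrow> ('r, 'q) module" and B :: "'i \<Rightarrow> ('r, 'm) module"
    and T :: "'i \<Rightarrow> ('r, 't) module" and \<tau> :: "'i \<Rightarrow> 't \<Rightarrow> ('q \<Rightarrow> 'r) \<Rightarrow> 'e"
  assumes E: "right_module k E"
    and A: "\<And>i. right_module \<Lambda> (A i)" and B: "\<And>i. right_module \<Lambda> (B i)"
    and db: "\<And>i. \<exists>S \<Xi>. dual_basis \<Lambda> (A i) S \<Xi>"
    and rep: "\<And>i. represents k E \<Lambda> (A i) (T i) (\<tau> i)"
begin

sublocale E: right_module k E by (rule E)
sublocale A: right_module \<Lambda> "A i" for i by (rule A)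
sublocale B: right_module \<Lambda> "B i" for i by (rule B)
sublocale F: right_module k "fin_homs \<Lambda> A B" by (rule right_module_fin_homs[OF A B])

abbreviation dual_hom :: "'i \<Rightarrow> ('q \<Rightarrow> 'r) set" where "dual_hom i \<equiv> module_homs \<Lambda> (A i) (regular_module \<Lambda>)"

lemma reg: "right_module \<Lambda> (regular_module \<Lambda>)"
  by (rule right_module_regular) (rule alg.ring_axioms)

lemma rank_one_closed:
  "\<xi> \<in> dual_hom i \<Longrightarrow> m \<in> carrier (B i) \<Longrightarrow> single A B i (rank_one (A i) (B i) \<xi> m) \<in> carrier (fin_homs \<Lambda> A B)"
  by (intro single_fin_homs A B rank_one_module_homs)

lemma finsum_fin_homs:
  assumes "finite S" "t \<in> S \<rightarrow> carrier (fin_homs \<Lambda> A B)" "x \<in> carrier (A i)"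
  shows "(\<Oplus>\<^bsub>fin_homs \<Lambda> A B\<^esub>s\<in>S. t s) i x = (\<Oplus>\<^bsub>B i\<^esub>s\<in>S. t s i x)"
  using additive_finsum[OF F.M.abelian_group_axioms B.M.abelian_group_axioms, of "\<lambda>f. f i x" i S t] assms
    fin_homs_closed[of _ \<Lambda> A B x i]
  by (simp del: fin_homs_simps(1))

text \<open>Finite support leaves finitely many degrees, and a dual basis expands each component
  into finitely many rank one maps. Hence rank one maps in single degrees generate the direct
  sum.\<close>

lemma fin_homs_decomp:
  assumes basis: "\<And>i. dual_basis \<Lambda> (A i) (S i) (\<Xi> i)"
    and f: "f \<in> carrier (fin_homs \<Lambda> A B)"
  shows "f = (\<Oplus>\<^bsub>fin_homs \<Lambda> A B\<^esub>p\<in>Sigma (supp A B f) S.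
    case p of (i, s) \<Rightarrow> single A B i (rank_one (A i) (B i) (\<Xi> i s) (f i s)))"
    (is "f = finsum _ ?t ?I")
proof -
  have S: "finite (S i)" "S i \<subseteq> carrier (A i)" "\<And>s. s \<in> S i \<Longrightarrow> \<Xi> i s \<in> dual_hom i" for i
    using basis by (auto simp: dual_basis_def)
  have Sc: "s \<in> carrier (A i)" if "s \<in> S i" for i s using S(2) that by blast
  have fc: "\<And>i x. x \<in> carrier (A i) \<Longrightarrow> f i x \<in> carrier (B i)" using fin_homs_closed[OF f] .
  have I: "finite ?I" using f S by auto
  have t: "?t \<in> ?I \<rightarrow> carrier (fin_homs \<Lambda> A B)"
  proof
    fix p assume "p \<in> ?I"
    then obtain i s where p: "p = (i, s)" "s \<in> S i" by auto
    then have "s \<in> carrier (A i)" using Sc by blast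
    then show "?t p \<in> carrier (fin_homs \<Lambda> A B)"
      unfolding p prod.case by (intro rank_one_closed S(3) fc p)
  qed
  have sum: "finsum (fin_homs \<Lambda> A B) ?t ?I \<in> carrier (fin_homs \<Lambda> A B)" by (rule F.M.finsum_closed[OF t])
  have "f j x = finsum (fin_homs \<Lambda> A B) ?t ?I j x" if x: "x \<in> carrier (A j)" for j x
  proof -
    have tx: "?t p j x = (if fst p = j then \<Xi> j (snd p) x \<odot>\<^bsub>B j\<^esub> f j (snd p) else \<zero>\<^bsub>B j\<^esub>)" for p
      using x by (auto simp: single_def rank_one_def split: prod.splits)
    have "finsum (fin_homs \<Lambda> A B) ?t ?I j x = (\<Oplus>\<^bsub>B j\<^esub>p\<in>?I. ?t p j x)"
      by (rule finsum_fin_homs[OF I t x])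
    \<comment> \<open>At index \<open>j\<close> only the summands belonging to \<open>j\<close>
      survive. If \<open>j\<close> lies outside the support there are none, and \<open>f j\<close>
      is zero as well.\<close>
    also have "\<dots> = (\<Oplus>\<^bsub>B j\<^esub>p\<in>?I \<inter> Pair j ` S j. \<Xi> j (snd p) x \<odot>\<^bsub>B j\<^esub> f j (snd p))"
      unfolding tx
      by (rule B.M.add.finprod_mono_neutral_cong_right)
        (use I S fc x in \<open>auto simp: module_homsD[OF S(3), simplified] subset_iff intro!: B.smult_closed\<close>)
    also have "\<dots> = f j x"
    proof (cases "j \<in> supp A B f")
      case True
      then have "?I \<inter> Pair j ` S j = Pair j ` S j" by auto
      moreover have "(\<Oplus>\<^bsub>B j\<^esub>p\<in>Pair j ` S j. \<Xi> j (snd p) x \<odot>\<^bsub>B j\<^esub> f j (snd p)) =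
          (\<Oplus>\<^bsub>B j\<^esub>s\<in>S j. \<Xi> j s x \<odot>\<^bsub>B j\<^esub> f j s)"
        using S fc x by (subst B.M.finsum_reindex)
          (auto simp: module_homsD[OF S(3), simplified] subset_iff inj_on_def intro!: B.smult_closed)
      ultimately show ?thesis
        using dual_basis_expand[OF A B basis module_homs_lin x] f by simp
    next
      case False
      then have "?I \<inter> Pair j ` S j = {}" by auto
      then show ?thesis using supp_zero[OF False x] by simp
    qed
    finally show ?thesis by simp
  qed
  then have eq: "f j x = finsum (fin_homs \<Lambda> A B) ?t ?I j x" if "x \<in> carrier (A j)" for j x using that .
  have "f j \<in> module_homs \<Lambda> (A j) (B j)" "finsum (fin_homs \<Lambda> A B) ?t ?I j \<in> module_homs \<Lambda> (A j) (B j)" for j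
    using f sum by (auto simp del: fin_homs_simps simp: fin_homs_simps(1))
  then have "f j = finsum (fin_homs \<Lambda> A B) ?t ?I j" for j
    by (rule module_homs_eqI) (rule eq)
  then show ?thesis by (rule ext)
qed

text \<open>Functionals are determined on the generators provided by \<open>fin_homs_decomp\<close>.
  Nearly every identity between functionals below is reduced to rank one maps in this way.\<close>

lemma fin_functional_eqI:
  assumes \<theta>: "lin k (fin_homs \<Lambda> A B) E \<theta>" and \<theta>': "lin k (fin_homs \<Lambda> A B) E \<theta>'"
    and eq: "\<And>i \<xi> m. \<xi> \<in> dual_hom i \<Longrightarrow> m \<in> carrier (B i) \<Longrightarrow>
      \<theta> (single A B i (rank_one (A i) (B i) \<xi> m)) = \<theta>' (single A B i (rank_one (A i) (B i) \<xi> m))"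
    and f: "f \<in> carrier (fin_homs \<Lambda> A B)"
  shows "\<theta> f = \<theta>' f"
proof -
  obtain S \<Xi> where basis: "\<And>i. dual_basis \<Lambda> (A i) (S i) (\<Xi> i)" using db by metis
  have S: "finite (S i)" "S i \<subseteq> carrier (A i)" "\<And>s. s \<in> S i \<Longrightarrow> \<Xi> i s \<in> dual_hom i" for i
    using basis by (auto simp: dual_basis_def)
  have Sc: "s \<in> carrier (A i)" if "s \<in> S i" for i s using S(2) that by blast
  have fc: "\<And>i x. x \<in> carrier (A i) \<Longrightarrow> f i x \<in> carrier (B i)" using fin_homs_closed[OF f] .
  let ?I = "Sigma (supp A B f) S"
  let ?t = "\<lambda>(i, s). single A B i (rank_one (A i) (B i) (\<Xi> i s) (f i s))"
  have I: "finite ?I" using f S by auto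
  have t: "?t \<in> ?I \<rightarrow> carrier (fin_homs \<Lambda> A B)"
  proof
    fix p assume "p \<in> ?I"
    then obtain i s where p: "p = (i, s)" "s \<in> S i" by auto
    then have "s \<in> carrier (A i)" using Sc by blast
    then show "?t p \<in> carrier (fin_homs \<Lambda> A B)"
      unfolding p prod.case by (intro rank_one_closed S(3) fc p)
  qed
  have "\<theta> (finsum (fin_homs \<Lambda> A B) ?t ?I) = (\<Oplus>\<^bsub>E\<^esub>p\<in>?I. \<theta> (?t p))"
    by (rule lin_finsum[OF F.right_module_axioms E \<theta> I t])
  also have "\<dots> = (\<Oplus>\<^bsub>E\<^esub>p\<in>?I. \<theta>' (?t p))"
  proof (rule E.M.finsum_cong')
    show "(\<lambda>p. \<theta>' (?t p)) \<in> ?I \<rightarrow> carrier E" by (intro funcsetI lin_closed[OF \<theta>'] funcset_mem[OF t])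
    fix p assume "p \<in> ?I"
    then obtain i s where "p = (i, s)" "s \<in> S i" by auto
    then show "\<theta> (?t p) = \<theta>' (?t p)" using eq[OF S(3) fc[OF Sc]] by simp
  qed simp
  also have "\<dots> = \<theta>' (finsum (fin_homs \<Lambda> A B) ?t ?I)"
    by (rule lin_finsum[OF F.right_module_axioms E \<theta>' I t, symmetric])
  finally show ?thesis using fin_homs_decomp[OF basis f] by simp
qed

text \<open>The functional is a trace: compose \<open>f\<close> with \<open>G\<close>, evaluate at
  the dual basis elements, pair with the dual coordinate functions and add up. The basis enters the
  formula, but the values on rank one maps do not depend on it.\<close>

lemma fin_functional_ex:
  assumes G: "\<And>i. lin \<Lambda> (B i) (T i) (G i)"
  shows "\<exists>\<theta>\<in>module_homs k (fin_homs \<Lambda> A B) E. \<forall>i. \<forall>\<xi>\<in>dual_hom i. \<forall>m\<in>carrier (B i).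
    \<theta> (single A B i (rank_one (A i) (B i) \<xi> m)) = \<tau> i (G i m) \<xi>"
proof -
  obtain S \<Xi> where basis: "\<And>i. dual_basis \<Lambda> (A i) (S i) (\<Xi> i)" using db by metis
  have S: "finite (S i)" "S i \<subseteq> carrier (A i)" "\<And>s. s \<in> S i \<Longrightarrow> \<Xi> i s \<in> dual_hom i" for i
    using basis by (auto simp: dual_basis_def)
  have Sc: "s \<in> carrier (A i)" if "s \<in> S i" for i s using S(2) that by blast
  \<comment> \<open>The contribution to the trace of the pair \<open>p\<close> consisting of a
    degree and a basis element in that degree.\<close>
  define e where "e f p = \<tau> (fst p) (G (fst p) (f (fst p) (snd p))) (\<Xi> (fst p) (snd p))" for f p
  define \<theta> where "\<theta> f = (\<Oplus>\<^bsub>E\<^esub>p\<in>Sigma (supp A B f) S. e f p)" for f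
  have \<tau>c: "\<tau> i (G i m) \<xi> \<in> carrier E" if "m \<in> carrier (B i)" "\<xi> \<in> dual_hom i" for i m \<xi>
    using module_homsD(1)[OF representsD(2)[OF rep lin_closed[OF G]]] that by auto
  have \<tau>0: "\<tau> i (G i \<zero>\<^bsub>B i\<^esub>) \<xi> = \<zero>\<^bsub>E\<^esub>" if "\<xi> \<in> dual_hom i" for i \<xi>
  proof -
    have "\<tau> i (G i (\<zero>\<^bsub>B i\<^esub> \<oplus>\<^bsub>B i\<^esub> \<zero>\<^bsub>B i\<^esub>)) \<xi> = \<tau> i (G i \<zero>\<^bsub>B i\<^esub>) \<xi> \<oplus>\<^bsub>E\<^esub> \<tau> i (G i \<zero>\<^bsub>B i\<^esub>) \<xi>"
      using representsD(3)[OF rep lin_closed[OF G] lin_closed[OF G] that] lin_add[OF G] B.M.zero_closed by metis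
    then show ?thesis using \<tau>c[OF B.M.zero_closed that] by simp
  qed
  have ec: "e f p \<in> carrier E" if "\<And>i x. x \<in> carrier (A i) \<Longrightarrow> f i x \<in> carrier (B i)" "snd p \<in> S (fst p)" for f p
    using that S \<tau>c unfolding e_def by blast
  have fc: "f i x \<in> carrier (B i)" if "f \<in> carrier (fin_homs \<Lambda> A B)" "x \<in> carrier (A i)" for f i x
    using fin_homs_closed that .
  \<comment> \<open>Degrees outside the support contribute zero, so the sum may run over any larger
    finite set. Two families can thus be summed over a common set of degrees.\<close>
  have \<theta>I: "\<theta> f = (\<Oplus>\<^bsub>E\<^esub>p\<in>Sigma I S. e f p)"
    if f: "f \<in> carrier (fin_homs \<Lambda> A B)" and I: "finite I" "supp A B f \<subseteq> I" for f I
    unfolding \<theta>_def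
  proof (rule E.M.add.finprod_mono_neutral_cong_left)
    show "finite (Sigma I S)" using I S by auto
    show "Sigma (supp A B f) S \<subseteq> Sigma I S" using I by auto
    show "e f p = \<zero>\<^bsub>E\<^esub>" if "p \<in> Sigma I S - Sigma (supp A B f) S" for p
    proof -
      from that have "fst p \<notin> supp A B f" "snd p \<in> S (fst p)" by auto
      moreover from this have "snd p \<in> carrier (A (fst p))" using Sc by blast
      ultimately show "e f p = \<zero>\<^bsub>E\<^esub>"
        using supp_zero[of "fst p" A B f "snd p"] \<tau>0[OF S(3)] unfolding e_def by simp
    qed
    show "e f \<in> Sigma I S \<rightarrow> carrier E" using ec fc[OF f] by auto
  qed simp
  have \<theta>l: "lin k (fin_homs \<Lambda> A B) E \<theta>"
  proof (rule linI)
    fix f assume f: "f \<in> carrier (fin_homs \<Lambda> A B)"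
    show "\<theta> f \<in> carrier E" unfolding \<theta>_def by (rule E.M.finsum_closed) (use ec fc[OF f] in auto)
  next
    fix f g assume f: "f \<in> carrier (fin_homs \<Lambda> A B)" and g: "g \<in> carrier (fin_homs \<Lambda> A B)"
    let ?I = "supp A B f \<union> supp A B g"
    have fI: "finite ?I" using f g by auto
    have fg: "f \<oplus>\<^bsub>fin_homs \<Lambda> A B\<^esub> g \<in> carrier (fin_homs \<Lambda> A B)" using F.M.add.m_closed[OF f g] .
    have sub: "supp A B (f \<oplus>\<^bsub>fin_homs \<Lambda> A B\<^esub> g) \<subseteq> ?I" using supp_add[OF B] by simp
    have "\<theta> (f \<oplus>\<^bsub>fin_homs \<Lambda> A B\<^esub> g) = (\<Oplus>\<^bsub>E\<^esub>p\<in>Sigma ?I S. e (f \<oplus>\<^bsub>fin_homs \<Lambda> A B\<^esub> g) p)"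
      by (rule \<theta>I[OF fg fI sub])
    also have "\<dots> = (\<Oplus>\<^bsub>E\<^esub>p\<in>Sigma ?I S. e f p \<oplus>\<^bsub>E\<^esub> e g p)"
    proof (rule E.M.finsum_cong')
      show "(\<lambda>p. e f p \<oplus>\<^bsub>E\<^esub> e g p) \<in> Sigma ?I S \<rightarrow> carrier E"
        using ec[OF fc[OF f]] ec[OF fc[OF g]] by auto
      fix p assume "p \<in> Sigma ?I S"
      then have s: "snd p \<in> S (fst p)" "snd p \<in> carrier (A (fst p))" using Sc by auto
      show "e (f \<oplus>\<^bsub>fin_homs \<Lambda> A B\<^esub> g) p = e f p \<oplus>\<^bsub>E\<^esub> e g p"
        unfolding e_def using s S fc[OF f s(2)] fc[OF g s(2)]
        by (simp add: lin_add[OF G] representsD(3)[OF rep] lin_closed[OF G])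
    qed simp
    also have "\<dots> = (\<Oplus>\<^bsub>E\<^esub>p\<in>Sigma ?I S. e f p) \<oplus>\<^bsub>E\<^esub> (\<Oplus>\<^bsub>E\<^esub>p\<in>Sigma ?I S. e g p)"
      by (rule E.M.finsum_addf) (use ec[OF fc[OF f]] ec[OF fc[OF g]] in auto)
    also have "\<dots> = \<theta> f \<oplus>\<^bsub>E\<^esub> \<theta> g"
      using \<theta>I[OF f fI] \<theta>I[OF g fI] by simp
    finally show "\<theta> (f \<oplus>\<^bsub>fin_homs \<Lambda> A B\<^esub> g) = \<theta> f \<oplus>\<^bsub>E\<^esub> \<theta> g" .
  next
    fix a f assume a: "a \<in> carrier k" and f: "f \<in> carrier (fin_homs \<Lambda> A B)"
    let ?I = "supp A B f"
    have fI: "finite ?I" using f by auto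
    have af: "a \<odot>\<^bsub>fin_homs \<Lambda> A B\<^esub> f \<in> carrier (fin_homs \<Lambda> A B)" using F.smult_closed[OF a f] .
    have sub: "supp A B (a \<odot>\<^bsub>fin_homs \<Lambda> A B\<^esub> f) \<subseteq> ?I"
      using supp_smult[where A=A and f=f, OF B scalar_closed[OF a]] by (simp add: scalar_def)
    have "\<theta> (a \<odot>\<^bsub>fin_homs \<Lambda> A B\<^esub> f) = (\<Oplus>\<^bsub>E\<^esub>p\<in>Sigma ?I S. e (a \<odot>\<^bsub>fin_homs \<Lambda> A B\<^esub> f) p)"
      by (rule \<theta>I[OF af fI sub])
    also have "\<dots> = (\<Oplus>\<^bsub>E\<^esub>p\<in>Sigma ?I S. a \<odot>\<^bsub>E\<^esub> e f p)"
    proof (rule E.M.finsum_cong')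
      show "(\<lambda>p. a \<odot>\<^bsub>E\<^esub> e f p) \<in> Sigma ?I S \<rightarrow> carrier E"
        using ec[OF fc[OF f]] E.smult_closed[OF a] by auto
      fix p assume "p \<in> Sigma ?I S"
      then have s: "snd p \<in> S (fst p)" "snd p \<in> carrier (A (fst p))" using Sc by auto
      show "e (a \<odot>\<^bsub>fin_homs \<Lambda> A B\<^esub> f) p = a \<odot>\<^bsub>E\<^esub> e f p"
        unfolding e_def using s S fc[OF f s(2)] a
        by (simp add: lin_smult[OF G] represents_scalar[OF rep A] lin_closed[OF G] flip: scalar_def)
    qed simp
    also have "\<dots> = a \<odot>\<^bsub>E\<^esub> (\<Oplus>\<^bsub>E\<^esub>p\<in>Sigma ?I S. e f p)"
      by (rule E.finsum_smult[symmetric]) (use ec[OF fc[OF f]] a fI S in auto)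
    finally show "\<theta> (a \<odot>\<^bsub>fin_homs \<Lambda> A B\<^esub> f) = a \<odot>\<^bsub>E\<^esub> \<theta> f"
      by (simp add: \<theta>_def)
  qed
  have val: "\<theta> (single A B i (rank_one (A i) (B i) \<xi> m)) = \<tau> i (G i m) \<xi>"
    if \<xi>: "\<xi> \<in> dual_hom i" and m: "m \<in> carrier (B i)" for i \<xi> m
  proof -
    let ?H = "hom_module \<Lambda> (A i) (regular_module \<Lambda>)"
    interpret H: right_module k ?H by (rule right_module_hom[OF A reg])
    let ?f = "single A B i (rank_one (A i) (B i) \<xi> m)"
    \<comment> \<open>The component of \<open>\<xi>\<close> along \<open>\<Xi> i s\<close>. Moving
      the scalar \<open>\<xi> s\<close> from \<open>G i m\<close> to the functional turns the trace
      into a sum over these components, and they add up to \<open>\<xi>\<close>.\<close>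
    define \<eta> where "\<eta> s = (\<lambda>q\<in>carrier (A i). \<xi> s \<otimes>\<^bsub>\<Lambda>\<^esub> \<Xi> i s q)" for s
    have \<xi>c: "\<xi> s \<in> carrier \<Lambda>" if "s \<in> carrier (A i)" for s using module_homsD(1)[OF \<xi> that] by simp
    have \<eta>: "\<eta> s \<in> dual_hom i" if "s \<in> S i" for s
      unfolding \<eta>_def by (rule dual_expand(1)[OF A basis \<xi> that])
    have t: "G i m \<in> carrier (T i)" using lin_closed[OF G m] .
    have "\<theta> ?f = (\<Oplus>\<^bsub>E\<^esub>p\<in>Sigma {i} S. e ?f p)"
      by (rule \<theta>I[OF rank_one_closed[OF \<xi> m] _ supp_single]) simp
    also have "Sigma {i} S = Pair i ` S i" by auto
    also have "(\<Oplus>\<^bsub>E\<^esub>p\<in>Pair i ` S i. e ?f p) = (\<Oplus>\<^bsub>E\<^esub>s\<in>S i. e ?f (i, s))"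
      by (rule E.M.finsum_reindex) (use ec[OF fc[OF rank_one_closed[OF \<xi> m]]] in \<open>auto simp: inj_on_def\<close>)
    also have "\<dots> = (\<Oplus>\<^bsub>E\<^esub>s\<in>S i. \<tau> i (G i m) (\<eta> s))"
    proof (rule E.M.finsum_cong')
      show "(\<lambda>s. \<tau> i (G i m) (\<eta> s)) \<in> S i \<rightarrow> carrier E" using \<tau>c[OF m \<eta>] by auto
      fix s assume s: "s \<in> S i"
      then have "s \<in> carrier (A i)" using Sc by auto
      then show "e ?f (i, s) = \<tau> i (G i m) (\<eta> s)"
        using m s \<xi>c representsD(4)[OF rep _ t S(3)[OF s]]
        by (simp add: e_def single_def rank_one_def lin_smult[OF G] \<eta>_def)
    qed simp
    also have "\<dots> = \<tau> i (G i m) (\<Oplus>\<^bsub>?H\<^esub>s\<in>S i. \<eta> s)"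
      by (rule module_homs_finsum[OF H.right_module_axioms E representsD(2)[OF rep t], symmetric])
        (use S \<eta> in auto)
    also have "(\<Oplus>\<^bsub>?H\<^esub>s\<in>S i. \<eta> s) = \<xi>"
      unfolding \<eta>_def by (rule dual_expand(2)[OF A basis \<xi>])
    finally show ?thesis .
  qed
  show ?thesis
    by (rule bexI[OF _ restrict_module_homs[OF F.right_module_axioms \<theta>l]])
      (use val rank_one_closed in \<open>auto simp del: fin_homs_simps\<close>)
qed

text \<open>For fixed \<open>m\<close>, evaluating \<open>\<theta>\<close> on rank one maps gives a
  functional of \<open>\<xi>\<close>, which is \<open>\<tau>\<close> of a unique element of
  \<open>T i\<close>. Uniqueness forces this element to depend linearly on \<open>m\<close>.\<close>

lemma fin_functional_repr:
  assumes \<theta>: "lin k (fin_homs \<Lambda> A B) E \<theta>"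
  shows "\<exists>G. \<forall>i. lin \<Lambda> (B i) (T i) (G i) \<and> (\<forall>\<xi>\<in>dual_hom i. \<forall>m\<in>carrier (B i).
    \<theta> (single A B i (rank_one (A i) (B i) \<xi> m)) = \<tau> i (G i m) \<xi>)"
proof -
  let ?s = "\<lambda>i \<xi> m. single A B i (rank_one (A i) (B i) \<xi> m)"
  have homs: "(\<lambda>\<xi>\<in>dual_hom i. \<theta> (?s i \<xi> m)) \<in> module_homs k (hom_module \<Lambda> (A i) (regular_module \<Lambda>)) E"
    if m: "m \<in> carrier (B i)" for i m
  proof (rule module_homsI)
    interpret H: right_module k "hom_module \<Lambda> (A i) (regular_module \<Lambda>)" by (rule right_module_hom[OF A reg])
    show "(\<lambda>\<xi>\<in>dual_hom i. \<theta> (?s i \<xi> m)) \<in> carrier (hom_module \<Lambda> (A i) (regular_module \<Lambda>)) \<rightarrow>\<^sub>E carrier E"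
      using lin_closed[OF \<theta> rank_one_closed] m by auto
    fix \<xi> assume \<xi>: "\<xi> \<in> carrier (hom_module \<Lambda> (A i) (regular_module \<Lambda>))"
    then have \<xi>c: "\<xi> q \<in> carrier \<Lambda>" if "q \<in> carrier (A i)" for q using module_homsD(1) that by fastforce
    {
      fix \<xi>' assume \<xi>': "\<xi>' \<in> carrier (hom_module \<Lambda> (A i) (regular_module \<Lambda>))"
      have \<xi>'c: "\<xi>' q \<in> carrier \<Lambda>" if "q \<in> carrier (A i)" for q using module_homsD(1) that \<xi>' by fastforce
      have "?s i (\<xi> \<oplus>\<^bsub>hom_module \<Lambda> (A i) (regular_module \<Lambda>)\<^esub> \<xi>') m = ?s i \<xi> m \<oplus>\<^bsub>fin_homs \<Lambda> A B\<^esub> ?s i \<xi>' m"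
        using \<xi>c \<xi>'c m by (auto simp: single_def rank_one_def fun_eq_iff B.smult_l_distr)
      then show "(\<lambda>\<xi>\<in>dual_hom i. \<theta> (?s i \<xi> m)) (\<xi> \<oplus>\<^bsub>hom_module \<Lambda> (A i) (regular_module \<Lambda>)\<^esub> \<xi>') =
          (\<lambda>\<xi>\<in>dual_hom i. \<theta> (?s i \<xi> m)) \<xi> \<oplus>\<^bsub>E\<^esub> (\<lambda>\<xi>\<in>dual_hom i. \<theta> (?s i \<xi> m)) \<xi>'"
        using lin_add[OF \<theta> rank_one_closed rank_one_closed, of \<xi> i m \<xi>' i m] \<xi> \<xi>' m H.M.add.m_closed[OF \<xi> \<xi>']
        by (simp del: fin_homs_simps hom_module_simps(2-4))
    }
    fix a assume a: "a \<in> carrier k"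
    have "?s i (a \<odot>\<^bsub>hom_module \<Lambda> (A i) (regular_module \<Lambda>)\<^esub> \<xi>) m = a \<odot>\<^bsub>fin_homs \<Lambda> A B\<^esub> ?s i \<xi> m"
      using \<xi>c m a
      by (auto simp: single_def rank_one_def fun_eq_iff B.smult_assoc B.smult_r_zero simp flip: scalar_def)
    then show "(\<lambda>\<xi>\<in>dual_hom i. \<theta> (?s i \<xi> m)) (a \<odot>\<^bsub>hom_module \<Lambda> (A i) (regular_module \<Lambda>)\<^esub> \<xi>) =
          a \<odot>\<^bsub>E\<^esub> (\<lambda>\<xi>\<in>dual_hom i. \<theta> (?s i \<xi> m)) \<xi>"
      using lin_smult[OF \<theta> a rank_one_closed, of \<xi> i m] \<xi> m H.smult_closed[OF a \<xi>]
      by (simp del: fin_homs_simps hom_module_simps(2-4))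
  qed
  \<comment> \<open>Existence comes from surjectivity of \<open>\<tau> i\<close>; its injectivity,
    through \<open>represents_eqI\<close>, makes the chosen elements linear in
    \<open>m\<close>.\<close>
  define G where "G i m = (SOME t. t \<in> carrier (T i) \<and> \<tau> i t = (\<lambda>\<xi>\<in>dual_hom i. \<theta> (?s i \<xi> m)))" for i m
  have G: "G i m \<in> carrier (T i) \<and> \<tau> i (G i m) = (\<lambda>\<xi>\<in>dual_hom i. \<theta> (?s i \<xi> m))" if "m \<in> carrier (B i)" for i m
    unfolding G_def by (rule someI_ex) (use represents_ex[OF rep homs[OF that]] in blast)
  have G1: "G i m \<in> carrier (T i)" and G2: "\<xi> \<in> dual_hom i \<Longrightarrow> \<tau> i (G i m) \<xi> = \<theta> (?s i \<xi> m)"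
    if "m \<in> carrier (B i)" for i m \<xi> using G[OF that] by simp_all
  have "lin \<Lambda> (B i) (T i) (G i)" for i
  proof -
    interpret Ti: right_module \<Lambda> "T i" by (rule representsD(1)[OF rep])
    show ?thesis
    proof (rule linI)
      show "G i x \<in> carrier (T i)" if "x \<in> carrier (B i)" for x by (rule G1[OF that])
      show "G i (x \<oplus>\<^bsub>B i\<^esub> y) = G i x \<oplus>\<^bsub>T i\<^esub> G i y" if x: "x \<in> carrier (B i)" and y: "y \<in> carrier (B i)" for x y
      proof (rule represents_eqI[OF rep G1])
        fix \<xi> assume \<xi>: "\<xi> \<in> dual_hom i"
        have \<xi>c: "\<xi> q \<in> carrier \<Lambda>" if "q \<in> carrier (A i)" for q using module_homsD(1)[OF \<xi>] that by simp
        have "?s i \<xi> (x \<oplus>\<^bsub>B i\<^esub> y) = ?s i \<xi> x \<oplus>\<^bsub>fin_homs \<Lambda> A B\<^esub> ?s i \<xi> y"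
          using \<xi>c x y by (auto simp: single_def rank_one_def fun_eq_iff B.smult_r_distr)
        then show "\<tau> i (G i (x \<oplus>\<^bsub>B i\<^esub> y)) \<xi> = \<tau> i (G i x \<oplus>\<^bsub>T i\<^esub> G i y) \<xi>"
          using \<xi> x y lin_add[OF \<theta> rank_one_closed rank_one_closed, of \<xi> i x \<xi> i y]
          by (simp add: G1 G2 representsD(3)[OF rep] del: fin_homs_simps)
      qed (use x y G1 in auto)
      show "G i (a \<odot>\<^bsub>B i\<^esub> x) = a \<odot>\<^bsub>T i\<^esub> G i x" if a: "a \<in> carrier \<Lambda>" and x: "x \<in> carrier (B i)" for a x
      proof (rule represents_eqI[OF rep G1])
        fix \<xi> assume \<xi>: "\<xi> \<in> dual_hom i"
        have \<xi>c: "\<xi> q \<in> carrier \<Lambda>" if "q \<in> carrier (A i)" for q using module_homsD(1)[OF \<xi>] that by simp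
        have a\<xi>: "(\<lambda>q\<in>carrier (A i). a \<otimes>\<^bsub>\<Lambda>\<^esub> \<xi> q) \<in> dual_hom i"
          using \<xi>c a module_homsD[OF \<xi>, simplified]
          by (intro restrict_module_homs[OF A] linI) (auto simp: alg.r_distr alg.m_assoc)
        \<comment> \<open>The scalar moves from \<open>x\<close> to the functional, as in the
          balancing relation of a tensor product; on the other side this is the way in which
          \<open>\<tau> i\<close> treats scalars.\<close>
        have "?s i \<xi> (a \<odot>\<^bsub>B i\<^esub> x) = ?s i (\<lambda>q\<in>carrier (A i). a \<otimes>\<^bsub>\<Lambda>\<^esub> \<xi> q) x"
          using \<xi>c x a by (auto simp: single_def rank_one_def fun_eq_iff B.smult_assoc)
        then show "\<tau> i (G i (a \<odot>\<^bsub>B i\<^esub> x)) \<xi> = \<tau> i (a \<odot>\<^bsub>T i\<^esub> G i x) \<xi>"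
          using \<xi> x a a\<xi> by (simp add: G1 G2 representsD(4)[OF rep] B.smult_closed)
      qed (use a x G1 B.smult_closed Ti.smult_closed in auto)
    qed
  qed
  then show ?thesis using G2 by (intro exI[of _ G]) simp
qed

end

section \<open>The tensor product with the dual of the algebra\<close>

lemma dual_simps [simp]:
  "carrier (dual k E V) = module_homs k V E"
  "\<zero>\<^bsub>dual k E V\<^esub> = (\<lambda>x\<in>carrier V. \<zero>\<^bsub>E\<^esub>)"
  "\<phi> \<oplus>\<^bsub>dual k E V\<^esub> \<psi> = (\<lambda>x\<in>carrier V. \<phi> x \<oplus>\<^bsub>E\<^esub> \<psi> x)"
  "a \<odot>\<^bsub>dual k E V\<^esub> \<phi> = (\<lambda>x\<in>carrier V. a \<odot>\<^bsub>E\<^esub> \<phi> x)"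
  by (simp_all add: dual_def)

lemma dual_algebra_simps [simp]:
  "carrier (dual_algebra k E \<Lambda>) = module_homs k \<Lambda> E"
  "\<zero>\<^bsub>dual_algebra k E \<Lambda>\<^esub> = (\<lambda>x\<in>carrier \<Lambda>. \<zero>\<^bsub>E\<^esub>)"
  "\<phi> \<oplus>\<^bsub>dual_algebra k E \<Lambda>\<^esub> \<psi> = (\<lambda>x\<in>carrier \<Lambda>. \<phi> x \<oplus>\<^bsub>E\<^esub> \<psi> x)"
  "t \<odot>\<^bsub>dual_algebra k E \<Lambda>\<^esub> \<phi> = (\<lambda>x\<in>carrier \<Lambda>. \<phi> (t \<otimes>\<^bsub>\<Lambda>\<^esub> x))"
  by (simp_all add: dual_algebra_def)

lemma right_module_dual:
  assumes k: "cring k" and V: "right_module k V" and E: "right_module k E"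
  shows "right_module k (dual k E V)"
proof -
  interpret k: cring k by fact
  interpret V: right_module k V by fact
  interpret E: right_module k E by fact
  note cl = module_homsD(1)[where R=k and M=V and N=E]
  have ext: "f = g" if "f \<in> module_homs k V E" "g \<in> module_homs k V E" "\<And>x. x \<in> carrier V \<Longrightarrow> f x = g x" for f g
    using module_homs_eqI that by blast
  have sm: "(\<lambda>x\<in>carrier V. a \<odot>\<^bsub>E\<^esub> f x) \<in> module_homs k V E" if "a \<in> carrier k" "f \<in> module_homs k V E" for a f
  proof (rule comp_module_homs[OF V module_homs_lin[OF that(2)]])
    show "lin k E E (\<lambda>x. a \<odot>\<^bsub>E\<^esub> x)"
      using that(1) E.smult_assoc[of a _] E.smult_assoc[of _ a]
      by (intro linI) (auto simp: E.smult_closed E.smult_r_distr k.m_comm)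
  qed
  show ?thesis
  proof (rule right_moduleI)
    show "ring k" by (rule k.ring_axioms)
    show "\<exists>g\<in>carrier (dual k E V). g \<oplus>\<^bsub>dual k E V\<^esub> f = \<zero>\<^bsub>dual k E V\<^esub>" if f: "f \<in> carrier (dual k E V)" for f
    proof
      show "(\<lambda>x\<in>carrier V. \<ominus>\<^bsub>E\<^esub> f x) \<in> carrier (dual k E V)"
        using f by (auto intro!: restrict_module_homs[OF V] lin_uminus[OF E] dest: module_homs_lin)
      show "(\<lambda>x\<in>carrier V. \<ominus>\<^bsub>E\<^esub> f x) \<oplus>\<^bsub>dual k E V\<^esub> f = \<zero>\<^bsub>dual k E V\<^esub>"
        using f cl by (auto simp: E.M.l_neg intro!: restrict_ext)
    qed
    show "\<zero>\<^bsub>dual k E V\<^esub> \<oplus>\<^bsub>dual k E V\<^esub> f = f" if "f \<in> carrier (dual k E V)" for f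
    proof (rule ext)
      show "\<zero>\<^bsub>dual k E V\<^esub> \<oplus>\<^bsub>dual k E V\<^esub> f \<in> module_homs k V E"
        using module_homs_add[OF V E zero_module_homs[OF V E]] that by (simp only: dual_simps)
    qed (use that cl in auto)
    show "\<one>\<^bsub>k\<^esub> \<odot>\<^bsub>dual k E V\<^esub> f = f" if "f \<in> carrier (dual k E V)" for f
    proof (rule ext)
      show "\<one>\<^bsub>k\<^esub> \<odot>\<^bsub>dual k E V\<^esub> f \<in> module_homs k V E" using sm[of "\<one>\<^bsub>k\<^esub>" f] that by simp
    qed (use that cl in \<open>auto simp: E.smult_one\<close>)
  qed (auto simp: sm module_homs_add[OF V E] zero_module_homs[OF V E] cl E.M.a_ac
      E.smult_closed E.smult_l_distr E.smult_r_distr E.smult_assoc intro!: restrict_ext)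
qed

lemma free_Abelian_group_induction [consumes 1, case_names zero one diff]:
  assumes "c \<in> carrier (free_Abelian_group S)" "P 0" "\<And>a. a \<in> S \<Longrightarrow> P (frag_of a)"
    and "\<And>x y. \<lbrakk>x \<in> carrier (free_Abelian_group S); y \<in> carrier (free_Abelian_group S); P x; P y\<rbrakk> \<Longrightarrow> P (x - y)"
  shows "P c"
  using assms by (intro free_Abelian_group_induct[of c S P]) auto

text \<open>A pair \<open>(q, \<phi>)\<close>, standing for \<open>q \<otimes> \<phi>\<close>, sends \<open>\<xi> : Q \<rightarrow> \<Lambda>\<close> to \<open>\<phi> (\<xi> q)\<close>.\<close>

definition free_pairing ::
    "('k, 'z) ring_scheme \<Rightarrow> ('k, 'e) module \<Rightarrow> ('k, 'r) module \<Rightarrow> ('r, 'q) module \<Rightarrow>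
      ('q \<times> ('r \<Rightarrow> 'e) \<Rightarrow>\<^sub>0 int) \<Rightarrow> ('q \<Rightarrow> 'r) \<Rightarrow> 'e"
  where "free_pairing k E \<Lambda> Q = (SOME h.
    h \<in> hom (free_Abelian_group (carrier Q \<times> module_homs k \<Lambda> E))
      (add_monoid (dual k E (hom_module \<Lambda> Q (regular_module \<Lambda>)))) \<and>
    (\<forall>q\<in>carrier Q. \<forall>\<phi>\<in>module_homs k \<Lambda> E.
      h (frag_of (q, \<phi>)) = (\<lambda>\<xi>\<in>module_homs \<Lambda> Q (regular_module \<Lambda>). \<phi> (\<xi> q))))"

text \<open>A class is evaluated on a chosen representative, which is harmless since
  \<open>free_pairing\<close> is constant on classes by \<open>ev_coset\<close>.\<close>

definition tensor_pairing ::
    "('k, 'z) ring_scheme \<Rightarrow> ('k, 'e) module \<Rightarrow> ('k, 'r) module \<Rightarrow> ('r, 'q) module \<Rightarrow>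
      ('q \<times> ('r \<Rightarrow> 'e) \<Rightarrow>\<^sub>0 int) set \<Rightarrow> ('q \<Rightarrow> 'r) \<Rightarrow> 'e"
  where "tensor_pairing k E \<Lambda> Q C = free_pairing k E \<Lambda> Q (SOME c. c \<in> C)"

locale dual_tensor = k_algebra k \<Lambda>
  for k :: "('k, 'c) ring_scheme" and \<Lambda> :: "('k, 'r) module" +
  fixes E :: "('k, 'e) module" and Q :: "('r, 'q) module" and S \<Xi>
  assumes E: "right_module k E" and Q: "right_module \<Lambda> Q" and db: "dual_basis \<Lambda> Q S \<Xi>"
begin

sublocale E: right_module k E by (rule E)
sublocale Q: right_module \<Lambda> Q by (rule Q)

abbreviation "Reg \<equiv> regular_module \<Lambda>"
abbreviation "H \<equiv> hom_module \<Lambda> Q Reg"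
abbreviation "Qd \<equiv> module_homs \<Lambda> Q Reg"
abbreviation "DH \<equiv> dual k E H"
abbreviation "DL \<equiv> module_homs k \<Lambda> E"
abbreviation "F \<equiv> free_Abelian_group (carrier Q \<times> DL)"
abbreviation "Rel \<equiv> tensor_relations \<Lambda> Q (dual_algebra k E \<Lambda>) (dual_algebra_left \<Lambda>)"
abbreviation "T \<equiv> tensor \<Lambda> Q (dual_algebra k E \<Lambda>) (dual_algebra_left \<Lambda>)"
abbreviation "ev \<equiv> free_pairing k E \<Lambda> Q"

lemma reg: "right_module \<Lambda> Reg" by (rule right_module_regular) (rule alg.ring_axioms)

sublocale H: right_module k H by (rule right_module_hom[OF Q reg])
sublocale DH: right_module k DH by (rule right_module_dual[OF cring_base H.right_module_axioms E])
sublocale DL: right_module k "dual k E \<Lambda>" by (rule right_module_dual[OF cring_base right_module_algebra E])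

lemma Qd_closed: "\<xi> \<in> Qd \<Longrightarrow> q \<in> carrier Q \<Longrightarrow> \<xi> q \<in> carrier \<Lambda>"
  using module_homsD(1) by fastforce

lemma generator_homs: "q \<in> carrier Q \<Longrightarrow> \<phi> \<in> DL \<Longrightarrow> (\<lambda>\<xi>\<in>Qd. \<phi> (\<xi> q)) \<in> module_homs k H E"
  using H.M.add.m_closed H.smult_closed
  by (intro module_homsI)
    (auto simp: Qd_closed module_homsD algmod.smult_closed mult_scalar smult_hom_module
      simp del: hom_module_simps(2-4) simp: hom_module_simps(3))

text \<open>The universal property of the free abelian group shows that the choice in the definition
  of \<open>free_pairing\<close> has a candidate.\<close>

lemma ev_spec: "ev \<in> hom F (add_monoid DH) \<and>
    (\<forall>q\<in>carrier Q. \<forall>\<phi>\<in>DL. ev (frag_of (q, \<phi>)) = (\<lambda>\<xi>\<in>Qd. \<phi> (\<xi> q)))"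
proof -
  have im: "(\<lambda>(q, \<phi>). \<lambda>\<xi>\<in>Qd. \<phi> (\<xi> q)) ` (carrier Q \<times> DL) \<subseteq> carrier (add_monoid DH)"
  proof (rule image_subsetI)
    fix p assume "p \<in> carrier Q \<times> DL"
    then obtain q \<phi> where p: "p = (q, \<phi>)" "q \<in> carrier Q" "\<phi> \<in> DL" by blast
    show "(\<lambda>(q, \<phi>). \<lambda>\<xi>\<in>Qd. \<phi> (\<xi> q)) p \<in> carrier (add_monoid DH)"
      unfolding p(1) prod.case using generator_homs[OF p(2,3)] by (simp only: partial_object.simps(1) dual_simps(1))
  qed
  obtain h where h: "h \<in> hom F (add_monoid DH)"
      "\<And>x. x \<in> carrier Q \<times> DL \<Longrightarrow> h (frag_of x) = (\<lambda>(q, \<phi>). \<lambda>\<xi>\<in>Qd. \<phi> (\<xi> q)) x"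
    by (rule comm_group.free_Abelian_group_universal[OF DH.M.a_comm_group im]) (rule that)
  have "h \<in> hom F (add_monoid DH) \<and> (\<forall>q\<in>carrier Q. \<forall>\<phi>\<in>DL. h (frag_of (q, \<phi>)) = (\<lambda>\<xi>\<in>Qd. \<phi> (\<xi> q)))"
    by (intro conjI h(1) ballI) (subst h(2), auto)
  then have "\<exists>h. h \<in> hom F (add_monoid DH) \<and> (\<forall>q\<in>carrier Q. \<forall>\<phi>\<in>DL. h (frag_of (q, \<phi>)) = (\<lambda>\<xi>\<in>Qd. \<phi> (\<xi> q)))"
    by blast
  then show ?thesis unfolding free_pairing_def by (rule someI_ex)
qed

lemma ev_closed: "c \<in> carrier F \<Longrightarrow> ev c \<in> module_homs k H E"
  using ev_spec by (auto simp: hom_def)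

lemma ev_E: "c \<in> carrier F \<Longrightarrow> \<xi> \<in> Qd \<Longrightarrow> ev c \<xi> \<in> carrier E"
  using module_homsD(1)[OF ev_closed] by simp

lemma ev_add: "c \<in> carrier F \<Longrightarrow> c' \<in> carrier F \<Longrightarrow> ev (c + c') = ev c \<oplus>\<^bsub>DH\<^esub> ev c'"
  using ev_spec by (auto simp: hom_def)

lemma ev_generator: "q \<in> carrier Q \<Longrightarrow> \<phi> \<in> DL \<Longrightarrow> ev (frag_of (q, \<phi>)) = (\<lambda>\<xi>\<in>Qd. \<phi> (\<xi> q))"
  using ev_spec by blast

lemma ev_generator_apply: "q \<in> carrier Q \<Longrightarrow> \<phi> \<in> DL \<Longrightarrow> \<xi> \<in> Qd \<Longrightarrow> ev (frag_of (q, \<phi>)) \<xi> = \<phi> (\<xi> q)"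
  by (simp add: ev_generator)

lemma F_closed:
  "0 \<in> carrier F" "c \<in> carrier F \<Longrightarrow> c' \<in> carrier F \<Longrightarrow> c + c' \<in> carrier F"
  "c \<in> carrier F \<Longrightarrow> c' \<in> carrier F \<Longrightarrow> c - c' \<in> carrier F"
  "c \<in> carrier F \<Longrightarrow> - c \<in> carrier F"
  using keys_add[of c c'] keys_diff[of c c'] by auto

lemma ev_0: "ev 0 = \<zero>\<^bsub>DH\<^esub>"
  using ev_add[of 0 0] ev_closed[of 0] F_closed(1) by (simp add: DH.M.add.l_cancel_one' del: dual_simps(2-3))

text \<open>Additive form of compatibility with differences: it avoids a subtraction in the dual
  module, where only the record operations are at hand.\<close>

lemma ev_diff_eq: "c \<in> carrier F \<Longrightarrow> c' \<in> carrier F \<Longrightarrow> ev (c - c') \<oplus>\<^bsub>DH\<^esub> ev c' = ev c"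
  using ev_add[of "c - c'" c'] F_closed(3)[of c c'] by (simp del: dual_simps carrier_free_Abelian_group_iff)

lemma left_closed: "\<phi> \<in> DL \<Longrightarrow> a \<in> carrier \<Lambda> \<Longrightarrow> dual_algebra_left \<Lambda> a \<phi> \<in> DL"
  unfolding dual_algebra_left_def
  by (rule restrict_module_homs[OF right_module_algebra], rule linI)
    (auto simp: module_homsD alg.l_distr smult_mult)

lemma left_apply: "x \<in> carrier \<Lambda> \<Longrightarrow> dual_algebra_left \<Lambda> a \<phi> x = \<phi> (x \<otimes>\<^bsub>\<Lambda>\<^esub> a)"
  by (simp add: dual_algebra_left_def)

lemma right_closed: "\<phi> \<in> DL \<Longrightarrow> a \<in> carrier \<Lambda> \<Longrightarrow> (\<lambda>x\<in>carrier \<Lambda>. \<phi> (a \<otimes>\<^bsub>\<Lambda>\<^esub> x)) \<in> DL"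
  by (rule restrict_module_homs[OF right_module_algebra], rule linI)
    (auto simp: module_homsD alg.r_distr mult_smult)

lemma DL_add: "\<phi> \<in> DL \<Longrightarrow> \<psi> \<in> DL \<Longrightarrow> (\<lambda>x\<in>carrier \<Lambda>. \<phi> x \<oplus>\<^bsub>E\<^esub> \<psi> x) \<in> DL"
  by (rule module_homs_add[OF right_module_algebra E])

definition gens where "gens =
      {frag_of (x \<oplus>\<^bsub>Q\<^esub> x', y) - frag_of (x, y) - frag_of (x', y) | x x' y.
          x \<in> carrier Q \<and> x' \<in> carrier Q \<and> y \<in> DL} \<union>
       {frag_of (x, y \<oplus>\<^bsub>dual_algebra k E \<Lambda>\<^esub> y') - frag_of (x, y) - frag_of (x, y') | x y y'.
          x \<in> carrier Q \<and> y \<in> DL \<and> y' \<in> DL} \<union>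
       {frag_of (a \<odot>\<^bsub>Q\<^esub> x, y) - frag_of (x, dual_algebra_left \<Lambda> a y) | a x y.
          a \<in> carrier \<Lambda> \<and> x \<in> carrier Q \<and> y \<in> DL}"

lemma Rel_generate: "Rel = generate F gens"
  by (simp add: tensor_relations_def gens_def)

lemma frag_in_F: "x \<in> carrier Q \<Longrightarrow> y \<in> DL \<Longrightarrow> frag_of (x, y) \<in> carrier F"
  by simp

lemma gens_F: "gens \<subseteq> carrier F"
proof -
  have "frag_of (x \<oplus>\<^bsub>Q\<^esub> x', y) - frag_of (x, y) - frag_of (x', y) \<in> carrier F"
    if "x \<in> carrier Q" "x' \<in> carrier Q" "y \<in> DL" for x x' y
    using that by (intro F_closed frag_in_F) auto
  moreover have "frag_of (x, y \<oplus>\<^bsub>dual_algebra k E \<Lambda>\<^esub> y') - frag_of (x, y) - frag_of (x, y') \<in> carrier F"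
    if "x \<in> carrier Q" "y \<in> DL" "y' \<in> DL" for x y y'
    using that DL_add by (intro F_closed frag_in_F) auto
  moreover have "frag_of (a \<odot>\<^bsub>Q\<^esub> x, y) - frag_of (x, dual_algebra_left \<Lambda> a y) \<in> carrier F"
    if "a \<in> carrier \<Lambda>" "x \<in> carrier Q" "y \<in> DL" for a x y
    using that left_closed by (intro F_closed frag_in_F) (auto simp: Q.smult_closed)
  ultimately show ?thesis unfolding gens_def by blast
qed

lemma Rel_subgroup: "subgroup Rel F"
  unfolding Rel_generate by (rule group.generate_is_subgroup[OF group_free_Abelian_group gens_F])

lemma Rel_F: "c \<in> Rel \<Longrightarrow> c \<in> carrier F"
  using subgroup.subset[OF Rel_subgroup] by blast

lemma Rel_0: "0 \<in> Rel"
  using subgroup.one_closed[OF Rel_subgroup] by simp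

lemma Rel_add: "c \<in> Rel \<Longrightarrow> c' \<in> Rel \<Longrightarrow> c + c' \<in> Rel"
  using subgroup.m_closed[OF Rel_subgroup] by simp

lemma Rel_uminus: "c \<in> Rel \<Longrightarrow> - c \<in> Rel"
  using subgroup.m_inv_closed[OF Rel_subgroup, of c] Rel_F[of c] by simp

lemma Rel_diff: "c \<in> Rel \<Longrightarrow> c' \<in> Rel \<Longrightarrow> c - c' \<in> Rel"
  using Rel_add[OF _ Rel_uminus] by fastforce

lemma Rel_sum: "finite I \<Longrightarrow> (\<And>i. i \<in> I \<Longrightarrow> g i \<in> Rel) \<Longrightarrow> sum g I \<in> Rel"
  by (induction I rule: finite_induct) (auto simp: Rel_0 intro!: Rel_add)

lemma gens_Rel: "c \<in> gens \<Longrightarrow> c \<in> Rel"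
  unfolding Rel_generate by (rule generate.incl)

lemma Rel_add_left: "x \<in> carrier Q \<Longrightarrow> x' \<in> carrier Q \<Longrightarrow> y \<in> DL \<Longrightarrow>
    frag_of (x \<oplus>\<^bsub>Q\<^esub> x', y) - frag_of (x, y) - frag_of (x', y) \<in> Rel"
  by (rule gens_Rel) (unfold gens_def, blast)

lemma Rel_add_right: "x \<in> carrier Q \<Longrightarrow> y \<in> DL \<Longrightarrow> y' \<in> DL \<Longrightarrow>
    frag_of (x, y \<oplus>\<^bsub>dual_algebra k E \<Lambda>\<^esub> y') - frag_of (x, y) - frag_of (x, y') \<in> Rel"
  by (rule gens_Rel) (unfold gens_def, blast)

lemma Rel_balanced: "a \<in> carrier \<Lambda> \<Longrightarrow> x \<in> carrier Q \<Longrightarrow> y \<in> DL \<Longrightarrow>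
    frag_of (a \<odot>\<^bsub>Q\<^esub> x, y) - frag_of (x, dual_algebra_left \<Lambda> a y) \<in> Rel"
  by (rule gens_Rel) (unfold gens_def, blast)

lemma ev_eqI:
  assumes "c \<in> carrier F" "c' \<in> carrier F" "\<And>\<xi>. \<xi> \<in> Qd \<Longrightarrow> ev c \<xi> = ev c' \<xi>"
  shows "ev c = ev c'"
  by (rule module_homs_eqI[OF ev_closed ev_closed]) (use assms in auto)

lemma ev_eq_imp_diff_zero: 
  assumes "c \<in> carrier F" "c' \<in> carrier F" "ev c = ev c'"
  shows "ev (c - c') = \<zero>\<^bsub>DH\<^esub>"
  using ev_diff_eq[OF assms(1,2)] assms ev_closed[OF assms(2)] ev_closed[OF F_closed(3)[OF assms(1,2)]]
  by (simp add: DH.M.add.r_cancel_one del: dual_simps(2-4))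

text \<open>Additivity in both arguments is immediate. For the balancing relation,
  \<open>\<xi>\<close> sends the multiple of \<open>x\<close> by \<open>a\<close> to
  \<open>\<xi> x\<close> times \<open>a\<close>, and the left action of \<open>a\<close> on a
  functional multiplies its argument by \<open>a\<close> on the right.\<close>

lemma ev_gens: assumes "c \<in> gens" shows "ev c = \<zero>\<^bsub>DH\<^esub>"
proof -
  have z: "ev (a - b - b') = \<zero>\<^bsub>DH\<^esub>" if "a \<in> carrier F" "b \<in> carrier F" "b' \<in> carrier F"
      "\<And>\<xi>. \<xi> \<in> Qd \<Longrightarrow> ev a \<xi> = ev b \<xi> \<oplus>\<^bsub>E\<^esub> ev b' \<xi>" for a b b'
  proof -
    have "ev a = ev (b + b')"
      by (rule ev_eqI) (use that F_closed in \<open>auto simp: ev_add simp del: carrier_free_Abelian_group_iff\<close>)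
    then have "ev (a - (b + b')) = \<zero>\<^bsub>DH\<^esub>" using that F_closed by (intro ev_eq_imp_diff_zero) 
    then show ?thesis by (simp add: diff_diff_eq)
  qed
  consider x x' y where "c = frag_of (x \<oplus>\<^bsub>Q\<^esub> x', y) - frag_of (x, y) - frag_of (x', y)" "x \<in> carrier Q" "x' \<in> carrier Q" "y \<in> DL"
    | x y y' where "c = frag_of (x, y \<oplus>\<^bsub>dual_algebra k E \<Lambda>\<^esub> y') - frag_of (x, y) - frag_of (x, y')" "x \<in> carrier Q" "y \<in> DL" "y' \<in> DL"
    | a x y where "c = frag_of (a \<odot>\<^bsub>Q\<^esub> x, y) - frag_of (x, dual_algebra_left \<Lambda> a y)" "a \<in> carrier \<Lambda>" "x \<in> carrier Q" "y \<in> DL"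
    using assms unfolding gens_def by blast
  then show ?thesis
  proof cases
    case 1
    then show ?thesis unfolding 1(1)
      by (intro z) (auto simp: ev_generator module_homsD(2)[where N=Reg, simplified] module_homsD(2)[where M=\<Lambda>] Qd_closed)
  next
    case 2
    then show ?thesis unfolding 2(1)
      using DL_add by (intro z) (auto simp: ev_generator Qd_closed)
  next
    case 3
    then have "ev (frag_of (a \<odot>\<^bsub>Q\<^esub> x, y)) = ev (frag_of (x, dual_algebra_left \<Lambda> a y))"
      using left_closed Q.smult_closed
      by (intro ev_eqI) (auto simp: ev_generator Qd_closed left_apply module_homsD(3)[where N=Reg, simplified])
    then show ?thesis unfolding 3(1) using 3 left_closed Q.smult_closed by (intro ev_eq_imp_diff_zero) auto
  qed
qed

lemma ev_Rel: assumes "c \<in> Rel" shows "ev c = \<zero>\<^bsub>DH\<^esub>"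
proof -
  interpret G: group_hom F "add_monoid DH" ev
    using ev_spec DH.M.a_group by (simp add: group_hom_def group_hom_axioms_def)
  have "Rel \<subseteq> kernel F (add_monoid DH) ev"
    unfolding Rel_generate
    by (rule group.generate_subgroup_incl[OF group_free_Abelian_group _ G.subgroup_kernel])
      (use ev_gens gens_F in \<open>auto simp: kernel_def subset_iff simp del: carrier_free_Abelian_group_iff dual_simps(2)\<close>)
  then show ?thesis using assms by (auto simp: kernel_def simp del: dual_simps(2))
qed

definition coef :: "'q \<Rightarrow> (('q \<Rightarrow> 'r) \<Rightarrow> 'e) \<Rightarrow> 'r \<Rightarrow> 'e"
  where "coef s \<psi> = (\<lambda>x\<in>carrier \<Lambda>. \<psi> (\<lambda>q\<in>carrier Q. x \<otimes>\<^bsub>\<Lambda>\<^esub> \<Xi> s q))"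

text \<open>The inverse of the pairing, at the level of formal sums: the dual basis turns a
  functional \<open>\<psi>\<close> on Hom(\<open>Q\<close>, \<Lambda>) into the sum of the pairs of
  a generator \<open>s\<close> with the functional \<open>coef s \<psi>\<close> on
  \<Lambda>.\<close>

definition expand :: "(('q \<Rightarrow> 'r) \<Rightarrow> 'e) \<Rightarrow> ('q \<times> ('r \<Rightarrow> 'e) \<Rightarrow>\<^sub>0 int)"
  where "expand \<psi> = (\<Sum>s\<in>S. frag_of (s, coef s \<psi>))"

lemma S: "finite S" "s \<in> S \<Longrightarrow> s \<in> carrier Q" "s \<in> S \<Longrightarrow> \<Xi> s \<in> Qd"
  using db by (auto simp: dual_basis_def)

lemma left_mult_Qd: "\<xi> \<in> Qd \<Longrightarrow> x \<in> carrier \<Lambda> \<Longrightarrow> (\<lambda>q\<in>carrier Q. x \<otimes>\<^bsub>\<Lambda>\<^esub> \<xi> q) \<in> Qd"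
  by (rule restrict_module_homs[OF Q], rule linI)
    (auto simp: Qd_closed module_homsD[where N=Reg, simplified] alg.r_distr alg.m_assoc)

lemma coef_closed:
  assumes \<psi>: "\<psi> \<in> module_homs k H E" and s: "s \<in> S" shows "coef s \<psi> \<in> DL"
proof -
  have c: "\<Xi> s q \<in> carrier \<Lambda>" if "q \<in> carrier Q" for q using Qd_closed[OF S(3)[OF s] that] .
  have "lin k \<Lambda> H (\<lambda>x. \<lambda>q\<in>carrier Q. x \<otimes>\<^bsub>\<Lambda>\<^esub> \<Xi> s q)"
    by (rule linI) (auto simp: left_mult_Qd[OF S(3)[OF s]] c alg.l_distr smult_hom_module smult_mult mult_scalar
        simp del: hom_module_simps(4) intro!: restrict_ext)
  from comp_module_homs[OF right_module_algebra this module_homs_lin[OF \<psi>]]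
  show ?thesis by (simp add: coef_def)
qed

lemma coef_add:
  assumes "\<psi> \<in> module_homs k H E" "\<psi>' \<in> module_homs k H E" "s \<in> S"
  shows "coef s (\<psi> \<oplus>\<^bsub>DH\<^esub> \<psi>') = coef s \<psi> \<oplus>\<^bsub>dual_algebra k E \<Lambda>\<^esub> coef s \<psi>'"
  using left_mult_Qd[OF S(3)[OF assms(3)]] by (auto simp: coef_def fun_eq_iff)

lemma expand_closed: "\<psi> \<in> module_homs k H E \<Longrightarrow> expand \<psi> \<in> carrier F"
  unfolding expand_def using S coef_closed by (intro sum_closed_free_Abelian_group) auto

lemma expand_add:
  assumes "\<psi> \<in> module_homs k H E" "\<psi>' \<in> module_homs k H E"
  shows "expand (\<psi> \<oplus>\<^bsub>DH\<^esub> \<psi>') - expand \<psi> - expand \<psi>' \<in> Rel"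
proof -
  have "expand (\<psi> \<oplus>\<^bsub>DH\<^esub> \<psi>') - expand \<psi> - expand \<psi>' =
    (\<Sum>s\<in>S. frag_of (s, coef s \<psi> \<oplus>\<^bsub>dual_algebra k E \<Lambda>\<^esub> coef s \<psi>') - frag_of (s, coef s \<psi>) - frag_of (s, coef s \<psi>'))"
    unfolding expand_def using coef_add[OF assms] by (simp add: sum_subtractf del: dual_simps dual_algebra_simps)
  also have "\<dots> \<in> Rel"
    using S assms by (intro Rel_sum Rel_add_right coef_closed)
  finally show ?thesis .
qed

lemma frag_zero_left: "y \<in> DL \<Longrightarrow> frag_of (\<zero>\<^bsub>Q\<^esub>, y) \<in> Rel"
  using Rel_uminus[OF Rel_add_left[of "\<zero>\<^bsub>Q\<^esub>" "\<zero>\<^bsub>Q\<^esub>" y]] by simp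

lemma frag_finsum:
  assumes "y \<in> DL"
  shows "finite I \<Longrightarrow> g \<in> I \<rightarrow> carrier Q \<Longrightarrow> frag_of (\<Oplus>\<^bsub>Q\<^esub>i\<in>I. g i, y) - (\<Sum>i\<in>I. frag_of (g i, y)) \<in> Rel"
proof (induction I rule: finite_induct)
  case empty
  then show ?case using frag_zero_left[OF assms] by simp
next
  case (insert i I)
  then have g: "g \<in> I \<rightarrow> carrier Q" "g i \<in> carrier Q" by auto
  have "frag_of (g i \<oplus>\<^bsub>Q\<^esub> (\<Oplus>\<^bsub>Q\<^esub>i\<in>I. g i), y) - frag_of (g i, y) - frag_of (\<Oplus>\<^bsub>Q\<^esub>i\<in>I. g i, y) \<in> Rel"
    by (rule Rel_add_left) (use g assms in auto)
  from Rel_add[OF this insert.IH[OF g(1)]] show ?case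
    using insert g by (simp add: algebra_simps)
qed

text \<open>Modulo the relations, a pair of \<open>q\<close> and \<open>\<phi>\<close> is first
  expanded through the dual basis expansion of \<open>q\<close>; the coordinates
  \<open>\<Xi> s q\<close> then move across to \<open>\<phi>\<close>. What arises at
  \<open>s\<close> is the coefficient of the functional defined by the pair. Induction over formal
  sums does the rest.\<close>

lemma expand_ev: "c \<in> carrier F \<Longrightarrow> c - expand (ev c) \<in> Rel"
proof -
  assume "c \<in> carrier F"
  then show ?thesis
  proof (induction c rule: free_Abelian_group_induction)
    case zero
    have "expand \<zero>\<^bsub>DH\<^esub> - expand \<zero>\<^bsub>DH\<^esub> - expand \<zero>\<^bsub>DH\<^esub> \<in> Rel"
      using expand_add[of "\<zero>\<^bsub>DH\<^esub>" "\<zero>\<^bsub>DH\<^esub>"] DH.M.zero_closed by (simp del: dual_simps(2-4))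
    then show ?case by (simp add: ev_0 del: dual_simps(2-4))
  next
    case (diff x y)
    then have F: "x \<in> carrier F" "y \<in> carrier F" by auto
    have "expand (ev (x - y) \<oplus>\<^bsub>DH\<^esub> ev y) - expand (ev (x - y)) - expand (ev y) \<in> Rel"
      by (intro expand_add ev_closed F_closed F)
    then have "expand (ev x) - expand (ev (x - y)) - expand (ev y) \<in> Rel"
      using ev_diff_eq[OF F] by simp
    from Rel_add[OF this Rel_diff[OF diff(3,4)]] show ?case by (simp add: algebra_simps)
  next
    case (one p)
    obtain q \<phi> where p: "p = (q, \<phi>)" "q \<in> carrier Q" "\<phi> \<in> DL" using one by auto
    have c: "\<Xi> s q \<in> carrier \<Lambda>" if "s \<in> S" for s using Qd_closed[OF S(3)[OF that] p(2)] .
    have q: "(\<Oplus>\<^bsub>Q\<^esub>s\<in>S. \<Xi> s q \<odot>\<^bsub>Q\<^esub> s) = q" using db p(2) by (simp add: dual_basis_def)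
    have "frag_of (\<Oplus>\<^bsub>Q\<^esub>s\<in>S. \<Xi> s q \<odot>\<^bsub>Q\<^esub> s, \<phi>) - (\<Sum>s\<in>S. frag_of (\<Xi> s q \<odot>\<^bsub>Q\<^esub> s, \<phi>)) \<in> Rel"
      by (rule frag_finsum[OF p(3) S(1)]) (use c S(2) Q.smult_closed in auto)
    then have 1: "frag_of (q, \<phi>) - (\<Sum>s\<in>S. frag_of (\<Xi> s q \<odot>\<^bsub>Q\<^esub> s, \<phi>)) \<in> Rel" unfolding q .
    have "coef s (ev (frag_of (q, \<phi>))) = dual_algebra_left \<Lambda> (\<Xi> s q) \<phi>" if "s \<in> S" for s
      using left_mult_Qd[OF S(3)[OF that]] p
      by (auto simp: coef_def ev_generator dual_algebra_left_def fun_eq_iff)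
    then have "(\<Sum>s\<in>S. frag_of (\<Xi> s q \<odot>\<^bsub>Q\<^esub> s, \<phi>)) - expand (ev (frag_of (q, \<phi>))) =
        (\<Sum>s\<in>S. frag_of (\<Xi> s q \<odot>\<^bsub>Q\<^esub> s, \<phi>) - frag_of (s, dual_algebra_left \<Lambda> (\<Xi> s q) \<phi>))"
      by (simp add: expand_def sum_subtractf)
    also have "\<dots> \<in> Rel" using S c p by (intro Rel_sum Rel_balanced)
    finally show ?case using Rel_add[OF 1] unfolding p(1) by fastforce
  qed
qed

text \<open>The relations lie in the kernel of the pairing by \<open>ev_Rel\<close>. Conversely,
  \<open>expand_ev\<close> recovers an element modulo relations from its pairing, so there is
  nothing else in the kernel.\<close>

lemma ev_eq_iff: "c \<in> carrier F \<Longrightarrow> c' \<in> carrier F \<Longrightarrow> ev c = ev c' \<longleftrightarrow> c - c' \<in> Rel"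
proof
  assume c: "c \<in> carrier F" "c' \<in> carrier F"
  show "c - c' \<in> Rel" if "ev c = ev c'"
    using Rel_diff[OF expand_ev[OF c(1)] expand_ev[OF c(2)]] that by simp
  show "ev c = ev c'" if "c - c' \<in> Rel"
    using ev_diff_eq[OF c] ev_Rel[OF that] ev_closed[OF c(2)] by (simp del: dual_simps(2-4))
qed

lemma ev_sum:
  assumes "finite I" "\<And>i. i \<in> I \<Longrightarrow> g i \<in> carrier F" "\<xi> \<in> Qd"
  shows "ev (\<Sum>i\<in>I. g i) \<xi> = (\<Oplus>\<^bsub>E\<^esub>i\<in>I. ev (g i) \<xi>)"
  using assms(1,2)
proof (induction I rule: finite_induct)
  case empty
  then show ?case using ev_0 assms(3) by simp
next
  case (insert i I)
  then have "sum g I \<in> carrier F" by (intro sum_closed_free_Abelian_group) auto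
  moreover have "(\<lambda>i. ev (g i) \<xi>) \<in> I \<rightarrow> carrier E" using insert assms(3) ev_E by auto
  ultimately show ?case
    using insert assms(3) ev_E[of "g i" \<xi>] by (simp add: ev_add del: carrier_free_Abelian_group_iff)
qed

text \<open>The pairing of \<open>expand \<psi>\<close> with \<open>\<xi>\<close> is the sum of the
  values of \<open>\<psi>\<close> on the components of \<open>\<xi>\<close> along the coordinate
  functions, and these components add up to \<open>\<xi>\<close> by
  \<open>dual_expand\<close>.\<close>

lemma ev_expand:
  assumes \<psi>: "\<psi> \<in> module_homs k H E" shows "ev (expand \<psi>) = \<psi>"
proof (rule module_homs_eqI[OF ev_closed[OF expand_closed[OF \<psi>]] \<psi>])
  fix \<xi> assume "\<xi> \<in> carrier H"
  then have \<xi>: "\<xi> \<in> Qd" by simp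
  have "ev (expand \<psi>) \<xi> = (\<Oplus>\<^bsub>E\<^esub>s\<in>S. ev (frag_of (s, coef s \<psi>)) \<xi>)"
    unfolding expand_def by (rule ev_sum[OF S(1) _ \<xi>]) (use S coef_closed[OF \<psi>] in auto)
  also have "\<dots> = (\<Oplus>\<^bsub>E\<^esub>s\<in>S. \<psi> (\<lambda>q\<in>carrier Q. \<xi> s \<otimes>\<^bsub>\<Lambda>\<^esub> \<Xi> s q))"
    by (rule E.M.finsum_cong')
      (use S coef_closed[OF \<psi>] \<xi> dual_expand(1)[OF Q db \<xi>] module_homsD(1)[OF \<psi>]
        in \<open>auto simp: ev_generator coef_def Qd_closed\<close>)
  also have "\<dots> = \<psi> (\<Oplus>\<^bsub>H\<^esub>s\<in>S. (\<lambda>q\<in>carrier Q. \<xi> s \<otimes>\<^bsub>\<Lambda>\<^esub> \<Xi> s q))"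
    by (rule module_homs_finsum[OF H.right_module_axioms E \<psi>, symmetric])
      (use S dual_expand(1)[OF Q db \<xi>] in auto)
  also have "\<dots> = \<psi> \<xi>" by (simp only: dual_expand(2)[OF Q db \<xi>])
  finally show "ev (expand \<psi>) \<xi> = \<psi> \<xi>" .
qed

abbreviation coset ("\<langle>_\<rangle>") where "\<langle>c\<rangle> \<equiv> Rel +>\<^bsub>tensor_free Q (dual_algebra k E \<Lambda>)\<^esub> c"

lemma coset_eq: "\<langle>c\<rangle> = (\<lambda>h. h + c) ` Rel"
  by (auto simp: a_r_coset_def' tensor_free_def)

lemma coset_self: "c \<in> \<langle>c\<rangle>"
  unfolding coset_eq by (rule image_eqI[OF _ Rel_0]) simp

lemma mem_coset: "d \<in> \<langle>c\<rangle> \<longleftrightarrow> d - c \<in> Rel"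
  unfolding coset_eq by (auto intro: image_eqI[of _ _ "d - c"])

lemma coset_eq_iff: "\<langle>c\<rangle> = \<langle>d\<rangle> \<longleftrightarrow> c - d \<in> Rel"
proof
  assume "\<langle>c\<rangle> = \<langle>d\<rangle>"
  then show "c - d \<in> Rel" using coset_self[of c] mem_coset by blast
next
  assume *: "c - d \<in> Rel"
  have "x - c \<in> Rel \<longleftrightarrow> x - d \<in> Rel" for x
    using Rel_add[OF _ *, of "x - c"] Rel_diff[OF _ *, of "x - d"] by auto
  then show "\<langle>c\<rangle> = \<langle>d\<rangle>" using mem_coset by blast
qed

text \<open>Equality in the tensor product is tested by the pairing. The axioms on the action of
  \<Lambda> that do not follow from additivity of \<open>act\<close> are checked in this
  way.\<close>

lemma coset_eq_iff_ev: "c \<in> carrier F \<Longrightarrow> d \<in> carrier F \<Longrightarrow> \<langle>c\<rangle> = \<langle>d\<rangle> \<longleftrightarrow> ev c = ev d"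
  by (simp only: coset_eq_iff ev_eq_iff)

lemma coset_F: "c \<in> carrier F \<Longrightarrow> d \<in> \<langle>c\<rangle> \<Longrightarrow> d \<in> carrier F"
  using F_closed(2)[of "d - c" c] Rel_F mem_coset[of d c] by fastforce

lemma ev_coset: "c \<in> carrier F \<Longrightarrow> d \<in> \<langle>c\<rangle> \<Longrightarrow> ev d = ev c"
  using ev_eq_iff coset_F mem_coset by blast

lemma carrier_T: "carrier T = coset ` carrier F"
  by (auto simp: tensor_def quotient_module_def A_RCOSETS_def RCOSETS_def a_r_coset_def tensor_free_def)

lemma zero_T: "\<zero>\<^bsub>T\<^esub> = \<langle>0\<rangle>"
  by (simp add: tensor_def quotient_module_def coset_eq)

lemma add_T: "\<langle>c\<rangle> \<oplus>\<^bsub>T\<^esub> \<langle>d\<rangle> = \<langle>c + d\<rangle>"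
proof -
  have "\<langle>c\<rangle> \<oplus>\<^bsub>T\<^esub> \<langle>d\<rangle> = {x + y | x y. x \<in> \<langle>c\<rangle> \<and> y \<in> \<langle>d\<rangle>}"
    by (auto simp: tensor_def quotient_module_def set_add_def set_mult_def tensor_free_def)
  also have "\<dots> = \<langle>c + d\<rangle>"
  proof (intro Set.set_eqI iffI)
    fix z assume "z \<in> {x + y | x y. x \<in> \<langle>c\<rangle> \<and> y \<in> \<langle>d\<rangle>}"
    then obtain x y where "z = x + y" "x - c \<in> Rel" "y - d \<in> Rel" by (auto simp: mem_coset)
    then show "z \<in> \<langle>c + d\<rangle>" using Rel_add[of "x - c" "y - d"] by (simp add: mem_coset algebra_simps)
  next
    fix z assume "z \<in> \<langle>c + d\<rangle>"
    then have "z = (z - d) + d" "z - d - c \<in> Rel" by (simp_all add: mem_coset algebra_simps)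
    then show "z \<in> {x + y | x y. x \<in> \<langle>c\<rangle> \<and> y \<in> \<langle>d\<rangle>}" using coset_self mem_coset by blast
  qed
  finally show ?thesis .
qed

definition act :: "'r \<Rightarrow> ('q \<times> ('r \<Rightarrow> 'e) \<Rightarrow>\<^sub>0 int) \<Rightarrow> ('q \<times> ('r \<Rightarrow> 'e) \<Rightarrow>\<^sub>0 int)"
  where "act a = frag_extend (\<lambda>(x, y). frag_of (x, a \<odot>\<^bsub>dual_algebra k E \<Lambda>\<^esub> y))"

text \<open>The right action of \<open>a\<close> replaces \<open>\<phi>\<close> by the functional
  that multiplies its argument by \<open>a\<close> on the left. Evaluated at \<open>\<xi> q\<close>,
  this is \<open>\<phi>\<close> at \<open>a\<close> times \<open>\<xi> q\<close>, so the action is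
  adjoint to left multiplication on \<open>\<xi>\<close>.\<close>

lemma act_ev:
  assumes a: "a \<in> carrier \<Lambda>" and c: "c \<in> carrier F"
  shows "act a c \<in> carrier F \<and> (\<forall>\<xi>\<in>Qd. ev (act a c) \<xi> = ev c (\<lambda>q\<in>carrier Q. a \<otimes>\<^bsub>\<Lambda>\<^esub> \<xi> q))"
  using c
  proof (induction c rule: free_Abelian_group_induction)
    case zero
    have "ev 0 \<xi> = \<zero>\<^bsub>E\<^esub>" if "\<xi> \<in> Qd" for \<xi> using that by (simp add: ev_0)
    then show ?case using left_mult_Qd[OF _ a] F_closed(1)
      unfolding act_def frag_extend_0 by (metis (no_types, lifting))
  next
    case (diff x y)
    then have F: "x \<in> carrier F" "y \<in> carrier F" "act a x \<in> carrier F" "act a y \<in> carrier F" by auto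
    have eq: "act a (x - y) = act a x - act a y" by (simp add: act_def frag_extend_diff)
    have "ev (act a x - act a y) \<xi> = ev (x - y) (\<lambda>q\<in>carrier Q. a \<otimes>\<^bsub>\<Lambda>\<^esub> \<xi> q)" (is "?l = ?r") if \<xi>: "\<xi> \<in> Qd" for \<xi>
    proof -
      note a\<xi> = left_mult_Qd[OF \<xi> a]
      have "?l \<oplus>\<^bsub>E\<^esub> ev (act a y) \<xi> = ev (act a x) \<xi>"
        using fun_cong[OF ev_diff_eq[OF F(3,4)], of \<xi>] \<xi> by simp
      also have "\<dots> = ev x (\<lambda>q\<in>carrier Q. a \<otimes>\<^bsub>\<Lambda>\<^esub> \<xi> q)" using diff \<xi> by blast
      also have "\<dots> = ?r \<oplus>\<^bsub>E\<^esub> ev y (\<lambda>q\<in>carrier Q. a \<otimes>\<^bsub>\<Lambda>\<^esub> \<xi> q)"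
        using fun_cong[OF ev_diff_eq[OF F(1,2)], of "\<lambda>q\<in>carrier Q. a \<otimes>\<^bsub>\<Lambda>\<^esub> \<xi> q"] a\<xi> by simp
      also have "ev y (\<lambda>q\<in>carrier Q. a \<otimes>\<^bsub>\<Lambda>\<^esub> \<xi> q) = ev (act a y) \<xi>"
        by (rule diff(4)[THEN conjunct2, rule_format, OF \<xi>, symmetric])
      finally show ?thesis
        using ev_E[OF F_closed(3)[OF F(3,4)] \<xi>] ev_E[OF F_closed(3)[OF F(1,2)] a\<xi>] ev_E[OF F(4) \<xi>]
        by (metis E.M.add.right_cancel)
    qed
    then show ?case unfolding eq using F_closed(3)[OF F(3,4)] by blast
  next
    case (one p)
    obtain q \<phi> where p: "p = (q, \<phi>)" "q \<in> carrier Q" "\<phi> \<in> DL" using one by auto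
    have r: "act a (frag_of p) = frag_of (q, \<lambda>x\<in>carrier \<Lambda>. \<phi> (a \<otimes>\<^bsub>\<Lambda>\<^esub> x))" by (simp add: act_def p(1))
    have "ev (act a (frag_of p)) \<xi> = ev (frag_of p) (\<lambda>q\<in>carrier Q. a \<otimes>\<^bsub>\<Lambda>\<^esub> \<xi> q)" if \<xi>: "\<xi> \<in> Qd" for \<xi>
      unfolding r unfolding p(1) ev_generator_apply[OF p(2,3) left_mult_Qd[OF \<xi> a]]
        ev_generator_apply[OF p(2) right_closed[OF p(3) a] \<xi>]
      using Qd_closed[OF \<xi> p(2)] p(2) by simp
    moreover have "act a (frag_of p) \<in> carrier F"
      unfolding r by (rule frag_in_F[OF p(2) right_closed[OF p(3) a]])
    ultimately show ?case by blast
qed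

text \<open>The action on classes is again a union over representatives. By \<open>act_ev\<close>
  the pairing of the result depends only on the pairing of the representative, hence only on its
  class.\<close>

lemma smult_T:
  assumes a: "a \<in> carrier \<Lambda>" and c: "c \<in> carrier F"
  shows "a \<odot>\<^bsub>T\<^esub> \<langle>c\<rangle> = \<langle>act a c\<rangle>"
proof -
  have "\<langle>act a d\<rangle> = \<langle>act a c\<rangle>" if d: "d \<in> \<langle>c\<rangle>" for d
  proof -
    have dF: "d \<in> carrier F" and e: "ev d = ev c" using coset_F[OF c d] ev_coset[OF c d] .
    have "ev (act a d) = ev (act a c)"
      by (rule ev_eqI) (use act_ev[OF a dF] act_ev[OF a c] e in auto)
    then show ?thesis using act_ev[OF a dF] act_ev[OF a c] coset_eq_iff_ev by blast
  qed
  then have "(\<Union>d\<in>\<langle>c\<rangle>. \<langle>act a d\<rangle>) = \<langle>act a c\<rangle>"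
    using coset_self[of c] by (intro SUP_eq_const) blast+
  moreover have "a \<odot>\<^bsub>T\<^esub> \<langle>c\<rangle> = (\<Union>d\<in>\<langle>c\<rangle>. \<langle>act a d\<rangle>)"
    by (simp add: tensor_def quotient_module_def tensor_free_def act_def)
  ultimately show ?thesis by simp
qed

lemma tensor_pairing_coset:
  assumes "c \<in> carrier F" shows "tensor_pairing k E \<Lambda> Q \<langle>c\<rangle> = ev c"
  unfolding tensor_pairing_def using someI[of "\<lambda>d. d \<in> \<langle>c\<rangle>", OF coset_self] ev_coset[OF assms] by blast

lemma act_F: "a \<in> carrier \<Lambda> \<Longrightarrow> c \<in> carrier F \<Longrightarrow> act a c \<in> carrier F"
  and ev_act: "a \<in> carrier \<Lambda> \<Longrightarrow> c \<in> carrier F \<Longrightarrow> \<xi> \<in> Qd \<Longrightarrow> ev (act a c) \<xi> = ev c (\<lambda>q\<in>carrier Q. a \<otimes>\<^bsub>\<Lambda>\<^esub> \<xi> q)"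
  using act_ev by blast+

lemma right_module_T: "right_module \<Lambda> T"
proof -
  have eqI: "\<langle>c\<rangle> = \<langle>d\<rangle>" if "c \<in> carrier F" "d \<in> carrier F" "\<And>\<xi>. \<xi> \<in> Qd \<Longrightarrow> ev c \<xi> = ev d \<xi>" for c d
    using that ev_eqI coset_eq_iff_ev by blast
  show ?thesis
  proof (rule right_moduleI)
    show "ring \<Lambda>" by (rule alg.ring_axioms)
    show "\<zero>\<^bsub>T\<^esub> \<in> carrier T" unfolding zero_T carrier_T using F_closed(1) by blast
  next
    fix x y assume "x \<in> carrier T" "y \<in> carrier T"
    then obtain c d where c: "x = \<langle>c\<rangle>" "y = \<langle>d\<rangle>" "c \<in> carrier F" "d \<in> carrier F" unfolding carrier_T by blast
    then show "x \<oplus>\<^bsub>T\<^esub> y \<in> carrier T" unfolding c add_T carrier_T using F_closed(2) by blast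
    show "x \<oplus>\<^bsub>T\<^esub> y = y \<oplus>\<^bsub>T\<^esub> x" unfolding c add_T by (simp add: add.commute)
    show "a \<odot>\<^bsub>T\<^esub> (x \<oplus>\<^bsub>T\<^esub> y) = a \<odot>\<^bsub>T\<^esub> x \<oplus>\<^bsub>T\<^esub> a \<odot>\<^bsub>T\<^esub> y" if "a \<in> carrier \<Lambda>" for a
      unfolding c add_T using that c F_closed(2)
      by (simp add: smult_T add_T del: carrier_free_Abelian_group_iff) (simp add: act_def frag_extend_add)
    fix z assume "z \<in> carrier T"
    then obtain e where e: "z = \<langle>e\<rangle>" "e \<in> carrier F" unfolding carrier_T by blast
    show "(x \<oplus>\<^bsub>T\<^esub> y) \<oplus>\<^bsub>T\<^esub> z = x \<oplus>\<^bsub>T\<^esub> (y \<oplus>\<^bsub>T\<^esub> z)" unfolding c e add_T by (simp add: add.assoc)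
  next
    fix x assume "x \<in> carrier T"
    then obtain c where c: "x = \<langle>c\<rangle>" "c \<in> carrier F" unfolding carrier_T by blast
    show "\<zero>\<^bsub>T\<^esub> \<oplus>\<^bsub>T\<^esub> x = x" unfolding c zero_T add_T by simp
    have "\<langle>- c\<rangle> \<oplus>\<^bsub>T\<^esub> x = \<zero>\<^bsub>T\<^esub>" unfolding c zero_T add_T by simp
    then show "\<exists>y\<in>carrier T. y \<oplus>\<^bsub>T\<^esub> x = \<zero>\<^bsub>T\<^esub>" unfolding carrier_T using F_closed(4)[OF c(2)] by blast
    show "\<one>\<^bsub>\<Lambda>\<^esub> \<odot>\<^bsub>T\<^esub> x = x"
    proof -
      have "ev (act \<one>\<^bsub>\<Lambda>\<^esub> c) \<xi> = ev c \<xi>" if \<xi>: "\<xi> \<in> Qd" for \<xi>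
      proof -
        have "(\<lambda>q\<in>carrier Q. \<one>\<^bsub>\<Lambda>\<^esub> \<otimes>\<^bsub>\<Lambda>\<^esub> \<xi> q) = \<xi>"
          by (rule module_homs_eqI[OF left_mult_Qd[OF \<xi>] \<xi>]) (use \<xi> Qd_closed in auto)
        then show ?thesis using ev_act[OF _ c(2) \<xi>, of "\<one>\<^bsub>\<Lambda>\<^esub>"] by simp
      qed
      then show ?thesis unfolding c using smult_T[OF _ c(2)] act_F[OF _ c(2)] eqI[of "act \<one>\<^bsub>\<Lambda>\<^esub> c" c] c(2)
        by (simp del: carrier_free_Abelian_group_iff)
    qed
    fix a assume a: "a \<in> carrier \<Lambda>"
    show "a \<odot>\<^bsub>T\<^esub> x \<in> carrier T"
      unfolding c smult_T[OF a c(2)] carrier_T using act_F[OF a c(2)] by blast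
    fix b assume b: "b \<in> carrier \<Lambda>"
    have ab: "a \<oplus>\<^bsub>\<Lambda>\<^esub> b \<in> carrier \<Lambda>" "a \<otimes>\<^bsub>\<Lambda>\<^esub> b \<in> carrier \<Lambda>" using a b by auto
    have "ev (act (a \<oplus>\<^bsub>\<Lambda>\<^esub> b) c) \<xi> = ev (act a c + act b c) \<xi>" if \<xi>: "\<xi> \<in> Qd" for \<xi>
    proof -
      have "(\<lambda>q\<in>carrier Q. (a \<oplus>\<^bsub>\<Lambda>\<^esub> b) \<otimes>\<^bsub>\<Lambda>\<^esub> \<xi> q) =
          (\<lambda>q\<in>carrier Q. a \<otimes>\<^bsub>\<Lambda>\<^esub> \<xi> q) \<oplus>\<^bsub>H\<^esub> (\<lambda>q\<in>carrier Q. b \<otimes>\<^bsub>\<Lambda>\<^esub> \<xi> q)"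
        using a b \<xi> Qd_closed by (auto simp: alg.l_distr intro!: restrict_ext)
      then show ?thesis
        using module_homsD(2)[OF ev_closed[OF c(2)], of "\<lambda>q\<in>carrier Q. a \<otimes>\<^bsub>\<Lambda>\<^esub> \<xi> q" "\<lambda>q\<in>carrier Q. b \<otimes>\<^bsub>\<Lambda>\<^esub> \<xi> q"]
          ev_act[OF ab(1) c(2) \<xi>] ev_act[OF a c(2) \<xi>] ev_act[OF b c(2) \<xi>] ev_add[OF act_F[OF a c(2)] act_F[OF b c(2)]]
          left_mult_Qd[OF \<xi>] a b \<xi> by (simp del: hom_module_simps(3) carrier_free_Abelian_group_iff)
    qed
    then show "(a \<oplus>\<^bsub>\<Lambda>\<^esub> b) \<odot>\<^bsub>T\<^esub> x = a \<odot>\<^bsub>T\<^esub> x \<oplus>\<^bsub>T\<^esub> b \<odot>\<^bsub>T\<^esub> x"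
      unfolding c smult_T[OF a c(2)] smult_T[OF b c(2)] smult_T[OF ab(1) c(2)] add_T
      by (intro eqI act_F ab c F_closed a b)
    have "ev (act (a \<otimes>\<^bsub>\<Lambda>\<^esub> b) c) \<xi> = ev (act b (act a c)) \<xi>" if \<xi>: "\<xi> \<in> Qd" for \<xi>
    proof -
      have "(\<lambda>q\<in>carrier Q. (a \<otimes>\<^bsub>\<Lambda>\<^esub> b) \<otimes>\<^bsub>\<Lambda>\<^esub> \<xi> q) = (\<lambda>q\<in>carrier Q. a \<otimes>\<^bsub>\<Lambda>\<^esub> (\<lambda>q\<in>carrier Q. b \<otimes>\<^bsub>\<Lambda>\<^esub> \<xi> q) q)"
        using a b \<xi> Qd_closed by (auto simp: alg.m_assoc intro!: restrict_ext)
      then show ?thesis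
        using ev_act[OF ab(2) c(2) \<xi>] ev_act[OF b act_F[OF a c(2)] \<xi>] ev_act[OF a c(2) left_mult_Qd[OF \<xi> b]] by simp
    qed
    then show "(a \<otimes>\<^bsub>\<Lambda>\<^esub> b) \<odot>\<^bsub>T\<^esub> x = b \<odot>\<^bsub>T\<^esub> (a \<odot>\<^bsub>T\<^esub> x)"
      unfolding c smult_T[OF a c(2)] smult_T[OF b act_F[OF a c(2)]] smult_T[OF ab(2) c(2)]
      by (intro eqI act_F ab c a b)
  qed
qed

lemma tensor_represents: "represents k E \<Lambda> Q T (tensor_pairing k E \<Lambda> Q)"
  unfolding represents_def
proof (intro conjI ballI)
  show "right_module \<Lambda> T" by (rule right_module_T)
  show "bij_betw (tensor_pairing k E \<Lambda> Q) (carrier T) (module_homs k H E)"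
    unfolding bij_betw_def
  proof
    show "inj_on (tensor_pairing k E \<Lambda> Q) (carrier T)"
      unfolding carrier_T by (intro inj_onI, clarify) (simp only: tensor_pairing_coset coset_eq_iff_ev)
    show "tensor_pairing k E \<Lambda> Q ` carrier T = module_homs k H E"
    proof
      show "tensor_pairing k E \<Lambda> Q ` carrier T \<subseteq> module_homs k H E"
        unfolding carrier_T using ev_closed by (auto simp: tensor_pairing_coset simp del: carrier_free_Abelian_group_iff)
      show "module_homs k H E \<subseteq> tensor_pairing k E \<Lambda> Q ` carrier T"
      proof
        fix \<psi> assume \<psi>: "\<psi> \<in> module_homs k H E"
        have "tensor_pairing k E \<Lambda> Q \<langle>expand \<psi>\<rangle> = \<psi>"
          using tensor_pairing_coset[OF expand_closed[OF \<psi>]] ev_expand[OF \<psi>] by simp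
        then show "\<psi> \<in> tensor_pairing k E \<Lambda> Q ` carrier T"
          unfolding carrier_T using expand_closed[OF \<psi>] by (metis imageI)
      qed
    qed
  qed
next
  fix t t' \<xi> assume "t \<in> carrier T" "t' \<in> carrier T" and \<xi>: "\<xi> \<in> Qd"
  then obtain c d where c: "t = \<langle>c\<rangle>" "t' = \<langle>d\<rangle>" "c \<in> carrier F" "d \<in> carrier F" unfolding carrier_T by blast
  then show "tensor_pairing k E \<Lambda> Q (t \<oplus>\<^bsub>T\<^esub> t') \<xi> = tensor_pairing k E \<Lambda> Q t \<xi> \<oplus>\<^bsub>E\<^esub> tensor_pairing k E \<Lambda> Q t' \<xi>"
    using F_closed(2)[OF c(3,4)] \<xi>
    by (simp add: add_T tensor_pairing_coset ev_add del: carrier_free_Abelian_group_iff)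
next
  fix a t \<xi> assume a: "a \<in> carrier \<Lambda>" and "t \<in> carrier T" and \<xi>: "\<xi> \<in> Qd"
  then obtain c where c: "t = \<langle>c\<rangle>" "c \<in> carrier F" unfolding carrier_T by blast
  then show "tensor_pairing k E \<Lambda> Q (a \<odot>\<^bsub>T\<^esub> t) \<xi> = tensor_pairing k E \<Lambda> Q t (\<lambda>q\<in>carrier Q. a \<otimes>\<^bsub>\<Lambda>\<^esub> \<xi> q)"
    using smult_T[OF a c(2)] act_F[OF a c(2)] ev_act[OF a c(2) \<xi>]
    by (simp add: tensor_pairing_coset del: carrier_free_Abelian_group_iff)
qed

end

section \<open>Maps induced on tensor products\<close>

locale dual_tensor_map = Q: dual_tensor k \<Lambda> E Q S \<Xi> + Q': dual_tensor k \<Lambda> E Q' S' \<Xi>'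
  for k :: "('k, 'c) ring_scheme" and \<Lambda> :: "('k, 'r) module" and E :: "('k, 'e) module"
    and Q :: "('r, 'q) module" and S \<Xi> and Q' :: "('r, 'q') module" and S' \<Xi>' +
  fixes f assumes f: "lin \<Lambda> Q Q' f"
begin

definition free_map :: "('q \<times> ('r \<Rightarrow> 'e) \<Rightarrow>\<^sub>0 int) \<Rightarrow> ('q' \<times> ('r \<Rightarrow> 'e) \<Rightarrow>\<^sub>0 int)"
  where "free_map = frag_extend (\<lambda>(x, y). frag_of (f x, y))"

lemma comp_Qd: "\<xi> \<in> Q'.Qd \<Longrightarrow> (\<lambda>q\<in>carrier Q. \<xi> (f q)) \<in> Q.Qd"
  by (rule comp_module_homs[OF Q.Q f module_homs_lin])

text \<open>A pair \<open>f q\<close>, \<open>\<phi>\<close> takes the value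
  \<open>\<phi> (\<xi> (f q))\<close> at \<open>\<xi>\<close>. Under the pairing, the induced map is
  therefore the transpose of composing functionals with \<open>f\<close>.\<close>

lemma free_map_ev:
  assumes c: "c \<in> carrier Q.F"
  shows "free_map c \<in> carrier Q'.F \<and> (\<forall>\<xi>\<in>Q'.Qd. Q'.ev (free_map c) \<xi> = Q.ev c (\<lambda>q\<in>carrier Q. \<xi> (f q)))"
  using c
  proof (induction c rule: free_Abelian_group_induction)
    case zero
    have "Q.ev 0 \<xi> = \<zero>\<^bsub>E\<^esub>" if "\<xi> \<in> Q.Qd" for \<xi> using that by (simp add: Q.ev_0)
    moreover have "Q'.ev 0 \<xi> = \<zero>\<^bsub>E\<^esub>" if "\<xi> \<in> Q'.Qd" for \<xi> using that by (simp add: Q'.ev_0)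
    ultimately show ?case using comp_Qd Q'.F_closed(1)
      unfolding free_map_def frag_extend_0 by (metis (no_types, lifting))
  next
    case (diff x y)
    then have F: "x \<in> carrier Q.F" "y \<in> carrier Q.F" "free_map x \<in> carrier Q'.F" "free_map y \<in> carrier Q'.F" by auto
    have eq: "free_map (x - y) = free_map x - free_map y" by (simp add: free_map_def frag_extend_diff)
    have "Q'.ev (free_map x - free_map y) \<xi> = Q.ev (x - y) (\<lambda>q\<in>carrier Q. \<xi> (f q))" (is "?l = ?r") if \<xi>: "\<xi> \<in> Q'.Qd" for \<xi>
    proof -
      note a\<xi> = comp_Qd[OF \<xi>]
      have "?l \<oplus>\<^bsub>E\<^esub> Q'.ev (free_map y) \<xi> = Q'.ev (free_map x) \<xi>"
        using fun_cong[OF Q'.ev_diff_eq[OF F(3,4)], of \<xi>] \<xi> by simp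
      also have "\<dots> = Q.ev x (\<lambda>q\<in>carrier Q. \<xi> (f q))" using diff \<xi> by blast
      also have "\<dots> = ?r \<oplus>\<^bsub>E\<^esub> Q.ev y (\<lambda>q\<in>carrier Q. \<xi> (f q))"
        using fun_cong[OF Q.ev_diff_eq[OF F(1,2)], of "\<lambda>q\<in>carrier Q. \<xi> (f q)"] a\<xi> by simp
      also have "Q.ev y (\<lambda>q\<in>carrier Q. \<xi> (f q)) = Q'.ev (free_map y) \<xi>"
        by (rule diff(4)[THEN conjunct2, rule_format, OF \<xi>, symmetric])
      finally show ?thesis
        using Q'.ev_E[OF Q'.F_closed(3)[OF F(3,4)] \<xi>] Q.ev_E[OF Q.F_closed(3)[OF F(1,2)] a\<xi>] Q'.ev_E[OF F(4) \<xi>]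
        by (metis Q.E.M.add.right_cancel)
    qed
    then show ?case unfolding eq using Q'.F_closed(3)[OF F(3,4)] by blast
  next
    case (one p)
    obtain q \<phi> where p: "p = (q, \<phi>)" "q \<in> carrier Q" "\<phi> \<in> Q.DL" using one by auto
    have r: "free_map (frag_of p) = frag_of (f q, \<phi>)" by (simp add: free_map_def p(1))
    have fq: "f q \<in> carrier Q'" using lin_closed[OF f p(2)] .
    have "Q'.ev (free_map (frag_of p)) \<xi> = Q.ev (frag_of p) (\<lambda>q\<in>carrier Q. \<xi> (f q))" if \<xi>: "\<xi> \<in> Q'.Qd" for \<xi>
      unfolding r unfolding p(1) Q.ev_generator_apply[OF p(2,3) comp_Qd[OF \<xi>]]
        Q'.ev_generator_apply[OF fq p(3) \<xi>]
      using p(2) by simp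
    moreover have "free_map (frag_of p) \<in> carrier Q'.F"
      unfolding r by (rule Q'.frag_in_F[OF fq p(3)])
    ultimately show ?case by blast
qed

abbreviation "Tf \<equiv> tensor_map \<Lambda> Q Q' (dual_algebra k E \<Lambda>) (dual_algebra_left \<Lambda>) f"

lemma tensor_map_coset:
  assumes c: "c \<in> carrier Q.F"
  shows "Tf (Q.coset c) = Q'.coset (free_map c)"
proof -
  have "Q'.coset (free_map d) = Q'.coset (free_map c)" if d: "d \<in> Q.coset c" for d
  proof -
    have dF: "d \<in> carrier Q.F" and e: "Q.ev d = Q.ev c" using Q.coset_F[OF c d] Q.ev_coset[OF c d] .
    have "Q'.ev (free_map d) = Q'.ev (free_map c)"
      by (rule Q'.ev_eqI) (use free_map_ev[OF dF] free_map_ev[OF c] e in auto)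
    then show ?thesis using free_map_ev[OF dF] free_map_ev[OF c] Q'.coset_eq_iff_ev by blast
  qed
  then have "(\<Union>d\<in>Q.coset c. Q'.coset (free_map d)) = Q'.coset (free_map c)"
    using Q.coset_self[of c] by (intro SUP_eq_const) blast+
  moreover have "Q.coset c \<in> a_rcosets\<^bsub>tensor_free Q (dual_algebra k E \<Lambda>)\<^esub> Q.Rel"
    using Q.carrier_T c by (auto simp: tensor_def quotient_module_def)
  then have "Tf (Q.coset c) = (\<Union>d\<in>Q.coset c. Q'.coset (free_map d))"
    by (simp add: tensor_map_def quotient_map_def free_map_def)
  ultimately show ?thesis by simp
qed

lemma tensor_map_closed: "t \<in> carrier Q.T \<Longrightarrow> Tf t \<in> carrier Q'.T"
  unfolding Q.carrier_T Q'.carrier_T using tensor_map_coset free_map_ev by blast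

lemma tensor_map_pairing:
  assumes "t \<in> carrier Q.T" "\<xi> \<in> Q'.Qd"
  shows "tensor_pairing k E \<Lambda> Q' (Tf t) \<xi> = tensor_pairing k E \<Lambda> Q t (\<lambda>q\<in>carrier Q. \<xi> (f q))"
proof -
  obtain c where c: "t = Q.coset c" "c \<in> carrier Q.F" using assms(1) unfolding Q.carrier_T by blast
  then show ?thesis
    using free_map_ev[OF c(2)] assms(2) tensor_map_coset[OF c(2)] Q.tensor_pairing_coset[OF c(2)]
      Q'.tensor_pairing_coset[of "free_map c"] by simp
qed

text \<open>Linearity is verified after pairing, where it becomes a statement about composing
  functionals with \<open>f\<close>.\<close>

lemma tensor_map_homs: "Tf \<in> module_homs \<Lambda> Q.T Q'.T"
proof (rule module_homsI)
  note rep = Q.tensor_represents and rep' = Q'.tensor_represents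
  interpret T: right_module \<Lambda> Q.T by (rule Q.right_module_T)
  interpret T': right_module \<Lambda> Q'.T by (rule Q'.right_module_T)
  have "Tf \<in> extensional (carrier Q.T)"
    by (auto simp: tensor_map_def quotient_map_def tensor_def quotient_module_def)
  then show "Tf \<in> carrier Q.T \<rightarrow>\<^sub>E carrier Q'.T" using tensor_map_closed by (auto simp: PiE_def)
  show "Tf (x \<oplus>\<^bsub>Q.T\<^esub> y) = Tf x \<oplus>\<^bsub>Q'.T\<^esub> Tf y" if "x \<in> carrier Q.T" "y \<in> carrier Q.T" for x y
    by (rule represents_eqI[OF rep'])
      (use that in \<open>simp_all add: tensor_map_closed tensor_map_pairing representsD(3)[OF rep] representsD(3)[OF rep'] comp_Qd\<close>)
  show "Tf (a \<odot>\<^bsub>Q.T\<^esub> x) = a \<odot>\<^bsub>Q'.T\<^esub> Tf x" if a: "a \<in> carrier \<Lambda>" and x: "x \<in> carrier Q.T" for a x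
  proof (rule represents_eqI[OF rep'])
    fix \<xi> assume \<xi>: "\<xi> \<in> Q'.Qd"
    have "(\<lambda>q\<in>carrier Q. (\<lambda>q\<in>carrier Q'. a \<otimes>\<^bsub>\<Lambda>\<^esub> \<xi> q) (f q)) = (\<lambda>q\<in>carrier Q. a \<otimes>\<^bsub>\<Lambda>\<^esub> (\<lambda>q\<in>carrier Q. \<xi> (f q)) q)"
      using lin_closed[OF f] by (auto intro!: restrict_ext)
    then show "tensor_pairing k E \<Lambda> Q' (Tf (a \<odot>\<^bsub>Q.T\<^esub> x)) \<xi> = tensor_pairing k E \<Lambda> Q' (a \<odot>\<^bsub>Q'.T\<^esub> Tf x) \<xi>"
      using a x \<xi> Q'.left_mult_Qd[OF \<xi> a]
      by (simp add: T.smult_closed tensor_map_closed tensor_map_pairing representsD(4)[OF rep] representsD(4)[OF rep'] comp_Qd)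
  qed (use a x in \<open>simp_all add: T.smult_closed T'.smult_closed tensor_map_closed\<close>)
qed

end

lemma fin_homs_postcomp:
  assumes kA: "k_algebra k \<Lambda>"
    and A: "\<And>i. right_module \<Lambda> (A i)" and B: "\<And>i. right_module \<Lambda> (B i)" and C: "\<And>i. right_module \<Lambda> (C i)"
    and g: "\<And>i. lin \<Lambda> (B i) (C i) (g i)"
  shows "lin k (fin_homs \<Lambda> A B) (fin_homs \<Lambda> A C) (\<lambda>f i. \<lambda>x\<in>carrier (A i). g i (f i x))"
proof -
  interpret k_algebra k \<Lambda> by fact
  show ?thesis
  proof (rule linI)
    fix f assume f: "f \<in> carrier (fin_homs \<Lambda> A B)"
    have "supp A C (\<lambda>i. \<lambda>x\<in>carrier (A i). g i (f i x)) \<subseteq> supp A B f"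
      by (rule subsetI, rule ccontr) (use lin_zero[OF B C g] in \<open>auto simp: supp_def\<close>)
    then have "finite (supp A C (\<lambda>i. \<lambda>x\<in>carrier (A i). g i (f i x)))"
      by (rule finite_subset) (use f in simp)
    moreover have "(\<lambda>x\<in>carrier (A i). g i (f i x)) \<in> module_homs \<Lambda> (A i) (C i)" for i
      using comp_module_homs[OF A module_homs_lin g] f by simp
    ultimately show "(\<lambda>i. \<lambda>x\<in>carrier (A i). g i (f i x)) \<in> carrier (fin_homs \<Lambda> A C)" by simp
  next
    fix f h assume f: "f \<in> carrier (fin_homs \<Lambda> A B)" and h: "h \<in> carrier (fin_homs \<Lambda> A B)"
    show "(\<lambda>i. \<lambda>x\<in>carrier (A i). g i ((f \<oplus>\<^bsub>fin_homs \<Lambda> A B\<^esub> h) i x)) =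
        (\<lambda>i. \<lambda>x\<in>carrier (A i). g i (f i x)) \<oplus>\<^bsub>fin_homs \<Lambda> A C\<^esub> (\<lambda>i. \<lambda>x\<in>carrier (A i). g i (h i x))"
      using fin_homs_closed[OF f] fin_homs_closed[OF h] by (auto simp: fun_eq_iff lin_add[OF g])
  next
    fix a f assume a: "a \<in> carrier k" and f: "f \<in> carrier (fin_homs \<Lambda> A B)"
    show "(\<lambda>i. \<lambda>x\<in>carrier (A i). g i ((a \<odot>\<^bsub>fin_homs \<Lambda> A B\<^esub> f) i x)) =
        a \<odot>\<^bsub>fin_homs \<Lambda> A C\<^esub> (\<lambda>i. \<lambda>x\<in>carrier (A i). g i (f i x))"
      using fin_homs_closed[OF f] scalar_closed[OF a] by (auto simp: fun_eq_iff lin_smult[OF g] scalar_def)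
  qed
qed

text \<open>Linear maps \<open>B\<close> to \<open>T\<close> correspond to functionals on
  Hom(\<open>Q\<close>, \<open>B\<close>), seen as families over a single point. As
  Hom(\<open>Q\<close>, -) preserves injections and \<open>E\<close> is injective, the functional
  belonging to \<open>f\<close> extends, and the extension is represented by the required
  map.\<close>

lemma represents_injective:
  fixes \<Lambda> :: "('k, 'r) module" and T :: "('r, 't) module"
  assumes kA: "k_algebra k \<Lambda>" and E: "injective_module k E"
    and Q: "right_module \<Lambda> Q" and db: "dual_basis \<Lambda> Q S \<Xi>" and rep: "represents k E \<Lambda> Q T \<tau>"
  shows "injective_module \<Lambda> T"
proof -
  interpret k_algebra k \<Lambda> by fact
  have E': "right_module k E" using E by (simp add: injective_module_def)
  have db': "\<exists>S \<Xi>. dual_basis \<Lambda> Q S \<Xi>" using db by blast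
  have lift: "\<exists>g\<in>module_homs \<Lambda> B T. \<forall>x\<in>carrier A. g (i x) = f x"
    if A: "right_module \<Lambda> A" and B: "right_module \<Lambda> B"
      and i: "i \<in> module_homs \<Lambda> A B" and f: "f \<in> module_homs \<Lambda> A T" and inj: "inj_on i (carrier A)"
    for A B :: "('r, 't \<Rightarrow> 'r) module" and i f
  proof -
    interpret FA: dual_families k \<Lambda> E "\<lambda>_::unit. Q" "\<lambda>_. A" "\<lambda>_. T" "\<lambda>_. \<tau>"
      by (intro dual_families.intro dual_families_axioms.intro kA E' Q A db' rep)
    interpret FB: dual_families k \<Lambda> E "\<lambda>_::unit. Q" "\<lambda>_. B" "\<lambda>_. T" "\<lambda>_. \<tau>"
      by (intro dual_families.intro dual_families_axioms.intro kA E' Q B db' rep)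
    let ?A = "fin_homs \<Lambda> (\<lambda>_::unit. Q) (\<lambda>_. A)" and ?B = "fin_homs \<Lambda> (\<lambda>_::unit. Q) (\<lambda>_. B)"
    let ?sA = "\<lambda>\<xi> x. single (\<lambda>_::unit. Q) (\<lambda>_. A) () (rank_one Q A \<xi> x)"
    let ?sB = "\<lambda>\<xi> x. single (\<lambda>_::unit. Q) (\<lambda>_. B) () (rank_one Q B \<xi> x)"
    let ?p = "\<lambda>g u. \<lambda>q\<in>carrier Q. i (g u q)"
    obtain \<theta> where \<theta>: "\<theta> \<in> module_homs k ?A E"
      "\<And>\<xi> x. \<xi> \<in> module_homs \<Lambda> Q (regular_module \<Lambda>) \<Longrightarrow> x \<in> carrier A \<Longrightarrow> \<theta> (?sA \<xi> x) = \<tau> (f x) \<xi>"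
      using FA.fin_functional_ex[of "\<lambda>_. f"] module_homs_lin[OF f] by auto
    have p: "lin k ?A ?B ?p" by (rule fin_homs_postcomp[OF kA Q A B module_homs_lin[OF i]])
    have "\<theta> g = \<zero>\<^bsub>E\<^esub>" if g: "g \<in> carrier ?A" and pg: "?p g = \<zero>\<^bsub>?B\<^esub>" for g
    proof -
      have "g = \<zero>\<^bsub>?A\<^esub>"
      proof (rule ext)
        fix u
        have gu: "g u \<in> module_homs \<Lambda> Q A" using g by simp
        show "g u = \<zero>\<^bsub>?A\<^esub> u"
          unfolding fin_homs_simps(2)
        proof (rule module_homs_eqI[OF gu zero_module_homs[OF Q A]])
          fix q assume q: "q \<in> carrier Q"
          have "i (g u q) = \<zero>\<^bsub>B\<^esub>" using fun_cong[OF fun_cong[OF pg, of u], of q] q by simp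
          then have "i (g u q) = i \<zero>\<^bsub>A\<^esub>" using module_homs_zero[OF A B i] by simp
          then show "g u q = (\<lambda>x\<in>carrier Q. \<zero>\<^bsub>A\<^esub>) q"
            using inj module_homsD(1)[OF gu q] FA.B.M.zero_closed q by (simp add: inj_on_eq_iff)
        qed
      qed
      then show ?thesis
        using module_homs_zero[OF FA.F.right_module_axioms E' \<theta>(1)] by simp
    qed
    then obtain \<eta> where \<eta>: "\<eta> \<in> module_homs k ?B E" "\<And>g. g \<in> carrier ?A \<Longrightarrow> \<eta> (?p g) = \<theta> g"
      using injective_module_factor[OF E FA.F.right_module_axioms FB.F.right_module_axioms p module_homs_lin[OF \<theta>(1)]]
      by auto
    obtain G where G: "lin \<Lambda> B T (G ())"
      "\<And>\<xi> y. \<xi> \<in> module_homs \<Lambda> Q (regular_module \<Lambda>) \<Longrightarrow> y \<in> carrier B \<Longrightarrow> \<eta> (?sB \<xi> y) = \<tau> (G () y) \<xi>"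
      using FB.fin_functional_repr[OF module_homs_lin[OF \<eta>(1)]] by auto
    have "G () (i x) = f x" if x: "x \<in> carrier A" for x
    proof (rule represents_eqI[OF rep])
      have ix: "i x \<in> carrier B" using module_homsD(1)[OF i x] .
      show "G () (i x) \<in> carrier T" using lin_closed[OF G(1) ix] .
      show "f x \<in> carrier T" using module_homsD(1)[OF f x] .
      fix \<xi> assume \<xi>: "\<xi> \<in> module_homs \<Lambda> Q (regular_module \<Lambda>)"
      have "?p (?sA \<xi> x) = ?sB \<xi> (i x)"
        using x module_homsD(1)[OF \<xi>] by (auto simp: single_def rank_one_def fun_eq_iff module_homsD(3)[OF i])
      then have "\<eta> (?sB \<xi> (i x)) = \<theta> (?sA \<xi> x)"
        using \<eta>(2)[OF FA.rank_one_closed[OF \<xi> x]] by simp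
      then show "\<tau> (G () (i x)) \<xi> = \<tau> (f x) \<xi>" using G(2)[OF \<xi> ix] \<theta>(2)[OF \<xi> x] by simp
    qed
    then show ?thesis
      using restrict_module_homs[OF B G(1)] module_homsD(1)[OF i]
      by (intro bexI[of _ "\<lambda>y\<in>carrier B. G () y"]) auto
  qed
  show ?thesis
    unfolding injective_module_def
    by (intro conjI allI impI ballI representsD(1)[OF rep]) (rule lift; assumption)
qed

section \<open>Complexes\<close>

lemma complexD:
  assumes "is_complex R X"
  shows "right_module R (cobj X n)"
    and "cdiff X n \<in> module_homs R (cobj X n) (cobj X (n + 1))"
    and "lin R (cobj X n) (cobj X (n + 1)) (cdiff X n)"
    and "x \<in> carrier (cobj X n) \<Longrightarrow> cdiff X (n + 1) (cdiff X n x) = \<zero>\<^bsub>cobj X (n + 1 + 1)\<^esub>"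
  using assms by (auto simp: is_complex_def module_homs_iff_lin)

text \<open>The same facts one degree lower, with \<open>n - 1 + 1\<close> already reduced to
  \<open>n\<close>.\<close>

lemma complexD':
  assumes "is_complex R X"
  shows "lin R (cobj X (n - 1)) (cobj X n) (cdiff X (n - 1))"
    and "x \<in> carrier (cobj X (n - 1)) \<Longrightarrow> cdiff X n (cdiff X (n - 1) x) = \<zero>\<^bsub>cobj X (n + 1)\<^esub>"
  using complexD(3)[OF assms, of "n - 1"] complexD(4)[OF assms, of _ "n - 1"] by simp_all

lemma cdiff_closed:
  assumes "is_complex R X"
  shows "x \<in> carrier (cobj X n) \<Longrightarrow> cdiff X n x \<in> carrier (cobj X (n + 1))"
    and "x \<in> carrier (cobj X (n - 1)) \<Longrightarrow> cdiff X (n - 1) x \<in> carrier (cobj X n)"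
  using lin_closed[OF complexD(3)[OF assms]] lin_closed[OF complexD'(1)[OF assms]] by auto

lemma is_complexI:
  assumes "\<And>n. right_module R (cobj X n)"
    and "\<And>n. cdiff X n \<in> module_homs R (cobj X n) (cobj X (n + 1))"
    and "\<And>n x. x \<in> carrier (cobj X n) \<Longrightarrow> cdiff X (n + 1) (cdiff X n x) = \<zero>\<^bsub>cobj X (n + 1 + 1)\<^esub>"
  shows "is_complex R X"
  using assms by (simp add: is_complex_def)

text \<open>Chain maps whose components may be arbitrary outside the carriers. They compose as plain
  functions; \<open>crestrict\<close> returns to \<open>chain_maps\<close>.\<close>

definition cmap :: "('r, 'z) ring_scheme \<Rightarrow> ('r, 'm) cochain_complex \<Rightarrow> ('r, 'n) cochain_complex \<Rightarrow> (int \<Rightarrow> 'm \<Rightarrow> 'n) \<Rightarrow> bool"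
  where "cmap R X Y f \<longleftrightarrow> (\<forall>n. lin R (cobj X n) (cobj Y n) (f n) \<and>
    (\<forall>x\<in>carrier (cobj X n). f (n + 1) (cdiff X n x) = cdiff Y n (f n x)))"

lemma cmapD:
  assumes "cmap R X Y f"
  shows "lin R (cobj X n) (cobj Y n) (f n)"
    and "x \<in> carrier (cobj X n) \<Longrightarrow> f (n + 1) (cdiff X n x) = cdiff Y n (f n x)"
    and "x \<in> carrier (cobj X (n - 1)) \<Longrightarrow> f n (cdiff X (n - 1) x) = cdiff Y (n - 1) (f (n - 1) x)"
    and "x \<in> carrier (cobj X n) \<Longrightarrow> f n x \<in> carrier (cobj Y n)"
proof -
  have *: "f (n + 1) (cdiff X n x) = cdiff Y n (f n x)" if "x \<in> carrier (cobj X n)" for n x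
    using assms that by (simp add: cmap_def)
  show l: "lin R (cobj X n) (cobj Y n) (f n)" using assms by (simp add: cmap_def)
  show "x \<in> carrier (cobj X n) \<Longrightarrow> f (n + 1) (cdiff X n x) = cdiff Y n (f n x)" by (rule *)
  show "x \<in> carrier (cobj X (n - 1)) \<Longrightarrow> f n (cdiff X (n - 1) x) = cdiff Y (n - 1) (f (n - 1) x)"
    using *[of x "n - 1"] by simp
  show "x \<in> carrier (cobj X n) \<Longrightarrow> f n x \<in> carrier (cobj Y n)" using lin_closed[OF l] .
qed

lemma cmapI:
  assumes "\<And>n. lin R (cobj X n) (cobj Y n) (f n)"
    and "\<And>n x. x \<in> carrier (cobj X n) \<Longrightarrow> f (n + 1) (cdiff X n x) = cdiff Y n (f n x)"
  shows "cmap R X Y f"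
  using assms by (simp add: cmap_def)

lemma chain_maps_cmap: "f \<in> chain_maps R X Y \<Longrightarrow> cmap R X Y f"
  by (simp add: chain_maps_def cmap_def module_homs_lin)

definition crestrict :: "('r, 'm) cochain_complex \<Rightarrow> (int \<Rightarrow> 'm \<Rightarrow> 'n) \<Rightarrow> int \<Rightarrow> 'm \<Rightarrow> 'n"
  where "crestrict X f = (\<lambda>n. \<lambda>x\<in>carrier (cobj X n). f n x)"

lemma crestrict_chain_maps: "is_complex R X \<Longrightarrow> cmap R X Y f \<Longrightarrow> crestrict X f \<in> chain_maps R X Y"
  unfolding chain_maps_def crestrict_def
  by (auto simp: cdiff_closed cmapD intro!: restrict_module_homs complexD(1) cmapD(1))

lemma crestrict_apply [simp]: "x \<in> carrier (cobj X n) \<Longrightarrow> crestrict X f n x = f n x"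
  by (simp add: crestrict_def)

lemma cmap_comp: "cmap R X Y f \<Longrightarrow> cmap R Y Z g \<Longrightarrow> cmap R X Z (\<lambda>n x. g n (f n x))"
  by (auto simp: cmap_def lin_def)

lemma chain_comp_crestrict: "chain_comp X g f = crestrict X (\<lambda>n x. g n (f n x))"
  by (simp add: chain_comp_def crestrict_def fun_eq_iff)

lemma chain_id_crestrict: "chain_id X = crestrict X (\<lambda>n x. x)"
  by (simp add: chain_id_def crestrict_def fun_eq_iff)

lemma cmap_id: "cmap R X X (\<lambda>n x. x)"
  by (simp add: cmap_def lin_id)

section \<open>Homotopies\<close>

definition hfam :: "('r, 'z) ring_scheme \<Rightarrow> ('r, 'm) cochain_complex \<Rightarrow> ('r, 'n) cochain_complex \<Rightarrow> (int \<Rightarrow> 'm \<Rightarrow> 'n) \<Rightarrow> bool"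
  where "hfam R X Y h \<longleftrightarrow> (\<forall>n. lin R (cobj X n) (cobj Y (n - 1)) (h n))"

text \<open>The differential of the Hom complex on a family of degree -1.\<close>

definition hbd :: "('r, 'm) cochain_complex \<Rightarrow> ('r, 'n) cochain_complex \<Rightarrow> (int \<Rightarrow> 'm \<Rightarrow> 'n) \<Rightarrow> int \<Rightarrow> 'm \<Rightarrow> 'n"
  where "hbd X Y h n x = cdiff Y (n - 1) (h n x) \<oplus>\<^bsub>cobj Y n\<^esub> h (n + 1) (cdiff X n x)"

lemma hfamD:
  assumes "hfam R X Y h"
  shows "lin R (cobj X n) (cobj Y (n - 1)) (h n)"
    and "lin R (cobj X (n + 1)) (cobj Y n) (h (n + 1))"
    and "x \<in> carrier (cobj X n) \<Longrightarrow> h n x \<in> carrier (cobj Y (n - 1))"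
    and "x \<in> carrier (cobj X (n + 1)) \<Longrightarrow> h (n + 1) x \<in> carrier (cobj Y n)"
proof -
  have *: "lin R (cobj X n) (cobj Y (n - 1)) (h n)" for n using assms by (simp add: hfam_def)
  then show "lin R (cobj X n) (cobj Y (n - 1)) (h n)" .
  show **: "lin R (cobj X (n + 1)) (cobj Y n) (h (n + 1))" using *[of "n + 1"] by simp
  show "x \<in> carrier (cobj X n) \<Longrightarrow> h n x \<in> carrier (cobj Y (n - 1))" using lin_closed[OF *] .
  show "x \<in> carrier (cobj X (n + 1)) \<Longrightarrow> h (n + 1) x \<in> carrier (cobj Y n)" using lin_closed[OF **] .
qed

lemma hbd_lin:
  assumes X: "is_complex R X" and Y: "is_complex R Y" and h: "hfam R X Y h"
  shows "lin R (cobj X n) (cobj Y n) (hbd X Y h n)"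
  unfolding hbd_def
  by (rule lin_plus[OF complexD(1)[OF Y] lin_comp[OF hfamD(1)[OF h] complexD'(1)[OF Y]]
        lin_comp[OF complexD(3)[OF X] hfamD(2)[OF h]]])

lemma hbd_cmap:
  assumes X: "is_complex R X" and Y: "is_complex R Y" and h: "hfam R X Y h"
  shows "cmap R X Y (hbd X Y h)"
proof (rule cmapI)
  show "lin R (cobj X n) (cobj Y n) (hbd X Y h n)" for n by (rule hbd_lin[OF X Y h])
  fix n x assume x: "x \<in> carrier (cobj X n)"
  interpret Y: right_module R "cobj Y i" for i by (rule complexD(1)[OF Y])
  have dx: "cdiff X n x \<in> carrier (cobj X (n + 1))" by (rule cdiff_closed(1)[OF X x])
  have hdx: "h (n + 1) (cdiff X n x) \<in> carrier (cobj Y n)" by (rule hfamD(4)[OF h dx])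
  have hx: "h n x \<in> carrier (cobj Y (n - 1))" by (rule hfamD(3)[OF h x])
  have "h (n + 1 + 1) (cdiff X (n + 1) (cdiff X n x)) = \<zero>\<^bsub>cobj Y (n + 1)\<^esub>"
    using complexD(4)[OF X x] lin_zero[OF complexD(1)[OF X] complexD(1)[OF Y] hfamD(2)[OF h, of "n + 1"]] by simp
  then have "hbd X Y h (n + 1) (cdiff X n x) = cdiff Y n (h (n + 1) (cdiff X n x))"
    using cdiff_closed(1)[OF Y hdx] by (simp add: hbd_def)
  also have "\<dots> = cdiff Y n (hbd X Y h n x)"
    using lin_add[OF complexD(3)[OF Y] cdiff_closed(2)[OF Y hx] hdx] complexD'(2)[OF Y hx]
      cdiff_closed(1)[OF Y hdx] by (simp add: hbd_def)
  finally show "hbd X Y h (n + 1) (cdiff X n x) = cdiff Y n (hbd X Y h n x)" .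
qed

text \<open>The equation is written with a sum on the right, so that no difference has to be formed
  in the target. The maps themselves may be arbitrary outside the carriers.\<close>

definition homotopic :: "('r, 'z) ring_scheme \<Rightarrow> ('r, 'm) cochain_complex \<Rightarrow> ('r, 'n) cochain_complex \<Rightarrow>
    (int \<Rightarrow> 'm \<Rightarrow> 'n) \<Rightarrow> (int \<Rightarrow> 'm \<Rightarrow> 'n) \<Rightarrow> bool"
  where "homotopic R X Y f g \<longleftrightarrow> (\<exists>h. hfam R X Y h \<and>
    (\<forall>n. \<forall>x\<in>carrier (cobj X n). f n x = g n x \<oplus>\<^bsub>cobj Y n\<^esub> hbd X Y h n x))"

lemma homotopicI:
  "hfam R X Y h \<Longrightarrow> (\<And>n x. x \<in> carrier (cobj X n) \<Longrightarrow> f n x = g n x \<oplus>\<^bsub>cobj Y n\<^esub> hbd X Y h n x) \<Longrightarrow>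
    homotopic R X Y f g"
  by (auto simp: homotopic_def)

lemma hbd_zero:
  assumes "is_complex R X" "is_complex R Y" "x \<in> carrier (cobj X n)"
  shows "hbd X Y (\<lambda>n x. \<zero>\<^bsub>cobj Y (n - 1)\<^esub>) n x = \<zero>\<^bsub>cobj Y n\<^esub>"
proof -
  interpret Y: right_module R "cobj Y i" for i by (rule complexD(1)[OF assms(2)])
  show ?thesis
    using lin_zero[OF complexD(1)[OF assms(2)] complexD(1)[OF assms(2)] complexD'(1)[OF assms(2), of n]]
    by (simp add: hbd_def)
qed

lemma hbd_add:
  assumes X: "is_complex R X" and Y: "is_complex R Y" and h: "hfam R X Y h" and h': "hfam R X Y h'" and x: "x \<in> carrier (cobj X n)"
  shows "hbd X Y (\<lambda>n x. h n x \<oplus>\<^bsub>cobj Y (n - 1)\<^esub> h' n x) n x = hbd X Y h n x \<oplus>\<^bsub>cobj Y n\<^esub> hbd X Y h' n x"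
proof -
  interpret Y: right_module R "cobj Y i" for i by (rule complexD(1)[OF Y])
  have c: "h n x \<in> carrier (cobj Y (n - 1))" "h' n x \<in> carrier (cobj Y (n - 1))"
    "h (n + 1) (cdiff X n x) \<in> carrier (cobj Y n)" "h' (n + 1) (cdiff X n x) \<in> carrier (cobj Y n)"
    using hfamD(3,4)[OF h] hfamD(3,4)[OF h'] x cdiff_closed(1)[OF X x] by auto
  show ?thesis
    using c cdiff_closed(2)[OF Y c(1)] cdiff_closed(2)[OF Y c(2)] lin_add[OF complexD'(1)[OF Y] c(1,2)]
    by (simp add: hbd_def Y.M.a_ac)
qed

lemma hbd_uminus:
  assumes X: "is_complex R X" and Y: "is_complex R Y" and h: "hfam R X Y h" and x: "x \<in> carrier (cobj X n)"
  shows "hbd X Y (\<lambda>n x. \<ominus>\<^bsub>cobj Y (n - 1)\<^esub> h n x) n x = \<ominus>\<^bsub>cobj Y n\<^esub> hbd X Y h n x"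
proof -
  interpret Y: right_module R "cobj Y i" for i by (rule complexD(1)[OF Y])
  have c: "h n x \<in> carrier (cobj Y (n - 1))" "h (n + 1) (cdiff X n x) \<in> carrier (cobj Y n)"
    using hfamD(3,4)[OF h] x cdiff_closed(1)[OF X x] by auto
  show ?thesis
    using c cdiff_closed(2)[OF Y c(1)] lin_minus[OF complexD(1)[OF Y] complexD(1)[OF Y] complexD'(1)[OF Y] c(1)]
    by (simp add: hbd_def Y.M.minus_add)
qed

lemma hfam_add: "is_complex R Y \<Longrightarrow> hfam R X Y h \<Longrightarrow> hfam R X Y h' \<Longrightarrow> hfam R X Y (\<lambda>n x. h n x \<oplus>\<^bsub>cobj Y (n - 1)\<^esub> h' n x)"
  by (auto simp: hfam_def intro!: lin_plus complexD(1))

lemma hfam_uminus: "is_complex R Y \<Longrightarrow> hfam R X Y h \<Longrightarrow> hfam R X Y (\<lambda>n x. \<ominus>\<^bsub>cobj Y (n - 1)\<^esub> h n x)"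
  by (auto simp: hfam_def intro!: lin_uminus complexD(1))

lemma hfam_zero: "is_complex R Y \<Longrightarrow> hfam R X Y (\<lambda>n x. \<zero>\<^bsub>cobj Y (n - 1)\<^esub>)"
  by (auto simp: hfam_def intro!: lin_const_zero complexD(1))

lemma hfam_post: "hfam R X Y h \<Longrightarrow> cmap R Y Z g \<Longrightarrow> hfam R X Z (\<lambda>n x. g (n - 1) (h n x))"
  unfolding hfam_def by (intro allI, rule lin_comp[OF _ cmapD(1)]) auto

lemma hfam_pre: "hfam R Y Z h \<Longrightarrow> cmap R X Y f \<Longrightarrow> hfam R X Z (\<lambda>n x. h n (f n x))"
  unfolding hfam_def by (intro allI, rule lin_comp[OF cmapD(1)]) auto

lemma hbd_post:
  assumes X: "is_complex R X" and Y: "is_complex R Y" and h: "hfam R X Y h" and g: "cmap R Y Z g" and x: "x \<in> carrier (cobj X n)"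
  shows "g n (hbd X Y h n x) = hbd X Z (\<lambda>n x. g (n - 1) (h n x)) n x"
proof -
  have c: "h n x \<in> carrier (cobj Y (n - 1))" "h (n + 1) (cdiff X n x) \<in> carrier (cobj Y n)"
    using hfamD(3,4)[OF h] x cdiff_closed(1)[OF X x] by auto
  show ?thesis
    using c cdiff_closed(2)[OF Y c(1)] lin_add[OF cmapD(1)[OF g]] cmapD(3)[OF g] by (simp add: hbd_def)
qed

lemma hbd_pre:
  assumes h: "hfam R Y Z h" and f: "cmap R X Y f" and x: "x \<in> carrier (cobj X n)"
  shows "hbd Y Z h n (f n x) = hbd X Z (\<lambda>n x. h n (f n x)) n x"
  using cmapD(2)[OF f x] by (simp add: hbd_def)

lemma homotopic_refl:
  assumes X: "is_complex R X" and Y: "is_complex R Y" and f: "cmap R X Y f"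
  shows "homotopic R X Y f f"
proof (rule homotopicI[OF hfam_zero[OF Y]])
  fix n x assume x: "x \<in> carrier (cobj X n)"
  interpret Y: right_module R "cobj Y n" by (rule complexD(1)[OF Y])
  show "f n x = f n x \<oplus>\<^bsub>cobj Y n\<^esub> hbd X Y (\<lambda>n x. \<zero>\<^bsub>cobj Y (n - 1)\<^esub>) n x"
    using hbd_zero[OF X Y x] cmapD(4)[OF f x] by simp
qed

lemma homotopic_sym:
  assumes X: "is_complex R X" and Y: "is_complex R Y" and g: "cmap R X Y g" and "homotopic R X Y f g"
  shows "homotopic R X Y g f"
proof -
  obtain h where h: "hfam R X Y h" "\<And>n x. x \<in> carrier (cobj X n) \<Longrightarrow> f n x = g n x \<oplus>\<^bsub>cobj Y n\<^esub> hbd X Y h n x"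
    using assms(4) by (auto simp: homotopic_def)
  show ?thesis
  proof (rule homotopicI[OF hfam_uminus[OF Y h(1)]])
    fix n x assume x: "x \<in> carrier (cobj X n)"
    interpret Y: right_module R "cobj Y n" by (rule complexD(1)[OF Y])
    show "g n x = f n x \<oplus>\<^bsub>cobj Y n\<^esub> hbd X Y (\<lambda>n x. \<ominus>\<^bsub>cobj Y (n - 1)\<^esub> h n x) n x"
      using h(2)[OF x] cmapD(4)[OF g x] lin_closed[OF hbd_lin[OF X Y h(1)] x] hbd_uminus[OF X Y h(1) x]
      by (simp add: Y.M.a_assoc Y.M.r_neg)
  qed
qed

lemma homotopic_trans:
  assumes X: "is_complex R X" and Y: "is_complex R Y" and g: "cmap R X Y g'"
    and "homotopic R X Y f g" and "homotopic R X Y g g'"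
  shows "homotopic R X Y f g'"
proof -
  obtain h where h: "hfam R X Y h" "\<And>n x. x \<in> carrier (cobj X n) \<Longrightarrow> f n x = g n x \<oplus>\<^bsub>cobj Y n\<^esub> hbd X Y h n x"
    using assms(4) by (auto simp: homotopic_def)
  obtain h' where h': "hfam R X Y h'" "\<And>n x. x \<in> carrier (cobj X n) \<Longrightarrow> g n x = g' n x \<oplus>\<^bsub>cobj Y n\<^esub> hbd X Y h' n x"
    using assms(5) by (auto simp: homotopic_def)
  show ?thesis
  proof (rule homotopicI[OF hfam_add[OF Y h'(1) h(1)]])
    fix n x assume x: "x \<in> carrier (cobj X n)"
    interpret Y: right_module R "cobj Y n" by (rule complexD(1)[OF Y])
    show "f n x = g' n x \<oplus>\<^bsub>cobj Y n\<^esub> hbd X Y (\<lambda>n x. h' n x \<oplus>\<^bsub>cobj Y (n - 1)\<^esub> h n x) n x"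
      using h(2)[OF x] h'(2)[OF x] cmapD(4)[OF g x] lin_closed[OF hbd_lin[OF X Y h(1)] x] lin_closed[OF hbd_lin[OF X Y h'(1)] x]
        hbd_add[OF X Y h'(1) h(1) x]
      by (simp add: Y.M.a_assoc)
  qed
qed

lemma homotopic_comp:
  assumes X: "is_complex R X" and Y: "is_complex R Y" and Z: "is_complex R Z"
    and f': "cmap R X Y f'" and g: "cmap R Y Z g" and g': "cmap R Y Z g'"
    and "homotopic R X Y f f'" and "homotopic R Y Z g g'"
  shows "homotopic R X Z (\<lambda>n x. g n (f n x)) (\<lambda>n x. g' n (f' n x))"
proof -
  obtain h where h: "hfam R X Y h" "\<And>n x. x \<in> carrier (cobj X n) \<Longrightarrow> f n x = f' n x \<oplus>\<^bsub>cobj Y n\<^esub> hbd X Y h n x"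
    using assms(7) by (auto simp: homotopic_def)
  obtain h' where h': "hfam R Y Z h'" "\<And>n x. x \<in> carrier (cobj Y n) \<Longrightarrow> g n x = g' n x \<oplus>\<^bsub>cobj Z n\<^esub> hbd Y Z h' n x"
    using assms(8) by (auto simp: homotopic_def)
  have "homotopic R X Z (\<lambda>n x. g n (f n x)) (\<lambda>n x. g n (f' n x))"
  proof (rule homotopicI[OF hfam_post[OF h(1) g]])
    fix n x assume x: "x \<in> carrier (cobj X n)"
    show "g n (f n x) = g n (f' n x) \<oplus>\<^bsub>cobj Z n\<^esub> hbd X Z (\<lambda>n x. g (n - 1) (h n x)) n x"
      using h(2)[OF x] lin_add[OF cmapD(1)[OF g] cmapD(4)[OF f' x] lin_closed[OF hbd_lin[OF X Y h(1)] x]]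
        hbd_post[OF X Y h(1) g x] by simp
  qed
  moreover have "homotopic R X Z (\<lambda>n x. g n (f' n x)) (\<lambda>n x. g' n (f' n x))"
  proof (rule homotopicI[OF hfam_pre[OF h'(1) f']])
    fix n x assume x: "x \<in> carrier (cobj X n)"
    show "g n (f' n x) = g' n (f' n x) \<oplus>\<^bsub>cobj Z n\<^esub> hbd X Z (\<lambda>n x. h' n (f' n x)) n x"
      using h'(2)[OF cmapD(4)[OF f' x]] hbd_pre[OF h'(1) f' x] by simp
  qed
  ultimately show ?thesis by (rule homotopic_trans[OF X Z cmap_comp[OF f' g']])
qed

lemma homotopic_cong:
  assumes "is_complex R X" "homotopic R X Y f g"
    and "\<And>n x. x \<in> carrier (cobj X n) \<Longrightarrow> f' n x = f n x" "\<And>n x. x \<in> carrier (cobj X n) \<Longrightarrow> g' n x = g n x"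
  shows "homotopic R X Y f' g'"
  using assms by (auto simp: homotopic_def)

lemma (in right_module) uminus_zero [simp]: "\<ominus>\<^bsub>M\<^esub> \<zero>\<^bsub>M\<^esub> = \<zero>\<^bsub>M\<^esub>"
  by (rule M.minus_equality) auto

lemma (in right_module) uminus_eq_zero: "\<ominus>\<^bsub>M\<^esub> x = \<zero>\<^bsub>M\<^esub> \<Longrightarrow> x \<in> carrier M \<Longrightarrow> x = \<zero>\<^bsub>M\<^esub>"
  using M.minus_minus uminus_zero by metis

section \<open>Mapping cones and homotopies\<close>

definition exact_complex :: "('r, 'm) cochain_complex \<Rightarrow> bool"
  where "exact_complex C \<longleftrightarrow> (\<forall>n. \<forall>x\<in>carrier (cobj C n). cdiff C n x = \<zero>\<^bsub>cobj C (n + 1)\<^esub> \<longrightarrow>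
    (\<exists>y\<in>carrier (cobj C (n - 1)). cdiff C (n - 1) y = x))"

text \<open>Injectivity and, below, surjectivity on cohomology are phrased with cycles and
  boundaries, so that diagram chases need no quotient modules. The link to \<open>quasi_iso\<close>
  is \<open>quasi_isoD\<close>.\<close>

definition cohomology_inj :: "('r, 'm) cochain_complex \<Rightarrow> ('r, 'n) cochain_complex \<Rightarrow> (int \<Rightarrow> 'm \<Rightarrow> 'n) \<Rightarrow> bool"
  where "cohomology_inj X Y f \<longleftrightarrow> (\<forall>n. \<forall>x\<in>carrier (cobj X n). cdiff X n x = \<zero>\<^bsub>cobj X (n + 1)\<^esub> \<longrightarrow>
    (\<exists>y\<in>carrier (cobj Y (n - 1)). cdiff Y (n - 1) y = f n x) \<longrightarrow>
    (\<exists>w\<in>carrier (cobj X (n - 1)). cdiff X (n - 1) w = x))"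

definition cohomology_surj :: "('r, 'm) cochain_complex \<Rightarrow> ('r, 'n) cochain_complex \<Rightarrow> (int \<Rightarrow> 'm \<Rightarrow> 'n) \<Rightarrow> bool"
  where "cohomology_surj X Y f \<longleftrightarrow> (\<forall>n. \<forall>y\<in>carrier (cobj Y n). cdiff Y n y = \<zero>\<^bsub>cobj Y (n + 1)\<^esub> \<longrightarrow>
    (\<exists>x\<in>carrier (cobj X n). cdiff X n x = \<zero>\<^bsub>cobj X (n + 1)\<^esub> \<and>
      (\<exists>w\<in>carrier (cobj Y (n - 1)). y = f n x \<oplus>\<^bsub>cobj Y n\<^esub> cdiff Y (n - 1) w)))"

lemma exact_complexD:
  "exact_complex C \<Longrightarrow> x \<in> carrier (cobj C n) \<Longrightarrow> cdiff C n x = \<zero>\<^bsub>cobj C (n + 1)\<^esub> \<Longrightarrow>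
    \<exists>y\<in>carrier (cobj C (n - 1)). cdiff C (n - 1) y = x"
  by (simp add: exact_complex_def)

lemma inj_complexD:
  assumes "inj_complex R Y" shows "is_complex R Y" "injective_module R (cobj Y n)"
  using assms by (auto simp: inj_complex_def)

text \<open>The homotopy is built upwards from degree \<open>N\<close>. Exactness of
  \<open>C\<close> makes the remaining error vanish on the kernel of the differential, so it factors
  through the next term because \<open>Y\<close> consists of injectives. That the homotopy vanishes
  up to \<open>N\<close> is recorded for the sake of finite supports.\<close>

lemma null_homotopy_to_injective:
  assumes C: "is_complex R C" and exact: "exact_complex C" and Y: "inj_complex R Y"
    and \<phi>: "cmap R C Y \<phi>" and below: "\<And>n x. n < N \<Longrightarrow> x \<in> carrier (cobj C n) \<Longrightarrow> \<phi> n x = \<zero>\<^bsub>cobj Y n\<^esub>"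
  shows "\<exists>h. hfam R C Y h \<and> (\<forall>n\<le>N. \<forall>x\<in>carrier (cobj C n). h n x = \<zero>\<^bsub>cobj Y (n - 1)\<^esub>) \<and>
    (\<forall>n. \<forall>x\<in>carrier (cobj C n). \<phi> n x = hbd C Y h n x)"
proof -
  note Yc = inj_complexD(1)[OF Y]
  interpret C: right_module R "cobj C i" for i by (rule complexD(1)[OF C])
  interpret Y: right_module R "cobj Y i" for i by (rule complexD(1)[OF Yc])
  \<comment> \<open>The condition for continuing at degree \<open>n\<close>: on boundaries,
    \<open>\<phi>\<close> already equals the differential of \<open>H\<close>. Boundaries are all
    cycles by exactness, so the error dies on cycles.\<close>
  define Inv where "Inv n H \<longleftrightarrow> (\<forall>x\<in>carrier (cobj C (n - 1)).
    \<phi> n (cdiff C (n - 1) x) = cdiff Y (n - 1) (H (cdiff C (n - 1) x)))" for n H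
  have step: "\<exists>H'. lin R (cobj C (n + 1)) (cobj Y n) H' \<and> Inv (n + 1) H' \<and>
      (\<forall>x\<in>carrier (cobj C n). \<phi> n x = cdiff Y (n - 1) (H x) \<oplus>\<^bsub>cobj Y n\<^esub> H' (cdiff C n x))"
    if H: "lin R (cobj C n) (cobj Y (n - 1)) H" and inv: "Inv n H" for n H
  proof -
    define \<psi> where "\<psi> x = \<phi> n x \<ominus>\<^bsub>cobj Y n\<^esub> cdiff Y (n - 1) (H x)" for x
    have c: "cdiff Y (n - 1) (H x) \<in> carrier (cobj Y n)" if "x \<in> carrier (cobj C n)" for x
      using cdiff_closed(2)[OF Yc lin_closed[OF H that]] .
    have \<psi>: "lin R (cobj C n) (cobj Y n) \<psi>"
      unfolding \<psi>_def
      by (rule lin_minus_fun[OF Y.right_module_axioms cmapD(1)[OF \<phi>] lin_comp[OF H complexD'(1)[OF Yc]]])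
    have ker: "\<psi> x = \<zero>\<^bsub>cobj Y n\<^esub>" if x: "x \<in> carrier (cobj C n)" "cdiff C n x = \<zero>\<^bsub>cobj C (n + 1)\<^esub>" for x
    proof -
      obtain y where y: "y \<in> carrier (cobj C (n - 1))" "cdiff C (n - 1) y = x"
        using exact_complexD[OF exact x] by blast
      then have "\<phi> n x = cdiff Y (n - 1) (H x)" using inv unfolding Inv_def by blast
      then show ?thesis using Y.diff_eq_zero_iff[OF cmapD(4)[OF \<phi> x(1)] c[OF x(1)]] by (simp add: \<psi>_def)
    qed
    obtain H' where H': "H' \<in> module_homs R (cobj C (n + 1)) (cobj Y n)"
        "\<And>x. x \<in> carrier (cobj C n) \<Longrightarrow> H' (cdiff C n x) = \<psi> x"
      using injective_module_factor[OF inj_complexD(2)[OF Y] C.right_module_axioms C.right_module_axioms complexD(3)[OF C] \<psi> ker]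
      by blast
    have eq: "\<phi> n x = cdiff Y (n - 1) (H x) \<oplus>\<^bsub>cobj Y n\<^esub> H' (cdiff C n x)" if x: "x \<in> carrier (cobj C n)" for x
    proof -
      have "\<phi> n x \<ominus>\<^bsub>cobj Y n\<^esub> cdiff Y (n - 1) (H x) = H' (cdiff C n x)" using H'(2)[OF x] by (simp add: \<psi>_def)
      then have "\<phi> n x = H' (cdiff C n x) \<oplus>\<^bsub>cobj Y n\<^esub> cdiff Y (n - 1) (H x)"
        using Y.diff_eq_iff[OF cmapD(4)[OF \<phi> x] c[OF x] module_homsD(1)[OF H'(1) cdiff_closed(1)[OF C x]]] by simp
      then show ?thesis using Y.M.a_comm[OF c[OF x] module_homsD(1)[OF H'(1) cdiff_closed(1)[OF C x]]] by simp
    qed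
    moreover have "Inv (n + 1) H'"
      unfolding Inv_def
    proof
      fix x assume "x \<in> carrier (cobj C (n + 1 - 1))"
      then have x: "x \<in> carrier (cobj C n)" by simp
      have hc: "H' (cdiff C n x) \<in> carrier (cobj Y n)" by (rule module_homsD(1)[OF H'(1) cdiff_closed(1)[OF C x]])
      have "\<phi> (n + 1) (cdiff C n x) = cdiff Y n (\<phi> n x)" by (rule cmapD(2)[OF \<phi> x])
      also have "\<dots> = cdiff Y n (H' (cdiff C n x))"
        using eq[OF x] lin_add[OF complexD(3)[OF Yc] c[OF x] hc] complexD'(2)[OF Yc lin_closed[OF H x]]
          cdiff_closed(1)[OF Yc hc] by simp
      finally show "\<phi> (n + 1) (cdiff C (n + 1 - 1) x) = cdiff Y (n + 1 - 1) (H' (cdiff C (n + 1 - 1) x))"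
        by simp
    qed
    ultimately show ?thesis using module_homs_lin[OF H'(1)] by blast
  qed
  \<comment> \<open>Degrees from \<open>N\<close> on are counted by naturals for dependent choice.
    The last clause pins the start to zero, which later lets the homotopy vanish in degree
    \<open>N\<close> too.\<close>
  define PP where "PP j H \<longleftrightarrow> lin R (cobj C (N + int j)) (cobj Y (N + int j - 1)) H \<and> Inv (N + int j) H \<and>
    (j = 0 \<longrightarrow> H = (\<lambda>_. \<zero>\<^bsub>cobj Y (N - 1)\<^esub>))" for j H
  define QQ where "QQ j H H' \<longleftrightarrow> (\<forall>x\<in>carrier (cobj C (N + int j)).
    \<phi> (N + int j) x = cdiff Y (N + int j - 1) (H x) \<oplus>\<^bsub>cobj Y (N + int j)\<^esub> H' (cdiff C (N + int j) x))" for j H H'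
  have "\<exists>H. \<forall>j. PP j (H j) \<and> QQ j (H j) (H (Suc j))"
  proof (rule dependent_nat_choice)
    have "Inv N (\<lambda>_. \<zero>\<^bsub>cobj Y (N - 1)\<^esub>)"
      unfolding Inv_def
    proof
      fix x assume x: "x \<in> carrier (cobj C (N - 1))"
      have z: "cdiff Y (N - 1) \<zero>\<^bsub>cobj Y (N - 1)\<^esub> = \<zero>\<^bsub>cobj Y N\<^esub>"
        by (rule lin_zero[OF Y.right_module_axioms Y.right_module_axioms complexD'(1)[OF Yc]])
      have "\<phi> N (cdiff C (N - 1) x) = cdiff Y (N - 1) (\<phi> (N - 1) x)" by (rule cmapD(3)[OF \<phi> x])
      then show "\<phi> N (cdiff C (N - 1) x) = cdiff Y (N - 1) \<zero>\<^bsub>cobj Y (N - 1)\<^esub>"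
        using below[of "N - 1" x] x z by simp
    qed
    then show "\<exists>H. PP 0 H" using lin_const_zero[OF Y.right_module_axioms] by (auto simp: PP_def)
    fix H j assume "PP j H"
    then obtain H' where "lin R (cobj C (N + int j + 1)) (cobj Y (N + int j)) H'" "Inv (N + int j + 1) H'" "QQ j H H'"
      using step[of "N + int j" H] unfolding PP_def QQ_def by blast
    moreover have e: "N + int (Suc j) = N + int j + 1" by simp
    ultimately show "\<exists>H'. PP (Suc j) H' \<and> QQ j H H'"
      unfolding PP_def e by (intro exI[of _ H']) simp
  qed
  then obtain H where H: "\<And>j. PP j (H j)" "\<And>j. QQ j (H j) (H (Suc j))" by blast
  \<comment> \<open>At \<open>N\<close> the second branch applies, but it agrees with zero by the
    last clause of \<open>PP 0\<close>; so the vanishing includes degree \<open>N\<close>.\<close>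
  define h where "h n = (if n < N then (\<lambda>_. \<zero>\<^bsub>cobj Y (n - 1)\<^esub>) else H (nat (n - N)))" for n
  have hN: "h n = (\<lambda>_. \<zero>\<^bsub>cobj Y (n - 1)\<^esub>)" if "n \<le> N" for n
    using that H(1)[of 0] by (cases "n = N") (auto simp: h_def PP_def)
  show ?thesis
  proof (intro exI[of _ h] conjI allI ballI impI)
    show "hfam R C Y h"
      unfolding hfam_def
    proof
      fix n show "lin R (cobj C n) (cobj Y (n - 1)) (h n)"
      proof (cases "n < N")
        case False
        then have "N + int (nat (n - N)) = n" by simp
        then show ?thesis using H(1)[of "nat (n - N)"] False by (simp add: PP_def h_def)
      qed (simp add: hN lin_const_zero Y.right_module_axioms)
    qed
    show "h n x = \<zero>\<^bsub>cobj Y (n - 1)\<^esub>" if "n \<le> N" for n x using hN[OF that] by simp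
    fix n x assume x: "x \<in> carrier (cobj C n)"
    show "\<phi> n x = hbd C Y h n x"
    proof (cases "n < N")
      case True
      then have "hbd C Y h n x = hbd C Y (\<lambda>n x. \<zero>\<^bsub>cobj Y (n - 1)\<^esub>) n x" by (simp add: hbd_def hN)
      then show ?thesis using hbd_zero[OF C Yc x] below[OF True x] by simp
    next
      case False
      then have j: "N + int (nat (n - N)) = n" "nat (n + 1 - N) = Suc (nat (n - N))" by simp_all
      then show ?thesis using H(2)[of "nat (n - N)"] False x by (simp add: QQ_def h_def hbd_def)
    qed
  qed
qed

text \<open>The construction dual to \<open>null_homotopy_to_injective\<close>, going downwards from
  the top of \<open>P\<close>: the remaining error takes values in cycles of \<open>C\<close>, which
  are boundaries by exactness, and projectivity lifts it through the differential.\<close>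

lemma null_homotopy_from_projective:
  assumes P: "is_complex R P" and proj: "\<And>n. projective_module R (cobj P n)"
    and C: "is_complex R C" and exact: "exact_complex C"
    and \<phi>: "cmap R P C \<phi>" and above: "\<And>n. n > N \<Longrightarrow> zero_module (cobj P n)"
  shows "\<exists>h. hfam R P C h \<and> (\<forall>n. \<forall>x\<in>carrier (cobj P n). \<phi> n x = hbd P C h n x)"
proof -
  interpret P: right_module R "cobj P i" for i by (rule complexD(1)[OF P])
  interpret C: right_module R "cobj C i" for i by (rule complexD(1)[OF C])
  \<comment> \<open>In degree \<open>n - 1\<close>, the map \<open>\<phi>\<close> and the composite
    of \<open>H\<close> with the differential of \<open>P\<close> have equal differentials, so their
    difference is a cycle.\<close>
  define Inv where "Inv n H \<longleftrightarrow> (\<forall>x\<in>carrier (cobj P (n - 1)).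
    cdiff C (n - 1) (\<phi> (n - 1) x) = cdiff C (n - 1) (H (cdiff P (n - 1) x)))" for n H
  have step: "\<exists>H'. lin R (cobj P (n - 1)) (cobj C (n - 1 - 1)) H' \<and> Inv (n - 1) H' \<and>
      (\<forall>x\<in>carrier (cobj P (n - 1)). \<phi> (n - 1) x = cdiff C (n - 1 - 1) (H' x) \<oplus>\<^bsub>cobj C (n - 1)\<^esub> H (cdiff P (n - 1) x))"
    if H: "lin R (cobj P n) (cobj C (n - 1)) H" and inv: "Inv n H" for n H
  proof -
    define \<psi> where "\<psi> x = \<phi> (n - 1) x \<ominus>\<^bsub>cobj C (n - 1)\<^esub> H (cdiff P (n - 1) x)" for x
    have c: "H (cdiff P (n - 1) x) \<in> carrier (cobj C (n - 1))" if "x \<in> carrier (cobj P (n - 1))" for x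
      using lin_closed[OF H cdiff_closed(2)[OF P that]] .
    have \<psi>: "lin R (cobj P (n - 1)) (cobj C (n - 1)) \<psi>"
      unfolding \<psi>_def
      by (rule lin_minus_fun[OF C.right_module_axioms cmapD(1)[OF \<phi>] lin_comp[OF complexD'(1)[OF P] H]])
    have im: "\<psi> x \<in> cdiff C (n - 1 - 1) ` carrier (cobj C (n - 1 - 1))" if x: "x \<in> carrier (cobj P (n - 1))" for x
    proof -
      have px: "\<phi> (n - 1) x \<in> carrier (cobj C (n - 1))" by (rule cmapD(4)[OF \<phi> x])
      have "cdiff C (n - 1) (\<psi> x) = cdiff C (n - 1) (\<phi> (n - 1) x) \<ominus>\<^bsub>cobj C n\<^esub> cdiff C (n - 1) (H (cdiff P (n - 1) x))"
        unfolding \<psi>_def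
        by (rule lin_diff[OF C.right_module_axioms C.right_module_axioms complexD'(1)[OF C] px c[OF x]])
      also have "\<dots> = \<zero>\<^bsub>cobj C n\<^esub>"
        using inv x C.diff_eq_zero_iff[OF cdiff_closed(2)[OF C px] cdiff_closed(2)[OF C c[OF x]]]
        unfolding Inv_def by simp
      finally have "cdiff C (n - 1) (\<psi> x) = \<zero>\<^bsub>cobj C (n - 1 + 1)\<^esub>" by simp
      from exact_complexD[OF exact lin_closed[OF \<psi> x] this] show ?thesis unfolding image_iff by metis
    qed
    obtain H' where H': "H' \<in> module_homs R (cobj P (n - 1)) (cobj C (n - 1 - 1))"
        "\<And>x. x \<in> carrier (cobj P (n - 1)) \<Longrightarrow> cdiff C (n - 1 - 1) (H' x) = \<psi> x"
      using projective_module_factor[OF proj C.right_module_axioms C.right_module_axioms complexD'(1)[OF C] \<psi> im]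
      by blast
    have eq: "\<phi> (n - 1) x = cdiff C (n - 1 - 1) (H' x) \<oplus>\<^bsub>cobj C (n - 1)\<^esub> H (cdiff P (n - 1) x)" if x: "x \<in> carrier (cobj P (n - 1))" for x
      using H'(2)[OF x] C.diff_eq_iff[OF cmapD(4)[OF \<phi> x] c[OF x] lin_closed[OF \<psi> x]] by (simp add: \<psi>_def)
    moreover have "Inv (n - 1) H'"
      unfolding Inv_def
    proof
      fix x assume x: "x \<in> carrier (cobj P (n - 1 - 1))"
      have dx: "cdiff P (n - 1 - 1) x \<in> carrier (cobj P (n - 1))" by (rule cdiff_closed(2)[OF P x])
      have "H (cdiff P (n - 1) (cdiff P (n - 1 - 1) x)) = \<zero>\<^bsub>cobj C (n - 1)\<^esub>"
        using complexD'(2)[OF P x] lin_zero[OF P.right_module_axioms C.right_module_axioms H] by simp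
      then have "\<phi> (n - 1) (cdiff P (n - 1 - 1) x) = cdiff C (n - 1 - 1) (H' (cdiff P (n - 1 - 1) x))"
        using eq[OF dx] cdiff_closed(2)[OF C module_homsD(1)[OF H'(1) dx]] by simp
      then show "cdiff C (n - 1 - 1) (\<phi> (n - 1 - 1) x) = cdiff C (n - 1 - 1) (H' (cdiff P (n - 1 - 1) x))"
        using cmapD(3)[OF \<phi> x] by simp
    qed
    ultimately show ?thesis using module_homs_lin[OF H'(1)] by blast
  qed
  have zero: "x = \<zero>\<^bsub>cobj P n\<^esub>" if "n > N" "x \<in> carrier (cobj P n)" for n x
    using above[OF that(1)] that(2) by (auto simp: zero_module_def)
  \<comment> \<open>The descent starts at \<open>N + 1\<close>, one degree above the last possibly
    nonzero term of \<open>P\<close>, where the zero map serves as the start.\<close>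
  define a where "a j = N + 1 - int j" for j
  define PP where "PP j H \<longleftrightarrow> lin R (cobj P (a j)) (cobj C (a j - 1)) H \<and> Inv (a j) H \<and>
    (j = 0 \<longrightarrow> H = (\<lambda>_. \<zero>\<^bsub>cobj C (a 0 - 1)\<^esub>))" for j H
  define QQ where "QQ j H H' \<longleftrightarrow> (\<forall>x\<in>carrier (cobj P (a j - 1)).
    \<phi> (a j - 1) x = cdiff C (a j - 1 - 1) (H' x) \<oplus>\<^bsub>cobj C (a j - 1)\<^esub> H (cdiff P (a j - 1) x))" for j H H'
  have "\<exists>H. \<forall>j. PP j (H j) \<and> QQ j (H j) (H (Suc j))"
  proof (rule dependent_nat_choice)
    have "Inv (a 0) (\<lambda>_. \<zero>\<^bsub>cobj C (a 0 - 1)\<^esub>)"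
      unfolding Inv_def
    proof
      fix x assume x: "x \<in> carrier (cobj P (a 0 - 1))"
      have z: "cdiff C (a 0 - 1) \<zero>\<^bsub>cobj C (a 0 - 1)\<^esub> = \<zero>\<^bsub>cobj C (a 0)\<^esub>"
        by (rule lin_zero[OF C.right_module_axioms C.right_module_axioms complexD'(1)[OF C]])
      have "cdiff P (a 0 - 1) x = \<zero>\<^bsub>cobj P (a 0)\<^esub>"
        using zero[OF _ cdiff_closed(2)[OF P x]] by (simp add: a_def)
      then have "\<phi> (a 0) (cdiff P (a 0 - 1) x) = \<zero>\<^bsub>cobj C (a 0)\<^esub>"
        using lin_zero[OF P.right_module_axioms C.right_module_axioms cmapD(1)[OF \<phi>]] by simp
      then show "cdiff C (a 0 - 1) (\<phi> (a 0 - 1) x) = cdiff C (a 0 - 1) \<zero>\<^bsub>cobj C (a 0 - 1)\<^esub>"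
        using cmapD(3)[OF \<phi> x] z by simp
    qed
    then show "\<exists>H. PP 0 H" using lin_const_zero[OF C.right_module_axioms] by (auto simp: PP_def)
    fix H j assume "PP j H"
    then obtain H' where "lin R (cobj P (a j - 1)) (cobj C (a j - 1 - 1)) H'" "Inv (a j - 1) H'" "QQ j H H'"
      using step[of "a j" H] unfolding PP_def QQ_def by blast
    moreover have "a (Suc j) = a j - 1" by (simp add: a_def)
    ultimately show "\<exists>H'. PP (Suc j) H' \<and> QQ j H H'"
      unfolding PP_def by (intro exI[of _ H']) simp
  qed
  then obtain H where H: "\<And>j. PP j (H j)" "\<And>j. QQ j (H j) (H (Suc j))" by blast
  define h where "h n = (if n > N then (\<lambda>_. \<zero>\<^bsub>cobj C (n - 1)\<^esub>) else H (nat (N + 1 - n)))" for n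
  have hN: "h n = (\<lambda>_. \<zero>\<^bsub>cobj C (n - 1)\<^esub>)" if "n > N" for n
    using that by (auto simp: h_def)
  show ?thesis
  proof (intro exI[of _ h] conjI allI ballI)
    show "hfam R P C h"
      unfolding hfam_def
    proof
      fix n show "lin R (cobj P n) (cobj C (n - 1)) (h n)"
      proof (cases "n > N")
        case False
        then have "a (nat (N + 1 - n)) = n" by (simp add: a_def)
        then show ?thesis using H(1)[of "nat (N + 1 - n)"] False by (simp add: PP_def h_def)
      qed (simp add: hN lin_const_zero C.right_module_axioms)
    qed
    fix n x assume x: "x \<in> carrier (cobj P n)"
    show "\<phi> n x = hbd P C h n x"
    proof (cases "n > N")
      case True
      then have "hbd P C h n x = hbd P C (\<lambda>n x. \<zero>\<^bsub>cobj C (n - 1)\<^esub>) n x" by (simp add: hbd_def hN)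
      moreover have "\<phi> n x = \<zero>\<^bsub>cobj C n\<^esub>"
        using zero[OF True x] lin_zero[OF P.right_module_axioms C.right_module_axioms cmapD(1)[OF \<phi>]] by simp
      ultimately show ?thesis using hbd_zero[OF P C x] by simp
    next
      case False
      define j where "j = nat (N - n)"
      have j: "a j - 1 = n" "nat (N + 1 - n) = Suc j" using False by (simp_all add: a_def j_def)
      \<comment> \<open>In degree \<open>n = N\<close> the left side belongs to the zero branch of
        \<open>h\<close>, while \<open>H 0\<close> is zero by the last clause of \<open>PP\<close>;
        in lower degrees both sides agree by definition.\<close>
      have "h (n + 1) = H j"
      proof (cases "n = N")
        case True
        then show ?thesis using H(1)[of 0] by (simp add: h_def j_def PP_def a_def)
      next
        case False
        then show ?thesis using \<open>\<not> n > N\<close> by (simp add: h_def j_def)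
      qed
      moreover have "h n = H (Suc j)" using False j(2) by (simp add: h_def)
      ultimately show ?thesis using H(2)[of j] x by (simp add: QQ_def j hbd_def)
    qed
  qed
qed

section \<open>Mapping cones and lifting problems along quasi-isomorphisms\<close>

definition cone :: "('r, 'm) cochain_complex \<Rightarrow> ('r, 'n) cochain_complex \<Rightarrow> (int \<Rightarrow> 'm \<Rightarrow> 'n) \<Rightarrow> ('r, 'm \<times> 'n) cochain_complex"
  where "cone P X u = \<lparr>cobj = (\<lambda>n. dsum (cobj P (n + 1)) (cobj X n)),
    cdiff = (\<lambda>n. \<lambda>x\<in>carrier (dsum (cobj P (n + 1)) (cobj X n)).
      (\<ominus>\<^bsub>cobj P (n + 1 + 1)\<^esub> cdiff P (n + 1) (fst x),
       u (n + 1) (fst x) \<oplus>\<^bsub>cobj X (n + 1)\<^esub> cdiff X n (snd x)))\<rparr>"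

text \<open>Shifting a cone of \<open>u\<close> by one puts \<open>P\<close> in its original
  degrees, so that the projection to \<open>P\<close> is a chain map. The sign turns the
  differential on this component back into that of \<open>P\<close>.\<close>

definition desuspension :: "('r, 'm) cochain_complex \<Rightarrow> ('r, 'm) cochain_complex"
  where "desuspension C = \<lparr>cobj = (\<lambda>n. cobj C (n - 1)),
    cdiff = (\<lambda>n. \<lambda>x\<in>carrier (cobj C (n - 1)). \<ominus>\<^bsub>cobj C n\<^esub> cdiff C (n - 1) x)\<rparr>"

lemma cone_simps [simp]:
  "cobj (cone P X u) n = dsum (cobj P (n + 1)) (cobj X n)"
  "fst x \<in> carrier (cobj P (n + 1)) \<Longrightarrow> snd x \<in> carrier (cobj X n) \<Longrightarrow> cdiff (cone P X u) n x =
    (\<ominus>\<^bsub>cobj P (n + 1 + 1)\<^esub> cdiff P (n + 1) (fst x), u (n + 1) (fst x) \<oplus>\<^bsub>cobj X (n + 1)\<^esub> cdiff X n (snd x))"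
  by (simp_all add: cone_def)

lemma desuspension_simps [simp]:
  "cobj (desuspension C) n = cobj C (n - 1)"
  "x \<in> carrier (cobj C (n - 1)) \<Longrightarrow> cdiff (desuspension C) n x = \<ominus>\<^bsub>cobj C n\<^esub> cdiff C (n - 1) x"
  by (simp_all add: desuspension_def)

lemma is_complex_desuspension:
  assumes C: "is_complex R C" shows "is_complex R (desuspension C)"
proof (rule is_complexI)
  interpret C: right_module R "cobj C i" for i by (rule complexD(1)[OF C])
  show "right_module R (cobj (desuspension C) n)" for n by (simp add: C.right_module_axioms)
  show "cdiff (desuspension C) n \<in> module_homs R (cobj (desuspension C) n) (cobj (desuspension C) (n + 1))" for n
    using restrict_module_homs[OF C.right_module_axioms lin_uminus[OF C.right_module_axioms complexD'(1)[OF C]]]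
    by (simp add: desuspension_def)
  fix n x assume "x \<in> carrier (cobj (desuspension C) n)"
  then have x: "x \<in> carrier (cobj C (n - 1))" by simp
  have dx: "cdiff C (n - 1) x \<in> carrier (cobj C n)" by (rule cdiff_closed(2)[OF C x])
  show "cdiff (desuspension C) (n + 1) (cdiff (desuspension C) n x) = \<zero>\<^bsub>cobj (desuspension C) (n + 1 + 1)\<^esub>"
    using x dx lin_minus[OF C.right_module_axioms C.right_module_axioms complexD(3)[OF C] dx] complexD'(2)[OF C x]
    by (simp add: add.commute[of 1 n])
qed

lemma exact_desuspension:
  assumes C: "is_complex R C" and exact: "exact_complex C" shows "exact_complex (desuspension C)"
  unfolding exact_complex_def
proof (intro allI ballI impI)
  interpret C: right_module R "cobj C i" for i by (rule complexD(1)[OF C])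
  fix n x assume "x \<in> carrier (cobj (desuspension C) n)"
    and z: "cdiff (desuspension C) n x = \<zero>\<^bsub>cobj (desuspension C) (n + 1)\<^esub>"
  then have x: "x \<in> carrier (cobj C (n - 1))" by simp
  have dx: "cdiff C (n - 1) x \<in> carrier (cobj C n)" by (rule cdiff_closed(2)[OF C x])
  have "\<ominus>\<^bsub>cobj C n\<^esub> cdiff C (n - 1) x = \<zero>\<^bsub>cobj C n\<^esub>" using z x by simp
  then have "cdiff C (n - 1) x = \<zero>\<^bsub>cobj C (n - 1 + 1)\<^esub>"
    using C.uminus_eq_zero[OF _ dx] by simp
  then obtain y where y: "y \<in> carrier (cobj C (n - 1 - 1))" "cdiff C (n - 1 - 1) y = x"
    using exact_complexD[OF exact x] by blast
  then show "\<exists>y\<in>carrier (cobj (desuspension C) (n - 1)). cdiff (desuspension C) (n - 1) y = x"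
    using lin_minus[OF C.right_module_axioms C.right_module_axioms complexD'(1)[OF C] y(1)] C.M.minus_minus[OF x]
    by (intro bexI[of _ "\<ominus>\<^bsub>cobj C (n - 1 - 1)\<^esub> y"]) simp_all
qed

lemma is_complex_cone:
  assumes P: "is_complex R P" and X: "is_complex R X" and u: "cmap R P X u"
  shows "is_complex R (cone P X u)"
proof (rule is_complexI)
  interpret P: right_module R "cobj P i" for i by (rule complexD(1)[OF P])
  interpret X: right_module R "cobj X i" for i by (rule complexD(1)[OF X])
  show C: "right_module R (cobj (cone P X u) n)" for n
    by (simp add: right_module_dsum P.right_module_axioms X.right_module_axioms)
  show "cdiff (cone P X u) n \<in> module_homs R (cobj (cone P X u) n) (cobj (cone P X u) (n + 1))" for n
  proof -
    have "lin R (dsum (cobj P (n + 1)) (cobj X n)) (dsum (cobj P (n + 1 + 1)) (cobj X (n + 1)))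
      (\<lambda>x. (\<ominus>\<^bsub>cobj P (n + 1 + 1)\<^esub> cdiff P (n + 1) (fst x), u (n + 1) (fst x) \<oplus>\<^bsub>cobj X (n + 1)\<^esub> cdiff X n (snd x)))"
      by (intro lin_pair lin_uminus[OF P.right_module_axioms] lin_plus[OF X.right_module_axioms]
          lin_comp[OF lin_fst complexD(3)[OF P]] lin_comp[OF lin_fst cmapD(1)[OF u]] lin_comp[OF lin_snd complexD(3)[OF X]])
    from restrict_module_homs[OF C[of n, simplified] this] show ?thesis by (simp add: cone_def)
  qed
  fix n x assume "x \<in> carrier (cobj (cone P X u) n)"
  then have x: "fst x \<in> carrier (cobj P (n + 1))" "snd x \<in> carrier (cobj X n)" by auto
  have c: "cdiff P (n + 1) (fst x) \<in> carrier (cobj P (n + 1 + 1))" "u (n + 1) (fst x) \<in> carrier (cobj X (n + 1))"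
    "cdiff X n (snd x) \<in> carrier (cobj X (n + 1))"
    using cdiff_closed(1)[OF P x(1)] cmapD(4)[OF u x(1)] cdiff_closed(1)[OF X x(2)] by auto
  have dP: "cdiff P (n + 1 + 1) (\<ominus>\<^bsub>cobj P (n + 1 + 1)\<^esub> cdiff P (n + 1) (fst x)) = \<zero>\<^bsub>cobj P (n + 1 + 1 + 1)\<^esub>"
    using lin_minus[OF P.right_module_axioms P.right_module_axioms complexD(3)[OF P] c(1)] complexD(4)[OF P x(1)] by simp
  have uP: "u (n + 1 + 1) (\<ominus>\<^bsub>cobj P (n + 1 + 1)\<^esub> cdiff P (n + 1) (fst x)) = \<ominus>\<^bsub>cobj X (n + 1 + 1)\<^esub> cdiff X (n + 1) (u (n + 1) (fst x))"
    using lin_minus[OF P.right_module_axioms X.right_module_axioms cmapD(1)[OF u] c(1)] cmapD(2)[OF u x(1)] by simp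
  have dX: "cdiff X (n + 1) (u (n + 1) (fst x) \<oplus>\<^bsub>cobj X (n + 1)\<^esub> cdiff X n (snd x)) = cdiff X (n + 1) (u (n + 1) (fst x))"
    using lin_add[OF complexD(3)[OF X] c(2,3)] complexD(4)[OF X x(2)] cdiff_closed(1)[OF X c(2)] by simp
  show "cdiff (cone P X u) (n + 1) (cdiff (cone P X u) n x) = \<zero>\<^bsub>cobj (cone P X u) (n + 1 + 1)\<^esub>"
    using x c dP uP dX cdiff_closed(1)[OF X c(2)] by (simp add: X.M.l_neg)
qed

text \<open>For a cycle of the cone, \<open>u\<close> of its first component is a boundary, so
  injectivity on cohomology provides a primitive \<open>p'\<close> of that component. Then
  \<open>u n p'\<close> plus the second component is a cycle of \<open>X\<close>, and surjectivity
  writes it as the image of a cycle \<open>q\<close> plus a boundary.\<close>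

lemma exact_cone:
  assumes P: "is_complex R P" and X: "is_complex R X" and u: "cmap R P X u"
    and inj: "cohomology_inj P X u" and surj: "cohomology_surj P X u"
  shows "exact_complex (cone P X u)"
  unfolding exact_complex_def
proof (intro allI ballI impI)
  interpret P: right_module R "cobj P i" for i by (rule complexD(1)[OF P])
  interpret X: right_module R "cobj X i" for i by (rule complexD(1)[OF X])
  fix n x assume "x \<in> carrier (cobj (cone P X u) n)"
    and z: "cdiff (cone P X u) n x = \<zero>\<^bsub>cobj (cone P X u) (n + 1)\<^esub>"
  then have x: "fst x \<in> carrier (cobj P (n + 1))" "snd x \<in> carrier (cobj X n)" by auto
  have c: "cdiff P (n + 1) (fst x) \<in> carrier (cobj P (n + 1 + 1))" "u (n + 1) (fst x) \<in> carrier (cobj X (n + 1))"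
    "cdiff X n (snd x) \<in> carrier (cobj X (n + 1))"
    using cdiff_closed(1)[OF P x(1)] cmapD(4)[OF u x(1)] cdiff_closed(1)[OF X x(2)] by auto
  have z1: "\<ominus>\<^bsub>cobj P (n + 1 + 1)\<^esub> cdiff P (n + 1) (fst x) = \<zero>\<^bsub>cobj P (n + 1 + 1)\<^esub>"
    and z2: "u (n + 1) (fst x) \<oplus>\<^bsub>cobj X (n + 1)\<^esub> cdiff X n (snd x) = \<zero>\<^bsub>cobj X (n + 1)\<^esub>"
    using z x by simp_all
  have z1': "cdiff P (n + 1) (fst x) = \<zero>\<^bsub>cobj P (n + 1 + 1)\<^esub>"
    by (rule P.uminus_eq_zero[OF z1 c(1)])
  have "cdiff X n (\<ominus>\<^bsub>cobj X n\<^esub> snd x) = u (n + 1) (fst x)"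
    using lin_minus[OF X.right_module_axioms X.right_module_axioms complexD(3)[OF X] x(2)] X.M.minus_equality[OF z2 c(3,2)] by simp
  then have "\<exists>y\<in>carrier (cobj X (n + 1 - 1)). cdiff X (n + 1 - 1) y = u (n + 1) (fst x)"
    using x(2) by (intro bexI[of _ "\<ominus>\<^bsub>cobj X n\<^esub> snd x"]) simp_all
  then obtain p' where "p' \<in> carrier (cobj P (n + 1 - 1))" "cdiff P (n + 1 - 1) p' = fst x"
    using inj x(1) z1' unfolding cohomology_inj_def by blast
  then have p': "p' \<in> carrier (cobj P n)" "cdiff P n p' = fst x" by simp_all
  have up': "u n p' \<in> carrier (cobj X n)" by (rule cmapD(4)[OF u p'(1)])
  have "cdiff X n (u n p' \<oplus>\<^bsub>cobj X n\<^esub> snd x) = \<zero>\<^bsub>cobj X (n + 1)\<^esub>"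
    using lin_add[OF complexD(3)[OF X] up' x(2)] cmapD(2)[OF u p'(1)] p'(2) z2 by simp
  then obtain q w where q: "q \<in> carrier (cobj P n)" "cdiff P n q = \<zero>\<^bsub>cobj P (n + 1)\<^esub>"
    and w: "w \<in> carrier (cobj X (n - 1))" "u n p' \<oplus>\<^bsub>cobj X n\<^esub> snd x = u n q \<oplus>\<^bsub>cobj X n\<^esub> cdiff X (n - 1) w"
    using surj up' x(2) unfolding cohomology_surj_def by (metis X.M.add.m_closed)
  have uq: "u n q \<in> carrier (cobj X n)" by (rule cmapD(4)[OF u q(1)])
  have dw: "cdiff X (n - 1) w \<in> carrier (cobj X n)" by (rule cdiff_closed(2)[OF X w(1)])
  \<comment> \<open>The preimage of \<open>x\<close> in the cone is \<open>q\<close> minus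
    \<open>p'\<close> together with \<open>w\<close>. The two components of its differential are
    computed separately.\<close>
  have "cdiff P n (q \<ominus>\<^bsub>cobj P n\<^esub> p') = \<ominus>\<^bsub>cobj P (n + 1)\<^esub> fst x"
    using lin_diff[OF P.right_module_axioms P.right_module_axioms complexD(3)[OF P] q(1) p'(1)] p'(2) q(2) x(1)
    by (simp add: a_minus_def)
  moreover have "u n (q \<ominus>\<^bsub>cobj P n\<^esub> p') \<oplus>\<^bsub>cobj X n\<^esub> cdiff X (n - 1) w = snd x"
  proof -
    have "u n (q \<ominus>\<^bsub>cobj P n\<^esub> p') \<oplus>\<^bsub>cobj X n\<^esub> cdiff X (n - 1) w =
        \<ominus>\<^bsub>cobj X n\<^esub> u n p' \<oplus>\<^bsub>cobj X n\<^esub> (u n q \<oplus>\<^bsub>cobj X n\<^esub> cdiff X (n - 1) w)"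
      using lin_diff[OF P.right_module_axioms X.right_module_axioms cmapD(1)[OF u] q(1) p'(1)] uq up' dw
      by (simp add: a_minus_def X.M.a_ac)
    then show ?thesis using w(2)[symmetric] up' x(2) by (simp add: X.M.r_neg1)
  qed
  ultimately show "\<exists>y\<in>carrier (cobj (cone P X u) (n - 1)). cdiff (cone P X u) (n - 1) y = x"
    using q(1) p'(1) w(1) x P.M.minus_minus[OF x(1)]
    by (intro bexI[of _ "(q \<ominus>\<^bsub>cobj P n\<^esub> p', w)"]) (simp_all add: prod_eq_iff)
qed

lemma a_inv_dsum:
  assumes "right_module R M" "right_module R N" "fst x \<in> carrier M" "snd x \<in> carrier N"
  shows "\<ominus>\<^bsub>dsum M N\<^esub> x = (\<ominus>\<^bsub>M\<^esub> fst x, \<ominus>\<^bsub>N\<^esub> snd x)"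
proof -
  interpret M: right_module R M by fact
  interpret N: right_module R N by fact
  interpret S: right_module R "dsum M N" by (rule right_module_dsum[OF assms(1,2)])
  show ?thesis
    by (rule S.M.minus_equality) (use assms in \<open>auto simp: M.M.l_neg N.M.l_neg\<close>)
qed

text \<open>The map \<open>f\<close> and the null homotopy \<open>h\<close> of its composite with
  \<open>u\<close> assemble into a chain map from the cone of \<open>u\<close> to \<open>Y\<close>.
  The cone is exact, so this map is null homotopic, and restricting the homotopy to \<open>X\<close>
  gives a null homotopy of \<open>f\<close>.\<close>

lemma homotopic_zero_reflect:
  assumes P: "is_complex R P" and X: "is_complex R X" and Y: "inj_complex R Y" and u: "cmap R P X u"
    and qi: "cohomology_inj P X u" "cohomology_surj P X u"
    and f: "cmap R X Y f" and f0: "\<And>n x. n < N \<Longrightarrow> x \<in> carrier (cobj X n) \<Longrightarrow> f n x = \<zero>\<^bsub>cobj Y n\<^esub>"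
    and h: "hfam R P Y h" and h0: "\<And>n x. n < N \<Longrightarrow> x \<in> carrier (cobj P n) \<Longrightarrow> h n x = \<zero>\<^bsub>cobj Y (n - 1)\<^esub>"
    and fu: "\<And>n x. x \<in> carrier (cobj P n) \<Longrightarrow> f n (u n x) = hbd P Y h n x"
  shows "\<exists>k. hfam R X Y k \<and> (\<forall>n. \<forall>x\<in>carrier (cobj X n). f n x = hbd X Y k n x)"
proof -
  note Yc = inj_complexD(1)[OF Y]
  interpret P: right_module R "cobj P i" for i by (rule complexD(1)[OF P])
  interpret X: right_module R "cobj X i" for i by (rule complexD(1)[OF X])
  interpret Y: right_module R "cobj Y i" for i by (rule complexD(1)[OF Yc])
  let ?C = "cone P X u"
  define \<phi> where "\<phi> n z = f n (snd z) \<oplus>\<^bsub>cobj Y n\<^esub> h (n + 1) (fst z)" for n z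
  have "cmap R ?C Y \<phi>"
  proof (rule cmapI)
    show "lin R (cobj ?C n) (cobj Y n) (\<phi> n)" for n
      unfolding \<phi>_def cone_simps(1)
      by (intro lin_plus[OF Y.right_module_axioms] lin_comp[OF lin_snd cmapD(1)[OF f]] lin_comp[OF lin_fst hfamD(2)[OF h]])
    fix n z assume "z \<in> carrier (cobj ?C n)"
    then have z: "fst z \<in> carrier (cobj P (n + 1))" "snd z \<in> carrier (cobj X n)" by auto
    have dz: "cdiff P (n + 1) (fst z) \<in> carrier (cobj P (n + 1 + 1))" by (rule cdiff_closed(1)[OF P z(1)])
    have hz: "h (n + 1) (fst z) \<in> carrier (cobj Y n)" by (rule hfamD(4)[OF h z(1)])
    have hdz: "h (n + 1 + 1) (cdiff P (n + 1) (fst z)) \<in> carrier (cobj Y (n + 1))" by (rule hfamD(4)[OF h dz])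
    have uz: "u (n + 1) (fst z) \<in> carrier (cobj X (n + 1))" by (rule cmapD(4)[OF u z(1)])
    have dx: "cdiff X n (snd z) \<in> carrier (cobj X (n + 1))" by (rule cdiff_closed(1)[OF X z(2)])
    have fz: "f n (snd z) \<in> carrier (cobj Y n)" by (rule cmapD(4)[OF f z(2)])
    have 1: "f (n + 1) (u (n + 1) (fst z) \<oplus>\<^bsub>cobj X (n + 1)\<^esub> cdiff X n (snd z)) =
        (cdiff Y n (h (n + 1) (fst z)) \<oplus>\<^bsub>cobj Y (n + 1)\<^esub> h (n + 1 + 1) (cdiff P (n + 1) (fst z))) \<oplus>\<^bsub>cobj Y (n + 1)\<^esub> cdiff Y n (f n (snd z))"
      using lin_add[OF cmapD(1)[OF f] uz dx] fu[OF z(1)] cmapD(2)[OF f z(2)] by (simp add: hbd_def)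
    have 2: "h (n + 1 + 1) (\<ominus>\<^bsub>cobj P (n + 1 + 1)\<^esub> cdiff P (n + 1) (fst z)) = \<ominus>\<^bsub>cobj Y (n + 1)\<^esub> h (n + 1 + 1) (cdiff P (n + 1) (fst z))"
      by (rule lin_minus[OF P.right_module_axioms Y.right_module_axioms hfamD(2)[OF h] dz])
    have 3: "cdiff Y n (f n (snd z) \<oplus>\<^bsub>cobj Y n\<^esub> h (n + 1) (fst z)) = cdiff Y n (f n (snd z)) \<oplus>\<^bsub>cobj Y (n + 1)\<^esub> cdiff Y n (h (n + 1) (fst z))"
      by (rule lin_add[OF complexD(3)[OF Yc] fz hz])
    have 4: "((a \<oplus>\<^bsub>cobj Y (n + 1)\<^esub> b) \<oplus>\<^bsub>cobj Y (n + 1)\<^esub> c) \<oplus>\<^bsub>cobj Y (n + 1)\<^esub> \<ominus>\<^bsub>cobj Y (n + 1)\<^esub> b = c \<oplus>\<^bsub>cobj Y (n + 1)\<^esub> a"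
      if "a \<in> carrier (cobj Y (n + 1))" "b \<in> carrier (cobj Y (n + 1))" "c \<in> carrier (cobj Y (n + 1))" for a b c
    proof -
      have "((a \<oplus>\<^bsub>cobj Y (n + 1)\<^esub> b) \<oplus>\<^bsub>cobj Y (n + 1)\<^esub> c) = (c \<oplus>\<^bsub>cobj Y (n + 1)\<^esub> a) \<oplus>\<^bsub>cobj Y (n + 1)\<^esub> b"
        using that by (simp add: Y.M.a_ac)
      then show ?thesis using that by (simp add: Y.M.a_assoc Y.M.r_neg)
    qed
    show "\<phi> (n + 1) (cdiff ?C n z) = cdiff Y n (\<phi> n z)"
      unfolding cone_simps(2)[OF z] \<phi>_def fst_conv snd_conv 1 2 3
      by (rule 4[OF cdiff_closed(1)[OF Yc hz] hdz cdiff_closed(1)[OF Yc fz]])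
  qed
  \<comment> \<open>Degree \<open>n\<close> of the cone contains \<open>P\<close> in degree
    \<open>n + 1\<close>, so both \<open>f\<close> in degree \<open>n\<close> and \<open>h\<close>
    in degree \<open>n + 1\<close> have to vanish. This lowers the bound by one.\<close>
  moreover have "\<phi> n z = \<zero>\<^bsub>cobj Y n\<^esub>" if "n < N - 1" "z \<in> carrier (cobj ?C n)" for n z
    using that f0[of n "snd z"] h0[of "n + 1" "fst z"] by (simp add: \<phi>_def)
  ultimately obtain k where k: "hfam R ?C Y k" "\<And>n z. z \<in> carrier (cobj ?C n) \<Longrightarrow> \<phi> n z = hbd ?C Y k n z"
    using null_homotopy_to_injective[OF is_complex_cone[OF P X u] exact_cone[OF P X u qi] Y, of \<phi> "N - 1"] by blast
  show ?thesis
  proof (intro exI[of _ "\<lambda>n x. k n (\<zero>\<^bsub>cobj P (n + 1)\<^esub>, x)"] conjI allI ballI)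
    show "hfam R X Y (\<lambda>n x. k n (\<zero>\<^bsub>cobj P (n + 1)\<^esub>, x))"
      unfolding hfam_def
      using lin_comp[OF lin_inr[OF P.right_module_axioms X.right_module_axioms] hfamD(1)[OF k(1), unfolded cone_simps(1)]] by blast
    fix n x assume x: "x \<in> carrier (cobj X n)"
    have "h (n + 1) \<zero>\<^bsub>cobj P (n + 1)\<^esub> = \<zero>\<^bsub>cobj Y n\<^esub>"
      by (rule lin_zero[OF P.right_module_axioms Y.right_module_axioms hfamD(2)[OF h]])
    moreover have "cdiff P (n + 1) \<zero>\<^bsub>cobj P (n + 1)\<^esub> = \<zero>\<^bsub>cobj P (n + 1 + 1)\<^esub>"
      by (rule lin_zero[OF P.right_module_axioms P.right_module_axioms complexD(3)[OF P]])
    moreover have "u (n + 1) \<zero>\<^bsub>cobj P (n + 1)\<^esub> = \<zero>\<^bsub>cobj X (n + 1)\<^esub>"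
      by (rule lin_zero[OF P.right_module_axioms X.right_module_axioms cmapD(1)[OF u]])
    ultimately show "f n x = hbd X Y (\<lambda>n x. k n (\<zero>\<^bsub>cobj P (n + 1)\<^esub>, x)) n x"
      using k(2)[of "(\<zero>\<^bsub>cobj P (n + 1)\<^esub>, x)" n] x cmapD(4)[OF f x] cdiff_closed(1)[OF X x]
      by (simp add: \<phi>_def hbd_def)
  qed
qed

text \<open>Compose \<open>f\<close> with the projection of the desuspended cone of \<open>u\<close>
  to \<open>P\<close>. The result is null homotopic because the cone is exact. Of the homotopy, the
  part on \<open>P\<close> is \<open>a\<close>, and the part on \<open>X\<close> is, up to sign, the
  chain map \<open>g\<close>.\<close>

lemma homotopy_factor:
  fixes P :: "('r, 'p) cochain_complex" and X :: "('r, 'x) cochain_complex"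
  assumes P: "is_complex R P" and X: "is_complex R X" and Y: "inj_complex R Y" and u: "cmap R P X u"
    and qi: "cohomology_inj P X u" "cohomology_surj P X u"
    and f: "cmap R P Y f" and f0: "\<And>n x. n < N \<Longrightarrow> x \<in> carrier (cobj P n) \<Longrightarrow> f n x = \<zero>\<^bsub>cobj Y n\<^esub>"
  shows "\<exists>g a. cmap R X Y g \<and> hfam R P Y a \<and> (\<forall>n\<le>N. \<forall>x\<in>carrier (cobj P n). a n x = \<zero>\<^bsub>cobj Y (n - 1)\<^esub>) \<and>
    (\<forall>n. \<forall>x\<in>carrier (cobj P n). f n x = g n (u n x) \<oplus>\<^bsub>cobj Y n\<^esub> hbd P Y a n x)"
proof -
  note Yc = inj_complexD(1)[OF Y]
  interpret P: right_module R "cobj P i" for i by (rule complexD(1)[OF P])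
  interpret X: right_module R "cobj X i" for i by (rule complexD(1)[OF X])
  interpret Y: right_module R "cobj Y i" for i by (rule complexD(1)[OF Yc])
  let ?C = "cone P X u" let ?K = "desuspension ?C"
  have C: "is_complex R ?C" by (rule is_complex_cone[OF P X u])
  have Kn: "cobj ?K n = dsum (cobj P n) (cobj X (n - 1))" for n by simp
  have Kd: "cdiff ?K n z = (cdiff P n (fst z), \<ominus>\<^bsub>cobj X n\<^esub> (u n (fst z) \<oplus>\<^bsub>cobj X n\<^esub> cdiff X (n - 1) (snd z)))"
    if z: "fst z \<in> carrier (cobj P n)" "snd z \<in> carrier (cobj X (n - 1))" for n z
    using z a_inv_dsum[OF P.right_module_axioms X.right_module_axioms, of _ "n + 1" n]
      cdiff_closed(1)[OF P z(1)] cdiff_closed(2)[OF X z(2)] cmapD(4)[OF u z(1)]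
    by simp
  define \<phi> where "\<phi> n z = f n (fst z)" for n and z :: "'p \<times> 'x"
  have "cmap R ?K Y \<phi>"
  proof (rule cmapI)
    show "lin R (cobj ?K n) (cobj Y n) (\<phi> n)" for n
      unfolding \<phi>_def Kn by (rule lin_comp[OF lin_fst cmapD(1)[OF f]])
    show "\<phi> (n + 1) (cdiff ?K n z) = cdiff Y n (\<phi> n z)" if "z \<in> carrier (cobj ?K n)" for n z
      using that cmapD(2)[OF f, of "fst z" n] unfolding Kn by (simp add: \<phi>_def Kd del: desuspension_simps)
  qed
  moreover have "\<phi> n z = \<zero>\<^bsub>cobj Y n\<^esub>" if "n < N" "z \<in> carrier (cobj ?K n)" for n z
    using that f0[of n "fst z"] by (simp add: \<phi>_def)
  ultimately obtain k where k: "hfam R ?K Y k" "\<And>n z. n \<le> N \<Longrightarrow> z \<in> carrier (cobj ?K n) \<Longrightarrow> k n z = \<zero>\<^bsub>cobj Y (n - 1)\<^esub>"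
      "\<And>n z. z \<in> carrier (cobj ?K n) \<Longrightarrow> \<phi> n z = hbd ?K Y k n z"
    using null_homotopy_to_injective[OF is_complex_desuspension[OF C] exact_desuspension[OF C exact_cone[OF P X u qi]] Y, of \<phi> N]
    by blast
  define a where "a n p = k n (p, \<zero>\<^bsub>cobj X (n - 1)\<^esub>)" for n p
  define b where "b n x = k (n + 1) (\<zero>\<^bsub>cobj P (n + 1)\<^esub>, x)" for n x
  have kl: "lin R (dsum (cobj P n) (cobj X (n - 1))) (cobj Y (n - 1)) (k n)" for n
    using hfamD(1)[OF k(1), of n] unfolding Kn .
  have kl': "lin R (dsum (cobj P (n + 1)) (cobj X n)) (cobj Y n) (k (n + 1))" for n
    using kl[of "n + 1"] by simp
  have a: "hfam R P Y a"
    unfolding hfam_def a_def using lin_comp[OF lin_inl[OF P.right_module_axioms X.right_module_axioms] kl] by blast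
  have bl: "lin R (cobj X n) (cobj Y n) (b n)" for n
    unfolding b_def by (rule lin_comp[OF lin_inr[OF P.right_module_axioms X.right_module_axioms] kl'])
  have z0: "cdiff P n \<zero>\<^bsub>cobj P n\<^esub> = \<zero>\<^bsub>cobj P (n + 1)\<^esub>" "u n \<zero>\<^bsub>cobj P n\<^esub> = \<zero>\<^bsub>cobj X n\<^esub>"
    "f n \<zero>\<^bsub>cobj P n\<^esub> = \<zero>\<^bsub>cobj Y n\<^esub>" "cdiff X (n - 1) \<zero>\<^bsub>cobj X (n - 1)\<^esub> = \<zero>\<^bsub>cobj X n\<^esub>" for n
    using lin_zero[OF P.right_module_axioms P.right_module_axioms complexD(3)[OF P]]
      lin_zero[OF P.right_module_axioms X.right_module_axioms cmapD(1)[OF u]]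
      lin_zero[OF P.right_module_axioms Y.right_module_axioms cmapD(1)[OF f]]
      lin_zero[OF X.right_module_axioms X.right_module_axioms complexD'(1)[OF X]] by auto
  have bc: "b n x \<in> carrier (cobj Y n)" if "x \<in> carrier (cobj X n)" for n x using lin_closed[OF bl that] .
  have bminus: "k (n + 1) (\<zero>\<^bsub>cobj P (n + 1)\<^esub>, \<ominus>\<^bsub>cobj X n\<^esub> x) = \<ominus>\<^bsub>cobj Y n\<^esub> b n x" if "x \<in> carrier (cobj X n)" for n x
    using lin_minus[OF X.right_module_axioms Y.right_module_axioms bl that] by (simp add: b_def)
  \<comment> \<open>The homotopy identity at elements with first component zero: its left side
    vanishes, and what remains says that \<open>b\<close> commutes with the differentials.\<close>
  have b: "cdiff Y n (b n x) = b (n + 1) (cdiff X n x)" if x: "x \<in> carrier (cobj X n)" for n x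
  proof -
    have dx: "cdiff X n x \<in> carrier (cobj X (n + 1))" by (rule cdiff_closed(1)[OF X x])
    have "\<zero>\<^bsub>cobj Y (n + 1)\<^esub> = cdiff Y n (b n x) \<oplus>\<^bsub>cobj Y (n + 1)\<^esub> k (n + 1 + 1) (\<zero>\<^bsub>cobj P (n + 1 + 1)\<^esub>, \<ominus>\<^bsub>cobj X (n + 1)\<^esub> cdiff X n x)"
      using k(3)[of "(\<zero>\<^bsub>cobj P (n + 1)\<^esub>, x)" "n + 1"] x Kd[of "(\<zero>\<^bsub>cobj P (n + 1)\<^esub>, x)" "n + 1"] z0[of "n + 1"] dx
      unfolding Kn by (simp add: \<phi>_def hbd_def b_def del: desuspension_simps)
    also have "\<dots> = cdiff Y n (b n x) \<ominus>\<^bsub>cobj Y (n + 1)\<^esub> b (n + 1) (cdiff X n x)"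
      using bminus[OF dx] by (simp add: a_minus_def)
    finally show ?thesis
      using Y.diff_eq_zero_iff[OF cdiff_closed(1)[OF Yc bc[OF x]] bc[OF dx]] by simp
  qed
  \<comment> \<open>The sign arises because the desuspended cone contains \<open>u\<close> with a
    minus sign in its differential.\<close>
  have g: "cmap R X Y (\<lambda>n x. \<ominus>\<^bsub>cobj Y n\<^esub> b n x)"
  proof (rule cmapI)
    show "lin R (cobj X n) (cobj Y n) (\<lambda>x. \<ominus>\<^bsub>cobj Y n\<^esub> b n x)" for n by (rule lin_uminus[OF Y.right_module_axioms bl])
    show "\<ominus>\<^bsub>cobj Y (n + 1)\<^esub> b (n + 1) (cdiff X n x) = cdiff Y n (\<ominus>\<^bsub>cobj Y n\<^esub> b n x)" if x: "x \<in> carrier (cobj X n)" for n x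
      using lin_minus[OF Y.right_module_axioms Y.right_module_axioms complexD(3)[OF Yc] bc[OF x]] b[OF x] by simp
  qed
  have fx: "f n x = \<ominus>\<^bsub>cobj Y n\<^esub> b n (u n x) \<oplus>\<^bsub>cobj Y n\<^esub> hbd P Y a n x" if x: "x \<in> carrier (cobj P n)" for n x
  proof -
    have ux: "u n x \<in> carrier (cobj X n)" by (rule cmapD(4)[OF u x])
    have dx: "cdiff P n x \<in> carrier (cobj P (n + 1))" by (rule cdiff_closed(1)[OF P x])
    have ac: "cdiff Y (n - 1) (a n x) \<in> carrier (cobj Y n)" "a (n + 1) (cdiff P n x) \<in> carrier (cobj Y n)"
      using cdiff_closed(2)[OF Yc hfamD(3)[OF a x]] hfamD(4)[OF a dx] by auto
    have "f n x = cdiff Y (n - 1) (a n x) \<oplus>\<^bsub>cobj Y n\<^esub> k (n + 1) (cdiff P n x, \<ominus>\<^bsub>cobj X n\<^esub> u n x)"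
      using k(3)[of "(x, \<zero>\<^bsub>cobj X (n - 1)\<^esub>)" n] x Kd[of "(x, \<zero>\<^bsub>cobj X (n - 1)\<^esub>)" n] z0[of n] ux
      unfolding Kn by (simp add: \<phi>_def hbd_def a_def del: desuspension_simps)
    also have "k (n + 1) (cdiff P n x, \<ominus>\<^bsub>cobj X n\<^esub> u n x) =
        k (n + 1) (cdiff P n x, \<zero>\<^bsub>cobj X n\<^esub>) \<oplus>\<^bsub>cobj Y n\<^esub> k (n + 1) (\<zero>\<^bsub>cobj P (n + 1)\<^esub>, \<ominus>\<^bsub>cobj X n\<^esub> u n x)"
      using lin_add[OF kl', of "(cdiff P n x, \<zero>\<^bsub>cobj X n\<^esub>)" n "(\<zero>\<^bsub>cobj P (n + 1)\<^esub>, \<ominus>\<^bsub>cobj X n\<^esub> u n x)"] dx ux by simp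
    also have "\<dots> = a (n + 1) (cdiff P n x) \<oplus>\<^bsub>cobj Y n\<^esub> \<ominus>\<^bsub>cobj Y n\<^esub> b n (u n x)"
      using bminus[OF ux] by (simp add: a_def)
    finally show ?thesis using ac bc[OF ux] by (simp add: hbd_def Y.M.a_ac)
  qed
  show ?thesis
    using g a fx k(2) by (intro exI[of _ "\<lambda>n x. \<ominus>\<^bsub>cobj Y n\<^esub> b n x"] exI[of _ a]) (auto simp: a_def)
qed

text \<open>The composite of \<open>g\<close> with the inclusion of \<open>W\<close> into the cone
  of \<open>s\<close> is null homotopic, since the cone is exact and \<open>P\<close> is bounded
  above with projective terms. The first component of the homotopy is the lift \<open>t\<close>, the
  second one is the homotopy from \<open>g\<close> to its composite with \<open>s\<close>.\<close>

lemma projective_lift: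
  assumes P: "is_complex R P" and proj: "\<And>n. projective_module R (cobj P n)" and above: "\<And>n. n > N \<Longrightarrow> zero_module (cobj P n)"
    and Z: "is_complex R Z" and W: "is_complex R W" and s: "cmap R Z W s"
    and qi: "cohomology_inj Z W s" "cohomology_surj Z W s" and g: "cmap R P W g"
  shows "\<exists>t. cmap R P Z t \<and> homotopic R P W g (\<lambda>n x. s n (t n x))"
proof -
  interpret Z: right_module R "cobj Z i" for i by (rule complexD(1)[OF Z])
  interpret W: right_module R "cobj W i" for i by (rule complexD(1)[OF W])
  let ?C = "cone Z W s"
  have C: "is_complex R ?C" by (rule is_complex_cone[OF Z W s])
  have z0: "cdiff Z n \<zero>\<^bsub>cobj Z n\<^esub> = \<zero>\<^bsub>cobj Z (n + 1)\<^esub>" "s n \<zero>\<^bsub>cobj Z n\<^esub> = \<zero>\<^bsub>cobj W n\<^esub>" for n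
    using lin_zero[OF Z.right_module_axioms Z.right_module_axioms complexD(3)[OF Z]]
      lin_zero[OF Z.right_module_axioms W.right_module_axioms cmapD(1)[OF s]] by auto
  have "cmap R P ?C (\<lambda>n x. (\<zero>\<^bsub>cobj Z (n + 1)\<^esub>, g n x))"
  proof (rule cmapI)
    show "lin R (cobj P n) (cobj ?C n) (\<lambda>x. (\<zero>\<^bsub>cobj Z (n + 1)\<^esub>, g n x))" for n
      unfolding cone_simps(1) by (rule lin_pair[OF lin_const_zero[OF Z.right_module_axioms] cmapD(1)[OF g]])
    fix n x assume x: "x \<in> carrier (cobj P n)"
    show "(\<zero>\<^bsub>cobj Z (n + 1 + 1)\<^esub>, g (n + 1) (cdiff P n x)) = cdiff ?C n (\<zero>\<^bsub>cobj Z (n + 1)\<^esub>, g n x)"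
      using cmapD(4)[OF g x] cmapD(2)[OF g x] z0[of "n + 1"] cdiff_closed(1)[OF W cmapD(4)[OF g x]] by simp
  qed
  from null_homotopy_from_projective[OF P proj C exact_cone[OF Z W s qi] this above] obtain h
    where h: "hfam R P ?C h" "\<And>n x. x \<in> carrier (cobj P n) \<Longrightarrow> (\<zero>\<^bsub>cobj Z (n + 1)\<^esub>, g n x) = hbd P ?C h n x"
    by blast
  define a where "a n x = fst (h n x)" for n x
  define b where "b n x = snd (h n x)" for n x
  have hl: "lin R (cobj P n) (dsum (cobj Z n) (cobj W (n - 1))) (h n)" for n
    using hfamD(1)[OF h(1), of n] by simp
  have al: "lin R (cobj P n) (cobj Z n) (a n)" for n unfolding a_def by (rule lin_comp[OF hl lin_fst])
  have b: "hfam R P W b" unfolding hfam_def b_def using lin_comp[OF hl lin_snd] by blast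
  have main: "\<zero>\<^bsub>cobj Z (n + 1)\<^esub> = \<ominus>\<^bsub>cobj Z (n + 1)\<^esub> cdiff Z n (a n x) \<oplus>\<^bsub>cobj Z (n + 1)\<^esub> a (n + 1) (cdiff P n x) \<and>
      g n x = (s n (a n x) \<oplus>\<^bsub>cobj W n\<^esub> cdiff W (n - 1) (b n x)) \<oplus>\<^bsub>cobj W n\<^esub> b (n + 1) (cdiff P n x)"
    if x: "x \<in> carrier (cobj P n)" for n x
    using h(2)[OF x] lin_closed[OF hl x] by (simp add: hbd_def a_def b_def)
  have ac: "a n x \<in> carrier (cobj Z n)" if "x \<in> carrier (cobj P n)" for n x using lin_closed[OF al that] .
  have a: "cmap R P Z a"
  proof (rule cmapI[OF al])
    fix n x assume x: "x \<in> carrier (cobj P n)"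
    have c: "cdiff Z n (a n x) \<in> carrier (cobj Z (n + 1))" "a (n + 1) (cdiff P n x) \<in> carrier (cobj Z (n + 1))"
      using cdiff_closed(1)[OF Z ac[OF x]] ac[OF cdiff_closed(1)[OF P x]] by auto
    have "a (n + 1) (cdiff P n x) \<ominus>\<^bsub>cobj Z (n + 1)\<^esub> cdiff Z n (a n x) = \<zero>\<^bsub>cobj Z (n + 1)\<^esub>"
      using main[OF x] c by (simp add: a_minus_def Z.M.a_comm)
    then show "a (n + 1) (cdiff P n x) = cdiff Z n (a n x)" using Z.diff_eq_zero_iff[OF c(2,1)] by simp
  qed
  moreover have "homotopic R P W g (\<lambda>n x. s n (a n x))"
  proof (rule homotopicI[OF b])
    fix n x assume x: "x \<in> carrier (cobj P n)"
    show "g n x = s n (a n x) \<oplus>\<^bsub>cobj W n\<^esub> hbd P W b n x"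
      using main[OF x] cmapD(4)[OF s ac[OF x]] cdiff_closed(2)[OF W hfamD(3)[OF b x]] hfamD(4)[OF b cdiff_closed(1)[OF P x]]
      by (simp add: hbd_def W.M.a_assoc)
  qed
  ultimately show ?thesis by blast
qed

text \<open>A null homotopy \<open>b\<close> of the composite makes the pair of \<open>t\<close> and
  minus \<open>b\<close> a chain map into the desuspended cone of \<open>s\<close>. It is null
  homotopic, and the first component of its homotopy is a null homotopy of \<open>t\<close>.\<close>

lemma projective_lift_zero:
  assumes P: "is_complex R P" and proj: "\<And>n. projective_module R (cobj P n)" and above: "\<And>n. n > N \<Longrightarrow> zero_module (cobj P n)"
    and Z: "is_complex R Z" and W: "is_complex R W" and s: "cmap R Z W s"
    and qi: "cohomology_inj Z W s" "cohomology_surj Z W s" and t: "cmap R P Z t"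
    and b: "hfam R P W b" and st: "\<And>n x. x \<in> carrier (cobj P n) \<Longrightarrow> s n (t n x) = hbd P W b n x"
  shows "\<exists>a. hfam R P Z a \<and> (\<forall>n. \<forall>x\<in>carrier (cobj P n). t n x = hbd P Z a n x)"
proof -
  interpret Z: right_module R "cobj Z i" for i by (rule complexD(1)[OF Z])
  interpret W: right_module R "cobj W i" for i by (rule complexD(1)[OF W])
  let ?C = "cone Z W s" let ?K = "desuspension ?C"
  have C: "is_complex R ?C" by (rule is_complex_cone[OF Z W s])
  have Kn: "cobj ?K n = dsum (cobj Z n) (cobj W (n - 1))" for n by simp
  have Kd: "cdiff ?K n z = (cdiff Z n (fst z), \<ominus>\<^bsub>cobj W n\<^esub> (s n (fst z) \<oplus>\<^bsub>cobj W n\<^esub> cdiff W (n - 1) (snd z)))"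
    if z: "fst z \<in> carrier (cobj Z n)" "snd z \<in> carrier (cobj W (n - 1))" for n z
    using z a_inv_dsum[OF Z.right_module_axioms W.right_module_axioms, of _ "n + 1" n]
      cdiff_closed(1)[OF Z z(1)] cdiff_closed(2)[OF W z(2)] cmapD(4)[OF s z(1)]
    by simp
  have "cmap R P ?K (\<lambda>n x. (t n x, \<ominus>\<^bsub>cobj W (n - 1)\<^esub> b n x))"
  proof (rule cmapI)
    show "lin R (cobj P n) (cobj ?K n) (\<lambda>x. (t n x, \<ominus>\<^bsub>cobj W (n - 1)\<^esub> b n x))" for n
      unfolding Kn by (rule lin_pair[OF cmapD(1)[OF t] lin_uminus[OF W.right_module_axioms hfamD(1)[OF b]]])
    fix n x assume x: "x \<in> carrier (cobj P n)"
    have tx: "t n x \<in> carrier (cobj Z n)" and bx: "b n x \<in> carrier (cobj W (n - 1))"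
      using cmapD(4)[OF t x] hfamD(3)[OF b x] .
    have dbx: "cdiff W (n - 1) (b n x) \<in> carrier (cobj W n)" by (rule cdiff_closed(2)[OF W bx])
    have bdx: "b (n + 1) (cdiff P n x) \<in> carrier (cobj W n)" by (rule hfamD(4)[OF b cdiff_closed(1)[OF P x]])
    have "cdiff W (n - 1) (\<ominus>\<^bsub>cobj W (n - 1)\<^esub> b n x) = \<ominus>\<^bsub>cobj W n\<^esub> cdiff W (n - 1) (b n x)"
      by (rule lin_minus[OF W.right_module_axioms W.right_module_axioms complexD'(1)[OF W] bx])
    then have "s n (t n x) \<oplus>\<^bsub>cobj W n\<^esub> cdiff W (n - 1) (\<ominus>\<^bsub>cobj W (n - 1)\<^esub> b n x) = b (n + 1) (cdiff P n x)"
      using st[OF x] dbx bdx W.M.a_comm[OF dbx bdx] by (simp add: hbd_def W.M.a_assoc W.M.r_neg)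
    then show "(t (n + 1) (cdiff P n x), \<ominus>\<^bsub>cobj W (n + 1 - 1)\<^esub> b (n + 1) (cdiff P n x)) =
        cdiff ?K n (t n x, \<ominus>\<^bsub>cobj W (n - 1)\<^esub> b n x)"
      using Kd[of "(t n x, \<ominus>\<^bsub>cobj W (n - 1)\<^esub> b n x)" n] tx bx cmapD(2)[OF t x] by (simp del: desuspension_simps)
  qed
  from null_homotopy_from_projective[OF P proj is_complex_desuspension[OF C] exact_desuspension[OF C exact_cone[OF Z W s qi]] this above]
  obtain h where h: "hfam R P ?K h" "\<And>n x. x \<in> carrier (cobj P n) \<Longrightarrow> (t n x, \<ominus>\<^bsub>cobj W (n - 1)\<^esub> b n x) = hbd P ?K h n x"
    by blast
  have hl: "lin R (cobj P n) (dsum (cobj Z (n - 1)) (cobj W (n - 1 - 1))) (h n)" for n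
    using hfamD(1)[OF h(1), of n] unfolding Kn .
  have a: "hfam R P Z (\<lambda>n x. fst (h n x))" unfolding hfam_def using lin_comp[OF hl lin_fst] by blast
  have "t n x = hbd P Z (\<lambda>n x. fst (h n x)) n x" if x: "x \<in> carrier (cobj P n)" for n x
  proof -
    have "cdiff ?K (n - 1) (h n x) = (cdiff Z (n - 1) (fst (h n x)), \<ominus>\<^bsub>cobj W (n - 1)\<^esub> (s (n - 1) (fst (h n x)) \<oplus>\<^bsub>cobj W (n - 1)\<^esub> cdiff W (n - 1 - 1) (snd (h n x))))"
      using lin_closed[OF hl x] by (intro Kd) auto
    then show ?thesis
      using arg_cong[OF h(2)[OF x], of fst] unfolding hbd_def Kn by simp
  qed
  then show ?thesis using a by blast
qed

text \<open>Apply \<open>projective_lift_zero\<close> to the difference of the two lifts.\<close>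

lemma projective_lift_unique:
  assumes P: "is_complex R P" and proj: "\<And>n. projective_module R (cobj P n)" and above: "\<And>n. n > N \<Longrightarrow> zero_module (cobj P n)"
    and Z: "is_complex R Z" and W: "is_complex R W" and s: "cmap R Z W s"
    and qi: "cohomology_inj Z W s" "cohomology_surj Z W s" and t: "cmap R P Z t" and t': "cmap R P Z t'"
    and st: "homotopic R P W (\<lambda>n x. s n (t n x)) (\<lambda>n x. s n (t' n x))"
  shows "homotopic R P Z t t'"
proof -
  interpret Z: right_module R "cobj Z i" for i by (rule complexD(1)[OF Z])
  interpret W: right_module R "cobj W i" for i by (rule complexD(1)[OF W])
  obtain b where b: "hfam R P W b" "\<And>n x. x \<in> carrier (cobj P n) \<Longrightarrow> s n (t n x) = s n (t' n x) \<oplus>\<^bsub>cobj W n\<^esub> hbd P W b n x"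
    using st by (auto simp: homotopic_def)
  have d: "cmap R P Z (\<lambda>n x. t n x \<ominus>\<^bsub>cobj Z n\<^esub> t' n x)"
  proof (rule cmapI)
    show "lin R (cobj P n) (cobj Z n) (\<lambda>x. t n x \<ominus>\<^bsub>cobj Z n\<^esub> t' n x)" for n
      by (rule lin_minus_fun[OF Z.right_module_axioms cmapD(1)[OF t] cmapD(1)[OF t']])
    show "t (n + 1) (cdiff P n x) \<ominus>\<^bsub>cobj Z (n + 1)\<^esub> t' (n + 1) (cdiff P n x) = cdiff Z n (t n x \<ominus>\<^bsub>cobj Z n\<^esub> t' n x)"
      if x: "x \<in> carrier (cobj P n)" for n x
      using lin_diff[OF Z.right_module_axioms Z.right_module_axioms complexD(3)[OF Z] cmapD(4)[OF t x] cmapD(4)[OF t' x]]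
        cmapD(2)[OF t x] cmapD(2)[OF t' x] by simp
  qed
  have sd: "s n (t n x \<ominus>\<^bsub>cobj Z n\<^esub> t' n x) = hbd P W b n x" if x: "x \<in> carrier (cobj P n)" for n x
  proof -
    have c: "s n (t' n x) \<in> carrier (cobj W n)" "s n (t n x) \<in> carrier (cobj W n)" "hbd P W b n x \<in> carrier (cobj W n)"
      using cmapD(4)[OF s cmapD(4)[OF t' x]] cmapD(4)[OF s cmapD(4)[OF t x]] lin_closed[OF hbd_lin[OF P W b(1)] x] by auto
    have "s n (t n x \<ominus>\<^bsub>cobj Z n\<^esub> t' n x) = s n (t n x) \<ominus>\<^bsub>cobj W n\<^esub> s n (t' n x)"
      by (rule lin_diff[OF Z.right_module_axioms W.right_module_axioms cmapD(1)[OF s] cmapD(4)[OF t x] cmapD(4)[OF t' x]])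
    then show ?thesis using W.diff_eq_iff[OF c(2,1,3)] b(2)[OF x] W.M.a_comm[OF c(1,3)] by simp
  qed
  obtain a where a: "hfam R P Z a" "\<And>n x. x \<in> carrier (cobj P n) \<Longrightarrow> t n x \<ominus>\<^bsub>cobj Z n\<^esub> t' n x = hbd P Z a n x"
    using projective_lift_zero[OF P proj above Z W s qi d b(1) sd] by blast
  show ?thesis
  proof (rule homotopicI[OF a(1)])
    fix n x assume x: "x \<in> carrier (cobj P n)"
    have c: "t n x \<in> carrier (cobj Z n)" "t' n x \<in> carrier (cobj Z n)" "hbd P Z a n x \<in> carrier (cobj Z n)"
      using cmapD(4)[OF t x] cmapD(4)[OF t' x] lin_closed[OF hbd_lin[OF P Z a(1)] x] by auto
    show "t n x = t' n x \<oplus>\<^bsub>cobj Z n\<^esub> hbd P Z a n x"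
      using Z.diff_eq_iff[OF c] a(2)[OF x] Z.M.a_comm[OF c(2,3)] by simp
  qed
qed

section \<open>Morphisms in the homotopy category\<close>

lemma chain_maps_homs: "f \<in> chain_maps R X Y \<Longrightarrow> f n \<in> module_homs R (cobj X n) (cobj Y n)"
  by (simp add: chain_maps_def)

lemma chain_maps_eqI:
  assumes "f \<in> chain_maps R X Y" "g \<in> chain_maps R X Y" "\<And>n x. x \<in> carrier (cobj X n) \<Longrightarrow> f n x = g n x"
  shows "f = g"
  by (rule ext, rule module_homs_eqI[OF chain_maps_homs[OF assms(1)] chain_maps_homs[OF assms(2)]]) (rule assms(3))

lemma cmap_add:
  assumes Y: "is_complex R Y" and f: "cmap R X Y f" and g: "cmap R X Y g"
  shows "cmap R X Y (\<lambda>n x. f n x \<oplus>\<^bsub>cobj Y n\<^esub> g n x)"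
  by (rule cmapI[OF lin_plus[OF complexD(1)[OF Y] cmapD(1)[OF f] cmapD(1)[OF g]]])
    (simp add: cmapD(2)[OF f] cmapD(2)[OF g] lin_add[OF complexD(3)[OF Y] cmapD(4)[OF f] cmapD(4)[OF g]])

lemma cmap_zero:
  assumes Y: "is_complex R Y"
  shows "cmap R X Y (\<lambda>n x. \<zero>\<^bsub>cobj Y n\<^esub>)"
  by (rule cmapI[OF lin_const_zero[OF complexD(1)[OF Y]]])
    (simp add: lin_zero[OF complexD(1)[OF Y] complexD(1)[OF Y] complexD(3)[OF Y]])

lemma null_homotopic_iff:
  assumes X: "is_complex R X"
  shows "f \<in> null_homotopic R X Y \<longleftrightarrow> f \<in> chain_maps R X Y \<and>
    (\<exists>h. hfam R X Y h \<and> (\<forall>n. \<forall>x\<in>carrier (cobj X n). f n x = hbd X Y h n x))"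
proof
  assume "f \<in> null_homotopic R X Y"
  then obtain h where "f \<in> chain_maps R X Y" "\<And>n. h n \<in> module_homs R (cobj X n) (cobj Y (n - 1))"
      "\<And>n x. x \<in> carrier (cobj X n) \<Longrightarrow> f n x = hbd X Y h n x"
    unfolding null_homotopic_def hbd_def by blast
  then show "f \<in> chain_maps R X Y \<and> (\<exists>h. hfam R X Y h \<and> (\<forall>n. \<forall>x\<in>carrier (cobj X n). f n x = hbd X Y h n x))"
    unfolding hfam_def using module_homs_lin by blast
next
  assume "f \<in> chain_maps R X Y \<and> (\<exists>h. hfam R X Y h \<and> (\<forall>n. \<forall>x\<in>carrier (cobj X n). f n x = hbd X Y h n x))"
  then obtain h where f: "f \<in> chain_maps R X Y" and h: "hfam R X Y h"
      "\<And>n x. x \<in> carrier (cobj X n) \<Longrightarrow> f n x = hbd X Y h n x" by blast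
  have "\<forall>n. crestrict X h n \<in> module_homs R (cobj X n) (cobj Y (n - 1)) \<and>
      (\<forall>x\<in>carrier (cobj X n). f n x = cdiff Y (n - 1) (crestrict X h n x) \<oplus>\<^bsub>cobj Y n\<^esub> crestrict X h (n + 1) (cdiff X n x))"
    using h(2) cdiff_closed(1)[OF X] restrict_module_homs[OF complexD(1)[OF X] hfamD(1)[OF h(1)]]
    by (auto simp: hbd_def crestrict_def)
  with f show "f \<in> null_homotopic R X Y" unfolding null_homotopic_def by blast
qed

section \<open>Homotopy classes of chain maps as a module over the base ring\<close>

context k_algebra
begin

lemma cmap_scalar:
  assumes Y: "is_complex \<Lambda> Y" and f: "cmap \<Lambda> X Y f" and a: "a \<in> carrier k"
  shows "cmap \<Lambda> X Y (\<lambda>n x. scalar a \<odot>\<^bsub>cobj Y n\<^esub> f n x)"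
  by (rule cmapI[OF lin_comp[OF cmapD(1)[OF f] lin_scalar[OF complexD(1)[OF Y] a]]])
    (simp add: cmapD(2)[OF f] lin_smult[OF complexD(3)[OF Y] scalar_closed[OF a] cmapD(4)[OF f]])

text \<open>Chain maps become a submodule of a product of Hom modules, so that the module axioms are
  inherited instead of being proved again.\<close>

lemma chain_map_module_eq:
  "chain_map_module \<Lambda> X Y = (prod_module (\<lambda>n. hom_module \<Lambda> (cobj X n) (cobj Y n)))\<lparr>carrier := chain_maps \<Lambda> X Y\<rparr>"
  by (simp add: chain_map_module_def prod_module_def hom_module_def)

lemma chain_map_module_simps [simp]:
  "carrier (chain_map_module \<Lambda> X Y) = chain_maps \<Lambda> X Y"
  "\<zero>\<^bsub>chain_map_module \<Lambda> X Y\<^esub> = crestrict X (\<lambda>n x. \<zero>\<^bsub>cobj Y n\<^esub>)"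
  "f \<oplus>\<^bsub>chain_map_module \<Lambda> X Y\<^esub> g = crestrict X (\<lambda>n x. f n x \<oplus>\<^bsub>cobj Y n\<^esub> g n x)"
  "a \<odot>\<^bsub>chain_map_module \<Lambda> X Y\<^esub> f = crestrict X (\<lambda>n x. scalar a \<odot>\<^bsub>cobj Y n\<^esub> f n x)"
  by (simp_all add: chain_map_module_def crestrict_def scalar_def)

lemma right_module_chain_map_module:
  assumes X: "is_complex \<Lambda> X" and Y: "is_complex \<Lambda> Y"
  shows "right_module k (chain_map_module \<Lambda> X Y)"
proof -
  let ?P = "prod_module (\<lambda>n. hom_module \<Lambda> (cobj X n) (cobj Y n))"
  have "right_module k ?P" by (rule right_module_prod) (rule right_module_hom[OF complexD(1)[OF X] complexD(1)[OF Y]])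
  then interpret P: right_module k ?P .
  show ?thesis
    unfolding chain_map_module_eq
  proof (rule P.right_module_carrier_update)
    show "chain_maps \<Lambda> X Y \<subseteq> carrier ?P" by (auto simp: chain_maps_homs)
    show "\<zero>\<^bsub>?P\<^esub> \<in> chain_maps \<Lambda> X Y"
      using crestrict_chain_maps[OF X cmap_zero[OF Y]] by (simp add: crestrict_def)
    show "f \<oplus>\<^bsub>?P\<^esub> g \<in> chain_maps \<Lambda> X Y" if "f \<in> chain_maps \<Lambda> X Y" "g \<in> chain_maps \<Lambda> X Y" for f g
      using crestrict_chain_maps[OF X cmap_add[OF Y chain_maps_cmap[OF that(1)] chain_maps_cmap[OF that(2)]]]
      by (simp add: crestrict_def)
    show "a \<odot>\<^bsub>?P\<^esub> f \<in> chain_maps \<Lambda> X Y" if "a \<in> carrier k" "f \<in> chain_maps \<Lambda> X Y" for a f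
      using crestrict_chain_maps[OF X cmap_scalar[OF Y chain_maps_cmap[OF that(2)] that(1)]]
      by (simp add: crestrict_def scalar_def)
  qed
qed

lemma null_submod:
  assumes X: "is_complex \<Lambda> X" and Y: "is_complex \<Lambda> Y"
  shows "submod k (chain_map_module \<Lambda> X Y) (null_homotopic \<Lambda> X Y)"
  unfolding submod_def chain_map_module_simps
proof (intro conjI ballI)
  note iff = null_homotopic_iff[OF X, where Y=Y]
  interpret Y: right_module \<Lambda> "cobj Y i" for i by (rule complexD(1)[OF Y])
  show "null_homotopic \<Lambda> X Y \<subseteq> chain_maps \<Lambda> X Y" by (auto simp: null_homotopic_def)
  show "crestrict X (\<lambda>n x. \<zero>\<^bsub>cobj Y n\<^esub>) \<in> null_homotopic \<Lambda> X Y"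
    unfolding iff using crestrict_chain_maps[OF X cmap_zero[OF Y]] hfam_zero[OF Y] hbd_zero[OF X Y]
    by (intro conjI exI[of _ "\<lambda>n x. \<zero>\<^bsub>cobj Y (n - 1)\<^esub>"]) auto
  show "crestrict X (\<lambda>n x. f n x \<oplus>\<^bsub>cobj Y n\<^esub> g n x) \<in> null_homotopic \<Lambda> X Y"
    if f: "f \<in> null_homotopic \<Lambda> X Y" and g: "g \<in> null_homotopic \<Lambda> X Y" for f g
  proof -
    obtain h where h: "f \<in> chain_maps \<Lambda> X Y" "hfam \<Lambda> X Y h" "\<And>n x. x \<in> carrier (cobj X n) \<Longrightarrow> f n x = hbd X Y h n x"
      using f unfolding iff by blast
    obtain h' where h': "g \<in> chain_maps \<Lambda> X Y" "hfam \<Lambda> X Y h'" "\<And>n x. x \<in> carrier (cobj X n) \<Longrightarrow> g n x = hbd X Y h' n x"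
      using g unfolding iff by blast
    show ?thesis
      unfolding iff
      using crestrict_chain_maps[OF X cmap_add[OF Y chain_maps_cmap[OF h(1)] chain_maps_cmap[OF h'(1)]]]
        hfam_add[OF Y h(2) h'(2)] hbd_add[OF X Y h(2) h'(2)] h(3) h'(3)
      by (intro conjI exI[of _ "\<lambda>n x. h n x \<oplus>\<^bsub>cobj Y (n - 1)\<^esub> h' n x"]) auto
  qed
  show "crestrict X (\<lambda>n x. scalar a \<odot>\<^bsub>cobj Y n\<^esub> f n x) \<in> null_homotopic \<Lambda> X Y"
    if a: "a \<in> carrier k" and f: "f \<in> null_homotopic \<Lambda> X Y" for a f
  proof -
    obtain h where h: "f \<in> chain_maps \<Lambda> X Y" "hfam \<Lambda> X Y h" "\<And>n x. x \<in> carrier (cobj X n) \<Longrightarrow> f n x = hbd X Y h n x"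
      using f unfolding iff by blast
    have s: "cmap \<Lambda> Y Y (\<lambda>n x. scalar a \<odot>\<^bsub>cobj Y n\<^esub> x)"
      by (rule cmap_scalar[OF Y cmap_id a])
    show ?thesis
      unfolding iff
      using crestrict_chain_maps[OF X cmap_scalar[OF Y chain_maps_cmap[OF h(1)] a]]
        hfam_post[OF h(2) s] hbd_post[OF X Y h(2) s] h(3)
      by (intro conjI exI[of _ "\<lambda>n x. scalar a \<odot>\<^bsub>cobj Y (n - 1)\<^esub> h n x"]) auto
  qed
qed

lemma right_module_hom_K:
  assumes "is_complex \<Lambda> X" "is_complex \<Lambda> Y" shows "right_module k (hom_K \<Lambda> X Y)"
  unfolding hom_K_def
  by (rule right_module.right_module_quotient[OF right_module_chain_map_module null_submod]) (use assms in auto)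

lemma carrier_hom_K:
  assumes "is_complex \<Lambda> X" "is_complex \<Lambda> Y"
  shows "carrier (hom_K \<Lambda> X Y) = class_K \<Lambda> X Y ` chain_maps \<Lambda> X Y"
  unfolding hom_K_def
  using right_module.carrier_quotient_module[OF right_module_chain_map_module null_submod, OF assms assms]
  by (simp add: class_K_def[abs_def])

lemma lin_class_K:
  assumes "is_complex \<Lambda> X" "is_complex \<Lambda> Y"
  shows "lin k (chain_map_module \<Lambda> X Y) (hom_K \<Lambda> X Y) (class_K \<Lambda> X Y)"
  unfolding hom_K_def class_K_def[abs_def]
  by (rule right_module.lin_coset[OF right_module_chain_map_module null_submod]) (use assms in auto)

lemma null_coset:
  assumes X: "is_complex \<Lambda> X" and Y: "is_complex \<Lambda> Y" and f: "f \<in> chain_maps \<Lambda> X Y" and g: "g \<in> chain_maps \<Lambda> X Y"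
  shows "(\<exists>h\<in>null_homotopic \<Lambda> X Y. f = h \<oplus>\<^bsub>chain_map_module \<Lambda> X Y\<^esub> g) \<longleftrightarrow> homotopic \<Lambda> X Y f g"
proof
  interpret Y: right_module \<Lambda> "cobj Y i" for i by (rule complexD(1)[OF Y])
  note gc = cmapD(4)[OF chain_maps_cmap[OF g]]
  show "homotopic \<Lambda> X Y f g" if ex: "\<exists>h\<in>null_homotopic \<Lambda> X Y. f = h \<oplus>\<^bsub>chain_map_module \<Lambda> X Y\<^esub> g"
  proof -
    obtain f' where f': "f' \<in> null_homotopic \<Lambda> X Y" "f = f' \<oplus>\<^bsub>chain_map_module \<Lambda> X Y\<^esub> g"
      using ex by blast
    obtain h where h: "hfam \<Lambda> X Y h" "\<And>i x. x \<in> carrier (cobj X i) \<Longrightarrow> f' i x = hbd X Y h i x"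
      using f'(1)[unfolded null_homotopic_iff[OF X]] by blast
    show ?thesis
    proof (rule homotopicI[OF h(1)])
      fix i x assume x: "x \<in> carrier (cobj X i)"
      have "f i x = f' i x \<oplus>\<^bsub>cobj Y i\<^esub> g i x" using f'(2) x by simp
      then show "f i x = g i x \<oplus>\<^bsub>cobj Y i\<^esub> hbd X Y h i x"
        unfolding h(2)[OF x] Y.M.a_comm[OF gc[OF x] lin_closed[OF hbd_lin[OF X Y h(1)] x]] .
    qed
  qed
  assume "homotopic \<Lambda> X Y f g"
  then obtain h where h: "hfam \<Lambda> X Y h" "\<And>i x. x \<in> carrier (cobj X i) \<Longrightarrow> f i x = g i x \<oplus>\<^bsub>cobj Y i\<^esub> hbd X Y h i x"
    unfolding homotopic_def by blast
  have n: "crestrict X (hbd X Y h) \<in> chain_maps \<Lambda> X Y" by (rule crestrict_chain_maps[OF X hbd_cmap[OF X Y h(1)]])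
  have "crestrict X (hbd X Y h) \<in> null_homotopic \<Lambda> X Y"
    unfolding null_homotopic_iff[OF X] using n h(1) by (intro conjI exI[of _ h]) auto
  moreover have "f = crestrict X (hbd X Y h) \<oplus>\<^bsub>chain_map_module \<Lambda> X Y\<^esub> g"
  proof (rule chain_maps_eqI[OF f])
    show "crestrict X (hbd X Y h) \<oplus>\<^bsub>chain_map_module \<Lambda> X Y\<^esub> g \<in> chain_maps \<Lambda> X Y"
      using crestrict_chain_maps[OF X cmap_add[OF Y chain_maps_cmap[OF n] chain_maps_cmap[OF g]]] by simp
    fix i x assume x: "x \<in> carrier (cobj X i)"
    show "f i x = (crestrict X (hbd X Y h) \<oplus>\<^bsub>chain_map_module \<Lambda> X Y\<^esub> g) i x"
      using x h(2)[OF x] Y.M.a_comm[OF gc[OF x] lin_closed[OF hbd_lin[OF X Y h(1)] x]] by simp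
  qed
  ultimately show "\<exists>h\<in>null_homotopic \<Lambda> X Y. f = h \<oplus>\<^bsub>chain_map_module \<Lambda> X Y\<^esub> g" by blast
qed

lemma class_K_eq_iff:
  assumes X: "is_complex \<Lambda> X" and Y: "is_complex \<Lambda> Y" and f: "f \<in> chain_maps \<Lambda> X Y" and g: "g \<in> chain_maps \<Lambda> X Y"
  shows "class_K \<Lambda> X Y f = class_K \<Lambda> X Y g \<longleftrightarrow> homotopic \<Lambda> X Y f g"
  using right_module.submod_coset_eq_iff[OF right_module_chain_map_module null_submod, OF X Y X Y, of f g]
    null_coset[OF X Y f g] f g by (simp add: class_K_def del: chain_map_module_simps(2-4))

lemma mem_class_K:
  assumes X: "is_complex \<Lambda> X" and Y: "is_complex \<Lambda> Y" and f: "f \<in> chain_maps \<Lambda> X Y"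
  shows "g \<in> class_K \<Lambda> X Y f \<longleftrightarrow> g \<in> chain_maps \<Lambda> X Y \<and> homotopic \<Lambda> X Y g f"
proof -
  note rm = right_module_chain_map_module[OF X Y] and sub = null_submod[OF X Y]
  have "g \<in> class_K \<Lambda> X Y f \<longleftrightarrow> (\<exists>h\<in>null_homotopic \<Lambda> X Y. g = h \<oplus>\<^bsub>chain_map_module \<Lambda> X Y\<^esub> f)"
    unfolding class_K_def by (rule right_module.mem_coset_iff[OF rm sub])
  moreover have "g \<in> chain_maps \<Lambda> X Y" if "g \<in> class_K \<Lambda> X Y f"
    using right_module.coset_mem_carrier[OF rm sub, of f g] that f by (simp add: class_K_def)
  ultimately show ?thesis using null_coset[OF X Y _ f] by blast
qed

lemma class_K_self:
  assumes X: "is_complex \<Lambda> X" and Y: "is_complex \<Lambda> Y" and f: "f \<in> chain_maps \<Lambda> X Y"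
  shows "f \<in> class_K \<Lambda> X Y f"
  using mem_class_K[OF X Y f] f homotopic_refl[OF X Y chain_maps_cmap[OF f]] by blast

lemma chain_comp_chain_maps:
  assumes "is_complex R X" "f \<in> chain_maps R X Y" "g \<in> chain_maps R Y Z"
  shows "chain_comp X g f \<in> chain_maps R X Z"
  unfolding chain_comp_crestrict
  by (rule crestrict_chain_maps[OF assms(1) cmap_comp]) (use assms chain_maps_cmap in auto)

lemma UN_const: "A \<noteq> {} \<Longrightarrow> (\<And>x. x \<in> A \<Longrightarrow> F x = c) \<Longrightarrow> (\<Union>x\<in>A. F x) = c"
  by (rule SUP_eq_const)

text \<open>\<open>comp_K\<close> is a union over all pairs of representatives. Composition respects
  homotopy, so all members of the union are the same class.\<close>

lemma comp_K_class:
  assumes X: "is_complex \<Lambda> X" and Y: "is_complex \<Lambda> Y" and Z: "is_complex \<Lambda> Z"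
    and f: "f \<in> chain_maps \<Lambda> X Y" and g: "g \<in> chain_maps \<Lambda> Y Z"
  shows "comp_K \<Lambda> X Z (class_K \<Lambda> Y Z g) (class_K \<Lambda> X Y f) = class_K \<Lambda> X Z (chain_comp X g f)"
proof -
  have "class_K \<Lambda> X Z (chain_comp X g' f') = class_K \<Lambda> X Z (chain_comp X g f)"
    if f': "f' \<in> class_K \<Lambda> X Y f" and g': "g' \<in> class_K \<Lambda> Y Z g" for f' g'
  proof -
    have m: "f' \<in> chain_maps \<Lambda> X Y" "homotopic \<Lambda> X Y f' f" "g' \<in> chain_maps \<Lambda> Y Z" "homotopic \<Lambda> Y Z g' g"
      using f' g' mem_class_K[OF X Y f] mem_class_K[OF Y Z g] by auto
    have "homotopic \<Lambda> X Z (\<lambda>n x. g' n (f' n x)) (\<lambda>n x. g n (f n x))"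
      by (rule homotopic_comp[OF X Y Z chain_maps_cmap[OF f] chain_maps_cmap[OF m(3)] chain_maps_cmap[OF g] m(2,4)])
    then have "homotopic \<Lambda> X Z (chain_comp X g' f') (chain_comp X g f)"
      by (rule homotopic_cong[OF X]) (auto simp: chain_comp_def)
    then show ?thesis
      using class_K_eq_iff[OF X Z chain_comp_chain_maps[OF X m(1,3)] chain_comp_chain_maps[OF X f g]] by blast
  qed
  moreover have "class_K \<Lambda> X Y f \<noteq> {}" "class_K \<Lambda> Y Z g \<noteq> {}" using class_K_self[OF X Y f] class_K_self[OF Y Z g] by auto
  ultimately show ?thesis unfolding comp_K_def by (intro UN_const) auto
qed

end

section \<open>The trace pairing for complexes\<close>

text \<open>The sign in \<open>\<tau>_cdiff\<close> is dictated by boundaries being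
  \<open>d h + h d\<close>: on a rank one map, the two terms of the boundary have to cancel under
  the functional of a chain map \<open>F\<close>. The complex \<open>T\<close> stays abstract here;
  only its identification with duals is used.\<close>

locale dual_complex = k_algebra k \<Lambda>
  for k :: "('k, 'c) ring_scheme" and \<Lambda> :: "('k, 'r) module" +
  fixes E :: "('k, 'e) module" and P :: "('r, 'p) cochain_complex" and Y :: "('r, 'y) cochain_complex"
    and T :: "('r, 't) cochain_complex" and \<tau> :: "int \<Rightarrow> 't \<Rightarrow> ('p \<Rightarrow> 'r) \<Rightarrow> 'e"
  assumes E: "injective_module k E" and P: "is_complex \<Lambda> P" and Y: "is_complex \<Lambda> Y" and T: "is_complex \<Lambda> T"
    and db: "\<And>n. \<exists>S \<Xi>. dual_basis \<Lambda> (cobj P n) S \<Xi>"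
    and rep: "\<And>n. represents k E \<Lambda> (cobj P n) (cobj T n) (\<tau> n)"
    and \<tau>_cdiff: "\<And>n t \<xi>. \<lbrakk>t \<in> carrier (cobj T n); \<xi> \<in> module_homs \<Lambda> (cobj P (n + 1)) (regular_module \<Lambda>)\<rbrakk> \<Longrightarrow>
      \<tau> (n + 1) (cdiff T n t) \<xi> = \<ominus>\<^bsub>E\<^esub> \<tau> n t (\<lambda>q\<in>carrier (cobj P n). \<xi> (cdiff P n q))"
begin

lemma E': "right_module k E" using E by (simp add: injective_module_def)

sublocale E: right_module k E by (rule E')
sublocale P: right_module \<Lambda> "cobj P n" for n by (rule complexD(1)[OF P])
sublocale Y: right_module \<Lambda> "cobj Y n" for n by (rule complexD(1)[OF Y])
sublocale T: right_module \<Lambda> "cobj T n" for n by (rule complexD(1)[OF T])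

sublocale D0: dual_families k \<Lambda> E "cobj P" "cobj Y" "cobj T" \<tau>
  by (intro dual_families.intro dual_families_axioms.intro k_algebra_axioms E' P.right_module_axioms
      Y.right_module_axioms db rep)
sublocale Dm: dual_families k \<Lambda> E "cobj P" "\<lambda>n. cobj Y (n - 1)" "cobj T" \<tau>
  by (intro dual_families.intro dual_families_axioms.intro k_algebra_axioms E' P.right_module_axioms
      Y.right_module_axioms db rep)
sublocale Dp: dual_families k \<Lambda> E "cobj P" "\<lambda>n. cobj Y (n + 1)" "cobj T" \<tau>
  by (intro dual_families.intro dual_families_axioms.intro k_algebra_axioms E' P.right_module_axioms
      Y.right_module_axioms db rep)

text \<open>\<open>Cm\<close>, \<open>C0\<close> and \<open>Cp\<close> are the terms of degrees -1,
  0 and 1 of the complex of finitely supported homomorphisms from \<open>P\<close> to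
  \<open>Y\<close>. The abbreviations \<open>sm\<close>, \<open>s0\<close> and \<open>sp\<close>
  denote their rank one generators.\<close>

abbreviation "C0 \<equiv> fin_homs \<Lambda> (cobj P) (cobj Y)"
abbreviation "Cm \<equiv> fin_homs \<Lambda> (cobj P) (\<lambda>n. cobj Y (n - 1))"
abbreviation "Cp \<equiv> fin_homs \<Lambda> (cobj P) (\<lambda>n. cobj Y (n + 1))"
abbreviation "s0 n \<xi> m \<equiv> single (cobj P) (cobj Y) n (rank_one (cobj P n) (cobj Y n) \<xi> m)"
abbreviation "sm n \<xi> m \<equiv> single (cobj P) (\<lambda>n. cobj Y (n - 1)) n (rank_one (cobj P n) (cobj Y (n - 1)) \<xi> m)"
abbreviation "sp n \<xi> m \<equiv> single (cobj P) (\<lambda>n. cobj Y (n + 1)) n (rank_one (cobj P n) (cobj Y (n + 1)) \<xi> m)"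
abbreviation "Pd n \<equiv> module_homs \<Lambda> (cobj P n) (regular_module \<Lambda>)"
abbreviation "dual_d n \<xi> \<equiv> (\<lambda>q\<in>carrier (cobj P n). \<xi> (cdiff P n q))"

lemma dual_d_closed: "\<xi> \<in> Pd (n + 1) \<Longrightarrow> dual_d n \<xi> \<in> Pd n"
  by (rule comp_module_homs[OF P.right_module_axioms complexD(3)[OF P] module_homs_lin])

lemma Pd_closed: "\<xi> \<in> Pd n \<Longrightarrow> q \<in> carrier (cobj P n) \<Longrightarrow> \<xi> q \<in> carrier \<Lambda>"
  using module_homsD(1) by fastforce

definition fbd :: "(int \<Rightarrow> 'p \<Rightarrow> 'y) \<Rightarrow> int \<Rightarrow> 'p \<Rightarrow> 'y"
  where "fbd h = crestrict P (hbd P Y h)"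

text \<open>The differential of the Hom complex from degree 0 to degree 1. Its kernel in
  \<open>C0\<close> consists of the finitely supported chain maps, see
  \<open>fcobd_zero_imp\<close>.\<close>

definition fcobd :: "(int \<Rightarrow> 'p \<Rightarrow> 'y) \<Rightarrow> int \<Rightarrow> 'p \<Rightarrow> 'y"
  where "fcobd f = crestrict P (\<lambda>n x. cdiff Y n (f n x) \<ominus>\<^bsub>cobj Y (n + 1)\<^esub> f (n + 1) (cdiff P n x))"

lemma Cm_hfam: "h \<in> carrier Cm \<Longrightarrow> hfam \<Lambda> P Y h"
  by (simp add: hfam_def module_homs_lin)

lemma lin_fbd: "lin k Cm C0 fbd"
proof (rule linI)
  fix h assume h: "h \<in> carrier Cm"
  note hf = Cm_hfam[OF h]
  let ?I = "supp (cobj P) (\<lambda>n. cobj Y (n - 1)) h"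
  have z: "cdiff Y (n - 1) \<zero>\<^bsub>cobj Y (n - 1)\<^esub> = \<zero>\<^bsub>cobj Y n\<^esub>" for n
    by (rule lin_zero[OF Y.right_module_axioms Y.right_module_axioms complexD'(1)[OF Y]])
  \<comment> \<open>Degree \<open>n\<close> of the boundary involves \<open>h\<close> in degrees
    \<open>n\<close> and \<open>n + 1\<close>, so the support grows at most by a shifted copy of
    itself.\<close>
  have "supp (cobj P) (cobj Y) (fbd h) \<subseteq> ?I \<union> (\<lambda>n. n - 1) ` ?I"
  proof (rule subsetI, rule ccontr)
    fix n assume n: "n \<in> supp (cobj P) (cobj Y) (fbd h)" "n \<notin> ?I \<union> (\<lambda>n. n - 1) ` ?I"
    then have nI: "n \<notin> ?I" "n + 1 \<notin> ?I" by (auto simp: image_iff)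
    obtain x where x: "x \<in> carrier (cobj P n)" "fbd h n x \<noteq> \<zero>\<^bsub>cobj Y n\<^esub>" using n(1) by (auto simp: supp_def)
    have "h n x = \<zero>\<^bsub>cobj Y (n - 1)\<^esub>" by (rule supp_zero[OF nI(1) x(1)])
    moreover have "h (n + 1) (cdiff P n x) = \<zero>\<^bsub>cobj Y (n + 1 - 1)\<^esub>"
      by (rule supp_zero[OF nI(2) cdiff_closed(1)[OF P x(1)]])
    ultimately show False using x z by (simp add: fbd_def hbd_def)
  qed
  moreover have "finite ?I" using h by simp
  ultimately have "finite (supp (cobj P) (cobj Y) (fbd h))" using finite_subset by blast
  moreover have "fbd h n \<in> module_homs \<Lambda> (cobj P n) (cobj Y n)" for n
    unfolding fbd_def crestrict_def by (rule restrict_module_homs[OF P.right_module_axioms hbd_lin[OF P Y hf]])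
  ultimately show "fbd h \<in> carrier C0" by simp
next
  fix h h' assume h: "h \<in> carrier Cm" and h': "h' \<in> carrier Cm"
  show "fbd (h \<oplus>\<^bsub>Cm\<^esub> h') = fbd h \<oplus>\<^bsub>C0\<^esub> fbd h'"
  proof (intro ext)
    fix n x
    show "fbd (h \<oplus>\<^bsub>Cm\<^esub> h') n x = (fbd h \<oplus>\<^bsub>C0\<^esub> fbd h') n x"
    proof (cases "x \<in> carrier (cobj P n)")
      case True
      have "hbd P Y (h \<oplus>\<^bsub>Cm\<^esub> h') n x = hbd P Y (\<lambda>n x. h n x \<oplus>\<^bsub>cobj Y (n - 1)\<^esub> h' n x) n x"
        using True cdiff_closed(1)[OF P True] by (simp add: hbd_def)
      then show ?thesis using hbd_add[OF P Y Cm_hfam[OF h] Cm_hfam[OF h'] True] True by (simp add: fbd_def)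
    qed (simp add: fbd_def crestrict_def)
  qed
next
  fix a h assume a: "a \<in> carrier k" and h: "h \<in> carrier Cm"
  have s: "cmap \<Lambda> Y Y (\<lambda>n x. scalar a \<odot>\<^bsub>cobj Y n\<^esub> x)" by (rule cmap_scalar[OF Y cmap_id a])
  show "fbd (a \<odot>\<^bsub>Cm\<^esub> h) = a \<odot>\<^bsub>C0\<^esub> fbd h"
  proof (intro ext)
    fix n x
    show "fbd (a \<odot>\<^bsub>Cm\<^esub> h) n x = (a \<odot>\<^bsub>C0\<^esub> fbd h) n x"
    proof (cases "x \<in> carrier (cobj P n)")
      case True
      have "hbd P Y (a \<odot>\<^bsub>Cm\<^esub> h) n x = hbd P Y (\<lambda>n x. scalar a \<odot>\<^bsub>cobj Y (n - 1)\<^esub> h n x) n x"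
        using True cdiff_closed(1)[OF P True] by (simp add: hbd_def scalar_def)
      then show ?thesis using hbd_post[OF P Y Cm_hfam[OF h] s True] True by (simp add: fbd_def scalar_def)
    qed (simp add: fbd_def crestrict_def)
  qed
qed

lemma lin_fcobd: "lin k C0 Cp fcobd"
proof (rule linI)
  fix f assume f: "f \<in> carrier C0"
  have fl: "lin \<Lambda> (cobj P n) (cobj Y n) (f n)" for n using f by (simp add: module_homs_lin)
  let ?I = "supp (cobj P) (cobj Y) f"
  have z: "cdiff Y n \<zero>\<^bsub>cobj Y n\<^esub> = \<zero>\<^bsub>cobj Y (n + 1)\<^esub>" for n
    by (rule lin_zero[OF Y.right_module_axioms Y.right_module_axioms complexD(3)[OF Y]])
  have "supp (cobj P) (\<lambda>n. cobj Y (n + 1)) (fcobd f) \<subseteq> ?I \<union> (\<lambda>n. n - 1) ` ?I"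
  proof (rule subsetI, rule ccontr)
    fix n assume n: "n \<in> supp (cobj P) (\<lambda>n. cobj Y (n + 1)) (fcobd f)" "n \<notin> ?I \<union> (\<lambda>n. n - 1) ` ?I"
    then have nI: "n \<notin> ?I" "n + 1 \<notin> ?I" by (auto simp: image_iff)
    obtain x where x: "x \<in> carrier (cobj P n)" "fcobd f n x \<noteq> \<zero>\<^bsub>cobj Y (n + 1)\<^esub>" using n(1) by (auto simp: supp_def)
    have "f n x = \<zero>\<^bsub>cobj Y n\<^esub>" by (rule supp_zero[OF nI(1) x(1)])
    moreover have "f (n + 1) (cdiff P n x) = \<zero>\<^bsub>cobj Y (n + 1)\<^esub>"
      by (rule supp_zero[OF nI(2) cdiff_closed(1)[OF P x(1)]])
    ultimately show False using x z by (simp add: fcobd_def a_minus_def)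
  qed
  moreover have "finite ?I" using f by simp
  ultimately have "finite (supp (cobj P) (\<lambda>n. cobj Y (n + 1)) (fcobd f))" using finite_subset by blast
  moreover have "fcobd f n \<in> module_homs \<Lambda> (cobj P n) (cobj Y (n + 1))" for n
    unfolding fcobd_def crestrict_def
    by (rule restrict_module_homs[OF P.right_module_axioms lin_minus_fun[OF Y.right_module_axioms
          lin_comp[OF fl complexD(3)[OF Y]] lin_comp[OF complexD(3)[OF P] fl]]])
  ultimately show "fcobd f \<in> carrier Cp" by simp
next
  fix f g assume f: "f \<in> carrier C0" and g: "g \<in> carrier C0"
  show "fcobd (f \<oplus>\<^bsub>C0\<^esub> g) = fcobd f \<oplus>\<^bsub>Cp\<^esub> fcobd g"
  proof (intro ext)
    fix n x
    show "fcobd (f \<oplus>\<^bsub>C0\<^esub> g) n x = (fcobd f \<oplus>\<^bsub>Cp\<^esub> fcobd g) n x"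
    proof (cases "x \<in> carrier (cobj P n)")
      case True
      have dx: "cdiff P n x \<in> carrier (cobj P (n + 1))" by (rule cdiff_closed(1)[OF P True])
      have c: "f n x \<in> carrier (cobj Y n)" "g n x \<in> carrier (cobj Y n)"
        "f (n + 1) (cdiff P n x) \<in> carrier (cobj Y (n + 1))" "g (n + 1) (cdiff P n x) \<in> carrier (cobj Y (n + 1))"
        by (rule fin_homs_closed[OF f True] fin_homs_closed[OF g True] fin_homs_closed[OF f dx] fin_homs_closed[OF g dx])+
      show ?thesis
        using True dx c cdiff_closed(1)[OF Y c(1)] cdiff_closed(1)[OF Y c(2)] lin_add[OF complexD(3)[OF Y] c(1,2)]
        by (simp add: fcobd_def a_minus_def Y.M.minus_add Y.M.a_ac)
    qed (simp add: fcobd_def crestrict_def)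
  qed
next
  fix a f assume a: "a \<in> carrier k" and f: "f \<in> carrier C0"
  show "fcobd (a \<odot>\<^bsub>C0\<^esub> f) = a \<odot>\<^bsub>Cp\<^esub> fcobd f"
  proof (intro ext)
    fix n x
    show "fcobd (a \<odot>\<^bsub>C0\<^esub> f) n x = (a \<odot>\<^bsub>Cp\<^esub> fcobd f) n x"
    proof (cases "x \<in> carrier (cobj P n)")
      case True
      have dx: "cdiff P n x \<in> carrier (cobj P (n + 1))" by (rule cdiff_closed(1)[OF P True])
      have c: "f n x \<in> carrier (cobj Y n)" "f (n + 1) (cdiff P n x) \<in> carrier (cobj Y (n + 1))"
        by (rule fin_homs_closed[OF f True] fin_homs_closed[OF f dx])+
      show ?thesis
        using True dx c cdiff_closed(1)[OF Y c(1)] lin_smult[OF complexD(3)[OF Y] scalar_closed[OF a] c(1)] scalar_closed[OF a]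
        by (simp add: fcobd_def a_minus_def Y.smult_r_distr Y.smult_minus flip: scalar_def)
    qed (simp add: fcobd_def crestrict_def)
  qed
qed

text \<open>The boundary of a rank one map lives in two degrees. In one, the differential of
  \<open>Y\<close> acts on \<open>m\<close>; in the other, the transposed differential of
  \<open>P\<close> acts on \<open>\<xi>\<close>.\<close>

lemma fbd_single:
  assumes \<xi>: "\<xi> \<in> Pd (n + 1)" and m: "m \<in> carrier (cobj Y n)"
  shows "fbd (sm (n + 1) \<xi> m) = s0 (n + 1) \<xi> (cdiff Y n m) \<oplus>\<^bsub>C0\<^esub> s0 n (dual_d n \<xi>) m"
proof (intro ext)
  fix j x
  have z: "cdiff Y (j - 1) \<zero>\<^bsub>cobj Y (j - 1)\<^esub> = \<zero>\<^bsub>cobj Y j\<^esub>" for j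
    by (rule lin_zero[OF Y.right_module_axioms Y.right_module_axioms complexD'(1)[OF Y]])
  show "fbd (sm (n + 1) \<xi> m) j x = (s0 (n + 1) \<xi> (cdiff Y n m) \<oplus>\<^bsub>C0\<^esub> s0 n (dual_d n \<xi>) m) j x"
  proof (cases "x \<in> carrier (cobj P j)")
    case x: True
    have dx: "cdiff P j x \<in> carrier (cobj P (j + 1))" by (rule cdiff_closed(1)[OF P x])
    consider "j = n + 1" | "j = n" | "j \<noteq> n + 1" "j \<noteq> n" by blast
    then show ?thesis
    proof cases
      case 1
      then show ?thesis
        using x dx m Pd_closed[OF \<xi>] lin_smult[OF complexD(3)[OF Y] _ m] cdiff_closed(1)[OF Y m]
        by (simp add: fbd_def hbd_def single_def rank_one_def Y.smult_closed add.commute[of 1 n])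
    next
      case 2
      then show ?thesis
        using x dx m Pd_closed[OF \<xi>] z[of n]
        by (simp add: fbd_def hbd_def single_def rank_one_def Y.smult_closed)
    next
      case 3
      then show ?thesis
        using x dx z[of j] by (simp add: fbd_def hbd_def single_def)
    qed
  qed (simp add: fbd_def crestrict_def)
qed

text \<open>The coboundary again has two terms, the second one with a minus sign; it is moved to the
  left side so that no subtraction of families occurs.\<close>

lemma fcobd_single:
  assumes \<xi>: "\<xi> \<in> Pd n" and m: "m \<in> carrier (cobj Y n)"
  shows "fcobd (s0 n \<xi> m) \<oplus>\<^bsub>Cp\<^esub> sp (n - 1) (dual_d (n - 1) \<xi>) m = sp n \<xi> (cdiff Y n m)"
proof (intro ext)
  fix j x
  have z: "cdiff Y j \<zero>\<^bsub>cobj Y j\<^esub> = \<zero>\<^bsub>cobj Y (j + 1)\<^esub>" for j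
    by (rule lin_zero[OF Y.right_module_axioms Y.right_module_axioms complexD(3)[OF Y]])
  show "(fcobd (s0 n \<xi> m) \<oplus>\<^bsub>Cp\<^esub> sp (n - 1) (dual_d (n - 1) \<xi>) m) j x = sp n \<xi> (cdiff Y n m) j x"
  proof (cases "x \<in> carrier (cobj P j)")
    case x: True
    have dx: "cdiff P j x \<in> carrier (cobj P (j + 1))" by (rule cdiff_closed(1)[OF P x])
    consider "j = n" | "j = n - 1" | "j \<noteq> n - 1" "j \<noteq> n" by blast
    then show ?thesis
    proof cases
      case 1
      then show ?thesis
        using x dx m Pd_closed[OF \<xi>] lin_smult[OF complexD(3)[OF Y] _ m] cdiff_closed(1)[OF Y m]
        by (simp add: fcobd_def single_def rank_one_def Y.smult_closed a_minus_def)
    next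
      case 2
      then have n: "n = j + 1" by simp
      show ?thesis
        using x dx m Pd_closed[OF \<xi>] z[of j] unfolding n
        by (simp add: fcobd_def single_def rank_one_def Y.smult_closed a_minus_def Y.M.l_neg)
    next
      case 3
      then show ?thesis
        using x dx z[of j] by (simp add: fcobd_def single_def a_minus_def)
    qed
  qed (auto simp: fcobd_def crestrict_def single_def rank_one_def)
qed

text \<open>The trace of the composite of \<open>F\<close> and \<open>f\<close>. For linear
  \<open>F\<close>, the choice is unique because rank one maps generate \<open>C0\<close>; only the
  values on them are ever used.\<close>

definition pairing :: "(int \<Rightarrow> 'y \<Rightarrow> 't) \<Rightarrow> (int \<Rightarrow> 'p \<Rightarrow> 'y) \<Rightarrow> 'e"
  where "pairing F = (SOME \<theta>. \<theta> \<in> module_homs k C0 E \<and>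
    (\<forall>n. \<forall>\<xi>\<in>Pd n. \<forall>m\<in>carrier (cobj Y n). \<theta> (s0 n \<xi> m) = \<tau> n (F n m) \<xi>))"

lemma pairing_spec:
  assumes "\<And>n. lin \<Lambda> (cobj Y n) (cobj T n) (F n)"
  shows "pairing F \<in> module_homs k C0 E"
    and "\<xi> \<in> Pd n \<Longrightarrow> m \<in> carrier (cobj Y n) \<Longrightarrow> pairing F (s0 n \<xi> m) = \<tau> n (F n m) \<xi>"
proof -
  have "\<exists>\<theta>. \<theta> \<in> module_homs k C0 E \<and>
    (\<forall>n. \<forall>\<xi>\<in>Pd n. \<forall>m\<in>carrier (cobj Y n). \<theta> (s0 n \<xi> m) = \<tau> n (F n m) \<xi>)"
    using D0.fin_functional_ex[OF assms] unfolding Bex_def .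
  then have "pairing F \<in> module_homs k C0 E \<and>
    (\<forall>n. \<forall>\<xi>\<in>Pd n. \<forall>m\<in>carrier (cobj Y n). pairing F (s0 n \<xi> m) = \<tau> n (F n m) \<xi>)"
    unfolding pairing_def by (rule someI_ex)
  then show "pairing F \<in> module_homs k C0 E"
    and "\<xi> \<in> Pd n \<Longrightarrow> m \<in> carrier (cobj Y n) \<Longrightarrow> pairing F (s0 n \<xi> m) = \<tau> n (F n m) \<xi>" by auto
qed

lemma pairing_eqI:
  assumes "\<And>n. lin \<Lambda> (cobj Y n) (cobj T n) (F n)" "lin k C0 E \<theta>"
    and "\<And>n \<xi> m. \<xi> \<in> Pd n \<Longrightarrow> m \<in> carrier (cobj Y n) \<Longrightarrow> \<theta> (s0 n \<xi> m) = \<tau> n (F n m) \<xi>"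
    and "f \<in> carrier C0"
  shows "pairing F f = \<theta> f"
  by (rule D0.fin_functional_eqI[OF module_homs_lin[OF pairing_spec(1)] assms(2)])
    (use assms pairing_spec(2)[of F] in \<open>simp_all del: fin_homs_simps\<close>)

lemma pairing_closed: "(\<And>n. lin \<Lambda> (cobj Y n) (cobj T n) (F n)) \<Longrightarrow> f \<in> carrier C0 \<Longrightarrow> pairing F f \<in> carrier E"
  by (rule module_homsD(1)[OF pairing_spec(1)])

lemma \<tau>_closed: "t \<in> carrier (cobj T n) \<Longrightarrow> \<xi> \<in> Pd n \<Longrightarrow> \<tau> n t \<xi> \<in> carrier E"
  using module_homsD(1)[OF representsD(2)[OF rep]] by simp

text \<open>On generators, \<open>F\<close> being a chain map turns the first term of
  \<open>fbd_single\<close> into \<open>\<tau>\<close> of a differential of \<open>T\<close>, which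
  by \<open>\<tau>_cdiff\<close> is the negative of the second term.\<close>

lemma pairing_fbd:
  assumes F: "cmap \<Lambda> Y T F" and h: "h \<in> carrier Cm"
  shows "pairing F (fbd h) = \<zero>\<^bsub>E\<^esub>"
proof -
  note \<theta> = pairing_spec[of F, OF cmapD(1)[OF F]]
  show ?thesis
  proof (rule Dm.fin_functional_eqI[OF lin_comp[OF lin_fbd module_homs_lin[OF \<theta>(1)]] lin_const_zero[OF E'] _ h])
    fix i \<xi> m assume \<xi>: "\<xi> \<in> Pd i" and m: "m \<in> carrier (cobj Y (i - 1))"
    \<comment> \<open>A family of degree -1 has values at \<open>i\<close> in \<open>Y\<close> of
      degree \<open>i - 1\<close>. Writing \<open>i\<close> as \<open>n + 1\<close> brings this into
      the form of \<open>fbd_single\<close>.\<close>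
    define n where "n = i - 1"
    have i: "i = n + 1" by (simp add: n_def)
    have \<xi>: "\<xi> \<in> Pd (n + 1)" and m: "m \<in> carrier (cobj Y n)" using \<xi> m by (simp_all add: i)
    have dm: "cdiff Y n m \<in> carrier (cobj Y (n + 1))" by (rule cdiff_closed(1)[OF Y m])
    have Fm: "F n m \<in> carrier (cobj T n)" by (rule cmapD(4)[OF F m])
    have "pairing F (fbd (sm (n + 1) \<xi> m)) = pairing F (s0 (n + 1) \<xi> (cdiff Y n m)) \<oplus>\<^bsub>E\<^esub> pairing F (s0 n (dual_d n \<xi>) m)"
      unfolding fbd_single[OF \<xi> m]
      by (rule module_homsD(2)[OF \<theta>(1) D0.rank_one_closed[OF \<xi> dm] D0.rank_one_closed[OF dual_d_closed[OF \<xi>] m]])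
    also have "\<dots> = \<tau> (n + 1) (F (n + 1) (cdiff Y n m)) \<xi> \<oplus>\<^bsub>E\<^esub> \<tau> n (F n m) (dual_d n \<xi>)"
      by (simp only: \<theta>(2)[OF \<xi> dm] \<theta>(2)[OF dual_d_closed[OF \<xi>] m])
    also have "F (n + 1) (cdiff Y n m) = cdiff T n (F n m)" by (rule cmapD(2)[OF F m])
    also have "\<tau> (n + 1) (cdiff T n (F n m)) \<xi> = \<ominus>\<^bsub>E\<^esub> \<tau> n (F n m) (dual_d n \<xi>)" by (rule \<tau>_cdiff[OF Fm \<xi>])
    finally show "pairing F (fbd (sm i \<xi> m)) = \<zero>\<^bsub>E\<^esub>"
      unfolding i E.M.l_neg[OF \<tau>_closed[OF Fm dual_d_closed[OF \<xi>]]] .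
  qed
qed

text \<open>A functional on \<open>Cp\<close> is represented by maps \<open>G n\<close> from
  \<open>Y\<close> in degree \<open>n + 1\<close> to \<open>T\<close> in degree \<open>n\<close>,
  that is, by a homotopy. Composing the functional with \<open>fcobd\<close> yields the functional
  of the map that this homotopy bounds.\<close>

lemma functional_fcobd:
  assumes \<eta>: "lin k Cp E \<eta>" and G: "\<And>n. lin \<Lambda> (cobj Y (n + 1)) (cobj T n) (G n)"
    and \<eta>G: "\<And>n \<xi> m. \<xi> \<in> Pd n \<Longrightarrow> m \<in> carrier (cobj Y (n + 1)) \<Longrightarrow> \<eta> (sp n \<xi> m) = \<tau> n (G n m) \<xi>"
    and \<xi>: "\<xi> \<in> Pd n" and m: "m \<in> carrier (cobj Y n)"
  shows "\<eta> (fcobd (s0 n \<xi> m)) = \<tau> n (cdiff T (n - 1) (G (n - 1) m) \<oplus>\<^bsub>cobj T n\<^esub> G n (cdiff Y n m)) \<xi>"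
proof -
  have \<xi>': "dual_d (n - 1) \<xi> \<in> Pd (n - 1)" using dual_d_closed[of \<xi> "n - 1"] \<xi> by simp
  have m': "m \<in> carrier (cobj Y (n - 1 + 1))" using m by simp
  have dm: "cdiff Y n m \<in> carrier (cobj Y (n + 1))" by (rule cdiff_closed(1)[OF Y m])
  have Gm: "G (n - 1) m \<in> carrier (cobj T (n - 1))" using lin_closed[OF G m'] .
  have Gdm: "G n (cdiff Y n m) \<in> carrier (cobj T n)" using lin_closed[OF G dm] .
  have fc: "fcobd (s0 n \<xi> m) \<in> carrier Cp" by (rule lin_closed[OF lin_fcobd D0.rank_one_closed[OF \<xi> m]])
  have sc: "sp (n - 1) (dual_d (n - 1) \<xi>) m \<in> carrier Cp" by (rule Dp.rank_one_closed[OF \<xi>' m'])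
  have "\<eta> (fcobd (s0 n \<xi> m)) \<oplus>\<^bsub>E\<^esub> \<eta> (sp (n - 1) (dual_d (n - 1) \<xi>) m) = \<eta> (sp n \<xi> (cdiff Y n m))"
    using lin_add[OF \<eta> fc sc] fcobd_single[OF \<xi> m] by simp
  then have eq: "\<eta> (fcobd (s0 n \<xi> m)) \<oplus>\<^bsub>E\<^esub> \<tau> (n - 1) (G (n - 1) m) (dual_d (n - 1) \<xi>) = \<tau> n (G n (cdiff Y n m)) \<xi>"
    using \<eta>G[OF \<xi>' m'] \<eta>G[OF \<xi> dm] by simp
  have td: "\<tau> n (cdiff T (n - 1) (G (n - 1) m)) \<xi> = \<ominus>\<^bsub>E\<^esub> \<tau> (n - 1) (G (n - 1) m) (dual_d (n - 1) \<xi>)"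
    using \<tau>_cdiff[OF Gm, of \<xi>] \<xi> by simp
  have c: "\<eta> (fcobd (s0 n \<xi> m)) \<in> carrier E" "\<tau> (n - 1) (G (n - 1) m) (dual_d (n - 1) \<xi>) \<in> carrier E"
    using lin_closed[OF \<eta> fc] \<tau>_closed[OF Gm \<xi>'] .
  have "\<tau> n (cdiff T (n - 1) (G (n - 1) m) \<oplus>\<^bsub>cobj T n\<^esub> G n (cdiff Y n m)) \<xi> =
      \<tau> n (cdiff T (n - 1) (G (n - 1) m)) \<xi> \<oplus>\<^bsub>E\<^esub> \<tau> n (G n (cdiff Y n m)) \<xi>"
    by (rule representsD(3)[OF rep cdiff_closed(2)[OF T Gm] Gdm \<xi>])
  then show ?thesis
    unfolding td eq[symmetric] using c by (simp add: E.add_left_comm E.M.l_neg)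
qed

text \<open>By \<open>functional_fcobd\<close>, the functional of a null homotopic map factors
  through \<open>fcobd\<close>, so it vanishes on the kernel.\<close>

lemma pairing_null:
  assumes H: "hfam \<Lambda> Y T H" and F: "\<And>n. lin \<Lambda> (cobj Y n) (cobj T n) (F n)"
    and FH: "\<And>n m. m \<in> carrier (cobj Y n) \<Longrightarrow> F n m = hbd Y T H n m"
    and f: "f \<in> carrier C0" and f0: "fcobd f = \<zero>\<^bsub>Cp\<^esub>"
  shows "pairing F f = \<zero>\<^bsub>E\<^esub>"
proof -
  obtain \<eta> where \<eta>: "\<eta> \<in> module_homs k Cp E"
    "\<And>n \<xi> m. \<xi> \<in> Pd n \<Longrightarrow> m \<in> carrier (cobj Y (n + 1)) \<Longrightarrow> \<eta> (sp n \<xi> m) = \<tau> n (H (n + 1) m) \<xi>"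
    using Dp.fin_functional_ex[of "\<lambda>n. H (n + 1)"] hfamD(2)[OF H] by blast
  have "pairing F f = \<eta> (fcobd f)"
  proof (rule pairing_eqI[OF F lin_comp[OF lin_fcobd module_homs_lin[OF \<eta>(1)]] _ f])
    fix n \<xi> m assume \<xi>: "\<xi> \<in> Pd n" and m: "m \<in> carrier (cobj Y n)"
    show "\<eta> (fcobd (s0 n \<xi> m)) = \<tau> n (F n m) \<xi>"
      using functional_fcobd[OF module_homs_lin[OF \<eta>(1)], of "\<lambda>n. H (n + 1)", OF hfamD(2)[OF H] \<eta>(2) \<xi> m] FH[OF m]
      by (simp add: hbd_def)
  qed
  then show ?thesis using f0 module_homs_zero[OF Dp.F.right_module_axioms E' \<eta>(1)] by simp
qed

text \<open>A functional that kills the kernel of \<open>fcobd\<close> factors through its image,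
  and injectivity of \<open>E\<close> extends it to \<open>Cp\<close>. The extension is represented
  by a homotopy, which bounds \<open>F\<close> by \<open>functional_fcobd\<close>.\<close>

lemma pairing_zero_imp_null:
  assumes F: "\<And>n. lin \<Lambda> (cobj Y n) (cobj T n) (F n)"
    and zero: "\<And>f. f \<in> carrier C0 \<Longrightarrow> fcobd f = \<zero>\<^bsub>Cp\<^esub> \<Longrightarrow> pairing F f = \<zero>\<^bsub>E\<^esub>"
  shows "\<exists>H. hfam \<Lambda> Y T H \<and> (\<forall>n. \<forall>m\<in>carrier (cobj Y n). F n m = hbd Y T H n m)"
proof -
  obtain \<eta> where \<eta>: "\<eta> \<in> module_homs k Cp E" "\<And>f. f \<in> carrier C0 \<Longrightarrow> \<eta> (fcobd f) = pairing F f"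
    using injective_module_factor[OF E D0.F.right_module_axioms Dp.F.right_module_axioms lin_fcobd
        module_homs_lin[OF pairing_spec(1)[OF F]] zero] by blast
  obtain G where G: "\<And>n. lin \<Lambda> (cobj Y (n + 1)) (cobj T n) (G n)"
    "\<And>n \<xi> m. \<xi> \<in> Pd n \<Longrightarrow> m \<in> carrier (cobj Y (n + 1)) \<Longrightarrow> \<eta> (sp n \<xi> m) = \<tau> n (G n m) \<xi>"
    using Dp.fin_functional_repr[OF module_homs_lin[OF \<eta>(1)]] by blast
  \<comment> \<open>The representing maps raise no index but start one degree higher in
    \<open>Y\<close>; as a homotopy they are therefore numbered by \<open>n - 1\<close>.\<close>
  have H: "hfam \<Lambda> Y T (\<lambda>n. G (n - 1))"
    unfolding hfam_def using G(1)[of "_ - 1"] by simp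
  moreover have "F n m = hbd Y T (\<lambda>n. G (n - 1)) n m" if m: "m \<in> carrier (cobj Y n)" for n m
  proof (rule represents_eqI[OF rep lin_closed[OF F m] lin_closed[OF hbd_lin[OF Y T H] m]])
    fix \<xi> assume \<xi>: "\<xi> \<in> Pd n"
    show "\<tau> n (F n m) \<xi> = \<tau> n (hbd Y T (\<lambda>n. G (n - 1)) n m) \<xi>"
      using functional_fcobd[OF module_homs_lin[OF \<eta>(1)] G \<xi> m] \<eta>(2)[OF D0.rank_one_closed[OF \<xi> m]]
        pairing_spec(2)[of F, OF F \<xi> m] by (simp add: hbd_def)
  qed
  ultimately show ?thesis by blast
qed

text \<open>A functional on \<open>C0\<close> is represented by a family \<open>F\<close> in any
  case. Its vanishing on the boundaries of rank one maps says, after pairing with every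
  \<open>\<xi>\<close>, that \<open>F\<close> commutes with the differentials.\<close>

lemma pairing_surj:
  assumes \<theta>: "lin k C0 E \<theta>" and zero: "\<And>h. h \<in> carrier Cm \<Longrightarrow> \<theta> (fbd h) = \<zero>\<^bsub>E\<^esub>"
  shows "\<exists>F. cmap \<Lambda> Y T F \<and> (\<forall>f\<in>carrier C0. pairing F f = \<theta> f)"
proof -
  obtain F where F: "\<And>n. lin \<Lambda> (cobj Y n) (cobj T n) (F n)"
    "\<And>n \<xi> m. \<xi> \<in> Pd n \<Longrightarrow> m \<in> carrier (cobj Y n) \<Longrightarrow> \<theta> (s0 n \<xi> m) = \<tau> n (F n m) \<xi>"
    using D0.fin_functional_repr[OF \<theta>] by blast
  have "cmap \<Lambda> Y T F"
  proof (rule cmapI[OF F(1)])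
    fix n m assume m: "m \<in> carrier (cobj Y n)"
    have dm: "cdiff Y n m \<in> carrier (cobj Y (n + 1))" by (rule cdiff_closed(1)[OF Y m])
    have Fm: "F n m \<in> carrier (cobj T n)" by (rule lin_closed[OF F(1) m])
    show "F (n + 1) (cdiff Y n m) = cdiff T n (F n m)"
    proof (rule represents_eqI[OF rep lin_closed[OF F(1) dm] cdiff_closed(1)[OF T Fm]])
      fix \<xi> assume \<xi>: "\<xi> \<in> Pd (n + 1)"
      note d\<xi> = dual_d_closed[OF \<xi>]
      have "m \<in> carrier (cobj Y (n + 1 - 1))" using m by simp
      from zero[OF Dm.rank_one_closed[OF \<xi> this]]
      have "\<theta> (s0 (n + 1) \<xi> (cdiff Y n m) \<oplus>\<^bsub>C0\<^esub> s0 n (dual_d n \<xi>) m) = \<zero>\<^bsub>E\<^esub>"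
        unfolding fbd_single[OF \<xi> m, symmetric] .
      then have "\<tau> (n + 1) (F (n + 1) (cdiff Y n m)) \<xi> \<oplus>\<^bsub>E\<^esub> \<tau> n (F n m) (dual_d n \<xi>) = \<zero>\<^bsub>E\<^esub>"
        using lin_add[OF \<theta> D0.rank_one_closed[OF \<xi> dm] D0.rank_one_closed[OF d\<xi> m]] F(2)[OF \<xi> dm] F(2)[OF d\<xi> m] by simp
      then have "\<ominus>\<^bsub>E\<^esub> \<tau> n (F n m) (dual_d n \<xi>) = \<tau> (n + 1) (F (n + 1) (cdiff Y n m)) \<xi>"
        by (rule E.M.minus_equality[OF _ \<tau>_closed[OF Fm d\<xi>] \<tau>_closed[OF lin_closed[OF F(1) dm] \<xi>]])
      then show "\<tau> (n + 1) (F (n + 1) (cdiff Y n m)) \<xi> = \<tau> (n + 1) (cdiff T n (F n m)) \<xi>"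
        using \<tau>_cdiff[OF Fm \<xi>] by simp
    qed
  qed
  moreover have "pairing F f = \<theta> f" if "f \<in> carrier C0" for f
    by (rule pairing_eqI[OF F(1) \<theta> F(2) that])
  ultimately show ?thesis by blast
qed

lemma pairing_add:
  assumes F: "\<And>n. lin \<Lambda> (cobj Y n) (cobj T n) (F n)" and F': "\<And>n. lin \<Lambda> (cobj Y n) (cobj T n) (F' n)"
    and F'': "\<And>n. lin \<Lambda> (cobj Y n) (cobj T n) (F'' n)"
    and eq: "\<And>n m. m \<in> carrier (cobj Y n) \<Longrightarrow> F'' n m = F n m \<oplus>\<^bsub>cobj T n\<^esub> F' n m"
    and f: "f \<in> carrier C0"
  shows "pairing F'' f = pairing F f \<oplus>\<^bsub>E\<^esub> pairing F' f"
  by (rule pairing_eqI[OF F'' lin_plus[OF E' module_homs_lin[OF pairing_spec(1)[OF F]] module_homs_lin[OF pairing_spec(1)[OF F']]] _ f])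
    (simp add: pairing_spec(2)[of F, OF F] pairing_spec(2)[of F', OF F'] eq representsD(3)[OF rep] lin_closed[OF F] lin_closed[OF F'])

lemma pairing_scalar:
  assumes F: "\<And>n. lin \<Lambda> (cobj Y n) (cobj T n) (F n)" and F'': "\<And>n. lin \<Lambda> (cobj Y n) (cobj T n) (F'' n)"
    and a: "a \<in> carrier k"
    and eq: "\<And>n m. m \<in> carrier (cobj Y n) \<Longrightarrow> F'' n m = scalar a \<odot>\<^bsub>cobj T n\<^esub> F n m"
    and f: "f \<in> carrier C0"
  shows "pairing F'' f = a \<odot>\<^bsub>E\<^esub> pairing F f"
proof (rule pairing_eqI[OF F'' _ _ f])
  have "lin k E E (\<lambda>x. a \<odot>\<^bsub>E\<^esub> x)"
    using a E.smult_assoc[of a _] E.smult_assoc[of _ a]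
    by (intro linI) (auto simp: E.smult_closed E.smult_r_distr base.m_comm)
  then show "lin k C0 E (\<lambda>f. a \<odot>\<^bsub>E\<^esub> pairing F f)"
    by (rule lin_comp[OF module_homs_lin[OF pairing_spec(1)[OF F]]])
  show "a \<odot>\<^bsub>E\<^esub> pairing F (s0 n \<xi> m) = \<tau> n (F'' n m) \<xi>" if "\<xi> \<in> Pd n" "m \<in> carrier (cobj Y n)" for n \<xi> m
    using that a by (simp add: pairing_spec(2)[of F, OF F] eq represents_scalar[OF rep P.right_module_axioms] lin_closed[OF F])
qed

end

lemma finite_supp_bounded:
  fixes A :: "int \<Rightarrow> ('r, 'm) module"
  assumes A: "\<And>n. right_module R (A n)" and B: "\<And>n. right_module R (B n)"
    and h: "\<And>n. lin R (A n) (B n) (h n)"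
    and below: "\<And>n x. n < N \<Longrightarrow> x \<in> carrier (A n) \<Longrightarrow> h n x = \<zero>\<^bsub>B n\<^esub>"
    and above: "\<And>n. n > M \<Longrightarrow> zero_module (A n)"
  shows "finite (supp A B h)"
proof (rule finite_subset)
  show "supp A B h \<subseteq> {N..M}"
  proof (rule subsetI, rule ccontr)
    fix n assume "n \<in> supp A B h" and n: "n \<notin> {N..M}"
    then obtain x where x: "x \<in> carrier (A n)" "h n x \<noteq> \<zero>\<^bsub>B n\<^esub>" by (auto simp: supp_def)
    have "n > M" using n below x by fastforce
    then have "x = \<zero>\<^bsub>A n\<^esub>" using above x(1) by (auto simp: zero_module_def)
    then show False using x(2) lin_zero[OF A B h] by simp
  qed
qed simp

section \<open>The trace pairing along a resolution\<close>

locale dual_resolution = dual_complex k \<Lambda> E P Y T \<tau>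
  for k :: "('k, 'c) ring_scheme" and \<Lambda> :: "('k, 'r) module"
    and E :: "('k, 'e) module" and P :: "('r, 'p) cochain_complex" and Y :: "('r, 'y) cochain_complex"
    and T :: "('r, 't) cochain_complex" and \<tau> :: "int \<Rightarrow> 't \<Rightarrow> ('p \<Rightarrow> 'r) \<Rightarrow> 'e" +
  fixes X :: "('r, 'x) cochain_complex" and u :: "int \<Rightarrow> 'p \<Rightarrow> 'x"
  assumes Y_inj: "inj_complex \<Lambda> Y" and X: "is_complex \<Lambda> X"
    and X_below: "\<exists>N. \<forall>n<N. zero_module (cobj X n)" and P_above: "\<exists>N. \<forall>n>N. zero_module (cobj P n)"
    and u: "cmap \<Lambda> P X u" and u_inj: "cohomology_inj P X u" and u_surj: "cohomology_surj P X u"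
begin

sublocale X: right_module \<Lambda> "cobj X n" for n by (rule complexD(1)[OF X])

abbreviation pull :: "(int \<Rightarrow> 'x \<Rightarrow> 'y) \<Rightarrow> int \<Rightarrow> 'p \<Rightarrow> 'y" where "pull f \<equiv> chain_comp P f u"

lemma pull_apply: "x \<in> carrier (cobj P n) \<Longrightarrow> pull f n x = f n (u n x)"
  by (simp add: chain_comp_def)

lemma C0_bounded:
  assumes f: "f \<in> carrier C0"
  shows "\<exists>N. \<forall>n<N. \<forall>x\<in>carrier (cobj P n). f n x = \<zero>\<^bsub>cobj Y n\<^esub>"
proof -
  have "bdd_below (supp (cobj P) (cobj Y) f)" by (rule bdd_below_finite) (use f in simp)
  then obtain N where "\<And>n. n \<in> supp (cobj P) (cobj Y) f \<Longrightarrow> N \<le> n" unfolding bdd_below_def by blast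
  then show ?thesis using supp_zero[of _ "cobj P" "cobj Y" f] by (intro exI[of _ N]) force
qed

lemma pull_chain_maps: "f \<in> chain_maps \<Lambda> X Y \<Longrightarrow> pull f \<in> chain_maps \<Lambda> P Y"
  unfolding chain_comp_crestrict by (intro crestrict_chain_maps[OF P] cmap_comp[OF u] chain_maps_cmap)

lemma pull_C0:
  assumes f: "f \<in> chain_maps \<Lambda> X Y" shows "pull f \<in> carrier C0"
proof -
  obtain N M where N: "\<And>n. n < N \<Longrightarrow> zero_module (cobj X n)" and M: "\<And>n. n > M \<Longrightarrow> zero_module (cobj P n)"
    using X_below P_above by blast
  note pf = pull_chain_maps[OF f] and fc = chain_maps_cmap[OF f]
  have "finite (supp (cobj P) (cobj Y) (pull f))"
  proof (rule finite_supp_bounded[OF P.right_module_axioms Y.right_module_axioms cmapD(1)[OF chain_maps_cmap[OF pf]] _ M])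
    fix n x assume n: "n < N" and x: "x \<in> carrier (cobj P n)"
    then have "u n x = \<zero>\<^bsub>cobj X n\<^esub>" using N[OF n] cmapD(4)[OF u x] by (auto simp: zero_module_def)
    then show "pull f n x = \<zero>\<^bsub>cobj Y n\<^esub>"
      using lin_zero[OF X.right_module_axioms Y.right_module_axioms cmapD(1)[OF fc]] pull_apply[OF x] by simp
  qed
  then show ?thesis using chain_maps_homs[OF pf] by simp
qed

lemma fcobd_chain_maps:
  assumes "f \<in> chain_maps \<Lambda> P Y" shows "fcobd f = \<zero>\<^bsub>Cp\<^esub>"
  using cmapD(2,4)[OF chain_maps_cmap[OF assms]] cdiff_closed(1)[OF Y]
  by (auto simp: fcobd_def crestrict_def fun_eq_iff a_minus_def Y.M.r_neg)

lemma fcobd_zero_imp: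
  assumes f: "f \<in> carrier C0" and z: "fcobd f = \<zero>\<^bsub>Cp\<^esub>" shows "f \<in> chain_maps \<Lambda> P Y"
proof -
  have "f (n + 1) (cdiff P n x) = cdiff Y n (f n x)" if x: "x \<in> carrier (cobj P n)" for n x
  proof -
    have "cdiff Y n (f n x) \<ominus>\<^bsub>cobj Y (n + 1)\<^esub> f (n + 1) (cdiff P n x) = \<zero>\<^bsub>cobj Y (n + 1)\<^esub>"
      using fun_cong[OF fun_cong[OF z, of n], of x] x by (simp add: fcobd_def)
    then show ?thesis
      using Y.diff_eq_zero_iff cdiff_closed(1)[OF Y fin_homs_closed[OF f x]]
        fin_homs_closed[OF f cdiff_closed(1)[OF P x]] by simp
  qed
  then show ?thesis using f by (simp add: chain_maps_def)
qed

text \<open>The homotopy vanishes below \<open>N\<close>, and \<open>P\<close> vanishes in large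
  degrees. So the homotopy lies in \<open>Cm\<close>, and the two families differ by a boundary,
  which \<open>pairing_fbd\<close> kills. For a homotopy without finite support this argument would
  break down.\<close>

lemma pairing_homotopic:
  assumes F: "cmap \<Lambda> Y T F" and f: "f \<in> carrier C0" and g: "g \<in> carrier C0" and a: "hfam \<Lambda> P Y a"
    and a0: "\<And>n x. n < N \<Longrightarrow> x \<in> carrier (cobj P n) \<Longrightarrow> a n x = \<zero>\<^bsub>cobj Y (n - 1)\<^esub>"
    and fg: "\<And>n x. x \<in> carrier (cobj P n) \<Longrightarrow> f n x = g n x \<oplus>\<^bsub>cobj Y n\<^esub> hbd P Y a n x"
  shows "pairing F f = pairing F g"
proof -
  obtain M where M: "\<And>n. n > M \<Longrightarrow> zero_module (cobj P n)" using P_above by blast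
  let ?a = "crestrict P a"
  have "finite (supp (cobj P) (\<lambda>n. cobj Y (n - 1)) a)"
    by (rule finite_supp_bounded[OF P.right_module_axioms Y.right_module_axioms hfamD(1)[OF a] a0 M])
  moreover have "supp (cobj P) (\<lambda>n. cobj Y (n - 1)) ?a = supp (cobj P) (\<lambda>n. cobj Y (n - 1)) a"
    by (auto simp: supp_def)
  ultimately have ac: "?a \<in> carrier Cm"
    using restrict_module_homs[OF P.right_module_axioms hfamD(1)[OF a]] by (simp add: crestrict_def)
  have "f = g \<oplus>\<^bsub>C0\<^esub> fbd ?a"
  proof (intro ext)
    fix n x
    show "f n x = (g \<oplus>\<^bsub>C0\<^esub> fbd ?a) n x"
    proof (cases "x \<in> carrier (cobj P n)")
      case True
      then show ?thesis using fg[OF True] cdiff_closed(1)[OF P True] by (simp add: fbd_def hbd_def)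
    next
      case False
      have "f n \<in> module_homs \<Lambda> (cobj P n) (cobj Y n)" using f by simp
      then show ?thesis using module_homs_ext[OF _ False] False by simp
    qed
  qed
  then have "pairing F f = pairing F g \<oplus>\<^bsub>E\<^esub> pairing F (fbd ?a)"
    using module_homsD(2)[OF pairing_spec(1) g lin_closed[OF lin_fbd ac]] cmapD(1)[OF F] by simp
  then show ?thesis using pairing_fbd[OF F ac] pairing_closed[OF cmapD(1)[OF F] g] by simp
qed

lemma pairing_pull_homotopic:
  assumes F: "cmap \<Lambda> Y T F" and f: "f \<in> chain_maps \<Lambda> X Y" and g: "g \<in> chain_maps \<Lambda> X Y"
    and fg: "homotopic \<Lambda> X Y f g"
  shows "pairing F (pull f) = pairing F (pull g)"
proof -
  obtain h where h: "hfam \<Lambda> X Y h" "\<And>n x. x \<in> carrier (cobj X n) \<Longrightarrow> f n x = g n x \<oplus>\<^bsub>cobj Y n\<^esub> hbd X Y h n x"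
    using fg unfolding homotopic_def by blast
  obtain N where N: "\<And>n. n < N \<Longrightarrow> zero_module (cobj X n)" using X_below by blast
  show ?thesis
  \<comment> \<open>A homotopy that passes through \<open>X\<close> vanishes wherever
    \<open>X\<close> does, which supplies the bound.\<close>
  proof (rule pairing_homotopic[OF F pull_C0[OF f] pull_C0[OF g] hfam_pre[OF h(1) u], of N])
    fix n x assume n: "n < N" and x: "x \<in> carrier (cobj P n)"
    have "u n x = \<zero>\<^bsub>cobj X n\<^esub>" using N[OF n] cmapD(4)[OF u x] by (auto simp: zero_module_def)
    then show "h n (u n x) = \<zero>\<^bsub>cobj Y (n - 1)\<^esub>"
      using lin_zero[OF X.right_module_axioms Y.right_module_axioms hfamD(1)[OF h(1)]] by simp
  next
    fix n x assume x: "x \<in> carrier (cobj P n)"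
    show "pull f n x = pull g n x \<oplus>\<^bsub>cobj Y n\<^esub> hbd P Y (\<lambda>n x. h n (u n x)) n x"
      using h(2)[OF cmapD(4)[OF u x]] hbd_pre[OF h(1) u x] pull_apply[OF x] by simp
  qed
qed

lemma pairing_homotopic_left:
  assumes F: "cmap \<Lambda> Y T F" and F': "cmap \<Lambda> Y T F'" and h: "homotopic \<Lambda> Y T F F'" and f: "f \<in> chain_maps \<Lambda> X Y"
  shows "pairing F (pull f) = pairing F' (pull f)"
proof -
  obtain H where H: "hfam \<Lambda> Y T H" "\<And>n x. x \<in> carrier (cobj Y n) \<Longrightarrow> F n x = F' n x \<oplus>\<^bsub>cobj T n\<^esub> hbd Y T H n x"
    using h unfolding homotopic_def by blast
  note l = hbd_lin[OF Y T H(1)] and c = pull_C0[OF f]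
  have "pairing F (pull f) = pairing F' (pull f) \<oplus>\<^bsub>E\<^esub> pairing (hbd Y T H) (pull f)"
    by (rule pairing_add[OF cmapD(1)[OF F'] l cmapD(1)[OF F] H(2) c])
  also have "pairing (hbd Y T H) (pull f) = \<zero>\<^bsub>E\<^esub>"
    by (rule pairing_null[OF H(1) l refl c fcobd_chain_maps[OF pull_chain_maps[OF f]]])
  finally show ?thesis using pairing_closed[OF cmapD(1)[OF F'] c] by simp
qed

text \<open>Kernel elements of \<open>fcobd\<close> are chain maps from \<open>P\<close> to
  \<open>Y\<close>. By \<open>homotopy_factor\<close> each of them is, up to a homotopy that
  vanishes in small degrees, pulled back from \<open>X\<close>. So it suffices to know the pairing
  on pulled back maps.\<close>

lemma pairing_detects_null:
  assumes F: "cmap \<Lambda> Y T F" and zero: "\<And>f. f \<in> chain_maps \<Lambda> X Y \<Longrightarrow> pairing F (pull f) = \<zero>\<^bsub>E\<^esub>"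
  shows "\<exists>H. hfam \<Lambda> Y T H \<and> (\<forall>n. \<forall>m\<in>carrier (cobj Y n). F n m = hbd Y T H n m)"
proof (rule pairing_zero_imp_null[OF cmapD(1)[OF F]])
  fix f assume f: "f \<in> carrier C0" and "fcobd f = \<zero>\<^bsub>Cp\<^esub>"
  then have fc: "cmap \<Lambda> P Y f" using chain_maps_cmap fcobd_zero_imp by blast
  obtain N where N: "\<And>n x. n < N \<Longrightarrow> x \<in> carrier (cobj P n) \<Longrightarrow> f n x = \<zero>\<^bsub>cobj Y n\<^esub>"
    using C0_bounded[OF f] by blast
  obtain g a where g: "cmap \<Lambda> X Y g" and a: "hfam \<Lambda> P Y a"
    "\<And>n x. n \<le> N \<Longrightarrow> x \<in> carrier (cobj P n) \<Longrightarrow> a n x = \<zero>\<^bsub>cobj Y (n - 1)\<^esub>"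
    "\<And>n x. x \<in> carrier (cobj P n) \<Longrightarrow> f n x = g n (u n x) \<oplus>\<^bsub>cobj Y n\<^esub> hbd P Y a n x"
    using homotopy_factor[OF P X Y_inj u u_inj u_surj fc N] by blast
  have g': "crestrict X g \<in> chain_maps \<Lambda> X Y" by (rule crestrict_chain_maps[OF X g])
  have "pairing F f = pairing F (pull (crestrict X g))"
    by (rule pairing_homotopic[OF F f pull_C0[OF g'] a(1), of N])
      (use a(2,3) cmapD(4)[OF u] in \<open>simp_all add: pull_apply\<close>)
  then show "pairing F f = \<zero>\<^bsub>E\<^esub>" using zero[OF g'] by simp
qed

lemma pairing_pull_add:
  assumes F: "cmap \<Lambda> Y T F" and f: "f \<in> chain_maps \<Lambda> X Y" and g: "g \<in> chain_maps \<Lambda> X Y"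
  shows "pairing F (pull (f \<oplus>\<^bsub>chain_map_module \<Lambda> X Y\<^esub> g)) = pairing F (pull f) \<oplus>\<^bsub>E\<^esub> pairing F (pull g)"
proof -
  have "pull (f \<oplus>\<^bsub>chain_map_module \<Lambda> X Y\<^esub> g) = pull f \<oplus>\<^bsub>C0\<^esub> pull g"
    using cmapD(4)[OF u] by (auto simp: chain_comp_def fun_eq_iff)
  then show ?thesis
    using module_homsD(2)[OF pairing_spec(1) pull_C0[OF f] pull_C0[OF g]] cmapD(1)[OF F] by simp
qed

lemma pairing_pull_smult:
  assumes F: "cmap \<Lambda> Y T F" and f: "f \<in> chain_maps \<Lambda> X Y" and a: "a \<in> carrier k"
  shows "pairing F (pull (a \<odot>\<^bsub>chain_map_module \<Lambda> X Y\<^esub> f)) = a \<odot>\<^bsub>E\<^esub> pairing F (pull f)"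
proof -
  have "pull (a \<odot>\<^bsub>chain_map_module \<Lambda> X Y\<^esub> f) = a \<odot>\<^bsub>C0\<^esub> pull f"
    using cmapD(4)[OF u] by (auto simp: chain_comp_def fun_eq_iff scalar_def)
  then show ?thesis
    using module_homsD(3)[OF pairing_spec(1) a pull_C0[OF f]] cmapD(1)[OF F] by simp
qed

lemma pull_eq: "f \<in> chain_maps \<Lambda> X Y \<Longrightarrow> g \<in> chain_maps \<Lambda> X Y \<Longrightarrow>
    pull (f \<oplus>\<^bsub>chain_map_module \<Lambda> X Y\<^esub> g) = pull f \<oplus>\<^bsub>C0\<^esub> pull g"
  "a \<in> carrier k \<Longrightarrow> f \<in> chain_maps \<Lambda> X Y \<Longrightarrow> pull (a \<odot>\<^bsub>chain_map_module \<Lambda> X Y\<^esub> f) = a \<odot>\<^bsub>C0\<^esub> pull f"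
  using cmapD(4)[OF u] by (auto simp: chain_comp_def fun_eq_iff scalar_def)

text \<open>A representative of the class is chosen; by \<open>pairing_pull_homotopic\<close> its
  choice has no influence when \<open>F\<close> is a chain map.\<close>

definition trace_functional :: "(int \<Rightarrow> 'y \<Rightarrow> 't) \<Rightarrow> (int \<Rightarrow> 'x \<Rightarrow> 'y) set \<Rightarrow> 'e"
  where "trace_functional F = (\<lambda>D\<in>carrier (hom_K \<Lambda> X Y). pairing F (pull (SOME f. f \<in> D)))"

lemma trace_functional_class:
  assumes F: "cmap \<Lambda> Y T F" and f: "f \<in> chain_maps \<Lambda> X Y"
  shows "trace_functional F (class_K \<Lambda> X Y f) = pairing F (pull f)"
proof -
  define g where "g = (SOME g. g \<in> class_K \<Lambda> X Y f)"
  have "g \<in> class_K \<Lambda> X Y f" unfolding g_def by (rule someI[of "\<lambda>g. g \<in> class_K \<Lambda> X Y f", OF class_K_self[OF X Y f]])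
  then have "g \<in> chain_maps \<Lambda> X Y" "homotopic \<Lambda> X Y g f" using mem_class_K[OF X Y f] by auto
  then have "pairing F (pull g) = pairing F (pull f)" using pairing_pull_homotopic[OF F _ f] by blast
  moreover have "class_K \<Lambda> X Y f \<in> carrier (hom_K \<Lambda> X Y)" using f carrier_hom_K[OF X Y] by blast
  ultimately show ?thesis by (simp add: trace_functional_def g_def)
qed

lemma trace_functional_homs:
  assumes F: "cmap \<Lambda> Y T F"
  shows "trace_functional F \<in> module_homs k (hom_K \<Lambda> X Y) E"
proof (rule module_homsI)
  note tc = trace_functional_class[OF F] and cl = lin_class_K[OF X Y]
  interpret M: right_module k "chain_map_module \<Lambda> X Y" by (rule right_module_chain_map_module[OF X Y])
  show "trace_functional F \<in> carrier (hom_K \<Lambda> X Y) \<rightarrow>\<^sub>E carrier E"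
    using tc pairing_closed[OF cmapD(1)[OF F] pull_C0] carrier_hom_K[OF X Y]
    by (auto simp: trace_functional_def[of F] PiE_def)
  fix D assume "D \<in> carrier (hom_K \<Lambda> X Y)"
  then obtain f where f: "D = class_K \<Lambda> X Y f" "f \<in> chain_maps \<Lambda> X Y" using carrier_hom_K[OF X Y] by auto
  then have f': "f \<in> carrier (chain_map_module \<Lambda> X Y)" by simp
  show "trace_functional F (a \<odot>\<^bsub>hom_K \<Lambda> X Y\<^esub> D) = a \<odot>\<^bsub>E\<^esub> trace_functional F D" if a: "a \<in> carrier k" for a
    using tc[of "a \<odot>\<^bsub>chain_map_module \<Lambda> X Y\<^esub> f"] tc[OF f(2)] lin_smult[OF cl a f'] pairing_pull_smult[OF F f(2) a]
      M.smult_closed[OF a f'] f(1) by (simp del: chain_map_module_simps(2-4))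
  fix D' assume "D' \<in> carrier (hom_K \<Lambda> X Y)"
  then obtain g where g: "D' = class_K \<Lambda> X Y g" "g \<in> chain_maps \<Lambda> X Y" using carrier_hom_K[OF X Y] by auto
  then have g': "g \<in> carrier (chain_map_module \<Lambda> X Y)" by simp
  show "trace_functional F (D \<oplus>\<^bsub>hom_K \<Lambda> X Y\<^esub> D') = trace_functional F D \<oplus>\<^bsub>E\<^esub> trace_functional F D'"
    using tc[of "f \<oplus>\<^bsub>chain_map_module \<Lambda> X Y\<^esub> g"] tc[OF f(2)] tc[OF g(2)] lin_add[OF cl f' g'] pairing_pull_add[OF F f(2) g(2)]
      M.M.add.m_closed[OF f' g'] f(1) g(1) by (simp del: chain_map_module_simps(2-4))
qed

lemma trace_functional_eqI:
  assumes F: "cmap \<Lambda> Y T F" and \<theta>: "\<theta> \<in> module_homs k (hom_K \<Lambda> X Y) E"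
    and eq: "\<And>f. f \<in> chain_maps \<Lambda> X Y \<Longrightarrow> pairing F (pull f) = \<theta> (class_K \<Lambda> X Y f)"
  shows "trace_functional F = \<theta>"
  by (rule module_homs_eqI[OF trace_functional_homs[OF F] \<theta>])
    (use eq trace_functional_class[OF F] carrier_hom_K[OF X Y] in auto)

text \<open>The difference of the two chain maps pairs to zero with all maps pulled back from
  \<open>X\<close>, so it is null homotopic by \<open>pairing_detects_null\<close>.\<close>

lemma trace_functional_eq_iff:
  assumes F: "F \<in> chain_maps \<Lambda> Y T" and F': "F' \<in> chain_maps \<Lambda> Y T"
  shows "trace_functional F = trace_functional F' \<longleftrightarrow> homotopic \<Lambda> Y T F F'"
proof
  note Fc = chain_maps_cmap[OF F] and Fc' = chain_maps_cmap[OF F']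
  show "trace_functional F = trace_functional F'" if "homotopic \<Lambda> Y T F F'"
    by (rule trace_functional_eqI[OF Fc trace_functional_homs[OF Fc']])
      (simp add: trace_functional_class[OF Fc'] pairing_homotopic_left[OF Fc Fc' that])
  assume eq: "trace_functional F = trace_functional F'"
  let ?D = "\<lambda>n x. F n x \<ominus>\<^bsub>cobj T n\<^esub> F' n x"
  have D: "cmap \<Lambda> Y T ?D"
  proof (rule cmapI)
    show "lin \<Lambda> (cobj Y n) (cobj T n) (?D n)" for n
      by (rule lin_minus_fun[OF T.right_module_axioms cmapD(1)[OF Fc] cmapD(1)[OF Fc']])
    show "?D (n + 1) (cdiff Y n x) = cdiff T n (?D n x)" if x: "x \<in> carrier (cobj Y n)" for n x
      using lin_diff[OF T.right_module_axioms T.right_module_axioms complexD(3)[OF T] cmapD(4)[OF Fc x] cmapD(4)[OF Fc' x]]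
        cmapD(2)[OF Fc x] cmapD(2)[OF Fc' x] by simp
  qed
  have sum: "F n x = ?D n x \<oplus>\<^bsub>cobj T n\<^esub> F' n x" if x: "x \<in> carrier (cobj Y n)" for n x
    using T.diff_eq_iff[OF cmapD(4)[OF Fc x] cmapD(4)[OF Fc' x] cmapD(4)[OF D x]] by simp
  have "pairing ?D (pull f) = \<zero>\<^bsub>E\<^esub>" if f: "f \<in> chain_maps \<Lambda> X Y" for f
  proof -
    have "pairing F (pull f) = pairing ?D (pull f) \<oplus>\<^bsub>E\<^esub> pairing F' (pull f)"
      by (rule pairing_add[OF cmapD(1)[OF D] cmapD(1)[OF Fc'] cmapD(1)[OF Fc] sum pull_C0[OF f]])
    moreover have "pairing F (pull f) = pairing F' (pull f)"
      using eq trace_functional_class[OF Fc f] trace_functional_class[OF Fc' f] by simp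
    ultimately have "pairing F' (pull f) = pairing ?D (pull f) \<oplus>\<^bsub>E\<^esub> pairing F' (pull f)" by simp
    then show ?thesis
      using E.M.add.r_cancel_one'[OF pairing_closed[OF cmapD(1)[OF Fc'] pull_C0[OF f]] pairing_closed[OF cmapD(1)[OF D] pull_C0[OF f]]]
      by blast
  qed
  then obtain H where H: "hfam \<Lambda> Y T H" "\<And>n m. m \<in> carrier (cobj Y n) \<Longrightarrow> ?D n m = hbd Y T H n m"
    using pairing_detects_null[OF D] by blast
  show "homotopic \<Lambda> Y T F F'"
  proof (rule homotopicI[OF H(1)])
    fix n x assume x: "x \<in> carrier (cobj Y n)"
    show "F n x = F' n x \<oplus>\<^bsub>cobj T n\<^esub> hbd Y T H n x"
      using sum[OF x] T.M.a_comm[OF cmapD(4)[OF D x] cmapD(4)[OF Fc' x]] H(2)[OF x] by simp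
  qed
qed

text \<open>The functional \<open>\<theta>\<close> must be extended to all of \<open>C0\<close> so
  that it kills boundaries. Both demands are met at once by extending along the map
  \<open>\<delta>\<close>, whose source is the sum of the chain maps \<open>X\<close> to
  \<open>Y\<close> and the families of degree -1.\<close>

lemma trace_functional_surj:
  assumes \<theta>: "\<theta> \<in> module_homs k (hom_K \<Lambda> X Y) E"
  shows "\<exists>F\<in>chain_maps \<Lambda> Y T. trace_functional F = \<theta>"
proof -
  let ?M = "chain_map_module \<Lambda> X Y"
  interpret M: right_module k ?M by (rule right_module_chain_map_module[OF X Y])
  note K = right_module_hom_K[OF X Y] and cl = lin_class_K[OF X Y]
  let ?D = "dsum ?M Cm"
  have D: "right_module k ?D" by (rule right_module_dsum[OF M.right_module_axioms Dm.F.right_module_axioms])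
  define \<delta> where "\<delta> z = pull (fst z) \<oplus>\<^bsub>C0\<^esub> fbd (snd z)" for z
  have lp: "lin k ?M C0 pull"
    by (rule linI) (use pull_C0 pull_eq in \<open>simp_all del: chain_map_module_simps(2-4) fin_homs_simps\<close>)
  have \<delta>: "lin k ?D C0 \<delta>"
    unfolding \<delta>_def
    by (rule lin_plus[OF D0.F.right_module_axioms lin_comp[OF lin_fst lp] lin_comp[OF lin_snd lin_fbd]])
  have \<psi>: "lin k ?D E (\<lambda>z. \<theta> (class_K \<Lambda> X Y (fst z)))"
    by (rule lin_comp[OF lin_comp[OF lin_fst cl] module_homs_lin[OF \<theta>]])
  \<comment> \<open>An element of the kernel is a chain map \<open>f\<close> whose pullback is
    bounded by minus \<open>h\<close>. By \<open>homotopic_zero_reflect\<close> such an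
    \<open>f\<close> is null homotopic, so \<open>\<theta>\<close> vanishes on its class.\<close>
  have ker: "\<theta> (class_K \<Lambda> X Y (fst z)) = \<zero>\<^bsub>E\<^esub>" if z: "z \<in> carrier ?D" and \<delta>z: "\<delta> z = \<zero>\<^bsub>C0\<^esub>" for z
  proof -
    define f h where "f = fst z" and "h = snd z"
    have f: "f \<in> chain_maps \<Lambda> X Y" and h: "h \<in> carrier Cm" using z by (simp_all add: f_def h_def del: fin_homs_simps)
    note fc = chain_maps_cmap[OF f] and hf = Cm_hfam[OF h]
    have fu: "f n (u n x) = hbd P Y (\<lambda>n x. \<ominus>\<^bsub>cobj Y (n - 1)\<^esub> h n x) n x" if x: "x \<in> carrier (cobj P n)" for n x
    proof -
      have c: "f n (u n x) \<in> carrier (cobj Y n)" "hbd P Y h n x \<in> carrier (cobj Y n)"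
        using cmapD(4)[OF fc cmapD(4)[OF u x]] lin_closed[OF hbd_lin[OF P Y hf] x] by auto
      have "f n (u n x) \<oplus>\<^bsub>cobj Y n\<^esub> hbd P Y h n x = \<zero>\<^bsub>cobj Y n\<^esub>"
        using fun_cong[OF fun_cong[OF \<delta>z, of n], of x] x by (simp add: \<delta>_def f_def h_def fbd_def pull_apply)
      then show ?thesis
        using Y.M.minus_equality[OF _ c(2,1)] hbd_uminus[OF P Y hf x] by simp
    qed
    \<comment> \<open>Two bounds are combined: below \<open>N\<close> the complex \<open>X\<close>
      vanishes, hence \<open>f\<close> does; below \<open>N'\<close> the finitely supported
      \<open>h\<close> vanishes.\<close>
    obtain N where N: "\<And>n. n < N \<Longrightarrow> zero_module (cobj X n)" using X_below by blast
    have "bdd_below (supp (cobj P) (\<lambda>n. cobj Y (n - 1)) h)" by (rule bdd_below_finite) (use h in simp)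
    then obtain N' where N': "\<And>n. n \<in> supp (cobj P) (\<lambda>n. cobj Y (n - 1)) h \<Longrightarrow> N' \<le> n" unfolding bdd_below_def by blast
    have f0: "f n x = \<zero>\<^bsub>cobj Y n\<^esub>" if "n < min N N'" "x \<in> carrier (cobj X n)" for n x
    proof -
      have "x = \<zero>\<^bsub>cobj X n\<^esub>" using N[of n] that by (auto simp: zero_module_def)
      then show ?thesis using lin_zero[OF X.right_module_axioms Y.right_module_axioms cmapD(1)[OF fc]] by simp
    qed
    have h0: "\<ominus>\<^bsub>cobj Y (n - 1)\<^esub> h n x = \<zero>\<^bsub>cobj Y (n - 1)\<^esub>" if "n < min N N'" "x \<in> carrier (cobj P n)" for n x
    proof -
      have "n \<notin> supp (cobj P) (\<lambda>n. cobj Y (n - 1)) h" using N'[of n] that by auto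
      from supp_zero[OF this that(2)] show ?thesis by simp
    qed
    obtain k' where "hfam \<Lambda> X Y k'" "\<And>n x. x \<in> carrier (cobj X n) \<Longrightarrow> f n x = hbd X Y k' n x"
      using homotopic_zero_reflect[OF P X Y_inj u u_inj u_surj fc f0 hfam_uminus[OF Y hf] h0 fu] by blast
    then have "homotopic \<Lambda> X Y f (crestrict X (\<lambda>n x. \<zero>\<^bsub>cobj Y n\<^esub>))"
      using lin_closed[OF hbd_lin[OF X Y]] by (intro homotopicI) auto
    then have "class_K \<Lambda> X Y f = class_K \<Lambda> X Y \<zero>\<^bsub>?M\<^esub>"
      using class_K_eq_iff[OF X Y f] M.M.zero_closed by simp
    also have "\<dots> = \<zero>\<^bsub>hom_K \<Lambda> X Y\<^esub>" by (rule lin_zero[OF M.right_module_axioms K cl])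
    finally show ?thesis unfolding f_def[symmetric] using module_homs_zero[OF K E' \<theta>] by simp
  qed
  obtain \<eta> where \<eta>: "\<eta> \<in> module_homs k C0 E" "\<And>z. z \<in> carrier ?D \<Longrightarrow> \<eta> (\<delta> z) = \<theta> (class_K \<Lambda> X Y (fst z))"
    using injective_module_factor[OF E D D0.F.right_module_axioms \<delta> \<psi> ker] by blast
  \<comment> \<open>Pairs with first component zero show that the extension kills boundaries; by
    \<open>pairing_surj\<close> it then comes from a chain map.\<close>
  have "\<eta> (fbd h) = \<zero>\<^bsub>E\<^esub>" if h: "h \<in> carrier Cm" for h
  proof -
    have z: "(\<zero>\<^bsub>?M\<^esub>, h) \<in> carrier ?D" using h M.M.zero_closed by (simp del: chain_map_module_simps fin_homs_simps)
    have "\<delta> (\<zero>\<^bsub>?M\<^esub>, h) = fbd h"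
      using lin_zero[OF M.right_module_axioms D0.F.right_module_axioms lp] lin_closed[OF lin_fbd h]
      by (simp add: \<delta>_def del: chain_map_module_simps fin_homs_simps)
    then show ?thesis
      using \<eta>(2)[OF z] lin_zero[OF M.right_module_axioms K cl] module_homs_zero[OF K E' \<theta>] by simp
  qed
  then obtain F where F: "cmap \<Lambda> Y T F" "\<And>f. f \<in> carrier C0 \<Longrightarrow> pairing F f = \<eta> f"
    using pairing_surj[OF module_homs_lin[OF \<eta>(1)]] by blast
  define F' where "F' = crestrict Y F"
  have F': "F' \<in> chain_maps \<Lambda> Y T" unfolding F'_def by (rule crestrict_chain_maps[OF Y F(1)])
  have "pairing F' (pull f) = \<theta> (class_K \<Lambda> X Y f)" if f: "f \<in> chain_maps \<Lambda> X Y" for f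
  proof -
    have z: "(f, \<zero>\<^bsub>Cm\<^esub>) \<in> carrier ?D" using f Dm.F.M.zero_closed by (simp del: fin_homs_simps)
    have "homotopic \<Lambda> Y T F' F"
      by (rule homotopic_cong[OF Y homotopic_refl[OF Y T F(1)]]) (simp_all add: F'_def)
    then have "pairing F' (pull f) = pairing F (pull f)"
      by (rule pairing_homotopic_left[OF chain_maps_cmap[OF F'] F(1) _ f])
    also have "\<dots> = \<eta> (pull f)" by (rule F(2)[OF pull_C0[OF f]])
    also have "\<eta> (pull f) = \<eta> (\<delta> (f, \<zero>\<^bsub>Cm\<^esub>))"
      using lin_zero[OF Dm.F.right_module_axioms D0.F.right_module_axioms lin_fbd] pull_C0[OF f]
      by (simp add: \<delta>_def del: fin_homs_simps)
    also have "\<eta> (\<delta> (f, \<zero>\<^bsub>Cm\<^esub>)) = \<theta> (class_K \<Lambda> X Y f)" using \<eta>(2)[OF z] by simp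
    finally show ?thesis .
  qed
  then show ?thesis using trace_functional_eqI[OF chain_maps_cmap[OF F'] \<theta>] F' by blast
qed

text \<open>The inverse of the map that \<open>trace_functional\<close> induces on homotopy classes.
  It is evaluated through \<open>duality_trace_functional\<close>, after writing a functional as a
  trace functional.\<close>

definition duality :: "((int \<Rightarrow> 'x \<Rightarrow> 'y) set \<Rightarrow> 'e) \<Rightarrow> (int \<Rightarrow> 'y \<Rightarrow> 't) set"
  where "duality = (\<lambda>\<theta>\<in>module_homs k (hom_K \<Lambda> X Y) E.
    class_K \<Lambda> Y T (SOME F. F \<in> chain_maps \<Lambda> Y T \<and> trace_functional F = \<theta>))"

lemma duality_trace_functional:
  assumes F: "F \<in> chain_maps \<Lambda> Y T"
  shows "duality (trace_functional F) = class_K \<Lambda> Y T F"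
proof -
  define F' where "F' = (SOME F'. F' \<in> chain_maps \<Lambda> Y T \<and> trace_functional F' = trace_functional F)"
  have "F' \<in> chain_maps \<Lambda> Y T \<and> trace_functional F' = trace_functional F"
    unfolding F'_def by (rule someI[of _ F]) (use F in simp)
  then have "class_K \<Lambda> Y T F' = class_K \<Lambda> Y T F"
    using class_K_eq_iff[OF Y T _ F] trace_functional_eq_iff[OF _ F] by blast
  then show ?thesis
    using trace_functional_homs[OF chain_maps_cmap[OF F]] by (simp add: duality_def F'_def)
qed

lemma trace_functional_add:
  assumes F: "F \<in> chain_maps \<Lambda> Y T" and G: "G \<in> chain_maps \<Lambda> Y T"
  shows "trace_functional (F \<oplus>\<^bsub>chain_map_module \<Lambda> Y T\<^esub> G) =
    trace_functional F \<oplus>\<^bsub>dual k E (hom_K \<Lambda> X Y)\<^esub> trace_functional G"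
proof (rule trace_functional_eqI)
  interpret M: right_module k "chain_map_module \<Lambda> Y T" by (rule right_module_chain_map_module[OF Y T])
  interpret D: right_module k "dual k E (hom_K \<Lambda> X Y)" by (rule right_module_dual[OF cring_base right_module_hom_K[OF X Y] E'])
  note Fc = chain_maps_cmap[OF F] and Gc = chain_maps_cmap[OF G]
  show S: "cmap \<Lambda> Y T (F \<oplus>\<^bsub>chain_map_module \<Lambda> Y T\<^esub> G)"
    using M.M.add.m_closed[of F G] F G chain_maps_cmap by (simp del: chain_map_module_simps(2-4))
  show "trace_functional F \<oplus>\<^bsub>dual k E (hom_K \<Lambda> X Y)\<^esub> trace_functional G \<in> module_homs k (hom_K \<Lambda> X Y) E"
    using D.M.add.m_closed[of "trace_functional F" "trace_functional G"] trace_functional_homs[OF Fc] trace_functional_homs[OF Gc]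
    by (simp del: dual_simps(2-4))
  fix f assume f: "f \<in> chain_maps \<Lambda> X Y"
  have "class_K \<Lambda> X Y f \<in> carrier (hom_K \<Lambda> X Y)" using f carrier_hom_K[OF X Y] by blast
  then show "pairing (F \<oplus>\<^bsub>chain_map_module \<Lambda> Y T\<^esub> G) (pull f) =
      (trace_functional F \<oplus>\<^bsub>dual k E (hom_K \<Lambda> X Y)\<^esub> trace_functional G) (class_K \<Lambda> X Y f)"
    using pairing_add[OF cmapD(1)[OF Fc] cmapD(1)[OF Gc] cmapD(1)[OF S] _ pull_C0[OF f]]
    by (simp add: trace_functional_class[OF Fc f] trace_functional_class[OF Gc f])
qed

lemma trace_functional_smult:
  assumes F: "F \<in> chain_maps \<Lambda> Y T" and a: "a \<in> carrier k"
  shows "trace_functional (a \<odot>\<^bsub>chain_map_module \<Lambda> Y T\<^esub> F) = a \<odot>\<^bsub>dual k E (hom_K \<Lambda> X Y)\<^esub> trace_functional F"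
proof (rule trace_functional_eqI)
  interpret M: right_module k "chain_map_module \<Lambda> Y T" by (rule right_module_chain_map_module[OF Y T])
  interpret D: right_module k "dual k E (hom_K \<Lambda> X Y)" by (rule right_module_dual[OF cring_base right_module_hom_K[OF X Y] E'])
  note Fc = chain_maps_cmap[OF F]
  show S: "cmap \<Lambda> Y T (a \<odot>\<^bsub>chain_map_module \<Lambda> Y T\<^esub> F)"
    using M.smult_closed[OF a, of F] F chain_maps_cmap by (simp del: chain_map_module_simps(2-4))
  show "a \<odot>\<^bsub>dual k E (hom_K \<Lambda> X Y)\<^esub> trace_functional F \<in> module_homs k (hom_K \<Lambda> X Y) E"
    using D.smult_closed[OF a, of "trace_functional F"] trace_functional_homs[OF Fc]
    by (simp del: dual_simps(2-4))
  fix f assume f: "f \<in> chain_maps \<Lambda> X Y"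
  have "class_K \<Lambda> X Y f \<in> carrier (hom_K \<Lambda> X Y)" using f carrier_hom_K[OF X Y] by blast
  then show "pairing (a \<odot>\<^bsub>chain_map_module \<Lambda> Y T\<^esub> F) (pull f) =
      (a \<odot>\<^bsub>dual k E (hom_K \<Lambda> X Y)\<^esub> trace_functional F) (class_K \<Lambda> X Y f)"
    using pairing_scalar[OF cmapD(1)[OF Fc] cmapD(1)[OF S] a _ pull_C0[OF f]]
    by (simp add: trace_functional_class[OF Fc f])
qed

lemma duality_iso: "duality \<in> module_isos k (dual k E (hom_K \<Lambda> X Y)) (hom_K \<Lambda> Y T)"
proof -
  interpret M: right_module k "chain_map_module \<Lambda> Y T" by (rule right_module_chain_map_module[OF Y T])
  note cl = lin_class_K[OF Y T]
  have rep: "\<exists>F\<in>chain_maps \<Lambda> Y T. \<theta> = trace_functional F" if "\<theta> \<in> module_homs k (hom_K \<Lambda> X Y) E" for \<theta>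
    using trace_functional_surj[OF that] by blast
  have "duality \<in> module_homs k (dual k E (hom_K \<Lambda> X Y)) (hom_K \<Lambda> Y T)"
  proof (rule module_homsI)
    have "duality \<theta> \<in> carrier (hom_K \<Lambda> Y T)" if \<theta>: "\<theta> \<in> module_homs k (hom_K \<Lambda> X Y) E" for \<theta>
    proof -
      obtain F where "F \<in> chain_maps \<Lambda> Y T" "\<theta> = trace_functional F" using rep[OF \<theta>] by blast
      then show ?thesis using duality_trace_functional carrier_hom_K[OF Y T] by simp
    qed
    then show "duality \<in> carrier (dual k E (hom_K \<Lambda> X Y)) \<rightarrow>\<^sub>E carrier (hom_K \<Lambda> Y T)"
      by (auto simp: duality_def)
    fix \<theta> assume "\<theta> \<in> carrier (dual k E (hom_K \<Lambda> X Y))"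
    then obtain F where F: "F \<in> chain_maps \<Lambda> Y T" "\<theta> = trace_functional F" using rep by auto
    then have F': "F \<in> carrier (chain_map_module \<Lambda> Y T)" by simp
    show "duality (a \<odot>\<^bsub>dual k E (hom_K \<Lambda> X Y)\<^esub> \<theta>) = a \<odot>\<^bsub>hom_K \<Lambda> Y T\<^esub> duality \<theta>" if a: "a \<in> carrier k" for a
      unfolding F(2) trace_functional_smult[OF F(1) a, symmetric] duality_trace_functional[OF F(1)] lin_smult[OF cl a F', symmetric]
      using M.smult_closed[OF a F'] by (intro duality_trace_functional) (simp only: chain_map_module_simps(1))
    fix \<theta>' assume "\<theta>' \<in> carrier (dual k E (hom_K \<Lambda> X Y))"
    then obtain G where G: "G \<in> chain_maps \<Lambda> Y T" "\<theta>' = trace_functional G" using rep by auto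
    then have G': "G \<in> carrier (chain_map_module \<Lambda> Y T)" by simp
    show "duality (\<theta> \<oplus>\<^bsub>dual k E (hom_K \<Lambda> X Y)\<^esub> \<theta>') = duality \<theta> \<oplus>\<^bsub>hom_K \<Lambda> Y T\<^esub> duality \<theta>'"
      unfolding F(2) G(2) trace_functional_add[OF F(1) G(1), symmetric] duality_trace_functional[OF F(1)] duality_trace_functional[OF G(1)]
        lin_add[OF cl F' G', symmetric]
      using M.M.add.m_closed[OF F' G'] by (intro duality_trace_functional) (simp only: chain_map_module_simps(1))
  qed
  moreover have "bij_betw duality (carrier (dual k E (hom_K \<Lambda> X Y))) (carrier (hom_K \<Lambda> Y T))"
    unfolding bij_betw_def dual_simps(1)
  proof
    show "inj_on duality (module_homs k (hom_K \<Lambda> X Y) E)"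
    proof (rule inj_onI)
      fix \<theta> \<theta>' assume "\<theta> \<in> module_homs k (hom_K \<Lambda> X Y) E" "\<theta>' \<in> module_homs k (hom_K \<Lambda> X Y) E" and eq: "duality \<theta> = duality \<theta>'"
      then obtain F G where FG: "F \<in> chain_maps \<Lambda> Y T" "\<theta> = trace_functional F" "G \<in> chain_maps \<Lambda> Y T" "\<theta>' = trace_functional G"
        using rep by metis
      then show "\<theta> = \<theta>'"
        using eq duality_trace_functional[OF FG(1)] duality_trace_functional[OF FG(3)]
          class_K_eq_iff[OF Y T FG(1,3)] trace_functional_eq_iff[OF FG(1,3)] by simp
    qed
    show "duality ` module_homs k (hom_K \<Lambda> X Y) E = carrier (hom_K \<Lambda> Y T)"
    proof (intro equalityI image_subsetI subsetI)
      fix \<theta> assume "\<theta> \<in> module_homs k (hom_K \<Lambda> X Y) E"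
      then obtain F where "F \<in> chain_maps \<Lambda> Y T" "\<theta> = trace_functional F" using rep by blast
      then show "duality \<theta> \<in> carrier (hom_K \<Lambda> Y T)"
        using duality_trace_functional carrier_hom_K[OF Y T] by simp
    next
      fix C assume "C \<in> carrier (hom_K \<Lambda> Y T)"
      then obtain F where F: "F \<in> chain_maps \<Lambda> Y T" "C = class_K \<Lambda> Y T F"
        unfolding carrier_hom_K[OF Y T] by (rule imageE)
      then have "C = duality (trace_functional F)" using duality_trace_functional[OF F(1)] by simp
      then show "C \<in> duality ` module_homs k (hom_K \<Lambda> X Y) E"
        using trace_functional_homs[OF chain_maps_cmap[OF F(1)]] by (rule image_eqI)
    qed
  qed
  ultimately show ?thesis by (simp add: module_isos_def)
qed

end

section \<open>Naturality of the trace pairing\<close>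

lemma fin_homs_precomp:
  assumes kA: "k_algebra k \<Lambda>"
    and A: "\<And>i. right_module \<Lambda> (A i)" and A': "\<And>i. right_module \<Lambda> (A' i)" and B: "\<And>i. right_module \<Lambda> (B i)"
    and g: "\<And>i. lin \<Lambda> (A i) (A' i) (g i)"
  shows "lin k (fin_homs \<Lambda> A' B) (fin_homs \<Lambda> A B) (\<lambda>f i. \<lambda>x\<in>carrier (A i). f i (g i x))"
proof -
  interpret k_algebra k \<Lambda> by fact
  show ?thesis
  proof (rule linI)
    fix f assume f: "f \<in> carrier (fin_homs \<Lambda> A' B)"
    have "supp A B (\<lambda>i. \<lambda>x\<in>carrier (A i). f i (g i x)) \<subseteq> supp A' B f"
      using lin_closed[OF g] by (auto simp: supp_def)
    then have "finite (supp A B (\<lambda>i. \<lambda>x\<in>carrier (A i). f i (g i x)))"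
      by (rule finite_subset) (use f in simp)
    moreover have "(\<lambda>x\<in>carrier (A i). f i (g i x)) \<in> module_homs \<Lambda> (A i) (B i)" for i
    proof -
      have "f i \<in> module_homs \<Lambda> (A' i) (B i)" using f by simp
      then show ?thesis by (rule comp_module_homs[OF A g module_homs_lin])
    qed
    ultimately show "(\<lambda>i. \<lambda>x\<in>carrier (A i). f i (g i x)) \<in> carrier (fin_homs \<Lambda> A B)" by simp
  qed (use lin_closed[OF g] in \<open>auto simp: fun_eq_iff\<close>)
qed

text \<open>Both sides are functionals of \<open>f\<close>, so rank one maps suffice. Composing the
  rank one map of \<open>\<xi>\<close> and \<open>m\<close> with \<open>b\<close> gives the one of
  \<open>\<xi>\<close> and \<open>b n m\<close>.\<close>

lemma pairing_natural_target:
  assumes D: "dual_complex k \<Lambda> E P Y T \<tau>" and D': "dual_complex k \<Lambda> E P Y' T \<tau>"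
    and F: "cmap \<Lambda> Y' T F" and b: "cmap \<Lambda> Y Y' b" and f: "f \<in> carrier (fin_homs \<Lambda> (cobj P) (cobj Y))"
  shows "dual_complex.pairing k \<Lambda> E P Y \<tau> (\<lambda>n y. F n (b n y)) f =
    dual_complex.pairing k \<Lambda> E P Y' \<tau> F (\<lambda>n. \<lambda>x\<in>carrier (cobj P n). b n (f n x))"
proof -
  interpret D: dual_complex k \<Lambda> E P Y T \<tau> by (rule D)
  interpret D': dual_complex k \<Lambda> E P Y' T \<tau> by (rule D')
  have post: "lin k D.C0 D'.C0 (\<lambda>f n. \<lambda>x\<in>carrier (cobj P n). b n (f n x))"
    by (rule fin_homs_postcomp[OF D.k_algebra_axioms D.P.right_module_axioms D.Y.right_module_axioms
          D'.Y.right_module_axioms cmapD(1)[OF b]])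
  show ?thesis
  proof (rule D.pairing_eqI[OF cmapD(1)[OF cmap_comp[OF b F]] _ _ f])
    show "lin k D.C0 E (\<lambda>f. D'.pairing F (\<lambda>n. \<lambda>x\<in>carrier (cobj P n). b n (f n x)))"
      by (rule lin_comp[OF post module_homs_lin[OF D'.pairing_spec(1)[OF cmapD(1)[OF F]]]])
    fix n \<xi> m assume \<xi>: "\<xi> \<in> D.Pd n" and m: "m \<in> carrier (cobj Y n)"
    have z: "b i \<zero>\<^bsub>cobj Y i\<^esub> = \<zero>\<^bsub>cobj Y' i\<^esub>" for i
      by (rule lin_zero[OF D.Y.right_module_axioms D'.Y.right_module_axioms cmapD(1)[OF b]])
    have "(\<lambda>i. \<lambda>x\<in>carrier (cobj P i). b i (D.s0 n \<xi> m i x)) = D'.s0 n \<xi> (b n m)"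
      using m D.Pd_closed[OF \<xi>] z by (auto simp: single_def rank_one_def fun_eq_iff lin_smult[OF cmapD(1)[OF b]])
    then show "D'.pairing F (\<lambda>i. \<lambda>x\<in>carrier (cobj P i). b i (D.s0 n \<xi> m i x)) = \<tau> n (F n (b n m)) \<xi>"
      using D'.pairing_spec(2)[of F, OF cmapD(1)[OF F] \<xi> cmapD(4)[OF b m]] by simp
  qed
qed

text \<open>By \<open>\<tau>G\<close>, the maps \<open>G\<close> are the transposes of the
  composition with \<open>g\<close>. On rank one maps, composing with \<open>g\<close> only replaces
  \<open>\<xi>\<close> by its composite with \<open>g\<close>, and the two sides agree.\<close>

lemma pairing_natural_source:
  assumes D: "dual_complex k \<Lambda> E P Y T \<tau>" and D': "dual_complex k \<Lambda> E P' Y T' \<tau>'"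
    and F: "cmap \<Lambda> Y T F" and g: "cmap \<Lambda> P P' g" and G: "\<And>n. lin \<Lambda> (cobj T n) (cobj T' n) (G n)"
    and \<tau>G: "\<And>n t \<xi>. t \<in> carrier (cobj T n) \<Longrightarrow> \<xi> \<in> module_homs \<Lambda> (cobj P' n) (regular_module \<Lambda>) \<Longrightarrow>
      \<tau>' n (G n t) \<xi> = \<tau> n t (\<lambda>q\<in>carrier (cobj P n). \<xi> (g n q))"
    and f: "f \<in> carrier (fin_homs \<Lambda> (cobj P') (cobj Y))"
  shows "dual_complex.pairing k \<Lambda> E P' Y \<tau>' (\<lambda>n y. G n (F n y)) f =
    dual_complex.pairing k \<Lambda> E P Y \<tau> F (\<lambda>n. \<lambda>x\<in>carrier (cobj P n). f n (g n x))"
proof -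
  interpret D: dual_complex k \<Lambda> E P Y T \<tau> by (rule D)
  interpret D': dual_complex k \<Lambda> E P' Y T' \<tau>' by (rule D')
  have pre: "lin k D'.C0 D.C0 (\<lambda>f n. \<lambda>x\<in>carrier (cobj P n). f n (g n x))"
    by (rule fin_homs_precomp[OF D.k_algebra_axioms D.P.right_module_axioms D'.P.right_module_axioms
          D.Y.right_module_axioms cmapD(1)[OF g]])
  show ?thesis
  proof (rule D'.pairing_eqI[OF lin_comp[OF cmapD(1)[OF F] G] _ _ f])
    show "lin k D'.C0 E (\<lambda>f. D.pairing F (\<lambda>n. \<lambda>x\<in>carrier (cobj P n). f n (g n x)))"
      by (rule lin_comp[OF pre module_homs_lin[OF D.pairing_spec(1)[OF cmapD(1)[OF F]]]])
    fix n \<xi> m assume \<xi>: "\<xi> \<in> D'.Pd n" and m: "m \<in> carrier (cobj Y n)"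
    have \<xi>g: "(\<lambda>q\<in>carrier (cobj P n). \<xi> (g n q)) \<in> D.Pd n"
      by (rule comp_module_homs[OF D.P.right_module_axioms cmapD(1)[OF g] module_homs_lin[OF \<xi>]])
    have "(\<lambda>i. \<lambda>x\<in>carrier (cobj P i). D'.s0 n \<xi> m i (g i x)) = D.s0 n (\<lambda>q\<in>carrier (cobj P n). \<xi> (g n q)) m"
      using cmapD(4)[OF g] by (auto simp: single_def rank_one_def fun_eq_iff)
    then show "D.pairing F (\<lambda>i. \<lambda>x\<in>carrier (cobj P i). D'.s0 n \<xi> m i (g i x)) = \<tau>' n (G n (F n m)) \<xi>"
      using D.pairing_spec(2)[of F, OF cmapD(1)[OF F] \<xi>g m] \<tau>G[OF cmapD(4)[OF F m] \<xi>] by simp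
  qed
qed

section \<open>Quasi-isomorphisms and roofs\<close>

lemma right_module_cycles:
  assumes X: "is_complex R X" shows "right_module R (cycles X n)"
proof -
  interpret X: right_module R "cobj X i" for i by (rule complexD(1)[OF X])
  show ?thesis
    unfolding cycles_def
    by (rule X.right_module_carrier_update)
      (auto simp: lin_zero[OF X.right_module_axioms X.right_module_axioms complexD(3)[OF X]]
        lin_add[OF complexD(3)[OF X]] lin_smult[OF complexD(3)[OF X]] X.smult_closed X.smult_r_zero)
qed

lemma submod_boundaries:
  assumes X: "is_complex R X" shows "submod R (cycles X n) (boundaries X n)"
proof -
  interpret X: right_module R "cobj X i" for i by (rule complexD(1)[OF X])
  note d = complexD'(1)[OF X]
  have "cdiff X (n - 1) x \<oplus>\<^bsub>cobj X n\<^esub> cdiff X (n - 1) y \<in> boundaries X n"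
    if "x \<in> carrier (cobj X (n - 1))" "y \<in> carrier (cobj X (n - 1))" for x y
    unfolding boundaries_def using lin_add[OF d that] that by (metis X.M.add.m_closed imageI)
  moreover have "a \<odot>\<^bsub>cobj X n\<^esub> cdiff X (n - 1) x \<in> boundaries X n"
    if "a \<in> carrier R" "x \<in> carrier (cobj X (n - 1))" for a x
    unfolding boundaries_def using lin_smult[OF d that] that by (metis X.smult_closed imageI)
  moreover have "\<zero>\<^bsub>cobj X n\<^esub> \<in> boundaries X n"
    unfolding boundaries_def
    using lin_zero[OF X.right_module_axioms X.right_module_axioms d] X.M.zero_closed by (metis imageI)
  moreover have "boundaries X n \<subseteq> carrier (cycles X n)"
    using cdiff_closed(2)[OF X] complexD'(2)[OF X] by (auto simp: boundaries_def cycles_def)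
  ultimately show ?thesis
    unfolding submod_def by (auto simp: cycles_def boundaries_def)
qed

lemma cohomology_map_coset:
  assumes X: "is_complex R X" and Y: "is_complex R Y" and f: "cmap R X Y f" and x: "x \<in> carrier (cycles X n)"
  shows "f n x \<in> carrier (cycles Y n)"
    and "cohomology_map X Y f n (boundaries X n +>\<^bsub>cycles X n\<^esub> x) = boundaries Y n +>\<^bsub>cycles Y n\<^esub> f n x"
proof -
  interpret CX: right_module R "cycles X n" by (rule right_module_cycles[OF X])
  interpret CY: right_module R "cycles Y n" by (rule right_module_cycles[OF Y])
  have cyc: "f n y \<in> carrier (cycles Y n)" if "y \<in> carrier (cycles X n)" for y
    using that cmapD(2)[OF f, of y n] cmapD(4)[OF f, of y n]
      lin_zero[OF complexD(1)[OF X] complexD(1)[OF Y] cmapD(1)[OF f, of "n + 1"]]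
    by (auto simp: cycles_def)
  then show fx: "f n x \<in> carrier (cycles Y n)" using x .
  show "cohomology_map X Y f n (boundaries X n +>\<^bsub>cycles X n\<^esub> x) = boundaries Y n +>\<^bsub>cycles Y n\<^esub> f n x"
    unfolding cohomology_map_def
  proof (rule quotient_map_coset[OF CX.right_module_axioms submod_boundaries[OF X] x])
    fix y assume y: "y \<in> boundaries X n +>\<^bsub>cycles X n\<^esub> x"
    then have yc: "y \<in> carrier (cycles X n)" by (rule CX.coset_mem_carrier[OF submod_boundaries[OF X] x])
    obtain w where w: "w \<in> carrier (cobj X (n - 1))" "y = cdiff X (n - 1) w \<oplus>\<^bsub>cobj X n\<^esub> x"
      using y unfolding CX.mem_coset_iff[OF submod_boundaries[OF X]] by (auto simp: boundaries_def cycles_def)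
    have "f n y = cdiff Y (n - 1) (f (n - 1) w) \<oplus>\<^bsub>cobj Y n\<^esub> f n x"
      using w lin_add[OF cmapD(1)[OF f] cdiff_closed(2)[OF X w(1)], of x] x cmapD(3)[OF f w(1)] by (simp add: cycles_def)
    moreover have "cdiff Y (n - 1) (f (n - 1) w) \<in> boundaries Y n"
      using cmapD(4)[OF f w(1)] by (simp add: boundaries_def)
    ultimately show "boundaries Y n +>\<^bsub>cycles Y n\<^esub> f n y = boundaries Y n +>\<^bsub>cycles Y n\<^esub> f n x"
      by (subst CY.submod_coset_eq_iff[OF submod_boundaries[OF Y] cyc[OF yc] fx]) (auto simp: cycles_def)
  qed
qed

text \<open>Bijectivity on cohomology is unpacked into statements on elements: injectivity by
  comparing the class of \<open>x\<close> with the class of zero, surjectivity by choosing a cycle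
  in a preimage of the class of \<open>y\<close>.\<close>

lemma quasi_isoD:
  assumes X: "is_complex R X" and Y: "is_complex R Y" and q: "quasi_iso R X Y f"
  shows "f \<in> chain_maps R X Y" "cmap R X Y f" "cohomology_inj X Y f" "cohomology_surj X Y f"
proof -
  show f: "f \<in> chain_maps R X Y" using q by (simp add: quasi_iso_def)
  then show fc: "cmap R X Y f" by (rule chain_maps_cmap)
  have bij: "bij_betw (cohomology_map X Y f n) (carrier (cohomology X n)) (carrier (cohomology Y n))" for n
    using q by (simp add: quasi_iso_def)
  have carX: "carrier (cohomology X n) = (\<lambda>x. boundaries X n +>\<^bsub>cycles X n\<^esub> x) ` carrier (cycles X n)" for n
    unfolding cohomology_def by (rule right_module.carrier_quotient_module[OF right_module_cycles[OF X] submod_boundaries[OF X]])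
  have carY: "carrier (cohomology Y n) = (\<lambda>x. boundaries Y n +>\<^bsub>cycles Y n\<^esub> x) ` carrier (cycles Y n)" for n
    unfolding cohomology_def by (rule right_module.carrier_quotient_module[OF right_module_cycles[OF Y] submod_boundaries[OF Y]])
  show "cohomology_inj X Y f"
    unfolding cohomology_inj_def
  proof (intro allI ballI impI)
    fix n x assume x: "x \<in> carrier (cobj X n)" "cdiff X n x = \<zero>\<^bsub>cobj X (n + 1)\<^esub>"
      and b: "\<exists>y\<in>carrier (cobj Y (n - 1)). cdiff Y (n - 1) y = f n x"
    interpret CX: right_module R "cycles X n" by (rule right_module_cycles[OF X])
    interpret CY: right_module R "cycles Y n" by (rule right_module_cycles[OF Y])
    interpret X: right_module R "cobj X n" by (rule complexD(1)[OF X])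
    interpret Y: right_module R "cobj Y n" by (rule complexD(1)[OF Y])
    have xc: "x \<in> carrier (cycles X n)" using x by (simp add: cycles_def)
    have z: "\<zero>\<^bsub>cycles X n\<^esub> = \<zero>\<^bsub>cobj X n\<^esub>" by (simp add: cycles_def)
    have zc: "\<zero>\<^bsub>cobj X n\<^esub> \<in> carrier (cycles X n)" using CX.M.zero_closed z by simp
    have f0: "f n \<zero>\<^bsub>cobj X n\<^esub> = \<zero>\<^bsub>cobj Y n\<^esub>" by (rule lin_zero[OF X.right_module_axioms Y.right_module_axioms cmapD(1)[OF fc]])
    have fb: "f n x \<in> boundaries Y n" unfolding boundaries_def using b by (metis imageI)
    have "boundaries Y n +>\<^bsub>cycles Y n\<^esub> f n x = boundaries Y n +>\<^bsub>cycles Y n\<^esub> f n \<zero>\<^bsub>cobj X n\<^esub>"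
      unfolding CY.submod_coset_eq_iff[OF submod_boundaries[OF Y] cohomology_map_coset(1)[OF X Y fc xc] cohomology_map_coset(1)[OF X Y fc zc]]
      by (rule bexI[OF _ fb]) (use f0 cmapD(4)[OF fc x(1)] in \<open>simp add: cycles_def\<close>)
    then have "cohomology_map X Y f n (boundaries X n +>\<^bsub>cycles X n\<^esub> x) = cohomology_map X Y f n (boundaries X n +>\<^bsub>cycles X n\<^esub> \<zero>\<^bsub>cobj X n\<^esub>)"
      using cohomology_map_coset(2)[OF X Y fc xc] cohomology_map_coset(2)[OF X Y fc zc] by simp
    then have "boundaries X n +>\<^bsub>cycles X n\<^esub> x = boundaries X n +>\<^bsub>cycles X n\<^esub> \<zero>\<^bsub>cobj X n\<^esub>"
      by (rule inj_onD[OF bij_betw_imp_inj_on[OF bij]]) (use xc zc carX in auto)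
    then obtain v where "v \<in> boundaries X n" "x = v \<oplus>\<^bsub>cycles X n\<^esub> \<zero>\<^bsub>cobj X n\<^esub>"
      using CX.submod_coset_eq_iff[OF submod_boundaries[OF X] xc zc] by auto
    then show "\<exists>w\<in>carrier (cobj X (n - 1)). cdiff X (n - 1) w = x"
      using cdiff_closed(2)[OF X] by (auto simp: boundaries_def cycles_def)
  qed
  show "cohomology_surj X Y f"
    unfolding cohomology_surj_def
  proof (intro allI ballI impI)
    fix n y assume y: "y \<in> carrier (cobj Y n)" "cdiff Y n y = \<zero>\<^bsub>cobj Y (n + 1)\<^esub>"
    interpret CY: right_module R "cycles Y n" by (rule right_module_cycles[OF Y])
    interpret Y: right_module R "cobj Y n" by (rule complexD(1)[OF Y])
    have yc: "y \<in> carrier (cycles Y n)" using y by (simp add: cycles_def)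
    then have "boundaries Y n +>\<^bsub>cycles Y n\<^esub> y \<in> cohomology_map X Y f n ` carrier (cohomology X n)"
      using bij_betw_imp_surj_on[OF bij] carY by blast
    then obtain x where x: "x \<in> carrier (cycles X n)"
      "boundaries Y n +>\<^bsub>cycles Y n\<^esub> y = cohomology_map X Y f n (boundaries X n +>\<^bsub>cycles X n\<^esub> x)"
      unfolding carX by blast
    then have "boundaries Y n +>\<^bsub>cycles Y n\<^esub> y = boundaries Y n +>\<^bsub>cycles Y n\<^esub> f n x"
      using cohomology_map_coset(2)[OF X Y fc x(1)] by simp
    then obtain v where v: "v \<in> boundaries Y n" "y = v \<oplus>\<^bsub>cycles Y n\<^esub> f n x"
      using CY.submod_coset_eq_iff[OF submod_boundaries[OF Y] yc cohomology_map_coset(1)[OF X Y fc x(1)]] by auto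
    obtain w where w: "w \<in> carrier (cobj Y (n - 1))" "v = cdiff Y (n - 1) w" using v(1) by (auto simp: boundaries_def)
    have xX: "x \<in> carrier (cobj X n)" "cdiff X n x = \<zero>\<^bsub>cobj X (n + 1)\<^esub>" using x(1) by (auto simp: cycles_def)
    have "y = f n x \<oplus>\<^bsub>cobj Y n\<^esub> cdiff Y (n - 1) w"
      using v(2) w(2) Y.M.a_comm[OF cdiff_closed(2)[OF Y w(1)] cmapD(4)[OF fc xX(1)]] by (simp add: cycles_def)
    then show "\<exists>x\<in>carrier (cobj X n). cdiff X n x = \<zero>\<^bsub>cobj X (n + 1)\<^esub> \<and>
        (\<exists>w\<in>carrier (cobj Y (n - 1)). y = f n x \<oplus>\<^bsub>cobj Y n\<^esub> cdiff Y (n - 1) w)"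
      using xX w(1) by blast
  qed
qed

text \<open>On a cycle, the term of the homotopy that starts with the differential of
  \<open>X\<close> vanishes, and only a boundary of \<open>Y\<close> remains.\<close>

lemma homotopic_on_cycles:
  assumes X: "is_complex R X" and Y: "is_complex R Y" and h: "homotopic R X Y f g" and g: "cmap R X Y g"
    and x: "x \<in> carrier (cobj X n)" "cdiff X n x = \<zero>\<^bsub>cobj X (n + 1)\<^esub>"
  shows "\<exists>w\<in>carrier (cobj Y (n - 1)). f n x = g n x \<oplus>\<^bsub>cobj Y n\<^esub> cdiff Y (n - 1) w"
proof -
  obtain h where h: "hfam R X Y h" "f n x = g n x \<oplus>\<^bsub>cobj Y n\<^esub> hbd X Y h n x"
    using h x(1) unfolding homotopic_def by blast
  interpret Y: right_module R "cobj Y n" by (rule complexD(1)[OF Y])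
  have "h (n + 1) \<zero>\<^bsub>cobj X (n + 1)\<^esub> = \<zero>\<^bsub>cobj Y n\<^esub>"
    by (rule lin_zero[OF complexD(1)[OF X] complexD(1)[OF Y] hfamD(2)[OF h(1)]])
  then show ?thesis
    using h(2) x hfamD(3)[OF h(1) x(1)] cdiff_closed(2)[OF Y] by (intro bexI[of _ "h n x"]) (auto simp: hbd_def)
qed

lemma cmap_cycle:
  assumes "is_complex R X" "is_complex R Y" "cmap R X Y f" "x \<in> carrier (cobj X n)" "cdiff X n x = \<zero>\<^bsub>cobj X (n + 1)\<^esub>"
  shows "cdiff Y n (f n x) = \<zero>\<^bsub>cobj Y (n + 1)\<^esub>"
  using cmapD(2)[OF assms(3,4)] assms(5) lin_zero[OF complexD(1)[OF assms(1)] complexD(1)[OF assms(2)] cmapD(1)[OF assms(3)]]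
  by simp

section \<open>Homotopy invariance and cancellation on cohomology\<close>

lemma cohomology_inj_homotopic:
  assumes X: "is_complex R X" and Y: "is_complex R Y" and f: "cmap R X Y f" and g: "cmap R X Y g"
    and h: "homotopic R X Y f g" and inj: "cohomology_inj X Y f"
  shows "cohomology_inj X Y g"
  unfolding cohomology_inj_def
proof (intro allI ballI impI)
  fix n x assume x: "x \<in> carrier (cobj X n)" "cdiff X n x = \<zero>\<^bsub>cobj X (n + 1)\<^esub>"
    and "\<exists>y\<in>carrier (cobj Y (n - 1)). cdiff Y (n - 1) y = g n x"
  then obtain y where y: "y \<in> carrier (cobj Y (n - 1))" "cdiff Y (n - 1) y = g n x" by blast
  obtain w where w: "w \<in> carrier (cobj Y (n - 1))" "f n x = g n x \<oplus>\<^bsub>cobj Y n\<^esub> cdiff Y (n - 1) w"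
    using homotopic_on_cycles[OF X Y h g x] by blast
  interpret Y: right_module R "cobj Y (n - 1)" by (rule complexD(1)[OF Y])
  have "cdiff Y (n - 1) (y \<oplus>\<^bsub>cobj Y (n - 1)\<^esub> w) = f n x"
    using lin_add[OF complexD'(1)[OF Y] y(1) w(1)] y(2) w(2) by simp
  then have "\<exists>y\<in>carrier (cobj Y (n - 1)). cdiff Y (n - 1) y = f n x" using Y.M.add.m_closed[OF y(1) w(1)] by blast
  then show "\<exists>w\<in>carrier (cobj X (n - 1)). cdiff X (n - 1) w = x" using inj x unfolding cohomology_inj_def by blast
qed

lemma cohomology_surj_homotopic:
  assumes X: "is_complex R X" and Y: "is_complex R Y" and f: "cmap R X Y f" and g: "cmap R X Y g"
    and h: "homotopic R X Y f g" and surj: "cohomology_surj X Y f"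
  shows "cohomology_surj X Y g"
  unfolding cohomology_surj_def
proof (intro allI ballI impI)
  fix n y assume y: "y \<in> carrier (cobj Y n)" "cdiff Y n y = \<zero>\<^bsub>cobj Y (n + 1)\<^esub>"
  then obtain x v where x: "x \<in> carrier (cobj X n)" "cdiff X n x = \<zero>\<^bsub>cobj X (n + 1)\<^esub>"
    and v: "v \<in> carrier (cobj Y (n - 1))" "y = f n x \<oplus>\<^bsub>cobj Y n\<^esub> cdiff Y (n - 1) v"
    using surj unfolding cohomology_surj_def by blast
  obtain w where w: "w \<in> carrier (cobj Y (n - 1))" "f n x = g n x \<oplus>\<^bsub>cobj Y n\<^esub> cdiff Y (n - 1) w"
    using homotopic_on_cycles[OF X Y h g x] by blast
  interpret Y: right_module R "cobj Y i" for i by (rule complexD(1)[OF Y])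
  have "y = g n x \<oplus>\<^bsub>cobj Y n\<^esub> cdiff Y (n - 1) (w \<oplus>\<^bsub>cobj Y (n - 1)\<^esub> v)"
    using lin_add[OF complexD'(1)[OF Y] w(1) v(1)] v(2) w(2) cmapD(4)[OF g x(1)] cdiff_closed(2)[OF Y w(1)] cdiff_closed(2)[OF Y v(1)]
    by (simp add: Y.M.a_assoc)
  then show "\<exists>x\<in>carrier (cobj X n). cdiff X n x = \<zero>\<^bsub>cobj X (n + 1)\<^esub> \<and>
      (\<exists>w\<in>carrier (cobj Y (n - 1)). y = g n x \<oplus>\<^bsub>cobj Y n\<^esub> cdiff Y (n - 1) w)"
    using x Y.M.add.m_closed[OF w(1) v(1)] by blast
qed

lemma cohomology_inj_comp:
  assumes X: "is_complex R X" and Y: "is_complex R Y" and f: "cmap R X Y f"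
    and "cohomology_inj X Y f" "cohomology_inj Y Z g"
  shows "cohomology_inj X Z (\<lambda>n x. g n (f n x))"
  unfolding cohomology_inj_def
proof (intro allI ballI impI)
  fix n x assume x: "x \<in> carrier (cobj X n)" "cdiff X n x = \<zero>\<^bsub>cobj X (n + 1)\<^esub>"
    and y: "\<exists>y\<in>carrier (cobj Z (n - 1)). cdiff Z (n - 1) y = g n (f n x)"
  have "\<exists>w\<in>carrier (cobj Y (n - 1)). cdiff Y (n - 1) w = f n x"
    using assms(5) cmapD(4)[OF f x(1)] cmap_cycle[OF X Y f x] y unfolding cohomology_inj_def by blast
  then show "\<exists>w\<in>carrier (cobj X (n - 1)). cdiff X (n - 1) w = x"
    using assms(4) x unfolding cohomology_inj_def by blast
qed

lemma cohomology_inj_compD: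
  assumes g: "cmap R Y Z g" and inj: "cohomology_inj X Z (\<lambda>n x. g n (f n x))"
  shows "cohomology_inj X Y f"
  unfolding cohomology_inj_def
proof (intro allI ballI impI)
  fix n x assume x: "x \<in> carrier (cobj X n)" "cdiff X n x = \<zero>\<^bsub>cobj X (n + 1)\<^esub>"
    and "\<exists>y\<in>carrier (cobj Y (n - 1)). cdiff Y (n - 1) y = f n x"
  then obtain y where y: "y \<in> carrier (cobj Y (n - 1))" "cdiff Y (n - 1) y = f n x" by blast
  then have "\<exists>y\<in>carrier (cobj Z (n - 1)). cdiff Z (n - 1) y = g n (f n x)"
    using cmapD(3)[OF g y(1)] cmapD(4)[OF g y(1)] by metis
  then show "\<exists>w\<in>carrier (cobj X (n - 1)). cdiff X (n - 1) w = x" using inj x unfolding cohomology_inj_def by blast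
qed

lemma cohomology_surj_comp:
  assumes X: "is_complex R X" and Y: "is_complex R Y" and Z: "is_complex R Z" and f: "cmap R X Y f" and g: "cmap R Y Z g"
    and "cohomology_surj X Y f" "cohomology_surj Y Z g"
  shows "cohomology_surj X Z (\<lambda>n x. g n (f n x))"
  unfolding cohomology_surj_def
proof (intro allI ballI impI)
  fix n z assume "z \<in> carrier (cobj Z n)" "cdiff Z n z = \<zero>\<^bsub>cobj Z (n + 1)\<^esub>"
  then obtain y v where y: "y \<in> carrier (cobj Y n)" "cdiff Y n y = \<zero>\<^bsub>cobj Y (n + 1)\<^esub>"
    and v: "v \<in> carrier (cobj Z (n - 1))" "z = g n y \<oplus>\<^bsub>cobj Z n\<^esub> cdiff Z (n - 1) v"
    using assms(7) unfolding cohomology_surj_def by blast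
  obtain x w where x: "x \<in> carrier (cobj X n)" "cdiff X n x = \<zero>\<^bsub>cobj X (n + 1)\<^esub>"
    and w: "w \<in> carrier (cobj Y (n - 1))" "y = f n x \<oplus>\<^bsub>cobj Y n\<^esub> cdiff Y (n - 1) w"
    using assms(6) y unfolding cohomology_surj_def by blast
  interpret Z: right_module R "cobj Z i" for i by (rule complexD(1)[OF Z])
  have gw: "g (n - 1) w \<in> carrier (cobj Z (n - 1))" by (rule cmapD(4)[OF g w(1)])
  have "z = g n (f n x) \<oplus>\<^bsub>cobj Z n\<^esub> cdiff Z (n - 1) (g (n - 1) w \<oplus>\<^bsub>cobj Z (n - 1)\<^esub> v)"
    using v(2) w(2) lin_add[OF cmapD(1)[OF g] cmapD(4)[OF f x(1)] cdiff_closed(2)[OF Y w(1)]] cmapD(3)[OF g w(1)]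
      lin_add[OF complexD'(1)[OF Z] gw v(1)] cmapD(4)[OF g cmapD(4)[OF f x(1)]] cdiff_closed(2)[OF Z gw] cdiff_closed(2)[OF Z v(1)]
    by (simp add: Z.M.a_assoc)
  then show "\<exists>x\<in>carrier (cobj X n). cdiff X n x = \<zero>\<^bsub>cobj X (n + 1)\<^esub> \<and>
      (\<exists>w\<in>carrier (cobj Z (n - 1)). z = g n (f n x) \<oplus>\<^bsub>cobj Z n\<^esub> cdiff Z (n - 1) w)"
    using x Z.M.add.m_closed[OF gw v(1)] by blast
qed

lemma cohomology_surj_compD:
  assumes X: "is_complex R X" and Y: "is_complex R Y" and f: "cmap R X Y f" and surj: "cohomology_surj X Z (\<lambda>n x. g n (f n x))"
  shows "cohomology_surj Y Z g"
  using surj cmapD(4)[OF f] cmap_cycle[OF X Y f] unfolding cohomology_surj_def by blast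

text \<open>For a cycle \<open>y\<close>, surjectivity of the composite provides a cycle
  \<open>x\<close> such that the images of \<open>y\<close> and \<open>f n x\<close> under
  \<open>g\<close> differ by a boundary. Injectivity of \<open>g\<close> carries this back to
  \<open>Y\<close>.\<close>

lemma cohomology_surj_cancel:
  assumes X: "is_complex R X" and Y: "is_complex R Y" and Z: "is_complex R Z" and f: "cmap R X Y f" and g: "cmap R Y Z g"
    and surj: "cohomology_surj X Z (\<lambda>n x. g n (f n x))" and inj: "cohomology_inj Y Z g"
  shows "cohomology_surj X Y f"
  unfolding cohomology_surj_def
proof (intro allI ballI impI)
  fix n y assume y: "y \<in> carrier (cobj Y n)" "cdiff Y n y = \<zero>\<^bsub>cobj Y (n + 1)\<^esub>"
  interpret Y: right_module R "cobj Y i" for i by (rule complexD(1)[OF Y])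
  interpret Z: right_module R "cobj Z i" for i by (rule complexD(1)[OF Z])
  obtain x w where x: "x \<in> carrier (cobj X n)" "cdiff X n x = \<zero>\<^bsub>cobj X (n + 1)\<^esub>"
    and w: "w \<in> carrier (cobj Z (n - 1))" "g n y = g n (f n x) \<oplus>\<^bsub>cobj Z n\<^esub> cdiff Z (n - 1) w"
    using surj cmapD(4)[OF g y(1)] cmap_cycle[OF Y Z g y] unfolding cohomology_surj_def by blast
  have fx: "f n x \<in> carrier (cobj Y n)" by (rule cmapD(4)[OF f x(1)])
  let ?d = "y \<ominus>\<^bsub>cobj Y n\<^esub> f n x"
  have dc: "?d \<in> carrier (cobj Y n)" using y(1) fx by (simp add: a_minus_def)
  have "g n ?d = cdiff Z (n - 1) w"
    using lin_diff[OF Y.right_module_axioms Z.right_module_axioms cmapD(1)[OF g] y(1) fx] w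
      Z.diff_eq_iff[OF cmapD(4)[OF g y(1)] cmapD(4)[OF g fx] cdiff_closed(2)[OF Z w(1)]]
      Z.M.a_comm[OF cmapD(4)[OF g fx] cdiff_closed(2)[OF Z w(1)]] by simp
  moreover have "cdiff Y n ?d = \<zero>\<^bsub>cobj Y (n + 1)\<^esub>"
    using lin_diff[OF Y.right_module_axioms Y.right_module_axioms complexD(3)[OF Y] y(1) fx] y(2) cmap_cycle[OF X Y f x]
    by (simp add: a_minus_def)
  ultimately have "\<exists>v\<in>carrier (cobj Y (n - 1)). cdiff Y (n - 1) v = ?d"
    using inj dc w(1) unfolding cohomology_inj_def by metis
  then obtain v where v: "v \<in> carrier (cobj Y (n - 1))" "cdiff Y (n - 1) v = ?d" by blast
  then have "y = f n x \<oplus>\<^bsub>cobj Y n\<^esub> cdiff Y (n - 1) v"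
    using Y.diff_eq_iff[OF y(1) fx dc] Y.M.a_comm[OF dc fx] by simp
  then show "\<exists>x\<in>carrier (cobj X n). cdiff X n x = \<zero>\<^bsub>cobj X (n + 1)\<^esub> \<and>
      (\<exists>w\<in>carrier (cobj Y (n - 1)). y = f n x \<oplus>\<^bsub>cobj Y n\<^esub> cdiff Y (n - 1) w)"
    using x v(1) by blast
qed

text \<open>Replace \<open>y\<close> by a cohomologous element \<open>f n x\<close>, using
  surjectivity of \<open>f\<close>. Then \<open>x\<close> is a cycle whose image in \<open>Z\<close>
  is a boundary, hence a boundary itself.\<close>

lemma cohomology_inj_cancel:
  assumes X: "is_complex R X" and Y: "is_complex R Y" and Z: "is_complex R Z" and f: "cmap R X Y f" and g: "cmap R Y Z g"
    and inj: "cohomology_inj X Z (\<lambda>n x. g n (f n x))" and surj: "cohomology_surj X Y f"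
  shows "cohomology_inj Y Z g"
  unfolding cohomology_inj_def
proof (intro allI ballI impI)
  interpret Y: right_module R "cobj Y i" for i by (rule complexD(1)[OF Y])
  interpret Z: right_module R "cobj Z i" for i by (rule complexD(1)[OF Z])
  fix n y assume y: "y \<in> carrier (cobj Y n)" "cdiff Y n y = \<zero>\<^bsub>cobj Y (n + 1)\<^esub>"
    and "\<exists>z\<in>carrier (cobj Z (n - 1)). cdiff Z (n - 1) z = g n y"
  then obtain z where z: "z \<in> carrier (cobj Z (n - 1))" "cdiff Z (n - 1) z = g n y" by blast
  obtain x w where x: "x \<in> carrier (cobj X n)" "cdiff X n x = \<zero>\<^bsub>cobj X (n + 1)\<^esub>"
    and w: "w \<in> carrier (cobj Y (n - 1))" "y = f n x \<oplus>\<^bsub>cobj Y n\<^esub> cdiff Y (n - 1) w"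
    using surj y unfolding cohomology_surj_def by blast
  have fx: "f n x \<in> carrier (cobj Y n)" and gfx: "g n (f n x) \<in> carrier (cobj Z n)"
    using cmapD(4)[OF f x(1)] cmapD(4)[OF g cmapD(4)[OF f x(1)]] .
  have gw: "g (n - 1) w \<in> carrier (cobj Z (n - 1))" by (rule cmapD(4)[OF g w(1)])
  have "g n y = g n (f n x) \<oplus>\<^bsub>cobj Z n\<^esub> cdiff Z (n - 1) (g (n - 1) w)"
    using w(2) lin_add[OF cmapD(1)[OF g] fx cdiff_closed(2)[OF Y w(1)]] cmapD(3)[OF g w(1)] by simp
  then have "cdiff Z (n - 1) (z \<ominus>\<^bsub>cobj Z (n - 1)\<^esub> g (n - 1) w) = g n (f n x)"
    using lin_diff[OF Z.right_module_axioms Z.right_module_axioms complexD'(1)[OF Z] z(1) gw] z(2)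
      Z.diff_eq_iff[OF cdiff_closed(2)[OF Z z(1)] cdiff_closed(2)[OF Z gw] gfx] by simp
  moreover have "z \<ominus>\<^bsub>cobj Z (n - 1)\<^esub> g (n - 1) w \<in> carrier (cobj Z (n - 1))" using z(1) gw by (simp add: a_minus_def)
  ultimately obtain v where v: "v \<in> carrier (cobj X (n - 1))" "cdiff X (n - 1) v = x"
    using inj x unfolding cohomology_inj_def by metis
  have fv: "f (n - 1) v \<in> carrier (cobj Y (n - 1))" by (rule cmapD(4)[OF f v(1)])
  have "cdiff Y (n - 1) (f (n - 1) v \<oplus>\<^bsub>cobj Y (n - 1)\<^esub> w) = y"
    using lin_add[OF complexD'(1)[OF Y] fv w(1)] cmapD(3)[OF f v(1)] v(2) w(2) by simp
  then show "\<exists>w\<in>carrier (cobj Y (n - 1)). cdiff Y (n - 1) w = y" using Y.M.add.m_closed[OF fv w(1)] by blast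
qed

lemma cohomology_id:
  assumes X: "is_complex R X"
  shows "cohomology_inj X X (\<lambda>n x. x)" "cohomology_surj X X (\<lambda>n x. x)"
proof -
  show "cohomology_inj X X (\<lambda>n x. x)" by (auto simp: cohomology_inj_def)
  interpret X: right_module R "cobj X i" for i by (rule complexD(1)[OF X])
  have "x = x \<oplus>\<^bsub>cobj X n\<^esub> cdiff X (n - 1) \<zero>\<^bsub>cobj X (n - 1)\<^esub>" if "x \<in> carrier (cobj X n)" for n x
    using that lin_zero[OF X.right_module_axioms X.right_module_axioms complexD'(1)[OF X]] by simp
  then show "cohomology_surj X X (\<lambda>n x. x)" unfolding cohomology_surj_def using X.M.zero_closed by blast
qed

context k_algebra
begin

lemma homotopic_of_class:
  assumes W: "is_complex \<Lambda> W" and X: "is_complex \<Lambda> X"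
    and "a \<in> chain_maps \<Lambda> W V" "b \<in> chain_maps \<Lambda> V X" "c \<in> chain_maps \<Lambda> W V'" "d \<in> chain_maps \<Lambda> V' X"
    and "class_K \<Lambda> W X (chain_comp W b a) = class_K \<Lambda> W X (chain_comp W d c)"
  shows "homotopic \<Lambda> W X (\<lambda>n x. b n (a n x)) (\<lambda>n x. d n (c n x))"
proof -
  have "homotopic \<Lambda> W X (chain_comp W b a) (chain_comp W d c)"
    using class_K_eq_iff[OF W X chain_comp_chain_maps[OF W assms(3,4)] chain_comp_chain_maps[OF W assms(5,6)]] assms(7) by simp
  then show ?thesis by (rule homotopic_cong[OF W]) (auto simp: chain_comp_def)
qed

text \<open>A section of \<open>s\<close> up to homotopy. It turns a roof with legs \<open>s\<close>
  and \<open>f\<close> into an actual chain map, the composite of \<open>f\<close> and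
  \<open>t\<close>.\<close>

definition lifts :: "('r, 'm) cochain_complex \<Rightarrow> ('r, 'm) cochain_complex \<Rightarrow> (int \<Rightarrow> 'm \<Rightarrow> 'm) \<Rightarrow> (int \<Rightarrow> 'm \<Rightarrow> 'm) \<Rightarrow> bool"
  where "lifts P Z s t \<longleftrightarrow> cmap \<Lambda> P Z t \<and> homotopic \<Lambda> P P (\<lambda>n x. x) (\<lambda>n x. s n (t n x))"

end

section \<open>Roofs starting at a bounded above complex of projectives\<close>

locale bounded_projective = k_algebra k \<Lambda>
  for k :: "('k, 'c) ring_scheme" and \<Lambda> :: "('k, 'r) module" +
  fixes P :: "('r, 'm) cochain_complex"
  assumes P: "is_complex \<Lambda> P" and proj: "\<And>n. projective_module \<Lambda> (cobj P n)"
    and bounded: "\<exists>N. \<forall>n>N. zero_module (cobj P n)"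
begin

lemma lift_ex:
  assumes Z: "is_complex \<Lambda> Z" and q: "quasi_iso \<Lambda> Z P s"
  shows "\<exists>t. lifts P Z s t"
proof -
  note s = quasi_isoD[OF Z P q]
  show ?thesis
    using projective_lift[OF P proj _ Z P s(2,3,4) cmap_id] bounded unfolding lifts_def by blast
qed

lemma lift_unique:
  assumes Z: "is_complex \<Lambda> Z" and W: "is_complex \<Lambda> W" and q: "quasi_iso \<Lambda> Z W s"
    and t: "cmap \<Lambda> P Z t" and t': "cmap \<Lambda> P Z t'"
    and "homotopic \<Lambda> P W (\<lambda>n x. s n (t n x)) (\<lambda>n x. s n (t' n x))"
  shows "homotopic \<Lambda> P Z t t'"
proof -
  note s = quasi_isoD[OF Z W q]
  show ?thesis
    using projective_lift_unique[OF P proj _ Z W s(2,3,4) t t' assms(6)] bounded by blast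
qed

lemma homotopic_post:
  assumes "is_complex \<Lambda> Z" "is_complex \<Lambda> W" "cmap \<Lambda> Z W s" "cmap \<Lambda> P Z t'" "homotopic \<Lambda> P Z t t'"
  shows "homotopic \<Lambda> P W (\<lambda>n x. s n (t n x)) (\<lambda>n x. s n (t' n x))"
  by (rule homotopic_comp[OF P assms(1,2,4,3,3,5) homotopic_refl[OF assms(1,2,3)]])

lemma homotopic_pre:
  assumes "is_complex \<Lambda> Z" "is_complex \<Lambda> W" "cmap \<Lambda> Z W s" "cmap \<Lambda> Z W s'" "cmap \<Lambda> P Z t" "homotopic \<Lambda> Z W s s'"
  shows "homotopic \<Lambda> P W (\<lambda>n x. s n (t n x)) (\<lambda>n x. s' n (t n x))"
  by (rule homotopic_comp[OF P assms(1,2,5,3,4) homotopic_refl[OF P assms(1,5)] assms(6)])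

lemma lift_homotopic:
  assumes Z: "is_complex \<Lambda> Z" and q: "quasi_iso \<Lambda> Z P s" and t: "lifts P Z s t" and t': "lifts P Z s t'"
  shows "homotopic \<Lambda> P Z t t'"
proof (rule lift_unique[OF Z P q])
  show tc: "cmap \<Lambda> P Z t" and tc': "cmap \<Lambda> P Z t'" using t t' by (auto simp: lifts_def)
  note sc = quasi_isoD(2)[OF Z P q]
  have "homotopic \<Lambda> P P (\<lambda>n x. s n (t n x)) (\<lambda>n x. x)"
    by (rule homotopic_sym[OF P P cmap_comp[OF tc sc]]) (use t in \<open>simp add: lifts_def\<close>)
  then show "homotopic \<Lambda> P P (\<lambda>n x. s n (t n x)) (\<lambda>n x. s n (t' n x))"
    by (rule homotopic_trans[OF P P cmap_comp[OF tc' sc]]) (use t' in \<open>simp add: lifts_def\<close>)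
qed

text \<open>Equality of the roofs is witnessed by a complex \<open>W\<close> over both of them. A
  lift of the identity to \<open>W\<close> induces lifts to \<open>Z\<close> and \<open>Z'\<close>,
  to which the given ones are homotopic by uniqueness; the two right legs agree on \<open>W\<close>
  up to homotopy.\<close>

lemma roof_eq_lift:
  assumes Y: "is_complex \<Lambda> Y" and eq: "roof_eq \<Lambda> P Y (Z, s, f) (Z', s', f')"
    and t: "lifts P Z s t" and t': "lifts P Z' s' t'"
  shows "homotopic \<Lambda> P Y (\<lambda>n x. f n (t n x)) (\<lambda>n x. f' n (t' n x))"
proof -
  have Z: "is_complex \<Lambda> Z" "quasi_iso \<Lambda> Z P s" "f \<in> chain_maps \<Lambda> Z Y"
    and Z': "is_complex \<Lambda> Z'" "quasi_iso \<Lambda> Z' P s'" "f' \<in> chain_maps \<Lambda> Z' Y"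
    using eq by (auto simp: roof_eq_def is_roof_def)
  obtain W :: "('r, 'm) cochain_complex" and a b where W: "is_complex \<Lambda> W" and a: "a \<in> chain_maps \<Lambda> W Z" and b: "b \<in> chain_maps \<Lambda> W Z'"
    and q: "quasi_iso \<Lambda> W P (chain_comp W s a)"
    and e1: "class_K \<Lambda> W P (chain_comp W s a) = class_K \<Lambda> W P (chain_comp W s' b)"
    and e2: "class_K \<Lambda> W Y (chain_comp W f a) = class_K \<Lambda> W Y (chain_comp W f' b)"
    using eq by (auto simp: roof_eq_def)
  note s = quasi_isoD[OF Z(1) P Z(2)] and s' = quasi_isoD[OF Z'(1) P Z'(2)]
  note ac = chain_maps_cmap[OF a] and bc = chain_maps_cmap[OF b]
  note fc = chain_maps_cmap[OF Z(3)] and fc' = chain_maps_cmap[OF Z'(3)]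
  obtain r where r: "lifts P W (chain_comp W s a) r" using lift_ex[OF W q] by blast
  then have rc: "cmap \<Lambda> P W r" by (simp add: lifts_def)
  have ar: "lifts P Z s (\<lambda>n x. a n (r n x))"
    unfolding lifts_def
  proof
    show "cmap \<Lambda> P Z (\<lambda>n x. a n (r n x))" by (rule cmap_comp[OF rc ac])
    have "homotopic \<Lambda> P P (\<lambda>n x. x) (\<lambda>n x. chain_comp W s a n (r n x))" using r by (simp add: lifts_def)
    then show "homotopic \<Lambda> P P (\<lambda>n x. x) (\<lambda>n x. s n (a n (r n x)))"
      by (rule homotopic_cong[OF P]) (auto simp: chain_comp_def cmapD(4)[OF rc])
  qed
  have br: "lifts P Z' s' (\<lambda>n x. b n (r n x))"
    unfolding lifts_def
  proof
    show "cmap \<Lambda> P Z' (\<lambda>n x. b n (r n x))" by (rule cmap_comp[OF rc bc])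
    have "homotopic \<Lambda> W P (\<lambda>n x. s n (a n x)) (\<lambda>n x. s' n (b n x))"
      by (rule homotopic_of_class[OF W P a s(1) b s'(1) e1])
    from homotopic_pre[OF W P cmap_comp[OF ac s(2)] cmap_comp[OF bc s'(2)] rc this]
    show "homotopic \<Lambda> P P (\<lambda>n x. x) (\<lambda>n x. s' n (b n (r n x)))"
      using ar homotopic_trans[OF P P cmap_comp[OF cmap_comp[OF rc bc] s'(2)]] unfolding lifts_def by blast
  qed
  have tc': "cmap \<Lambda> P Z' t'" using t' by (simp add: lifts_def)
  have 1: "homotopic \<Lambda> P Y (\<lambda>n x. f n (t n x)) (\<lambda>n x. f n (a n (r n x)))"
    by (rule homotopic_post[OF Z(1) Y fc cmap_comp[OF rc ac] lift_homotopic[OF Z(1,2) t ar]])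
  have "homotopic \<Lambda> W Y (\<lambda>n x. f n (a n x)) (\<lambda>n x. f' n (b n x))"
    by (rule homotopic_of_class[OF W Y a Z(3) b Z'(3) e2])
  from homotopic_pre[OF W Y cmap_comp[OF ac fc] cmap_comp[OF bc fc'] rc this]
  have 2: "homotopic \<Lambda> P Y (\<lambda>n x. f n (a n (r n x))) (\<lambda>n x. f' n (b n (r n x)))" .
  have 3: "homotopic \<Lambda> P Y (\<lambda>n x. f' n (b n (r n x))) (\<lambda>n x. f' n (t' n x))"
    by (rule homotopic_post[OF Z'(1) Y fc' tc' lift_homotopic[OF Z'(1,2) br t']])
  show ?thesis
    by (rule homotopic_trans[OF P Y cmap_comp[OF tc' fc'] 1 homotopic_trans[OF P Y cmap_comp[OF tc' fc'] 2 3]])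
qed

text \<open>Of the two composites with an inverse roof, the one on \<open>P\<close> gives
  injectivity of \<open>f\<close> on cohomology and the one on \<open>X\<close> surjectivity.
  Equality with an identity roof is unfolded to complexes on which the homotopies live, and
  cancellation removes the auxiliary maps.\<close>

lemma derived_iso_resolution:
  assumes X: "is_complex \<Lambda> X" and iso: "is_derived_iso \<Lambda> P X (Z, s, f)"
  shows "is_complex \<Lambda> Z" "quasi_iso \<Lambda> Z P s" "f \<in> chain_maps \<Lambda> Z X" "cohomology_inj Z X f" "cohomology_surj Z X f"
proof -
  obtain q where q1: "is_composite \<Lambda> P X P (Z, s, f) q (roof_of P (chain_id P))"
    and q2: "is_composite \<Lambda> X P X q (Z, s, f) (roof_of X (chain_id X))"
    using iso unfolding is_derived_iso_def by blast
  obtain Z' s' f' where q: "q = (Z', s', f')" by (cases q) auto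
  have r: "is_roof \<Lambda> P X (Z, s, f)" "is_roof \<Lambda> X P (Z', s', f')"
    using q1 unfolding q by (auto simp: is_composite_def)
  show Z: "is_complex \<Lambda> Z" and sq: "quasi_iso \<Lambda> Z P s" and f: "f \<in> chain_maps \<Lambda> Z X"
    using r(1) by (auto simp: is_roof_def)
  have Z': "is_complex \<Lambda> Z'" and sq': "quasi_iso \<Lambda> Z' X s'" and f': "f' \<in> chain_maps \<Lambda> Z' P"
    using r(2) by (auto simp: is_roof_def)
  note s = quasi_isoD[OF Z P sq] and s' = quasi_isoD[OF Z' X sq']
  note fc = chain_maps_cmap[OF f] and fc' = chain_maps_cmap[OF f']
  obtain V :: "('r, 'm) cochain_complex" and a b where V: "is_complex \<Lambda> V" and a: "quasi_iso \<Lambda> V Z a" and b: "b \<in> chain_maps \<Lambda> V Z'"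
    and e: "class_K \<Lambda> V X (chain_comp V f a) = class_K \<Lambda> V X (chain_comp V s' b)"
    and re: "roof_eq \<Lambda> P P (V, chain_comp V s a, chain_comp V f' b) (P, chain_id P, chain_id P)"
    using q1 unfolding q roof_of_def by (auto simp: is_composite_def)
  obtain W :: "('r, 'm) cochain_complex" and c d where W: "is_complex \<Lambda> W" and c: "c \<in> chain_maps \<Lambda> W V" and d: "d \<in> chain_maps \<Lambda> W P"
    and qW: "quasi_iso \<Lambda> W P (chain_comp W (chain_comp V s a) c)"
    and e1: "class_K \<Lambda> W P (chain_comp W (chain_comp V s a) c) = class_K \<Lambda> W P (chain_comp W (chain_id P) d)"
    and e2: "class_K \<Lambda> W P (chain_comp W (chain_comp V f' b) c) = class_K \<Lambda> W P (chain_comp W (chain_id P) d)"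
    using re by (auto simp: roof_eq_def)
  note ac = quasi_isoD(2)[OF V Z a] and bc = chain_maps_cmap[OF b] and cc = chain_maps_cmap[OF c]
  have sa: "chain_comp V s a \<in> chain_maps \<Lambda> V P" by (rule chain_comp_chain_maps[OF V quasi_isoD(1)[OF V Z a] s(1)])
  have fb: "chain_comp V f' b \<in> chain_maps \<Lambda> V P" by (rule chain_comp_chain_maps[OF V b f'])
  note gW = quasi_isoD[OF W P qW]
  have "class_K \<Lambda> W P (chain_comp W (chain_comp V s a) c) = class_K \<Lambda> W P (chain_comp W (chain_comp V f' b) c)"
    using e1 e2 by simp
  \<comment> \<open>Through \<open>W\<close>, the composite ending with \<open>f'\<close> is
    homotopic to the one ending with \<open>s\<close>, which is a quasi-isomorphism. So it is
    injective on cohomology, and hence so is its part up to \<open>Z'\<close>.\<close>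
  from homotopic_of_class[OF W P c sa c fb this]
  have h1: "homotopic \<Lambda> W P (\<lambda>n x. s n (a n (c n x))) (\<lambda>n x. f' n (b n (c n x)))"
    by (rule homotopic_cong[OF W]) (auto simp: chain_comp_def cmapD(4)[OF cc])
  have acc: "cmap \<Lambda> W Z (\<lambda>n x. a n (c n x))" by (rule cmap_comp[OF cc ac])
  have bcc: "cmap \<Lambda> W Z' (\<lambda>n x. b n (c n x))" by (rule cmap_comp[OF cc bc])
  have sac: "cmap \<Lambda> W P (\<lambda>n x. s n (a n (c n x)))" by (rule cmap_comp[OF acc s(2)])
  have fbc: "cmap \<Lambda> W P (\<lambda>n x. f' n (b n (c n x)))" by (rule cmap_comp[OF bcc fc'])
  have "homotopic \<Lambda> W P (chain_comp W (chain_comp V s a) c) (\<lambda>n x. s n (a n (c n x)))"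
    by (rule homotopic_cong[OF W homotopic_refl[OF W P sac]]) (auto simp: chain_comp_def cmapD(4)[OF cc])
  then have inj1: "cohomology_inj W P (\<lambda>n x. s n (a n (c n x)))" and surj1: "cohomology_surj W P (\<lambda>n x. s n (a n (c n x)))"
    using cohomology_inj_homotopic[OF W P gW(2) sac _ gW(3)] cohomology_surj_homotopic[OF W P gW(2) sac _ gW(4)] by auto
  have "cohomology_inj W P (\<lambda>n x. f' n (b n (c n x)))"
    by (rule cohomology_inj_homotopic[OF W P sac fbc h1 inj1])
  then have "cohomology_inj W Z' (\<lambda>n x. b n (c n x))" by (rule cohomology_inj_compD[OF fc'])
  then have i2: "cohomology_inj W X (\<lambda>n x. s' n (b n (c n x)))"
    by (rule cohomology_inj_comp[OF W Z' bcc _ s'(3)])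
  have h2: "homotopic \<Lambda> V X (\<lambda>n x. f n (a n x)) (\<lambda>n x. s' n (b n x))"
    by (rule homotopic_of_class[OF V X quasi_isoD(1)[OF V Z a] f b s'(1) e])
  have fa: "cmap \<Lambda> V X (\<lambda>n x. f n (a n x))" and sb: "cmap \<Lambda> V X (\<lambda>n x. s' n (b n x))"
    by (rule cmap_comp[OF ac fc], rule cmap_comp[OF bc s'(2)])
  have h3: "homotopic \<Lambda> W X (\<lambda>n x. s' n (b n (c n x))) (\<lambda>n x. f n (a n (c n x)))"
    by (rule homotopic_comp[OF W V X cc sb fa homotopic_refl[OF W V cc] homotopic_sym[OF V X sb h2]])
  have i3: "cohomology_inj W X (\<lambda>n x. f n (a n (c n x)))"
    by (rule cohomology_inj_homotopic[OF W X cmap_comp[OF cc sb] cmap_comp[OF cc fa] h3 i2])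
  \<comment> \<open>Injectivity is known so far only for \<open>f\<close> preceded by the map from
    \<open>W\<close> to \<open>Z\<close>. That map is surjective on cohomology, because its
    composite with \<open>s\<close> is and \<open>s\<close> is injective, so it can be
    cancelled.\<close>
  have "cohomology_surj W Z (\<lambda>n x. a n (c n x))"
    by (rule cohomology_surj_cancel[OF W Z P acc s(2) surj1 s(3)])
  from cohomology_inj_cancel[OF W Z X acc fc i3 this] show "cohomology_inj Z X f" .
  \<comment> \<open>The other composite is the identity of \<open>X\<close>: a map homotopic to a
    quasi-isomorphism ends with \<open>f\<close>, which makes \<open>f\<close> surjective on
    cohomology.\<close>
  obtain V2 :: "('r, 'm) cochain_complex" and a2 b2 where V2: "is_complex \<Lambda> V2" and a2: "quasi_iso \<Lambda> V2 Z' a2" and b2: "b2 \<in> chain_maps \<Lambda> V2 Z"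
    and re2: "roof_eq \<Lambda> X X (V2, chain_comp V2 s' a2, chain_comp V2 f b2) (X, chain_id X, chain_id X)"
    using q2 unfolding q roof_of_def by (auto simp: is_composite_def)
  obtain W2 :: "('r, 'm) cochain_complex" and c2 d2 where W2: "is_complex \<Lambda> W2" and c2: "c2 \<in> chain_maps \<Lambda> W2 V2" and d2: "d2 \<in> chain_maps \<Lambda> W2 X"
    and qW2: "quasi_iso \<Lambda> W2 X (chain_comp W2 (chain_comp V2 s' a2) c2)"
    and e12: "class_K \<Lambda> W2 X (chain_comp W2 (chain_comp V2 s' a2) c2) = class_K \<Lambda> W2 X (chain_comp W2 (chain_id X) d2)"
    and e22: "class_K \<Lambda> W2 X (chain_comp W2 (chain_comp V2 f b2) c2) = class_K \<Lambda> W2 X (chain_comp W2 (chain_id X) d2)"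
    using re2 by (auto simp: roof_eq_def)
  note b2c = chain_maps_cmap[OF b2] and c2c = chain_maps_cmap[OF c2]
  have sa2: "chain_comp V2 s' a2 \<in> chain_maps \<Lambda> V2 X" by (rule chain_comp_chain_maps[OF V2 quasi_isoD(1)[OF V2 Z' a2] s'(1)])
  have fb2: "chain_comp V2 f b2 \<in> chain_maps \<Lambda> V2 X" by (rule chain_comp_chain_maps[OF V2 b2 f])
  note gW2 = quasi_isoD[OF W2 X qW2]
  have fbc2: "cmap \<Lambda> W2 X (\<lambda>n x. f n (b2 n (c2 n x)))" by (rule cmap_comp[OF c2c cmap_comp[OF b2c fc]])
  have "class_K \<Lambda> W2 X (chain_comp W2 (chain_comp V2 s' a2) c2) = class_K \<Lambda> W2 X (chain_comp W2 (chain_comp V2 f b2) c2)"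
    using e12 e22 by simp
  from homotopic_of_class[OF W2 X c2 sa2 c2 fb2 this]
  have "homotopic \<Lambda> W2 X (chain_comp W2 (chain_comp V2 s' a2) c2) (\<lambda>n x. f n (b2 n (c2 n x)))"
    by (rule homotopic_cong[OF W2]) (auto simp: chain_comp_def cmapD(4)[OF c2c])
  then have "cohomology_surj W2 X (\<lambda>n x. f n (b2 n (c2 n x)))"
    by (rule cohomology_surj_homotopic[OF W2 X gW2(2) fbc2 _ gW2(4)])
  then show "cohomology_surj Z X f"
    by (rule cohomology_surj_compD[OF W2 Z cmap_comp[OF c2c b2c]])
qed

text \<open>As \<open>t\<close> is a section up to homotopy of the quasi-isomorphism
  \<open>s\<close>, it is itself bijective on cohomology; the right leg \<open>f\<close> is so by
  \<open>derived_iso_resolution\<close>.\<close>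

lemma resolution_map:
  assumes X: "is_complex \<Lambda> X" and iso: "is_derived_iso \<Lambda> P X (Z, s, f)" and t: "lifts P Z s t"
  shows "cmap \<Lambda> P X (\<lambda>n x. f n (t n x))" "cohomology_inj P X (\<lambda>n x. f n (t n x))" "cohomology_surj P X (\<lambda>n x. f n (t n x))"
proof -
  note r = derived_iso_resolution[OF X iso]
  note s = quasi_isoD[OF r(1) P r(2)] and fc = chain_maps_cmap[OF r(3)]
  have tc: "cmap \<Lambda> P Z t" and h: "homotopic \<Lambda> P P (\<lambda>n x. x) (\<lambda>n x. s n (t n x))" using t by (auto simp: lifts_def)
  note st = cmap_comp[OF tc s(2)]
  show "cmap \<Lambda> P X (\<lambda>n x. f n (t n x))" by (rule cmap_comp[OF tc fc])
  have "cohomology_inj P P (\<lambda>n x. s n (t n x))"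
    by (rule cohomology_inj_homotopic[OF P P cmap_id st h cohomology_id(1)[OF P]])
  then have "cohomology_inj P Z t" by (rule cohomology_inj_compD[OF s(2)])
  then show "cohomology_inj P X (\<lambda>n x. f n (t n x))" by (rule cohomology_inj_comp[OF P r(1) tc _ r(4)])
  have "cohomology_surj P P (\<lambda>n x. s n (t n x))"
    by (rule cohomology_surj_homotopic[OF P P cmap_id st h cohomology_id(2)[OF P]])
  then have "cohomology_surj P Z t" by (rule cohomology_surj_cancel[OF P r(1) P tc s(2) _ s(3)])
  then show "cohomology_surj P X (\<lambda>n x. f n (t n x))" by (rule cohomology_surj_comp[OF P r(1) X tc fc _ r(5)])
qed

end

text \<open>Both composites are represented by the same roof \<open>q\<close>. Lifting the identity
  of \<open>P\<close> to the complexes that witness the two compositions shows that each side is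
  homotopic to the chain map obtained from \<open>q\<close>.\<close>

lemma (in k_algebra) resolution_natural:
  fixes P P' :: "('r, 'm) cochain_complex"
  assumes bP: "bounded_projective k \<Lambda> P" and bP': "bounded_projective k \<Lambda> P'"
    and X: "is_complex \<Lambda> X" and X': "is_complex \<Lambda> X'"
    and \<alpha>: "\<alpha> \<in> chain_maps \<Lambda> X X'" and g: "g \<in> chain_maps \<Lambda> P P'"
    and c1: "is_composite \<Lambda> P X X' (Z, s, f) (roof_of X \<alpha>) q"
    and c2: "is_composite \<Lambda> P P' X' (roof_of P g) (Z', s', f') q"
    and t: "lifts P Z s t" and t': "lifts P' Z' s' t'"
  shows "homotopic \<Lambda> P X' (\<lambda>n x. \<alpha> n (f n (t n x))) (\<lambda>n x. f' n (t' n (g n x)))"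
proof -
  interpret P: bounded_projective k \<Lambda> P by (rule bP)
  interpret P': bounded_projective k \<Lambda> P' by (rule bP')
  obtain Zq sq fq where q: "q = (Zq, sq, fq)" by (cases q) auto
  have Z: "is_complex \<Lambda> Z" "quasi_iso \<Lambda> Z P s" "f \<in> chain_maps \<Lambda> Z X"
    using c1 unfolding q roof_of_def by (auto simp: is_composite_def is_roof_def)
  have Z': "is_complex \<Lambda> Z'" "quasi_iso \<Lambda> Z' P' s'" "f' \<in> chain_maps \<Lambda> Z' X'"
    using c2 unfolding q roof_of_def by (auto simp: is_composite_def is_roof_def)
  note s = quasi_isoD[OF Z(1) P.P Z(2)] and s' = quasi_isoD[OF Z'(1) P'.P Z'(2)]
  note fc = chain_maps_cmap[OF Z(3)] and fc' = chain_maps_cmap[OF Z'(3)] and \<alpha>c = chain_maps_cmap[OF \<alpha>] and gc = chain_maps_cmap[OF g]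
  have tc': "cmap \<Lambda> P' Z' t'" using t' by (simp add: lifts_def)
  have idX: "chain_id X \<in> chain_maps \<Lambda> X X" unfolding chain_id_crestrict by (rule crestrict_chain_maps[OF X cmap_id])
  obtain V :: "('r, 'm) cochain_complex" and a b where V: "is_complex \<Lambda> V" and a: "quasi_iso \<Lambda> V Z a" and b: "b \<in> chain_maps \<Lambda> V X"
    and e: "class_K \<Lambda> V X (chain_comp V f a) = class_K \<Lambda> V X (chain_comp V (chain_id X) b)"
    and re: "roof_eq \<Lambda> P X' (V, chain_comp V s a, chain_comp V \<alpha> b) (Zq, sq, fq)"
    using c1 unfolding q roof_of_def by (auto simp: is_composite_def)
  obtain V2 :: "('r, 'm) cochain_complex" and a2 b2 where V2: "is_complex \<Lambda> V2" and a2: "quasi_iso \<Lambda> V2 P a2" and b2: "b2 \<in> chain_maps \<Lambda> V2 Z'"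
    and e2: "class_K \<Lambda> V2 P' (chain_comp V2 g a2) = class_K \<Lambda> V2 P' (chain_comp V2 s' b2)"
    and re2: "roof_eq \<Lambda> P X' (V2, chain_comp V2 (chain_id P) a2, chain_comp V2 f' b2) (Zq, sq, fq)"
    using c2 unfolding q roof_of_def by (auto simp: is_composite_def)
  have rq: "is_complex \<Lambda> Zq" "quasi_iso \<Lambda> Zq P sq" "fq \<in> chain_maps \<Lambda> Zq X'" and qV: "quasi_iso \<Lambda> V P (chain_comp V s a)"
    using re by (auto simp: roof_eq_def is_roof_def)
  have qV2: "quasi_iso \<Lambda> V2 P (chain_comp V2 (chain_id P) a2)" using re2 by (auto simp: roof_eq_def is_roof_def)
  obtain tq where tq: "lifts P Zq sq tq" using P.lift_ex[OF rq(1,2)] by blast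
  then have tqc: "cmap \<Lambda> P Zq tq" by (simp add: lifts_def)
  note fqc = chain_maps_cmap[OF rq(3)]
  note ac = quasi_isoD(2)[OF V Z(1) a] and bc = chain_maps_cmap[OF b]
  note a2c = quasi_isoD(2)[OF V2 P.P a2] and b2c = chain_maps_cmap[OF b2]
  obtain r where r: "lifts P V (chain_comp V s a) r" using P.lift_ex[OF V qV] by blast
  then have rc: "cmap \<Lambda> P V r" by (simp add: lifts_def)
  have ar: "lifts P Z s (\<lambda>n x. a n (r n x))"
    unfolding lifts_def
  proof
    show "cmap \<Lambda> P Z (\<lambda>n x. a n (r n x))" by (rule cmap_comp[OF rc ac])
    have "homotopic \<Lambda> P P (\<lambda>n x. x) (\<lambda>n x. chain_comp V s a n (r n x))" using r by (simp add: lifts_def)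
    then show "homotopic \<Lambda> P P (\<lambda>n x. x) (\<lambda>n x. s n (a n (r n x)))"
      by (rule homotopic_cong[OF P.P]) (auto simp: chain_comp_def cmapD(4)[OF rc])
  qed
  have tar: "homotopic \<Lambda> P Z t (\<lambda>n x. a n (r n x))" by (rule P.lift_homotopic[OF Z(1,2) t ar])
  have 1: "homotopic \<Lambda> P X' (\<lambda>n x. \<alpha> n (f n (t n x))) (\<lambda>n x. \<alpha> n (f n (a n (r n x))))"
    by (rule P.homotopic_post[OF Z(1) X' cmap_comp[OF fc \<alpha>c] cmap_comp[OF rc ac] tar])
  have "homotopic \<Lambda> V X (\<lambda>n x. f n (a n x)) (\<lambda>n x. chain_id X n (b n x))"
    by (rule homotopic_of_class[OF V X quasi_isoD(1)[OF V Z(1) a] Z(3) b idX e])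
  then have fab: "homotopic \<Lambda> V X (\<lambda>n x. f n (a n x)) b"
    by (rule homotopic_cong[OF V]) (auto simp: chain_id_def cmapD(4)[OF bc])
  have "homotopic \<Lambda> P X (\<lambda>n x. f n (a n (r n x))) (\<lambda>n x. b n (r n x))"
    by (rule P.homotopic_pre[OF V X cmap_comp[OF ac fc] bc rc fab])
  then have 2: "homotopic \<Lambda> P X' (\<lambda>n x. \<alpha> n (f n (a n (r n x)))) (\<lambda>n x. \<alpha> n (b n (r n x)))"
    by (rule P.homotopic_post[OF X X' \<alpha>c cmap_comp[OF rc bc]])
  have "homotopic \<Lambda> P X' (\<lambda>n x. chain_comp V \<alpha> b n (r n x)) (\<lambda>n x. fq n (tq n x))"
    by (rule P.roof_eq_lift[OF X' re r tq])
  then have 3: "homotopic \<Lambda> P X' (\<lambda>n x. \<alpha> n (b n (r n x))) (\<lambda>n x. fq n (tq n x))"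
    by (rule homotopic_cong[OF P.P]) (auto simp: chain_comp_def cmapD(4)[OF rc])
  obtain r2 where r2: "lifts P V2 (chain_comp V2 (chain_id P) a2) r2" using P.lift_ex[OF V2 qV2] by blast
  then have r2c: "cmap \<Lambda> P V2 r2" by (simp add: lifts_def)
  have "homotopic \<Lambda> P P (\<lambda>n x. x) (\<lambda>n x. chain_comp V2 (chain_id P) a2 n (r2 n x))" using r2 by (simp add: lifts_def)
  then have ida: "homotopic \<Lambda> P P (\<lambda>n x. x) (\<lambda>n x. a2 n (r2 n x))"
    by (rule homotopic_cong[OF P.P]) (auto simp: chain_comp_def chain_id_def cmapD(4)[OF r2c] cmapD(4)[OF a2c])
  have g1: "homotopic \<Lambda> P P' (\<lambda>n x. g n (a2 n (r2 n x))) g"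
    using homotopic_sym[OF P.P P'.P cmap_comp[OF cmap_comp[OF r2c a2c] gc] P.homotopic_post[OF P.P P'.P gc cmap_comp[OF r2c a2c] ida]] .
  have "homotopic \<Lambda> V2 P' (\<lambda>n x. g n (a2 n x)) (\<lambda>n x. s' n (b2 n x))"
    by (rule homotopic_of_class[OF V2 P'.P quasi_isoD(1)[OF V2 P.P a2] g b2 s'(1) e2])
  from P.homotopic_pre[OF V2 P'.P cmap_comp[OF a2c gc] cmap_comp[OF b2c s'(2)] r2c this]
  have g2: "homotopic \<Lambda> P P' (\<lambda>n x. s' n (b2 n (r2 n x))) (\<lambda>n x. g n (a2 n (r2 n x)))"
    by (rule homotopic_sym[OF P.P P'.P cmap_comp[OF cmap_comp[OF r2c b2c] s'(2)]])
  have "homotopic \<Lambda> P' P' (\<lambda>n x. x) (\<lambda>n x. s' n (t' n x))" using t' by (simp add: lifts_def)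
  from P.homotopic_pre[OF P'.P P'.P cmap_id cmap_comp[OF tc' s'(2)] gc this]
  have g3: "homotopic \<Lambda> P P' g (\<lambda>n x. s' n (t' n (g n x)))" .
  note stg = cmap_comp[OF cmap_comp[OF gc tc'] s'(2)]
  have "homotopic \<Lambda> P P' (\<lambda>n x. s' n (b2 n (r2 n x))) (\<lambda>n x. s' n (t' n (g n x)))"
    by (rule homotopic_trans[OF P.P P'.P stg g2 homotopic_trans[OF P.P P'.P stg g1 g3]])
  \<comment> \<open>Both maps are compared after \<open>s'\<close>, where they are homotopic to
    \<open>g\<close>; uniqueness of lifts along a quasi-isomorphism then compares them in
    \<open>Z'\<close>.\<close>
  then have "homotopic \<Lambda> P Z' (\<lambda>n x. b2 n (r2 n x)) (\<lambda>n x. t' n (g n x))"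
    by (rule P.lift_unique[OF Z'(1) P'.P Z'(2) cmap_comp[OF r2c b2c] cmap_comp[OF gc tc']])
  then have 4: "homotopic \<Lambda> P X' (\<lambda>n x. f' n (b2 n (r2 n x))) (\<lambda>n x. f' n (t' n (g n x)))"
    by (rule P.homotopic_post[OF Z'(1) X' fc' cmap_comp[OF gc tc']])
  have "homotopic \<Lambda> P X' (\<lambda>n x. chain_comp V2 f' b2 n (r2 n x)) (\<lambda>n x. fq n (tq n x))"
    by (rule P.roof_eq_lift[OF X' re2 r2 tq])
  then have "homotopic \<Lambda> P X' (\<lambda>n x. f' n (b2 n (r2 n x))) (\<lambda>n x. fq n (tq n x))"
    by (rule homotopic_cong[OF P.P]) (auto simp: chain_comp_def cmapD(4)[OF r2c])
  then have 5: "homotopic \<Lambda> P X' (\<lambda>n x. fq n (tq n x)) (\<lambda>n x. f' n (b2 n (r2 n x)))"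
    by (rule homotopic_sym[OF P.P X' cmap_comp[OF tqc fqc]])
  note ep = cmap_comp[OF cmap_comp[OF gc tc'] fc']
  show ?thesis
    by (rule homotopic_trans[OF P.P X' ep 1 homotopic_trans[OF P.P X' ep 2
          homotopic_trans[OF P.P X' ep 3 homotopic_trans[OF P.P X' ep 5 4]]]])
qed

section \<open>Naturality of the duality\<close>

text \<open>Write \<open>\<theta>\<close> as the trace functional of \<open>F\<close>. Moving the
  pullback from \<alpha> after \<open>u\<close> to \<open>u'\<close> after \<open>g\<close> by the
  homotopy, and then \<open>g\<close> across the pairing, shows that the transported functional is
  the trace functional of \<open>G\<close> after \<open>F\<close>.\<close>

lemma duality_natural_source:
  assumes D: "dual_resolution k \<Lambda> E P Y T \<tau> X u" and D': "dual_resolution k \<Lambda> E P' Y T' \<tau>' X' u'"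
    and \<alpha>: "\<alpha> \<in> chain_maps \<Lambda> X X'" and g: "g \<in> chain_maps \<Lambda> P P'" and G: "G \<in> chain_maps \<Lambda> T T'"
    and h: "homotopic \<Lambda> P X' (\<lambda>n x. \<alpha> n (u n x)) (\<lambda>n x. u' n (g n x))"
    and \<tau>G: "\<And>n t \<xi>. t \<in> carrier (cobj T n) \<Longrightarrow> \<xi> \<in> module_homs \<Lambda> (cobj P' n) (regular_module \<Lambda>) \<Longrightarrow>
      \<tau>' n (G n t) \<xi> = \<tau> n t (\<lambda>q\<in>carrier (cobj P n). \<xi> (g n q))"
    and \<theta>: "\<theta> \<in> module_homs k (hom_K \<Lambda> X Y) E"
  shows "dual_resolution.duality k \<Lambda> E P' Y T' \<tau>' X' u'
      (dual_map (hom_K \<Lambda> X' Y) (\<lambda>\<gamma>. comp_K \<Lambda> X Y \<gamma> (class_K \<Lambda> X X' \<alpha>)) \<theta>) =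
    comp_K \<Lambda> Y T' (class_K \<Lambda> T T' G) (dual_resolution.duality k \<Lambda> E P Y T \<tau> X u \<theta>)"
proof -
  have C: "dual_complex k \<Lambda> E P Y T \<tau>" and C': "dual_complex k \<Lambda> E P' Y T' \<tau>'"
    and X: "is_complex \<Lambda> X" and X': "is_complex \<Lambda> X'" and u: "cmap \<Lambda> P X u" and u': "cmap \<Lambda> P' X' u'"
    using D D' by (auto simp: dual_resolution_def dual_resolution_axioms_def)
  have kA: "k_algebra k \<Lambda>" and P: "is_complex \<Lambda> P" and P': "is_complex \<Lambda> P'" and Y: "is_complex \<Lambda> Y"
    and T: "is_complex \<Lambda> T" and T': "is_complex \<Lambda> T'"
    using C C' by (auto simp: dual_complex_def dual_complex_axioms_def)
  interpret k_algebra k \<Lambda> by (rule kA)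
  obtain N where N: "\<And>n. n < N \<Longrightarrow> zero_module (cobj X' n)"
    using D' by (auto simp: dual_resolution_def dual_resolution_axioms_def)
  note gc = chain_maps_cmap[OF g] and Gc = chain_maps_cmap[OF G]
  obtain F where F: "F \<in> chain_maps \<Lambda> Y T" and tr: "dual_resolution.trace_functional k \<Lambda> E P Y \<tau> X u F = \<theta>"
    using dual_resolution.trace_functional_surj[OF D \<theta>] by blast
  note Fc = chain_maps_cmap[OF F]
  have GF: "chain_comp Y G F \<in> chain_maps \<Lambda> Y T'" by (rule chain_comp_chain_maps[OF Y F G])
  note GFc = chain_maps_cmap[OF GF]
  let ?\<theta>' = "dual_map (hom_K \<Lambda> X' Y) (\<lambda>\<gamma>. comp_K \<Lambda> X Y \<gamma> (class_K \<Lambda> X X' \<alpha>)) \<theta>"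
  obtain a where a: "hfam \<Lambda> P X' a"
    "\<And>n x. x \<in> carrier (cobj P n) \<Longrightarrow> \<alpha> n (u n x) = u' n (g n x) \<oplus>\<^bsub>cobj X' n\<^esub> hbd P X' a n x"
    using h unfolding homotopic_def by blast
  have key: "\<theta> (class_K \<Lambda> X Y (chain_comp X f \<alpha>)) =
      dual_resolution.trace_functional k \<Lambda> E P' Y \<tau>' X' u' (chain_comp Y G F) (class_K \<Lambda> X' Y f)"
    if f: "f \<in> chain_maps \<Lambda> X' Y" for f
  proof -
    note fc = chain_maps_cmap[OF f]
    have f\<alpha>: "chain_comp X f \<alpha> \<in> chain_maps \<Lambda> X Y" by (rule chain_comp_chain_maps[OF X \<alpha> f])
    let ?v = "\<lambda>n. \<lambda>x\<in>carrier (cobj P n). chain_comp P' f u' n (g n x)"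
    have v: "?v \<in> carrier (fin_homs \<Lambda> (cobj P) (cobj Y))"
      by (rule lin_closed[OF fin_homs_precomp[OF kA complexD(1)[OF P] complexD(1)[OF P'] complexD(1)[OF Y] cmapD(1)[OF gc]]
            dual_resolution.pull_C0[OF D' f]])
    have "\<theta> (class_K \<Lambda> X Y (chain_comp X f \<alpha>)) = dual_complex.pairing k \<Lambda> E P Y \<tau> F (chain_comp P (chain_comp X f \<alpha>) u)"
      using dual_resolution.trace_functional_class[OF D Fc f\<alpha>] tr by simp
    also have "\<dots> = dual_complex.pairing k \<Lambda> E P Y \<tau> F ?v"
    proof (rule dual_resolution.pairing_homotopic[OF D Fc dual_resolution.pull_C0[OF D f\<alpha>] v hfam_post[OF a(1) fc], of N])
      fix n x assume n: "n < N" and x: "x \<in> carrier (cobj P n)"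
      \<comment> \<open>The homotopy takes values in \<open>X'\<close> one degree lower, so the
        bound for \<open>X'\<close> applies at \<open>n - 1\<close>; it makes the homotopy vanish in
        small degrees, as \<open>pairing_homotopic\<close> demands.\<close>
      have "a n x = \<zero>\<^bsub>cobj X' (n - 1)\<^esub>" using N[of "n - 1"] n hfamD(3)[OF a(1) x] by (auto simp: zero_module_def)
      then show "f (n - 1) (a n x) = \<zero>\<^bsub>cobj Y (n - 1)\<^esub>"
        using lin_zero[OF complexD(1)[OF X'] complexD(1)[OF Y] cmapD(1)[OF fc]] by simp
    next
      fix n x assume x: "x \<in> carrier (cobj P n)"
      note ux = cmapD(4)[OF u x] and gx = cmapD(4)[OF gc x]
      have "f n (\<alpha> n (u n x)) = f n (u' n (g n x)) \<oplus>\<^bsub>cobj Y n\<^esub> f n (hbd P X' a n x)"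
        unfolding a(2)[OF x] by (rule lin_add[OF cmapD(1)[OF fc] cmapD(4)[OF u' gx] lin_closed[OF hbd_lin[OF P X' a(1)] x]])
      then show "chain_comp P (chain_comp X f \<alpha>) u n x = ?v n x \<oplus>\<^bsub>cobj Y n\<^esub> hbd P Y (\<lambda>n x. f (n - 1) (a n x)) n x"
        using x ux gx hbd_post[OF P X' a(1) fc x] by (simp add: chain_comp_def)
    qed
    also have "\<dots> = dual_complex.pairing k \<Lambda> E P' Y \<tau>' (\<lambda>n y. G n (F n y)) (chain_comp P' f u')"
      by (rule pairing_natural_source[OF C C' Fc gc cmapD(1)[OF Gc] \<tau>G dual_resolution.pull_C0[OF D' f], symmetric])
    also have "\<dots> = dual_complex.pairing k \<Lambda> E P' Y \<tau>' (chain_comp Y G F) (chain_comp P' f u')"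
      by (rule dual_resolution.pairing_homotopic_left[OF D' cmap_comp[OF Fc Gc] GFc _ f])
        (rule homotopic_cong[OF Y homotopic_refl[OF Y T' GFc]], auto simp: chain_comp_def)
    finally show ?thesis using dual_resolution.trace_functional_class[OF D' GFc f] by simp
  qed
  have "?\<theta>' = dual_resolution.trace_functional k \<Lambda> E P' Y \<tau>' X' u' (chain_comp Y G F)"
  proof
    fix C
    show "?\<theta>' C = dual_resolution.trace_functional k \<Lambda> E P' Y \<tau>' X' u' (chain_comp Y G F) C"
    proof (cases "C \<in> carrier (hom_K \<Lambda> X' Y)")
      case True
      then obtain f where "C = class_K \<Lambda> X' Y f" "f \<in> chain_maps \<Lambda> X' Y" unfolding carrier_hom_K[OF X' Y] by blast
      then show ?thesis using True key comp_K_class[OF X X' Y \<alpha>] by (simp add: dual_map_def)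
    next
      case False
      then show ?thesis by (simp add: dual_map_def dual_resolution.trace_functional_def[OF D'])
    qed
  qed
  then show ?thesis
    using dual_resolution.duality_trace_functional[OF D' GF] dual_resolution.duality_trace_functional[OF D F] tr
      comp_K_class[OF Y T T' F G] by simp
qed

text \<open>Writing \<open>\<theta>\<close> as the trace functional of \<open>F\<close>, the map
  \<beta> moves across the pairing by \<open>pairing_natural_target\<close>, and the result is the
  trace functional of \<open>F\<close> after \<beta>. The comparison map is the same on both
  sides.\<close>

lemma duality_natural_target:
  assumes D: "dual_resolution k \<Lambda> E P Y T \<tau> X u" and D': "dual_resolution k \<Lambda> E P Y' T \<tau> X u"
    and \<beta>: "\<beta> \<in> chain_maps \<Lambda> Y Y'" and \<theta>: "\<theta> \<in> module_homs k (hom_K \<Lambda> X Y') E"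
  shows "dual_resolution.duality k \<Lambda> E P Y T \<tau> X u
      (dual_map (hom_K \<Lambda> X Y) (\<lambda>\<gamma>. comp_K \<Lambda> X Y' (class_K \<Lambda> Y Y' \<beta>) \<gamma>) \<theta>) =
    comp_K \<Lambda> Y T (dual_resolution.duality k \<Lambda> E P Y' T \<tau> X u \<theta>) (class_K \<Lambda> Y Y' \<beta>)"
proof -
  have C: "dual_complex k \<Lambda> E P Y T \<tau>" and C': "dual_complex k \<Lambda> E P Y' T \<tau>"
    and X: "is_complex \<Lambda> X" and u: "cmap \<Lambda> P X u"
    using D D' by (auto simp: dual_resolution_def dual_resolution_axioms_def)
  have kA: "k_algebra k \<Lambda>" and P: "is_complex \<Lambda> P" and Y: "is_complex \<Lambda> Y" and Y': "is_complex \<Lambda> Y'"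
    and T: "is_complex \<Lambda> T"
    using C C' by (auto simp: dual_complex_def dual_complex_axioms_def)
  interpret k_algebra k \<Lambda> by (rule kA)
  note \<beta>c = chain_maps_cmap[OF \<beta>]
  obtain F where F: "F \<in> chain_maps \<Lambda> Y' T" and tr: "dual_resolution.trace_functional k \<Lambda> E P Y' \<tau> X u F = \<theta>"
    using dual_resolution.trace_functional_surj[OF D' \<theta>] by blast
  note Fc = chain_maps_cmap[OF F]
  have F\<beta>: "chain_comp Y F \<beta> \<in> chain_maps \<Lambda> Y T" by (rule chain_comp_chain_maps[OF Y \<beta> F])
  note F\<beta>c = chain_maps_cmap[OF F\<beta>]
  let ?\<theta>' = "dual_map (hom_K \<Lambda> X Y) (\<lambda>\<gamma>. comp_K \<Lambda> X Y' (class_K \<Lambda> Y Y' \<beta>) \<gamma>) \<theta>"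
  have key: "\<theta> (class_K \<Lambda> X Y' (chain_comp X \<beta> f)) =
      dual_resolution.trace_functional k \<Lambda> E P Y \<tau> X u (chain_comp Y F \<beta>) (class_K \<Lambda> X Y f)"
    if f: "f \<in> chain_maps \<Lambda> X Y" for f
  proof -
    have \<beta>f: "chain_comp X \<beta> f \<in> chain_maps \<Lambda> X Y'" by (rule chain_comp_chain_maps[OF X f \<beta>])
    have "\<theta> (class_K \<Lambda> X Y' (chain_comp X \<beta> f)) = dual_complex.pairing k \<Lambda> E P Y' \<tau> F (chain_comp P (chain_comp X \<beta> f) u)"
      using dual_resolution.trace_functional_class[OF D' Fc \<beta>f] tr by simp
    also have "chain_comp P (chain_comp X \<beta> f) u = (\<lambda>n. \<lambda>x\<in>carrier (cobj P n). \<beta> n (chain_comp P f u n x))"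
      using cmapD(4)[OF u] by (auto simp: chain_comp_def fun_eq_iff)
    also have "dual_complex.pairing k \<Lambda> E P Y' \<tau> F \<dots> = dual_complex.pairing k \<Lambda> E P Y \<tau> (\<lambda>n y. F n (\<beta> n y)) (chain_comp P f u)"
      by (rule pairing_natural_target[OF C C' Fc \<beta>c dual_resolution.pull_C0[OF D f], symmetric])
    also have "\<dots> = dual_complex.pairing k \<Lambda> E P Y \<tau> (chain_comp Y F \<beta>) (chain_comp P f u)"
      by (rule dual_resolution.pairing_homotopic_left[OF D cmap_comp[OF \<beta>c Fc] F\<beta>c _ f])
        (rule homotopic_cong[OF Y homotopic_refl[OF Y T F\<beta>c]], auto simp: chain_comp_def)
    finally show ?thesis using dual_resolution.trace_functional_class[OF D F\<beta>c f] by simp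
  qed
  have "?\<theta>' = dual_resolution.trace_functional k \<Lambda> E P Y \<tau> X u (chain_comp Y F \<beta>)"
  proof
    fix C
    show "?\<theta>' C = dual_resolution.trace_functional k \<Lambda> E P Y \<tau> X u (chain_comp Y F \<beta>) C"
    proof (cases "C \<in> carrier (hom_K \<Lambda> X Y)")
      case True
      then obtain f where "C = class_K \<Lambda> X Y f" "f \<in> chain_maps \<Lambda> X Y" unfolding carrier_hom_K[OF X Y] by blast
      then show ?thesis using True key comp_K_class[OF X Y Y' _ \<beta>] by (simp add: dual_map_def)
    next
      case False
      then show ?thesis by (simp add: dual_map_def dual_resolution.trace_functional_def[OF D])
    qed
  qed
  then show ?thesis
    using dual_resolution.duality_trace_functional[OF D F\<beta>] dual_resolution.duality_trace_functional[OF D' F] tr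
      comp_K_class[OF Y Y' T \<beta> F] by simp
qed

section \<open>Tensoring complexes with the dual of the algebra\<close>

text \<open>Supplies the identification in odd degrees. Negation of functionals is an involution, so
  bijectivity is preserved.\<close>

lemma represents_uminus:
  assumes kA: "k_algebra k \<Lambda>" and E: "right_module k E" and Q: "right_module \<Lambda> Q" and rep: "represents k E \<Lambda> Q T \<tau>"
  shows "represents k E \<Lambda> Q T (\<lambda>t. \<lambda>\<xi>\<in>module_homs \<Lambda> Q (regular_module \<Lambda>). \<ominus>\<^bsub>E\<^esub> \<tau> t \<xi>)"
proof -
  interpret k_algebra k \<Lambda> by fact
  interpret E: right_module k E by fact
  let ?Qd = "module_homs \<Lambda> Q (regular_module \<Lambda>)" let ?H = "hom_module \<Lambda> Q (regular_module \<Lambda>)"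
  have H: "right_module k ?H" by (rule right_module_hom[OF Q right_module_regular[OF ring_algebra]])
  define neg where "neg = (\<lambda>\<phi>. \<lambda>\<xi>\<in>?Qd. \<ominus>\<^bsub>E\<^esub> (\<phi> \<xi>))"
  have neg: "neg \<phi> \<in> module_homs k ?H E" if "\<phi> \<in> module_homs k ?H E" for \<phi>
    using restrict_module_homs[OF H lin_uminus[OF E module_homs_lin[OF that]]] by (simp add: neg_def)
  have negneg: "neg (neg \<phi>) = \<phi>" if "\<phi> \<in> module_homs k ?H E" for \<phi>
    by (rule module_homs_eqI[OF neg[OF neg[OF that]] that]) (use module_homsD(1)[OF that] in \<open>simp add: neg_def\<close>)
  have "bij_betw neg (module_homs k ?H E) (module_homs k ?H E)"
    by (rule bij_betw_byWitness[of _ neg]) (use neg negneg in auto)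
  moreover have "bij_betw \<tau> (carrier T) (module_homs k ?H E)" using rep by (simp add: represents_def)
  ultimately have bij: "bij_betw (\<lambda>t. neg (\<tau> t)) (carrier T) (module_homs k ?H E)"
    using bij_betw_trans by (fastforce simp: comp_def)
  have cl: "\<tau> t \<xi> \<in> carrier E" if "t \<in> carrier T" "\<xi> \<in> ?Qd" for t \<xi>
    using module_homsD(1)[OF representsD(2)[OF rep that(1)]] that(2) by simp
  have reg: "(\<lambda>q\<in>carrier Q. a \<otimes>\<^bsub>\<Lambda>\<^esub> \<xi> q) \<in> ?Qd" if a: "a \<in> carrier \<Lambda>" and \<xi>: "\<xi> \<in> ?Qd" for a \<xi>
  proof -
    have "\<xi> q \<in> carrier \<Lambda>" if "q \<in> carrier Q" for q using module_homsD(1)[OF \<xi>] that by simp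
    then show ?thesis
      using a module_homsD[OF \<xi>, simplified]
      by (intro restrict_module_homs[OF Q] linI) (auto simp: alg.r_distr alg.m_assoc)
  qed
  have "represents k E \<Lambda> Q T (\<lambda>t. neg (\<tau> t))"
    unfolding represents_def
  proof (intro conjI ballI)
    show "right_module \<Lambda> T" by (rule representsD(1)[OF rep])
    show "bij_betw (\<lambda>t. neg (\<tau> t)) (carrier T) (module_homs k ?H E)" by (rule bij)
    fix t \<xi> assume t: "t \<in> carrier T" and \<xi>: "\<xi> \<in> ?Qd"
    show "neg (\<tau> (t \<oplus>\<^bsub>T\<^esub> t')) \<xi> = neg (\<tau> t) \<xi> \<oplus>\<^bsub>E\<^esub> neg (\<tau> t') \<xi>" if t': "t' \<in> carrier T" for t'
      using representsD(3)[OF rep t t' \<xi>] cl[OF t \<xi>] cl[OF t' \<xi>] \<xi> by (simp add: neg_def E.M.minus_add)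
    show "neg (\<tau> (a \<odot>\<^bsub>T\<^esub> t)) \<xi> = neg (\<tau> t) (\<lambda>q\<in>carrier Q. a \<otimes>\<^bsub>\<Lambda>\<^esub> \<xi> q)" if a: "a \<in> carrier \<Lambda>" for a
      using representsD(4)[OF rep a t \<xi>] reg[OF a \<xi>] \<xi> by (simp only: neg_def restrict_apply if_True)
  qed
  then show ?thesis unfolding neg_def .
qed

locale dual_tensor_complex = k_algebra k \<Lambda>
  for k :: "('k, 'c) ring_scheme" and \<Lambda> :: "('k, 'r) module" +
  fixes E :: "('k, 'e) module"
  assumes E: "injective_module k E"
begin

sublocale E: right_module k E using E by (simp add: injective_module_def)

abbreviation "tens Q \<equiv> tensor \<Lambda> Q (dual_algebra k E \<Lambda>) (dual_algebra_left \<Lambda>)"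
abbreviation "tmap Q Q' f \<equiv> tensor_map \<Lambda> Q Q' (dual_algebra k E \<Lambda>) (dual_algebra_left \<Lambda>) f"
abbreviation "tp Q \<equiv> tensor_pairing k E \<Lambda> Q"
abbreviation "Qd Q \<equiv> module_homs \<Lambda> Q (regular_module \<Lambda>)"

text \<open>The dual basis is hidden behind an existential, so that the maps between tensor products
  can be discussed without carrying bases along.\<close>

definition perfect :: "('r, 'q) module \<Rightarrow> bool"
  where "perfect Q \<longleftrightarrow> right_module \<Lambda> Q \<and> (\<exists>S \<Xi>. dual_basis \<Lambda> Q S \<Xi>)"

lemma perfect_right_module: "perfect Q \<Longrightarrow> right_module \<Lambda> Q" by (simp add: perfect_def)

lemma perfect_obtain:
  assumes "perfect Q" obtains S \<Xi> where "dual_tensor k \<Lambda> E Q S \<Xi>"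
proof -
  obtain S \<Xi> where db: "dual_basis \<Lambda> Q S \<Xi>" and Q: "right_module \<Lambda> Q" using assms unfolding perfect_def by blast
  show thesis
    by (rule that[OF dual_tensor.intro[OF k_algebra_axioms dual_tensor_axioms.intro[OF E.right_module_axioms Q db]]])
qed

lemma perfect_represents:
  assumes "perfect Q" shows "represents k E \<Lambda> Q (tens Q) (tp Q)"
  using assms by (rule perfect_obtain) (rule dual_tensor.tensor_represents)

lemma right_module_tens: "perfect Q \<Longrightarrow> right_module \<Lambda> (tens Q)"
  by (rule representsD(1)[OF perfect_represents])

lemma injective_tens:
  assumes "perfect Q" shows "injective_module \<Lambda> (tens Q)"
  using assms represents_injective[OF k_algebra_axioms E _ _ perfect_represents[OF assms]] by (auto simp: perfect_def)

lemma tmap_facts: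
  assumes Q: "perfect Q" "perfect Q'" and f: "lin \<Lambda> Q Q' f"
  shows tmap_homs: "tmap Q Q' f \<in> module_homs \<Lambda> (tens Q) (tens Q')"
    and tmap_pairing: "\<And>t \<xi>. t \<in> carrier (tens Q) \<Longrightarrow> \<xi> \<in> Qd Q' \<Longrightarrow> tp Q' (tmap Q Q' f t) \<xi> = tp Q t (\<lambda>q\<in>carrier Q. \<xi> (f q))"
proof -
  obtain S \<Xi> S' \<Xi>' where D: "dual_tensor k \<Lambda> E Q S \<Xi>" and D': "dual_tensor k \<Lambda> E Q' S' \<Xi>'"
    using perfect_obtain[OF Q(1)] perfect_obtain[OF Q(2)] by metis
  have M: "dual_tensor_map k \<Lambda> E Q S \<Xi> Q' S' \<Xi>' f"
    by (rule dual_tensor_map.intro[OF D D' dual_tensor_map_axioms.intro[OF f]])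
  show "tmap Q Q' f \<in> module_homs \<Lambda> (tens Q) (tens Q')" by (rule dual_tensor_map.tensor_map_homs[OF M])
  show "tp Q' (tmap Q Q' f t) \<xi> = tp Q t (\<lambda>q\<in>carrier Q. \<xi> (f q))" if "t \<in> carrier (tens Q)" "\<xi> \<in> Qd Q'" for t \<xi>
    by (rule dual_tensor_map.tensor_map_pairing[OF M that])
qed

lemma tmap_closed: "perfect Q \<Longrightarrow> perfect Q' \<Longrightarrow> lin \<Lambda> Q Q' f \<Longrightarrow> t \<in> carrier (tens Q) \<Longrightarrow> tmap Q Q' f t \<in> carrier (tens Q')"
  using module_homsD(1)[OF tmap_homs] .

lemma comp_Qd: "perfect Q \<Longrightarrow> lin \<Lambda> Q Q' f \<Longrightarrow> \<xi> \<in> Qd Q' \<Longrightarrow> (\<lambda>q\<in>carrier Q. \<xi> (f q)) \<in> Qd Q"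
  by (rule comp_module_homs[OF perfect_right_module _ module_homs_lin])

text \<open>Functoriality is checked on functionals. The composite enters as a separate map
  \<open>h\<close> with a pointwise equation, which lets the lemma also compare two different
  factorisations of one map, as in a chain map square.\<close>

lemma tmap_comp:
  assumes Q: "perfect Q" "perfect Q'" "perfect Q''" and f: "lin \<Lambda> Q Q' f" and g: "lin \<Lambda> Q' Q'' g" and h: "lin \<Lambda> Q Q'' h"
    and eq: "\<And>q. q \<in> carrier Q \<Longrightarrow> h q = g (f q)" and t: "t \<in> carrier (tens Q)"
  shows "tmap Q Q'' h t = tmap Q' Q'' g (tmap Q Q' f t)"
proof (rule represents_eqI[OF perfect_represents[OF Q(3)] tmap_closed[OF Q(1,3) h t] tmap_closed[OF Q(2,3) g tmap_closed[OF Q(1,2) f t]]])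
  fix \<xi> assume \<xi>: "\<xi> \<in> Qd Q''"
  have "(\<lambda>q\<in>carrier Q. \<xi> (h q)) = (\<lambda>q\<in>carrier Q. (\<lambda>q\<in>carrier Q'. \<xi> (g q)) (f q))"
    using eq lin_closed[OF f] by (auto simp: fun_eq_iff)
  then show "tp Q'' (tmap Q Q'' h t) \<xi> = tp Q'' (tmap Q' Q'' g (tmap Q Q' f t)) \<xi>"
    using tmap_pairing[OF Q(1,3) h t \<xi>] tmap_pairing[OF Q(2,3) g tmap_closed[OF Q(1,2) f t] \<xi>]
      tmap_pairing[OF Q(1,2) f t comp_Qd[OF Q(2) g \<xi>]] by metis
qed

text \<open>Each \<open>\<xi>\<close> is additive, so composing it with a sum of maps gives a sum of
  functionals, and the pairing is additive in these.\<close>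

lemma tmap_add:
  assumes Q: "perfect Q" "perfect Q'" and f: "lin \<Lambda> Q Q' f" and g: "lin \<Lambda> Q Q' g" and h: "lin \<Lambda> Q Q' h"
    and eq: "\<And>q. q \<in> carrier Q \<Longrightarrow> h q = f q \<oplus>\<^bsub>Q'\<^esub> g q" and t: "t \<in> carrier (tens Q)"
  shows "tmap Q Q' h t = tmap Q Q' f t \<oplus>\<^bsub>tens Q'\<^esub> tmap Q Q' g t"
proof -
  interpret T: right_module \<Lambda> "tens Q'" by (rule right_module_tens[OF Q(2)])
  note ft = tmap_closed[OF Q f t] and gt = tmap_closed[OF Q g t]
  show ?thesis
  proof (rule represents_eqI[OF perfect_represents[OF Q(2)] tmap_closed[OF Q h t] T.M.add.m_closed[OF ft gt]])
    fix \<xi> assume \<xi>: "\<xi> \<in> Qd Q'"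
    note f\<xi> = comp_Qd[OF Q(1) f \<xi>] and g\<xi> = comp_Qd[OF Q(1) g \<xi>]
    have e: "(\<lambda>q\<in>carrier Q. \<xi> (h q)) =
        (\<lambda>q\<in>carrier Q. \<xi> (f q)) \<oplus>\<^bsub>hom_module \<Lambda> Q (regular_module \<Lambda>)\<^esub> (\<lambda>q\<in>carrier Q. \<xi> (g q))"
      using eq module_homsD(2)[OF \<xi>] lin_closed[OF f] lin_closed[OF g] by (auto simp: fun_eq_iff)
    have "tp Q t (\<lambda>q\<in>carrier Q. \<xi> (h q)) = tp Q t (\<lambda>q\<in>carrier Q. \<xi> (f q)) \<oplus>\<^bsub>E\<^esub> tp Q t (\<lambda>q\<in>carrier Q. \<xi> (g q))"
      unfolding e
      by (rule module_homsD(2)[OF representsD(2)[OF perfect_represents[OF Q(1)] t]]) (use f\<xi> g\<xi> in simp_all)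
    then show "tp Q' (tmap Q Q' h t) \<xi> = tp Q' (tmap Q Q' f t \<oplus>\<^bsub>tens Q'\<^esub> tmap Q Q' g t) \<xi>"
      using tmap_pairing[OF Q h t \<xi>] tmap_pairing[OF Q f t \<xi>] tmap_pairing[OF Q g t \<xi>]
        representsD(3)[OF perfect_represents[OF Q(2)] ft gt \<xi>] by simp
  qed
qed

lemma tmap_zero:
  assumes Q: "perfect Q" "perfect Q'" and f: "lin \<Lambda> Q Q' f"
    and eq: "\<And>q. q \<in> carrier Q \<Longrightarrow> f q = \<zero>\<^bsub>Q'\<^esub>" and t: "t \<in> carrier (tens Q)"
  shows "tmap Q Q' f t = \<zero>\<^bsub>tens Q'\<^esub>"
proof -
  interpret Q': right_module \<Lambda> Q' by (rule perfect_right_module[OF Q(2)])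
  interpret T: right_module \<Lambda> "tens Q'" by (rule right_module_tens[OF Q(2)])
  have "tmap Q Q' f t = tmap Q Q' f t \<oplus>\<^bsub>tens Q'\<^esub> tmap Q Q' f t"
    by (rule tmap_add[OF Q f f f _ t]) (simp add: eq)
  then show ?thesis using tmap_closed[OF Q f t] T.M.add.l_cancel_one' by metis
qed

definition perfect_complex :: "('r, 'q) cochain_complex \<Rightarrow> bool"
  where "perfect_complex P \<longleftrightarrow> is_complex \<Lambda> P \<and> (\<forall>n. perfect (cobj P n))"

lemma perfect_complexD:
  assumes "perfect_complex P"
  shows "is_complex \<Lambda> P" "perfect (cobj P n)"
  using assms by (auto simp: perfect_complex_def)

abbreviation "TD P \<equiv> tensor_dual k E \<Lambda> P"

lemma TD_simps [simp]:
  "cobj (TD P) n = tens (cobj P n)" "cdiff (TD P) n = tmap (cobj P n) (cobj P (n + 1)) (cdiff P n)"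
  by (simp_all add: tensor_dual_def tensor_complex_def)

lemma is_complex_TD:
  assumes P: "perfect_complex P" shows "is_complex \<Lambda> (TD P)"
proof (rule is_complexI)
  note c = perfect_complexD(1)[OF P] and q = perfect_complexD(2)[OF P]
  show "right_module \<Lambda> (cobj (TD P) n)" for n using right_module_tens[OF q] by simp
  show "cdiff (TD P) n \<in> module_homs \<Lambda> (cobj (TD P) n) (cobj (TD P) (n + 1))" for n
    unfolding TD_simps by (rule tmap_homs[OF q q complexD(3)[OF c]])
  fix n x assume x: "x \<in> carrier (cobj (TD P) n)"
  then have x': "x \<in> carrier (tens (cobj P n))" by simp
  have l: "lin \<Lambda> (cobj P n) (cobj P (n + 1 + 1)) (\<lambda>x. cdiff P (n + 1) (cdiff P n x))"
    by (rule lin_comp[OF complexD(3)[OF c] complexD(3)[OF c]])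
  show "cdiff (TD P) (n + 1) (cdiff (TD P) n x) = \<zero>\<^bsub>cobj (TD P) (n + 1 + 1)\<^esub>"
    unfolding TD_simps tmap_comp[OF q q q complexD(3)[OF c] complexD(3)[OF c] l refl x', symmetric]
    by (rule tmap_zero[OF q q l complexD(4)[OF c] x'])
qed

lemma inj_complex_TD: "perfect_complex P \<Longrightarrow> inj_complex \<Lambda> (TD P)"
  using is_complex_TD injective_tens perfect_complexD(2) by (auto simp: inj_complex_def)

abbreviation "tchain P P' g \<equiv> (\<lambda>n. tmap (cobj P n) (cobj P' n) (g n))"

lemma tchain_chain_maps:
  assumes P: "perfect_complex P" "perfect_complex P'" and g: "g \<in> chain_maps \<Lambda> P P'"
  shows "tchain P P' g \<in> chain_maps \<Lambda> (TD P) (TD P')"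
proof -
  note q = perfect_complexD(2)[OF P(1)] and q' = perfect_complexD(2)[OF P(2)] and gc = chain_maps_cmap[OF g]
  note c = perfect_complexD(1)[OF P(1)] and c' = perfect_complexD(1)[OF P(2)]
  have "tmap (cobj P (n + 1)) (cobj P' (n + 1)) (g (n + 1)) (cdiff (TD P) n x) =
      cdiff (TD P') n (tmap (cobj P n) (cobj P' n) (g n) x)" if x: "x \<in> carrier (tens (cobj P n))" for n x
  proof -
    have l: "lin \<Lambda> (cobj P n) (cobj P' (n + 1)) (\<lambda>x. g (n + 1) (cdiff P n x))"
      by (rule lin_comp[OF complexD(3)[OF c] cmapD(1)[OF gc]])
    show ?thesis
      unfolding TD_simps tmap_comp[OF q q q' complexD(3)[OF c] cmapD(1)[OF gc] l refl x, symmetric]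
      by (rule tmap_comp[OF q q' q' cmapD(1)[OF gc] complexD(3)[OF c'] l cmapD(2)[OF gc] x])
  qed
  then show ?thesis using tmap_homs[OF q q' cmapD(1)[OF gc]] by (simp add: chain_maps_def)
qed

text \<open>Tensoring is additive and functorial, so it carries a homotopy degree by degree to a
  homotopy.\<close>

lemma tchain_homotopic:
  assumes P: "perfect_complex P" "perfect_complex P'" and g: "cmap \<Lambda> P P' g" and g': "cmap \<Lambda> P P' g'"
    and h: "homotopic \<Lambda> P P' g g'"
  shows "homotopic \<Lambda> (TD P) (TD P') (tchain P P' g) (tchain P P' g')"
proof -
  note q = perfect_complexD(2)[OF P(1)] and q' = perfect_complexD(2)[OF P(2)]
  note c = perfect_complexD(1)[OF P(1)] and c' = perfect_complexD(1)[OF P(2)]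
  obtain h where h: "hfam \<Lambda> P P' h" and eq: "\<And>n x. x \<in> carrier (cobj P n) \<Longrightarrow> g n x = g' n x \<oplus>\<^bsub>cobj P' n\<^esub> hbd P P' h n x"
    using h unfolding homotopic_def by blast
  let ?h = "\<lambda>n. tmap (cobj P n) (cobj P' (n - 1)) (h n)"
  show ?thesis
  proof (rule homotopicI)
    show "hfam \<Lambda> (TD P) (TD P') ?h"
      using module_homs_lin[OF tmap_homs[OF q q' hfamD(1)[OF h]]] by (simp add: hfam_def)
    fix n x assume "x \<in> carrier (cobj (TD P) n)"
    then have x: "x \<in> carrier (tens (cobj P n))" by simp
    have l1: "lin \<Lambda> (cobj P n) (cobj P' n) (\<lambda>x. cdiff P' (n - 1) (h n x))"
      and l2: "lin \<Lambda> (cobj P n) (cobj P' n) (\<lambda>x. h (n + 1) (cdiff P n x))"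
      by (rule lin_comp[OF hfamD(1)[OF h] complexD'(1)[OF c']], rule lin_comp[OF complexD(3)[OF c] hfamD(2)[OF h]])
    have "tchain P P' g n x = tchain P P' g' n x \<oplus>\<^bsub>tens (cobj P' n)\<^esub> tmap (cobj P n) (cobj P' n) (hbd P P' h n) x"
      by (rule tmap_add[OF q q' cmapD(1)[OF g'] hbd_lin[OF c c' h] cmapD(1)[OF g] eq x])
    also have "tmap (cobj P n) (cobj P' n) (hbd P P' h n) x =
        tmap (cobj P n) (cobj P' n) (\<lambda>x. cdiff P' (n - 1) (h n x)) x \<oplus>\<^bsub>tens (cobj P' n)\<^esub>
        tmap (cobj P n) (cobj P' n) (\<lambda>x. h (n + 1) (cdiff P n x)) x"
      by (rule tmap_add[OF q q' l1 l2 hbd_lin[OF c c' h] hbd_def x])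
    also have "tmap (cobj P n) (cobj P' n) (\<lambda>x. cdiff P' (n - 1) (h n x)) x =
        tmap (cobj P' (n - 1)) (cobj P' n) (cdiff P' (n - 1)) (?h n x)"
      by (rule tmap_comp[OF q q' q' hfamD(1)[OF h] complexD'(1)[OF c'] l1 refl x])
    also have "tmap (cobj P n) (cobj P' n) (\<lambda>x. h (n + 1) (cdiff P n x)) x =
        tmap (cobj P (n + 1)) (cobj P' n) (h (n + 1)) (cdiff (TD P) n x)"
      unfolding TD_simps by (rule tmap_comp[OF q q q' complexD(3)[OF c] hfamD(2)[OF h] l2 refl x])
    finally show "tchain P P' g n x = tchain P P' g' n x \<oplus>\<^bsub>cobj (TD P') n\<^esub> hbd (TD P) (TD P') ?h n x"
      by (simp add: hbd_def)
  qed
qed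

lemma tensor_dual_map_class:
  assumes P: "perfect_complex P" "perfect_complex P'" and g: "g \<in> chain_maps \<Lambda> P P'"
  shows "tensor_dual_map k E \<Lambda> P P' (class_K \<Lambda> P P' g) = class_K \<Lambda> (TD P) (TD P') (tchain P P' g)"
  unfolding tensor_dual_map_def
proof (rule UN_const)
  note c = perfect_complexD(1)[OF P(1)] and c' = perfect_complexD(1)[OF P(2)]
  show "class_K \<Lambda> P P' g \<noteq> {}" using class_K_self[OF c c' g] by blast
  fix f assume "f \<in> class_K \<Lambda> P P' g"
  then have f: "f \<in> chain_maps \<Lambda> P P'" "homotopic \<Lambda> P P' f g" using mem_class_K[OF c c' g] by auto
  show "class_K \<Lambda> (TD P) (TD P') (tchain P P' f) = class_K \<Lambda> (TD P) (TD P') (tchain P P' g)"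
    using class_K_eq_iff[OF is_complex_TD[OF P(1)] is_complex_TD[OF P(2)] tchain_chain_maps[OF P f(1)] tchain_chain_maps[OF P g]]
      tchain_homotopic[OF P chain_maps_cmap[OF f(1)] chain_maps_cmap[OF g] f(2)] by simp
qed

text \<open>The signs turn the differential of the tensor complex into minus the transpose of that of \<open>P\<close>.\<close>

definition signed_pairing :: "('r, 'q) cochain_complex \<Rightarrow> int \<Rightarrow> ('q \<times> ('r \<Rightarrow> 'e) \<Rightarrow>\<^sub>0 int) set \<Rightarrow> ('q \<Rightarrow> 'r) \<Rightarrow> 'e"
  where "signed_pairing P n = (if even n then tp (cobj P n)
    else (\<lambda>t. \<lambda>\<xi>\<in>Qd (cobj P n). \<ominus>\<^bsub>E\<^esub> tp (cobj P n) t \<xi>))"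

lemma signed_pairing_represents:
  assumes P: "perfect_complex P"
  shows "represents k E \<Lambda> (cobj P n) (tens (cobj P n)) (signed_pairing P n)"
  using perfect_represents[OF perfect_complexD(2)[OF P]]
    represents_uminus[OF k_algebra_axioms E.right_module_axioms complexD(1)[OF perfect_complexD(1)[OF P]]
      perfect_represents[OF perfect_complexD(2)[OF P]]]
  by (cases "even n") (simp_all only: signed_pairing_def if_True if_False)

text \<open>Chain maps preserve degrees, so the same sign occurs on both sides.\<close>

lemma signed_pairing_tchain:
  assumes P: "perfect_complex P" "perfect_complex P'" and g: "\<And>n. lin \<Lambda> (cobj P n) (cobj P' n) (g n)"
    and t: "t \<in> carrier (tens (cobj P n))" and \<xi>: "\<xi> \<in> Qd (cobj P' n)"
  shows "signed_pairing P' n (tchain P P' g n t) \<xi> = signed_pairing P n t (\<lambda>q\<in>carrier (cobj P n). \<xi> (g n q))"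
proof -
  note q = perfect_complexD(2)[OF P(1)] and q' = perfect_complexD(2)[OF P(2)]
  show ?thesis
    using tmap_pairing[OF q q' g t \<xi>] \<xi> comp_Qd[OF q g \<xi>]
    by (cases "even n") (simp_all only: signed_pairing_def if_True if_False restrict_apply)
qed

text \<open>The degrees \<open>n\<close> and \<open>n + 1\<close> have different parity, so a sign
  is present on exactly one side; this is the sign required by \<open>\<tau>_cdiff\<close>.\<close>

lemma signed_pairing_cdiff:
  assumes P: "perfect_complex P"
    and t: "t \<in> carrier (tens (cobj P n))" and \<xi>: "\<xi> \<in> Qd (cobj P (n + 1))"
  shows "signed_pairing P (n + 1) (cdiff (TD P) n t) \<xi> =
    \<ominus>\<^bsub>E\<^esub> signed_pairing P n t (\<lambda>q\<in>carrier (cobj P n). \<xi> (cdiff P n q))"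
proof -
  note q = perfect_complexD(2)[OF P] and d = complexD(3)[OF perfect_complexD(1)[OF P]]
  note d\<xi> = comp_Qd[OF q d \<xi>]
  have cl: "tp (cobj P n) t (\<lambda>q\<in>carrier (cobj P n). \<xi> (cdiff P n q)) \<in> carrier E"
    using module_homsD(1)[OF representsD(2)[OF perfect_represents[OF q] t]] d\<xi> by simp
  note e = tmap_pairing[OF q q d t \<xi>]
  show ?thesis
  proof (cases "even n")
    case True
    then have "odd (n + 1)" by simp
    then show ?thesis using True e \<xi> unfolding TD_simps by (simp only: signed_pairing_def if_True if_False restrict_apply)
  next
    case False
    then have "even (n + 1)" by simp
    then show ?thesis
      using False e \<xi> d\<xi> E.M.minus_minus[OF cl] unfolding TD_simps by (simp only: signed_pairing_def if_True if_False restrict_apply)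
  qed
qed

end

section \<open>Projective resolution functors\<close>

text \<open>The natural isomorphism \<open>\<eta>\<close>, which exists by
  \<open>projective_resolution_functor\<close>, is fixed as a parameter because the comparison maps
  are built from it.\<close>

locale resolution_functor = dual_tensor_complex k \<Lambda> E
  for k :: "('k, 'c) ring_scheme" and \<Lambda> :: "('k, 'r) module" and E :: "('k, 'e) module" +
  fixes P :: "('r, 'u) cochain_complex \<Rightarrow> ('r, 'u) cochain_complex"
    and p :: "('r, 'u) cochain_complex \<Rightarrow> ('r, 'u) cochain_complex \<Rightarrow>
      (int \<Rightarrow> 'u \<Rightarrow> 'u) set \<Rightarrow> (int \<Rightarrow> 'u \<Rightarrow> 'u) set"
    and \<eta> :: "('r, 'u) cochain_complex \<Rightarrow> ('r, 'u) roof"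
  assumes P_resolution: "\<And>X. compact_inj_complex \<Lambda> X \<Longrightarrow> proj_resolution_complex \<Lambda> (P X)"
    and p_closed: "\<And>X X' \<alpha>. \<lbrakk>compact_inj_complex \<Lambda> X; compact_inj_complex \<Lambda> X'; \<alpha> \<in> carrier (hom_K \<Lambda> X X')\<rbrakk> \<Longrightarrow>
      p X X' \<alpha> \<in> carrier (hom_K \<Lambda> (P X) (P X'))"
    and \<eta>_iso: "\<And>X. compact_inj_complex \<Lambda> X \<Longrightarrow> is_derived_iso \<Lambda> (P X) X (\<eta> X)"
    and \<eta>_natural: "\<And>X X' f g. \<lbrakk>compact_inj_complex \<Lambda> X; compact_inj_complex \<Lambda> X'; f \<in> chain_maps \<Lambda> X X';
      g \<in> p X X' (class_K \<Lambda> X X' f)\<rbrakk> \<Longrightarrow>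
      \<exists>q. is_composite \<Lambda> (P X) X X' (\<eta> X) (roof_of X f) q \<and>
        is_composite \<Lambda> (P X) (P X') X' (roof_of (P X) g) (\<eta> X') q"
begin

lemma compact_complex: "compact_inj_complex \<Lambda> X \<Longrightarrow> is_complex \<Lambda> X"
  by (simp add: compact_inj_complex_def inj_complex_def)

lemma bounded_projective_P:
  assumes "compact_inj_complex \<Lambda> X" shows "bounded_projective k \<Lambda> (P X)"
  using P_resolution[OF assms]
  by (intro bounded_projective.intro k_algebra_axioms bounded_projective_axioms.intro)
    (simp_all add: proj_resolution_complex_def)

lemma perfect_complex_P:
  assumes "compact_inj_complex \<Lambda> X" shows "perfect_complex (P X)"
proof -
  have c: "is_complex \<Lambda> (P X)" and q: "projective_module \<Lambda> (cobj (P X) n)" "fg_module \<Lambda> (cobj (P X) n)" for n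
    using P_resolution[OF assms] by (simp_all add: proj_resolution_complex_def)
  show ?thesis unfolding perfect_complex_def perfect_def using c complexD(1)[OF c] ex_dual_basis[OF q] by blast
qed

text \<open>The right leg of \<open>\<eta> X\<close> after a homotopy section of its left leg: a
  chain map from \<open>P X\<close> to \<open>X\<close> that represents the same morphism of the
  derived category.\<close>

definition comparison :: "('r, 'u) cochain_complex \<Rightarrow> int \<Rightarrow> 'u \<Rightarrow> 'u"
  where "comparison X = (case \<eta> X of (Z, s, f) \<Rightarrow> \<lambda>n x. f n ((SOME t. lifts (P X) Z s t) n x))"

lemma comparison_lift:
  assumes X: "compact_inj_complex \<Lambda> X"
  obtains Z s f t where "\<eta> X = (Z, s, f)" "lifts (P X) Z s t" "comparison X = (\<lambda>n x. f n (t n x))"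
proof -
  obtain Z s f where \<eta>: "\<eta> X = (Z, s, f)" by (cases "\<eta> X") auto
  note B = bounded_projective_P[OF X]
  have "is_derived_iso \<Lambda> (P X) X (Z, s, f)" using \<eta>_iso[OF X] \<eta> by simp
  note r = bounded_projective.derived_iso_resolution[OF B compact_complex[OF X] this]
  have "lifts (P X) Z s (SOME t. lifts (P X) Z s t)"
    using bounded_projective.lift_ex[OF B r(1,2)] by (rule someI_ex)
  then show thesis by (rule that[OF \<eta>]) (simp add: comparison_def \<eta>)
qed

lemma comparison_quasi_iso:
  assumes X: "compact_inj_complex \<Lambda> X"
  shows "cmap \<Lambda> (P X) X (comparison X)" "cohomology_inj (P X) X (comparison X)" "cohomology_surj (P X) X (comparison X)"
proof -
  obtain Z s f t where c: "\<eta> X = (Z, s, f)" "lifts (P X) Z s t" "comparison X = (\<lambda>n x. f n (t n x))"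
    by (rule comparison_lift[OF X])
  have "is_derived_iso \<Lambda> (P X) X (Z, s, f)" using \<eta>_iso[OF X] c(1) by simp
  note m = bounded_projective.resolution_map[OF bounded_projective_P[OF X] compact_complex[OF X] this c(2)]
  show "cmap \<Lambda> (P X) X (comparison X)" "cohomology_inj (P X) X (comparison X)" "cohomology_surj (P X) X (comparison X)"
    unfolding c(3) by (rule m)+
qed

text \<open>A representative \<open>g\<close> of the image class inherits from the naturality of
  \<open>\<eta>\<close> a square of roofs, and \<open>resolution_natural\<close> turns it into a
  square of comparison maps commuting up to homotopy.\<close>

lemma p_class:
  assumes X: "compact_inj_complex \<Lambda> X" and X': "compact_inj_complex \<Lambda> X'" and \<alpha>: "\<alpha> \<in> chain_maps \<Lambda> X X'"
  obtains g where "g \<in> chain_maps \<Lambda> (P X) (P X')" "p X X' (class_K \<Lambda> X X' \<alpha>) = class_K \<Lambda> (P X) (P X') g"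
    "homotopic \<Lambda> (P X) X' (\<lambda>n x. \<alpha> n (comparison X n x)) (\<lambda>n x. comparison X' n (g n x))"
proof -
  note c = compact_complex[OF X] and c' = compact_complex[OF X']
  note q = perfect_complexD(1)[OF perfect_complex_P[OF X]] and q' = perfect_complexD(1)[OF perfect_complex_P[OF X']]
  have "class_K \<Lambda> X X' \<alpha> \<in> carrier (hom_K \<Lambda> X X')" using carrier_hom_K[OF c c'] \<alpha> by blast
  then have "p X X' (class_K \<Lambda> X X' \<alpha>) \<in> carrier (hom_K \<Lambda> (P X) (P X'))" by (rule p_closed[OF X X'])
  then obtain g where g: "g \<in> chain_maps \<Lambda> (P X) (P X')" and pg: "p X X' (class_K \<Lambda> X X' \<alpha>) = class_K \<Lambda> (P X) (P X') g"
    unfolding carrier_hom_K[OF q q'] by blast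
  have "g \<in> p X X' (class_K \<Lambda> X X' \<alpha>)" unfolding pg by (rule class_K_self[OF q q' g])
  from \<eta>_natural[OF X X' \<alpha> this] obtain r where
    r: "is_composite \<Lambda> (P X) X X' (\<eta> X) (roof_of X \<alpha>) r" "is_composite \<Lambda> (P X) (P X') X' (roof_of (P X) g) (\<eta> X') r"
    by blast
  obtain Z s f t where l: "\<eta> X = (Z, s, f)" "lifts (P X) Z s t" "comparison X = (\<lambda>n x. f n (t n x))"
    by (rule comparison_lift[OF X])
  obtain Z' s' f' t' where l': "\<eta> X' = (Z', s', f')" "lifts (P X') Z' s' t'" "comparison X' = (\<lambda>n x. f' n (t' n x))"
    by (rule comparison_lift[OF X'])
  have "homotopic \<Lambda> (P X) X' (\<lambda>n x. \<alpha> n (f n (t n x))) (\<lambda>n x. f' n (t' n (g n x)))"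
    by (rule resolution_natural[OF bounded_projective_P[OF X] bounded_projective_P[OF X'] c c' \<alpha> g
          r[unfolded l(1) l'(1)] l(2) l'(2)])
  then show thesis by (intro that[OF g pg]) (simp add: l(3) l'(3))
qed

lemma dual_resolution_comparison:
  assumes X: "compact_inj_complex \<Lambda> X" and Y: "inj_complex \<Lambda> Y"
  shows "dual_resolution k \<Lambda> E (P X) Y (TD (P X)) (signed_pairing (P X)) X (comparison X)"
proof (intro dual_resolution.intro dual_complex.intro dual_complex_axioms.intro dual_resolution_axioms.intro)
  note pc = perfect_complex_P[OF X]
  show "k_algebra k \<Lambda>" by (rule k_algebra_axioms)
  show "injective_module k E" by (rule E)
  show "is_complex \<Lambda> (P X)" by (rule perfect_complexD(1)[OF pc])
  show "is_complex \<Lambda> Y" using Y by (simp add: inj_complex_def)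
  show "is_complex \<Lambda> (TD (P X))" by (rule is_complex_TD[OF pc])
  show "\<exists>S \<Xi>. dual_basis \<Lambda> (cobj (P X) n) S \<Xi>" for n using perfect_complexD(2)[OF pc] unfolding perfect_def by blast
  show "represents k E \<Lambda> (cobj (P X) n) (cobj (TD (P X)) n) (signed_pairing (P X) n)" for n
    unfolding TD_simps by (rule signed_pairing_represents[OF pc])
  show "signed_pairing (P X) (n + 1) (cdiff (TD (P X)) n t) \<xi> =
      \<ominus>\<^bsub>E\<^esub> signed_pairing (P X) n t (\<lambda>q\<in>carrier (cobj (P X) n). \<xi> (cdiff (P X) n q))"
    if "t \<in> carrier (cobj (TD (P X)) n)" "\<xi> \<in> module_homs \<Lambda> (cobj (P X) (n + 1)) (regular_module \<Lambda>)" for n t \<xi>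
    by (rule signed_pairing_cdiff[OF pc _ that(2)]) (use that(1) in simp)
  show "inj_complex \<Lambda> Y" by (rule Y)
  show "is_complex \<Lambda> X" by (rule compact_complex[OF X])
  show "\<exists>N. \<forall>n<N. zero_module (cobj X n)" using X by (simp add: compact_inj_complex_def)
  show "\<exists>N. \<forall>n>N. zero_module (cobj (P X) n)" using P_resolution[OF X] by (simp add: proj_resolution_complex_def)
qed (use comparison_quasi_iso[OF X] in simp_all)

definition duality_map ::
    "('r, 'u) cochain_complex \<Rightarrow> ('r, 'u) cochain_complex \<Rightarrow> ((int \<Rightarrow> 'u \<Rightarrow> 'u) set \<Rightarrow> 'e) \<Rightarrow>
      (int \<Rightarrow> 'u \<Rightarrow> ('u \<times> ('r \<Rightarrow> 'e) \<Rightarrow>\<^sub>0 int) set) set"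
  where "duality_map X Y = dual_resolution.duality k \<Lambda> E (P X) Y (TD (P X)) (signed_pairing (P X)) X (comparison X)"

lemma duality_map_module_isos:
  assumes "compact_inj_complex \<Lambda> X" "inj_complex \<Lambda> Y"
  shows "duality_map X Y \<in> module_isos k (dual k E (hom_K \<Lambda> X Y)) (hom_K \<Lambda> Y (TD (P X)))"
  unfolding duality_map_def by (rule dual_resolution.duality_iso[OF dual_resolution_comparison[OF assms]])

lemma duality_map_natural_source:
  assumes X: "compact_inj_complex \<Lambda> X" and X': "compact_inj_complex \<Lambda> X'" and Y: "inj_complex \<Lambda> Y"
    and \<alpha>: "\<alpha> \<in> carrier (hom_K \<Lambda> X X')" and \<theta>: "\<theta> \<in> carrier (dual k E (hom_K \<Lambda> X Y))"
  shows "duality_map X' Y (dual_map (hom_K \<Lambda> X' Y) (\<lambda>\<gamma>. comp_K \<Lambda> X Y \<gamma> \<alpha>) \<theta>) =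
    comp_K \<Lambda> Y (TD (P X')) (tensor_dual_map k E \<Lambda> (P X) (P X') (p X X' \<alpha>)) (duality_map X Y \<theta>)"
proof -
  obtain a where a: "\<alpha> = class_K \<Lambda> X X' a" "a \<in> chain_maps \<Lambda> X X'"
    using \<alpha> unfolding carrier_hom_K[OF compact_complex[OF X] compact_complex[OF X']] by blast
  obtain g where g: "g \<in> chain_maps \<Lambda> (P X) (P X')" "p X X' \<alpha> = class_K \<Lambda> (P X) (P X') g"
    "homotopic \<Lambda> (P X) X' (\<lambda>n x. a n (comparison X n x)) (\<lambda>n x. comparison X' n (g n x))"
    unfolding a(1) by (rule p_class[OF X X' a(2)])
  note pc = perfect_complex_P[OF X] perfect_complex_P[OF X']
  show ?thesis
    unfolding duality_map_def a(1) g(2)[unfolded a(1)] tensor_dual_map_class[OF pc g(1)]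
  proof (rule duality_natural_source[OF dual_resolution_comparison[OF X Y] dual_resolution_comparison[OF X' Y] a(2) g(1)
        tchain_chain_maps[OF pc g(1)] g(3)])
    show "signed_pairing (P X') n (tchain (P X) (P X') g n t) \<xi> =
        signed_pairing (P X) n t (\<lambda>q\<in>carrier (cobj (P X) n). \<xi> (g n q))"
      if "t \<in> carrier (cobj (TD (P X)) n)" "\<xi> \<in> module_homs \<Lambda> (cobj (P X') n) (regular_module \<Lambda>)" for n t \<xi>
      by (rule signed_pairing_tchain[OF pc cmapD(1)[OF chain_maps_cmap[OF g(1)]] _ that(2)]) (use that(1) in simp)
    show "\<theta> \<in> module_homs k (hom_K \<Lambda> X Y) E" using \<theta> by simp
  qed
qed

lemma duality_map_natural_target:
  assumes X: "compact_inj_complex \<Lambda> X" and Y: "inj_complex \<Lambda> Y" and Y': "inj_complex \<Lambda> Y'"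
    and \<beta>: "\<beta> \<in> carrier (hom_K \<Lambda> Y Y')" and \<theta>: "\<theta> \<in> carrier (dual k E (hom_K \<Lambda> X Y'))"
  shows "duality_map X Y (dual_map (hom_K \<Lambda> X Y) (\<lambda>\<gamma>. comp_K \<Lambda> X Y' \<beta> \<gamma>) \<theta>) =
    comp_K \<Lambda> Y (TD (P X)) (duality_map X Y' \<theta>) \<beta>"
proof -
  have "is_complex \<Lambda> Y" "is_complex \<Lambda> Y'" using Y Y' by (simp_all add: inj_complex_def)
  then obtain b where b: "\<beta> = class_K \<Lambda> Y Y' b" "b \<in> chain_maps \<Lambda> Y Y'"
    using \<beta> carrier_hom_K by blast
  have "\<theta> \<in> module_homs k (hom_K \<Lambda> X Y') E" using \<theta> by simp
  then show ?thesis
    unfolding duality_map_def b(1)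
    by (rule duality_natural_target[OF dual_resolution_comparison[OF X Y] dual_resolution_comparison[OF X Y'] b(2)])
qed

end

theorem theorem3p4:
  fixes k :: "('k, 'c) ring_scheme" and \<mm> :: "'k set" and E :: "('k, 'e) module" and \<Lambda> :: "('k, 'r) module"
    and P :: "('r, 'u) cochain_complex \<Rightarrow> ('r, 'u) cochain_complex"
    and p :: "('r, 'u) cochain_complex \<Rightarrow> ('r, 'u) cochain_complex \<Rightarrow>
      (int \<Rightarrow> 'u \<Rightarrow> 'u) set \<Rightarrow> (int \<Rightarrow> 'u \<Rightarrow> 'u) set"
  assumes "complete_local_noetherian_ring k \<mm>"
    and "noetherian_algebra k \<Lambda>"
    and "injective_envelope k (quotient_module (regular_module k) \<mm>) E"
    and "projective_resolution_functor \<Lambda> P p"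
  shows "(\<forall>X. compact_inj_complex \<Lambda> X \<longrightarrow> inj_complex \<Lambda> (tensor_dual k E \<Lambda> (P X))) \<and>
    (\<exists>\<Phi> :: ('r, 'u) cochain_complex \<Rightarrow> ('r, 'u) cochain_complex \<Rightarrow>
        ((int \<Rightarrow> 'u \<Rightarrow> 'u) set \<Rightarrow> 'e) \<Rightarrow> (int \<Rightarrow> 'u \<Rightarrow> ('u \<times> ('r \<Rightarrow> 'e) \<Rightarrow>\<^sub>0 int) set) set.
      (\<forall>X Y. compact_inj_complex \<Lambda> X \<longrightarrow> inj_complex \<Lambda> Y \<longrightarrow>
        \<Phi> X Y \<in> module_isos k (dual k E (hom_K \<Lambda> X Y)) (hom_K \<Lambda> Y (tensor_dual k E \<Lambda> (P X)))) \<and>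
      (\<forall>X X' Y. compact_inj_complex \<Lambda> X \<longrightarrow> compact_inj_complex \<Lambda> X' \<longrightarrow> inj_complex \<Lambda> Y \<longrightarrow>
        (\<forall>\<alpha>\<in>carrier (hom_K \<Lambda> X X'). \<forall>\<theta>\<in>carrier (dual k E (hom_K \<Lambda> X Y)).
          \<Phi> X' Y (dual_map (hom_K \<Lambda> X' Y) (\<lambda>\<gamma>. comp_K \<Lambda> X Y \<gamma> \<alpha>) \<theta>) =
          comp_K \<Lambda> Y (tensor_dual k E \<Lambda> (P X'))
            (tensor_dual_map k E \<Lambda> (P X) (P X') (p X X' \<alpha>)) (\<Phi> X Y \<theta>))) \<and>
      (\<forall>X Y Y'. compact_inj_complex \<Lambda> X \<longrightarrow> inj_complex \<Lambda> Y \<longrightarrow> inj_complex \<Lambda> Y' \<longrightarrow>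
        (\<forall>\<beta>\<in>carrier (hom_K \<Lambda> Y Y'). \<forall>\<theta>\<in>carrier (dual k E (hom_K \<Lambda> X Y')).
          \<Phi> X Y (dual_map (hom_K \<Lambda> X Y) (\<lambda>\<gamma>. comp_K \<Lambda> X Y' \<beta> \<gamma>) \<theta>) =
          comp_K \<Lambda> Y (tensor_dual k E \<Lambda> (P X)) (\<Phi> X Y' \<theta>) \<beta>)))"
proof -
  have kA: "k_algebra k \<Lambda>"
    using assms(1,2) by (intro k_algebra.intro)
      (simp_all add: complete_local_noetherian_ring_def noetherian_algebra_def fg_module_def)
  have E: "injective_module k E" using assms(3) by (simp add: injective_envelope_def)
  note f = assms(4)[unfolded projective_resolution_functor_def]
  have fP: "\<forall>X. compact_inj_complex \<Lambda> X \<longrightarrow> proj_resolution_complex \<Lambda> (P X)"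
    and fp: "\<forall>X X'. compact_inj_complex \<Lambda> X \<longrightarrow> compact_inj_complex \<Lambda> X' \<longrightarrow>
      p X X' \<in> carrier (hom_K \<Lambda> X X') \<rightarrow> carrier (hom_K \<Lambda> (P X) (P X'))"
    by (rule conjunct1[OF f], rule conjunct1[OF conjunct2[OF f]])
  \<comment> \<open>The earlier conjuncts describe the functor on objects and morphisms; the natural
    isomorphism comes from the last one.\<close>
  obtain \<eta> where \<eta>: "\<forall>X. compact_inj_complex \<Lambda> X \<longrightarrow> is_derived_iso \<Lambda> (P X) X (\<eta> X)"
    and \<eta>_natural: "\<forall>X X'. compact_inj_complex \<Lambda> X \<longrightarrow> compact_inj_complex \<Lambda> X' \<longrightarrow>
      (\<forall>f\<in>chain_maps \<Lambda> X X'. \<forall>g\<in>p X X' (class_K \<Lambda> X X' f).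
        \<exists>q. is_composite \<Lambda> (P X) X X' (\<eta> X) (roof_of X f) q \<and>
          is_composite \<Lambda> (P X) (P X') X' (roof_of (P X) g) (\<eta> X') q)"
    using f[THEN conjunct2, THEN conjunct2, THEN conjunct2, THEN conjunct2] by (elim exE conjE)
  interpret resolution_functor k \<Lambda> E P p \<eta>
    by (intro resolution_functor.intro dual_tensor_complex.intro dual_tensor_complex_axioms.intro
      resolution_functor_axioms.intro kA E)
      (use fP fp \<eta> \<eta>_natural in \<open>simp_all add: Pi_iff\<close>)
  show ?thesis
    by (intro conjI exI[of _ duality_map] allI impI ballI)
      (simp_all only: inj_complex_TD perfect_complex_P duality_map_module_isos
        duality_map_natural_source duality_map_natural_target)
qed

end
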